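(* Fix $\theta\in(0,1]$ and an integer $q\ge2$. Let $G=(V,E)$ be a connected graph on $n$ vertices satisfying $|B_v(r)|\le\kappa_0\exp(r^{1-\alpha})$ for every $v\in V$ and $r\ge1$, for some $\kappa_0>0$ and $0<\alpha<1$, and let $\mathcal U$ be the uniform distribution on $\{0,\dots,q-1\}^V$. Then, for every fixed $0<\epsilon<1$, the $q$-state noisy voter model on $G$ with noise $\theta$ started from $\mathcal U$ has $$t_{\mathrm{mix}}^{\mathcal U}(\epsilon)=\frac{1+o(1)}{4\theta}\log n,$$ where the $o(1)$-term is $O((\log n)^{-\alpha/2})$ with a constant depending on $\epsilon,\theta,q,\kappa_0,\alpha$ (but not on $G$), and $$t_{\mathrm{mix}}(\epsilon)=\frac{1+o(1)}{2\theta}\log n,$$ i.e., the asymptotic worst-case mixing time (attained by the monochromatic initial state $\mathsf{x}_0=\mathbf 1$) is twice slower. Moreover, if $G^{(n)}$ is a sequence of connected $n$-vertex graphs satisfying $|B_v(r)|\le\kappa_0\exp(r^{1-\alpha})$ for every vertex $v$ of $G^{(n)}$ and every $r\ge1$, with the same $\alpha,\kappa_0$ for all $n$, then for any sequence $\mathsf{x}_0=\mathsf{x}_0^{(n)}$ of deterministic initial states, $$\liminf_{n\to\infty}\frac{t_{\mathrm{mix}}^{\mathsf{x}_0}(\epsilon)}{t_{\mathrm{mix}}^{\mathcal U}(\epsilon)}\ge1,$$ i.e., asymptotically, no deterministic initial state is faster than the uniform initial condition $\mathcal U$.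
   Context: Graphs are finite and undirected. $B_v(r)$ is the ball of radius $r$ around $v$ in graph distance. Noisy voter model on $G=(V,E)$ with $q$ states and noise $\theta$: the continuous-time Markov chain $(X_t)_{t\ge0}$ on $\Omega=\{0,\dots,q-1\}^V$ in which every vertex $u$ has an independent rate-1 Poisson clock, and when the clock of $u$ rings, with probability $1-\theta$ the value $X_t(u)$ is replaced by $X_t(v)$ for a uniformly chosen neighbor $v$ of $u$, and with probability $\theta$ it is replaced by a uniform element of $\{0,\dots,q-1\}$. Its unique stationary distribution is $\mu_G$. $\mathbb P_{\mathsf{x}_0}$ is the law of the chain with $X_0=\mathsf{x}_0$, and $\mathbb P_{\mathcal U}(X_t\in\cdot)=\frac1{|\Omega|}\sum_{\mathsf{x}_0\in\Omega}\mathbb P_{\mathsf{x}_0}(X_t\in\cdot)$. $t_{\mathrm{mix}}^{\mathsf{x}_0}(\epsilon)=\inf\{t\ge0:\ \|\mathbb P_{\mathsf{x}_0}(X_t\in\cdot)-\mu_G\|_{\mathrm{TV}}<\epsilon\}$, $t_{\mathrm{mix}}(\epsilon)=\max_{\mathsf{x}_0}t_{\mathrm{mix}}^{\mathsf{x}_0}(\epsilon)$, and $t_{\mathrm{mix}}^{\mathcal U}(\epsilon)=\inf\{t\ge0:\ \|\mathbb P_{\mathcal U}(X_t\in\cdot)-\mu_G\|_{\mathrm{TV}}<\epsilon\}$, where $\|\cdot\|_{\mathrm{TV}}$ is total variation distance. A monochromatic state assigns the same color to all vertices; $\mathbf 1$ denotes such a state. The $o(1)$ terms are as $n\to\infty$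.
   Formalization: The first asymptotic, for the uniform start, is stated only for θ<1: at θ=1 the uniform law is stationary, so that mixing time is 0 and the display fails; for θ=1 the ratio in the liminf is read as +∞ when its denominator is 0. *)

theory Defs
  imports "HOL-Probability.Probability" "Graph_Theory.Graph_Theory"
begin

(* Finite simple undirected graphs are the symmetric loop-free finite digraphs
   (locale pair_graph) of the AFP entry Graph_Theory; the graph distance is the
   shortest-path distance for unit arc weights (infinite between components). *)

definition graph_ball :: "'a pair_pre_digraph \<Rightarrow> 'a \<Rightarrow> real \<Rightarrow> 'a set" where
  "graph_ball G v r =
     {w \<in> pverts G. wf_digraph.\<mu> (with_proj G) (\<lambda>_. 1) v w \<le> ereal r}"

definition subexp_growth :: "real \<Rightarrow> real \<Rightarrow> 'a pair_pre_digraph \<Rightarrow> bool" where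
  "subexp_growth \<kappa> \<alpha> G \<longleftrightarrow>
     (\<forall>v\<in>pverts G. \<forall>r\<ge>1. real (card (graph_ball G v r)) \<le> \<kappa> * exp (r powr (1 - \<alpha>)))"

definition subexp_graph :: "real \<Rightarrow> real \<Rightarrow> nat \<Rightarrow> 'a pair_pre_digraph \<Rightarrow> bool" where
  "subexp_graph \<kappa> \<alpha> n G \<longleftrightarrow>
     pair_graph G \<and> connected (with_proj G) \<and> card (pverts G) = n \<and> subexp_growth \<kappa> \<alpha> G"

definition nbrs :: "'a pair_pre_digraph \<Rightarrow> 'a \<Rightarrow> 'a set" where
  "nbrs G u = {v. (u, v) \<in> parcs G}"

definition configs :: "'a pair_pre_digraph \<Rightarrow> nat \<Rightarrow> ('a \<Rightarrow> nat) set" where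
  "configs G q = (pverts G \<rightarrow>\<^sub>E {..<q})"

(* The new configuration when the clock of u rings in configuration x.  An isolated u, on
   which the library leaves pmf_of_set unspecified, only occurs in the connected graph with
   a single vertex. *)
definition voter_update ::
  "'a pair_pre_digraph \<Rightarrow> nat \<Rightarrow> real \<Rightarrow> 'a \<Rightarrow> ('a \<Rightarrow> nat) \<Rightarrow> ('a \<Rightarrow> nat) pmf" where
  "voter_update G q \<theta> u x =
     bind_pmf (bernoulli_pmf \<theta>) (\<lambda>noise.
       if noise then map_pmf (\<lambda>c. x(u := c)) (pmf_of_set {..<q})
       else map_pmf (\<lambda>v. x(u := x v)) (pmf_of_set (nbrs G u)))"

definition voter_ring ::
  "'a pair_pre_digraph \<Rightarrow> nat \<Rightarrow> real \<Rightarrow> ('a \<Rightarrow> nat) pmf \<Rightarrow> ('a \<Rightarrow> nat) pmf" where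
  "voter_ring G q \<theta> \<nu> =
     bind_pmf \<nu> (\<lambda>x. bind_pmf (pmf_of_set (pverts G)) (\<lambda>u. voter_update G q \<theta> u x))"

(* The law of X_t for the continuous-time chain with X_0 distributed as \<nu>.  The independent
   rate-1 Poisson clocks of the n vertices superpose to a Poisson clock of rate n, each of
   whose rings belongs to an independent uniformly chosen vertex.  Hence the number of rings
   up to time t is Poisson (n t), and each ring applies voter_ring.  The library has
   poisson_pmf only for a positive rate, whence the case distinction.  Lemma
   voter_law_master_equation below verifies that each vertex is updated at rate 1. *)
definition voter_law ::
  "'a pair_pre_digraph \<Rightarrow> nat \<Rightarrow> real \<Rightarrow> ('a \<Rightarrow> nat) pmf \<Rightarrow> real \<Rightarrow> ('a \<Rightarrow> nat) pmf" where
  "voter_law G q \<theta> \<nu> t =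
     (if t = 0 then \<nu>
      else bind_pmf (poisson_pmf (real (card (pverts G)) * t))
             (\<lambda>k. (voter_ring G q \<theta> ^^ k) \<nu>))"

definition voter_stationary ::
  "'a pair_pre_digraph \<Rightarrow> nat \<Rightarrow> real \<Rightarrow> ('a \<Rightarrow> nat) pmf \<Rightarrow> bool" where
  "voter_stationary G q \<theta> \<mu> \<longleftrightarrow>
     set_pmf \<mu> \<subseteq> configs G q \<and> (\<forall>t\<ge>0. voter_law G q \<theta> \<mu> t = \<mu>)"

definition voter_measure :: "'a pair_pre_digraph \<Rightarrow> nat \<Rightarrow> real \<Rightarrow> ('a \<Rightarrow> nat) pmf" where
  "voter_measure G q \<theta> = (THE \<mu>. voter_stationary G q \<theta> \<mu>)"

definition tv_dist :: "'b pmf \<Rightarrow> 'b pmf \<Rightarrow> real" where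
  "tv_dist p p' = (SUP A. \<bar>measure_pmf.prob p A - measure_pmf.prob p' A\<bar>)"

definition tmix_from ::
  "'a pair_pre_digraph \<Rightarrow> nat \<Rightarrow> real \<Rightarrow> ('a \<Rightarrow> nat) pmf \<Rightarrow> real \<Rightarrow> real" where
  "tmix_from G q \<theta> \<nu> \<epsilon> =
     Inf {t. 0 \<le> t \<and> tv_dist (voter_law G q \<theta> \<nu> t) (voter_measure G q \<theta>) < \<epsilon>}"

definition tmix_state ::
  "'a pair_pre_digraph \<Rightarrow> nat \<Rightarrow> real \<Rightarrow> ('a \<Rightarrow> nat) \<Rightarrow> real \<Rightarrow> real" where
  "tmix_state G q \<theta> x \<epsilon> = tmix_from G q \<theta> (return_pmf x) \<epsilon>"

definition tmix :: "'a pair_pre_digraph \<Rightarrow> nat \<Rightarrow> real \<Rightarrow> real \<Rightarrow> real" where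
  "tmix G q \<theta> \<epsilon> = Max ((\<lambda>x. tmix_state G q \<theta> x \<epsilon>) ` configs G q)"

definition tmix_unif :: "'a pair_pre_digraph \<Rightarrow> nat \<Rightarrow> real \<Rightarrow> real \<Rightarrow> real" where
  "tmix_unif G q \<theta> \<epsilon> = tmix_from G q \<theta> (pmf_of_set (configs G q)) \<epsilon>"

definition monochrome :: "'a pair_pre_digraph \<Rightarrow> nat \<Rightarrow> 'a \<Rightarrow> nat" where
  "monochrome G c = (\<lambda>v\<in>pverts G. c)"

lemma exp_weighted_series_deriv:
  fixes a :: "nat \<Rightarrow> real" and m t :: real
  assumes a: "\<And>k. \<bar>a k\<bar> \<le> 1"
  shows "((\<lambda>t. \<Sum>k. a k * ((m * t) ^ k / fact k * exp (- (m * t)))) has_real_derivative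
          (m * ((\<Sum>k. a (Suc k) * ((m * t) ^ k / fact k * exp (- (m * t))))
              - (\<Sum>k. a k * ((m * t) ^ k / fact k * exp (- (m * t))))))) (at t)"
proof -
  have summ: "summable (\<lambda>k. b k / fact k * s ^ k)"
    if "\<And>k. \<bar>b k\<bar> \<le> 1" for b :: "nat \<Rightarrow> real" and s :: real
  proof (rule summable_comparison_test')
    show "summable (\<lambda>k. \<bar>s\<bar> ^ k / fact k)"
      using summable_exp[of "\<bar>s\<bar>"] by (simp add: field_simps)
    show "norm (b k / fact k * s ^ k) \<le> \<bar>s\<bar> ^ k / fact k" if "k \<ge> 0" for k
      using mult_right_mono[OF \<open>\<bar>b k\<bar> \<le> 1\<close>, of "\<bar>s\<bar> ^ k / fact k"]
      by (simp add: abs_mult power_abs)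
  qed
  have D: "((\<lambda>s. \<Sum>k. a k / fact k * s ^ k) has_real_derivative
            (\<Sum>k. a (Suc k) / fact k * s ^ k)) (at s)" for s
  proof -
    have "diffs (\<lambda>k. a k / fact k) = (\<lambda>k. a (Suc k) / fact k)"
      by (simp add: diffs_def fun_eq_iff del: of_nat_Suc)
    then show ?thesis
      using termdiffs_strong_converges_everywhere[of "\<lambda>k. a k / fact k" s] summ[of a] a by simp
  qed
  have eq: "(\<Sum>k. b k * ((m * t) ^ k / fact k * exp (- (m * t)))) =
            exp (- (m * t)) * (\<Sum>k. b k / fact k * (m * t) ^ k)"
    if "\<And>k. \<bar>b k\<bar> \<le> 1" for b :: "nat \<Rightarrow> real" and t
    by (subst suminf_mult[symmetric, OF summ[OF that]]) (simp add: field_simps)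
  have "((\<lambda>t. exp (- (m * t)) * (\<Sum>k. a k / fact k * (m * t) ^ k)) has_real_derivative
          (exp (- (m * t)) * (m * (\<Sum>k. a (Suc k) / fact k * (m * t) ^ k))
           - m * exp (- (m * t)) * (\<Sum>k. a k / fact k * (m * t) ^ k))) (at t)"
    by (rule derivative_eq_intros DERIV_chain2[OF D] refl | simp add: algebra_simps)+
  then show ?thesis
    unfolding eq[of a, OF a] eq[of "\<lambda>k. a (Suc k)", OF a] by (simp add: algebra_simps)
qed

lemma pmf_voter_law:
  assumes "finite (pverts G)" "pverts G \<noteq> {}" "0 \<le> t"
  shows "pmf (voter_law G q \<theta> \<nu> t) y =
    (\<Sum>k. pmf ((voter_ring G q \<theta> ^^ k) \<nu>) y *
      ((real (card (pverts G)) * t) ^ k / fact k * exp (- (real (card (pverts G)) * t))))"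
proof (cases "t = 0")
  case True
  have "(\<Sum>k. pmf ((voter_ring G q \<theta> ^^ k) \<nu>) y * (0 ^ k / fact k)) =
        (\<Sum>k\<in>{0::nat}. pmf ((voter_ring G q \<theta> ^^ k) \<nu>) y * (0 ^ k / fact k))"
    by (rule suminf_finite) auto
  with True show ?thesis by (simp add: voter_law_def)
next
  case False
  define m where "m = real (card (pverts G)) * t"
  have m: "m > 0" using assms False by (simp add: m_def card_gt_0_iff)
  have int: "integrable (measure_pmf (poisson_pmf m))
               (\<lambda>k. pmf ((voter_ring G q \<theta> ^^ k) \<nu>) y)"
    by (rule measure_pmf.integrable_const_bound[where B = 1]) (auto simp: pmf_le_1)
  then have int': "integrable (count_space UNIV)
               (\<lambda>k. pmf (poisson_pmf m) k *\<^sub>R pmf ((voter_ring G q \<theta> ^^ k) \<nu>) y)"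
    by (subst (asm) measure_pmf_eq_density, subst (asm) integrable_density) auto
  have "pmf (voter_law G q \<theta> \<nu> t) y =
        (LINT k|measure_pmf (poisson_pmf m). pmf ((voter_ring G q \<theta> ^^ k) \<nu>) y)"
    using False by (simp add: voter_law_def pmf_bind m_def)
  also have "\<dots> = (LINT k|count_space UNIV.
      pmf (poisson_pmf m) k *\<^sub>R pmf ((voter_ring G q \<theta> ^^ k) \<nu>) y)"
    by (subst measure_pmf_eq_density, subst integral_density) auto
  also have "\<dots> = (\<Sum>k. pmf (poisson_pmf m) k *\<^sub>R pmf ((voter_ring G q \<theta> ^^ k) \<nu>) y)"
    using int' by (rule integral_count_space_nat)
  finally show ?thesis using m by (simp add: m_def mult.commute)
qed

lemma voter_law_master_equation:
  assumes fin: "finite (pverts G)" and ne: "pverts G \<noteq> {}" and t: "0 \<le> t"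
  shows "((\<lambda>t. pmf (voter_law G q \<theta> \<nu> t) y) has_real_derivative
          (\<Sum>u\<in>pverts G. pmf (bind_pmf (voter_law G q \<theta> \<nu> t) (voter_update G q \<theta> u)) y
                          - pmf (voter_law G q \<theta> \<nu> t) y)) (at t within {0..})"
proof -
  let ?m = "real (card (pverts G))"
  let ?a = "\<lambda>k. pmf ((voter_ring G q \<theta> ^^ k) \<nu>) y"
  have pos: "?m > 0" using fin ne by (simp add: card_gt_0_iff)
  have shift: "voter_law G q \<theta> (voter_ring G q \<theta> \<nu>) t = voter_ring G q \<theta> (voter_law G q \<theta> \<nu> t)"
  proof (cases "t = 0")
    case False
    have "voter_ring G q \<theta> (bind_pmf p f) = bind_pmf p (\<lambda>k. voter_ring G q \<theta> (f k))"
      for p :: "nat pmf" and f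
      by (simp add: voter_ring_def bind_assoc_pmf)
    with False show ?thesis by (simp add: voter_law_def funpow_swap1)
  qed (simp add: voter_law_def)
  have S: "(\<Sum>k. ?a (Suc k) * ((?m * t) ^ k / fact k * exp (- (?m * t)))) =
           pmf (voter_ring G q \<theta> (voter_law G q \<theta> \<nu> t)) y"
    unfolding shift[symmetric] pmf_voter_law[OF fin ne t] by (simp add: funpow_swap1)
  have "pmf (voter_ring G q \<theta> (voter_law G q \<theta> \<nu> t)) y =
        pmf (bind_pmf (pmf_of_set (pverts G))
              (\<lambda>u. bind_pmf (voter_law G q \<theta> \<nu> t) (voter_update G q \<theta> u))) y"
    unfolding voter_ring_def by (subst bind_commute_pmf) simp
  also have "\<dots> = (\<Sum>u\<in>pverts G.
        pmf (bind_pmf (voter_law G q \<theta> \<nu> t) (voter_update G q \<theta> u)) y) / ?m"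
    using fin ne by (simp add: pmf_bind_pmf_of_set)
  finally have R: "?m * pmf (voter_ring G q \<theta> (voter_law G q \<theta> \<nu> t)) y =
        (\<Sum>u\<in>pverts G. pmf (bind_pmf (voter_law G q \<theta> \<nu> t) (voter_update G q \<theta> u)) y)"
    using pos by simp
  have "((\<lambda>t. \<Sum>k. ?a k * ((?m * t) ^ k / fact k * exp (- (?m * t)))) has_real_derivative
          (\<Sum>u\<in>pverts G. pmf (bind_pmf (voter_law G q \<theta> \<nu> t) (voter_update G q \<theta> u)) y
                          - pmf (voter_law G q \<theta> \<nu> t) y)) (at t)"
    using exp_weighted_series_deriv[of ?a ?m t]
    unfolding S pmf_voter_law[OF fin ne t, of q \<theta> \<nu> y, symmetric]
    by (simp add: pmf_le_1 right_diff_distrib R sum_subtractf)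
  then have "((\<lambda>t. \<Sum>k. ?a k * ((?m * t) ^ k / fact k * exp (- (?m * t)))) has_real_derivative
          (\<Sum>u\<in>pverts G. pmf (bind_pmf (voter_law G q \<theta> \<nu> t) (voter_update G q \<theta> u)) y
                          - pmf (voter_law G q \<theta> \<nu> t) y)) (at t within {0..})"
    by (rule has_field_derivative_at_within)
  then show ?thesis
    by (rule has_field_derivative_transform_within[where d = 1])
       (use t in \<open>auto simp: pmf_voter_law[OF fin ne]\<close>)
qed

end

theory Submission
  imports Defs "HOL-Real_Asymp.Real_Asymp"
begin

text \<open>Backwards in time the model is a system of coalescing random walks killed at rate \<open>\<theta>\<close>.
  A set of \<open>K\<close> sites feels a deterministic initial state only if a lineage survives, which has
  probability at most \<open>K * exp (- (\<theta> * t))\<close>, but it feels the uniform initial law only if two lineages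
  survive without meeting, which has probability at most \<open>K\<^sup>2 * exp (- (2 * \<theta> * t))\<close>.  During a further time of order
  \<open>ln n powr (1 - \<alpha> / 2)\<close> the surviving lineages thin out, by the growth hypothesis, into
  well separated clusters of at most \<open>K = ln n powr (\<alpha> / 2)\<close> sites.  The restriction to the clusters is close
  to a product law, and its chi-square distance from stationarity is of order \<open>n\<close> times the square of
  the above probability.  The two squares produce the cut-offs \<open>ln n / (2 * \<theta>)\<close> and \<open>ln n / (4 * \<theta>)\<close>.

  The lower bounds apply Chebyshev's inequality to statistics with variance of order \<open>n * t\<close>.  From a
  monochromatic state, or for \<open>\<theta> = 1\<close>, count the sites that agree with the initial state.
  In general either the single-site biases are visible, or the number of monochromatic pairs at distance at most
  \<open>r\<close> is smaller than in equilibrium.  The deficit of such pairs satisfies a linear differential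
  inequality, and the mean of its logarithm decays at rate \<open>2 * \<theta>\<close> up to a boundary term; subexponential
  growth provides a radius \<open>r\<close> for which the boundary term is negligible.\<close>

section \<open>Poisson averages\<close>

text \<open>No probability space of clocks and walks is built. The chain enters through the operator
  \<open>T\<close> of one ring and its Poisson averages \<open>S t\<close>; lineages come from the
  same operator with the sites as colours. The number \<open>K\<close> of lineages per cluster and
  the extra time \<open>s\<close> face three demands: the chi-square bound loses a factor
  exponential in \<open>K\<close>, so \<open>s\<close> must dominate \<open>K\<close>; chains of
  \<open>K\<close> survivors have entropy of order \<open>ln n powr (1 - \<alpha>)\<close> per
  member, which \<open>s\<close> must dominate as well; and \<open>K * \<theta> * s\<close> must
  exceed \<open>ln n\<close>. Taking \<open>s\<close> of order
  \<open>ln n powr (1 - \<alpha> / 2)\<close> meets all three, and its ratio to \<open>ln n\<close>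
  is the relative error in the claim. In the lower bound the obstacle is that pair correlations are
  not explicit on a general graph. The logarithm of the deficit is averaged because a lower bound on
  that mean uses only reversibility of the walk of pairs and a count of the pairs from which a step
  leaves the chosen set. The radius is near \<open>sqrt (ln n)\<close>: balls then stay
  subpolynomial in \<open>n\<close>, while the boundary term over a time of order
  \<open>ln n\<close> costs a time of order \<open>ln n powr (1 - \<alpha> / 2)\<close>.\<close>

definition egrow :: "(nat \<Rightarrow> real) \<Rightarrow> bool" where
  "egrow a \<longleftrightarrow> (\<exists>M r. 0 \<le> r \<and> (\<forall>k. \<bar>a k\<bar> \<le> M * r ^ k))"

text \<open>The series form covers \<open>l = 0\<close> as well as negative \<open>l\<close>, so
  that later time derivatives at 0 are two-sided. The growth condition \<open>egrow\<close> makes it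
  absolutely convergent and survives shifts, sums and products.\<close>

definition pavg :: "real \<Rightarrow> (nat \<Rightarrow> real) \<Rightarrow> real" where
  "pavg l a = (\<Sum>k. a k * (l ^ k / fact k * exp (- l)))"

lemma egrow_bounded: "(\<And>k. \<bar>a k\<bar> \<le> M) \<Longrightarrow> egrow a"
  unfolding egrow_def by (intro exI[of _ M] exI[of _ 1]) auto

lemma egrow_power: "0 \<le> r \<Longrightarrow> egrow (\<lambda>k. r ^ k)"
  unfolding egrow_def by (intro exI[of _ 1] exI[of _ r]) auto

lemma egrow_const [simp]: "egrow (\<lambda>_. c)"
  by (rule egrow_bounded[of _ "\<bar>c\<bar>"]) simp

lemma egrow_cmult: "egrow a \<Longrightarrow> egrow (\<lambda>k. c * a k)"
proof -
  assume "egrow a"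
  then obtain M r where "0 \<le> r" "\<And>k. \<bar>a k\<bar> \<le> M * r ^ k" by (auto simp: egrow_def)
  then show ?thesis unfolding egrow_def
    by (intro exI[of _ "\<bar>c\<bar> * M"] exI[of _ r])
       (auto simp: abs_mult mult.assoc intro: mult_left_mono)
qed

lemma egrow_add: "egrow a \<Longrightarrow> egrow b \<Longrightarrow> egrow (\<lambda>k. a k + b k)"
proof -
  assume "egrow a" "egrow b"
  then obtain M r M' r' where *: "0 \<le> r" "\<And>k. \<bar>a k\<bar> \<le> M * r ^ k" "0 \<le> r'" "\<And>k. \<bar>b k\<bar> \<le> M' * r' ^ k"
    by (auto simp: egrow_def)
  have M: "M \<ge> 0" "M' \<ge> 0" using *(2)[of 0] *(4)[of 0] by auto
  show ?thesis unfolding egrow_def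
  proof (intro exI conjI allI)
    fix k
    have "r ^ k \<le> max r r' ^ k" "r' ^ k \<le> max r r' ^ k" using * by (auto intro!: power_mono)
    then have "M * r ^ k \<le> M * max r r' ^ k" "M' * r' ^ k \<le> M' * max r r' ^ k"
      using M by (auto intro: mult_left_mono)
    then show "\<bar>a k + b k\<bar> \<le> (M + M') * max r r' ^ k"
      using *(2)[of k] *(4)[of k] by (simp add: distrib_right)
  qed (use * in auto)
qed

lemma egrow_sum: "(\<And>i. i \<in> I \<Longrightarrow> egrow (a i)) \<Longrightarrow> egrow (\<lambda>k. \<Sum>i\<in>I. a i k)"
  by (induction I rule: infinite_finite_induct) (auto intro: egrow_add)

lemma egrow_mono: "egrow b \<Longrightarrow> (\<And>k. \<bar>a k\<bar> \<le> b k) \<Longrightarrow> egrow a"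
  unfolding egrow_def by (meson abs_ge_self order_trans)

lemma egrow_Suc: "egrow a \<Longrightarrow> egrow (\<lambda>k. a (Suc k))"
proof -
  assume "egrow a"
  then obtain M r where *: "0 \<le> r" "\<And>k. \<bar>a k\<bar> \<le> M * r ^ k" by (auto simp: egrow_def)
  then show ?thesis unfolding egrow_def
    by (intro exI[of _ "M * r"] exI[of _ r])
       (use *(2)[of "Suc _"] in \<open>auto simp: mult.assoc\<close>)
qed

lemma pavg_summable:
  assumes "egrow a"
  shows "summable (\<lambda>k. a k * (l ^ k / fact k * exp (- l)))"
proof -
  obtain M r where *: "0 \<le> r" "\<And>k. \<bar>a k\<bar> \<le> M * r ^ k"
    using assms by (auto simp: egrow_def)
  have s: "summable (\<lambda>k. M * exp (- l) * (inverse (fact k) * (r * \<bar>l\<bar>) ^ k))"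
    by (intro summable_mult summable_exp)
  show ?thesis
  proof (rule summable_comparison_test'[OF s])
    fix k
    have "\<bar>a k\<bar> * (\<bar>l\<bar> ^ k / fact k * exp (- l)) \<le> M * r ^ k * (\<bar>l\<bar> ^ k / fact k * exp (- l))"
      using * by (intro mult_right_mono) auto
    then show "norm (a k * (l ^ k / fact k * exp (- l)))
            \<le> M * exp (- l) * (inverse (fact k) * (r * \<bar>l\<bar>) ^ k)"
      by (simp add: abs_mult power_mult_distrib power_abs field_simps)
  qed
qed

lemma pavg_0 [simp]: "pavg 0 a = a 0"
proof -
  have "(\<Sum>k. a k * (0 ^ k / fact k * exp (- 0))) = (\<Sum>k\<in>{0::nat}. a k * (0 ^ k / fact k * exp (- 0::real)))"
    by (rule suminf_finite) auto
  then show ?thesis by (simp add: pavg_def)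
qed

text \<open>Generating function of the Poisson law. It turns a contraction by
  \<open>1 - \<theta> / n\<close> per ring into \<open>exp (- (\<theta> * t))\<close> when
  \<open>l = n * t\<close>.\<close>

lemma pavg_power: "pavg l (\<lambda>k. r ^ k) = exp (l * (r - 1))"
proof -
  have "(\<lambda>k. (r * l) ^ k /\<^sub>R fact k * exp (- l)) sums (exp (r * l) * exp (- l))"
    by (intro sums_mult2 exp_converges)
  then have "(\<lambda>k. r ^ k * (l ^ k / fact k * exp (- l))) sums (exp (r * l) * exp (- l))"
    by (rule sums_cong[THEN iffD1, rotated]) (simp add: power_mult_distrib field_simps)
  then show ?thesis
    by (simp add: pavg_def sums_iff mult_exp_exp algebra_simps)
qed

lemma pavg_const [simp]: "pavg l (\<lambda>_. c) = c"
proof -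
  have "summable (\<lambda>k. 1 * (l ^ k / fact k * exp (- l)))" by (rule pavg_summable) simp
  then have "pavg l (\<lambda>_. c) = c * pavg l (\<lambda>k. 1 ^ k)"
    unfolding pavg_def by (subst suminf_mult[symmetric]) (auto simp: mult_ac)
  then show ?thesis by (simp add: pavg_power del: power_one)
qed

lemma pavg_add: "egrow a \<Longrightarrow> egrow b \<Longrightarrow> pavg l (\<lambda>k. a k + b k) = pavg l a + pavg l b"
  unfolding pavg_def by (subst suminf_add) (auto intro: pavg_summable simp only: distrib_right)

lemma pavg_cmult: "egrow a \<Longrightarrow> pavg l (\<lambda>k. c * a k) = c * pavg l a"
  unfolding pavg_def by (subst suminf_mult[symmetric]) (auto intro: pavg_summable simp only: mult.assoc)

lemma pavg_diff: "egrow a \<Longrightarrow> egrow b \<Longrightarrow> pavg l (\<lambda>k. a k - b k) = pavg l a - pavg l b"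
  using pavg_add[of a "\<lambda>k. (-1) * b k" l] pavg_cmult[of b l "-1"] egrow_cmult[of b "-1"] by simp

lemma pavg_sum:
  assumes "\<And>i. i \<in> I \<Longrightarrow> egrow (a i)"
  shows "pavg l (\<lambda>k. \<Sum>i\<in>I. a i k) = (\<Sum>i\<in>I. pavg l (a i))"
  using assms by (induction I rule: infinite_finite_induct) (auto simp: pavg_add egrow_sum)

lemma pavg_mono: "egrow a \<Longrightarrow> egrow b \<Longrightarrow> 0 \<le> l \<Longrightarrow> (\<And>k. a k \<le> b k) \<Longrightarrow> pavg l a \<le> pavg l b"
  unfolding pavg_def by (intro suminf_le pavg_summable mult_right_mono) auto

lemma pavg_abs_le:
  assumes "egrow b" "0 \<le> l" "\<And>k. \<bar>a k\<bar> \<le> b k"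
  shows "\<bar>pavg l a\<bar> \<le> pavg l b"
proof -
  have a: "egrow a" by (rule egrow_mono[OF assms(1,3)])
  have "pavg l a \<le> pavg l b" using assms by (intro pavg_mono a) (auto intro: abs_le_D1)
  moreover have "- pavg l a = pavg l (\<lambda>k. (-1) * a k)" by (subst pavg_cmult[OF a]) simp
  moreover have "pavg l (\<lambda>k. (-1) * a k) \<le> pavg l b"
    using assms by (intro pavg_mono egrow_cmult a) (auto intro: abs_le_D2)
  ultimately show ?thesis by linarith
qed

lemma pavg_geometric_le:
  assumes "\<And>k. \<bar>a k\<bar> \<le> c * r ^ k" "0 \<le> r" "0 \<le> l"
  shows "\<bar>pavg l a\<bar> \<le> c * exp (l * (r - 1))"
  using pavg_abs_le[OF egrow_cmult[OF egrow_power[OF assms(2)]] assms(3,1)]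
  by (simp add: pavg_cmult egrow_power assms pavg_power)

text \<open>Size-biasing: \<open>k / fact k\<close> cancels to \<open>1 / fact (k - 1)\<close>, and
  the vanishing term \<open>k = 0\<close> is added back. It yields the first two moments of the
  Poisson law.\<close>

lemma pavg_shift:
  assumes "egrow a"
  shows "l * pavg l (\<lambda>k. a (Suc k)) = pavg l (\<lambda>k. real k * a k)"
proof -
  have s: "summable (\<lambda>k. a (Suc k) * (l ^ k / fact k * exp (- l)))"
    by (intro pavg_summable egrow_Suc assms)
  have e: "real (Suc k) * a (Suc k) * (l ^ Suc k / fact (Suc k) * exp (- l))
            = l * (a (Suc k) * (l ^ k / fact k * exp (- l)))" for k
    by (simp add: divide_simps del: of_nat_Suc)
  have "(\<lambda>k. l * (a (Suc k) * (l ^ k / fact k * exp (- l)))) sums (l * pavg l (\<lambda>k. a (Suc k)))"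
    unfolding pavg_def by (intro sums_mult summable_sums s)
  then have "(\<lambda>k. real (Suc k) * a (Suc k) * (l ^ Suc k / fact (Suc k) * exp (- l)))
              sums (l * pavg l (\<lambda>k. a (Suc k)))"
    unfolding e .
  then have "(\<lambda>k. real k * a k * (l ^ k / fact k * exp (- l))) sums
        (l * pavg l (\<lambda>k. a (Suc k)) + real 0 * a 0 * (l ^ 0 / fact 0 * exp (- l)))"
    by (rule sums_Suc)
  then show ?thesis unfolding pavg_def[of l "\<lambda>k. real k * a k"]
    by (simp add: sums_iff)
qed

lemma egrow_real: "egrow real"
proof (rule egrow_mono[OF egrow_power[of 2]])
  show "\<bar>real k\<bar> \<le> 2 ^ k" for k
    using less_exp[of k] by (simp add: of_nat_less_two_power less_imp_le)
qed simp

lemma egrow_mult: "egrow a \<Longrightarrow> egrow b \<Longrightarrow> egrow (\<lambda>k. a k * b k)"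
proof -
  assume "egrow a" "egrow b"
  then obtain M r M' r' where *: "0 \<le> r" "\<And>k. \<bar>a k\<bar> \<le> M * r ^ k" "0 \<le> r'" "\<And>k. \<bar>b k\<bar> \<le> M' * r' ^ k"
    by (auto simp: egrow_def)
  show ?thesis unfolding egrow_def
  proof (intro exI conjI allI)
    fix k
    have "\<bar>a k\<bar> * \<bar>b k\<bar> \<le> (M * r ^ k) * (M' * r' ^ k)"
      using * by (intro mult_mono) (auto intro: order_trans[OF abs_ge_zero])
    then show "\<bar>a k * b k\<bar> \<le> (M * M') * (r * r') ^ k"
      by (simp add: abs_mult power_mult_distrib mult_ac)
  qed (use * in auto)
qed

lemma pavg_real: "pavg l real = l"
  using pavg_shift[of "\<lambda>_. 1" l] by simp

lemma pavg_real_sq: "pavg l (\<lambda>k. (real k)\<^sup>2) = l\<^sup>2 + l"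
proof -
  have "pavg l (\<lambda>k. (real k)\<^sup>2) = l * pavg l (\<lambda>k. real (Suc k))"
    using pavg_shift[OF egrow_real, of l] by (simp add: power2_eq_square)
  also have "pavg l (\<lambda>k. real (Suc k)) = l + 1"
    using pavg_add[of real "\<lambda>_. 1" l] egrow_real by (simp add: pavg_real add.commute)
  finally show ?thesis by (simp add: power2_eq_square algebra_simps)
qed

text \<open>Accounts for the randomness of the number of rings. The square is centred at the value
  of \<open>a\<close> at the integer part of \<open>l\<close>, whose distance to \<open>l\<close>
  costs the summand 2.\<close>

lemma pavg_variance_le:
  assumes l: "0 \<le> l" and b: "egrow a" and lip: "\<And>j k. \<bar>a j - a k\<bar> \<le> L * \<bar>real j - real k\<bar>"
  shows "pavg l (\<lambda>k. (a k)\<^sup>2) - (pavg l a)\<^sup>2 \<le> L\<^sup>2 * (2 * l + 2)"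
proof -
  define m where "m = nat \<lfloor>l\<rfloor>"
  define c where "c = a m"
  have m: "\<bar>real m - l\<bar> \<le> 1" using l by (simp add: m_def) linarith
  have eg: "egrow (\<lambda>k. (a k)\<^sup>2)" unfolding power2_eq_square by (intro egrow_mult b)
  have egr: "egrow (\<lambda>k. (real k)\<^sup>2)" unfolding power2_eq_square by (intro egrow_mult egrow_real)
  define p where "p = pavg l a"
  have "pavg l (\<lambda>k. (a k - c)\<^sup>2) = pavg l (\<lambda>k. (a k)\<^sup>2 + ((- 2 * c) * a k + c\<^sup>2))"
    by (simp add: power2_eq_square algebra_simps)
  also have "\<dots> = pavg l (\<lambda>k. (a k)\<^sup>2) + ((- 2 * c) * p + c\<^sup>2)"
    unfolding p_def
    by (subst pavg_add, rule eg, intro egrow_add egrow_cmult b egrow_const,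
        subst pavg_add, intro egrow_cmult b, simp, subst pavg_cmult, rule b) simp
  finally have 1: "pavg l (\<lambda>k. (a k)\<^sup>2) - p\<^sup>2 = pavg l (\<lambda>k. (a k - c)\<^sup>2) - (p - c)\<^sup>2"
    by (simp add: power2_eq_square algebra_simps)
  have 2: "(a k - c)\<^sup>2 \<le> L\<^sup>2 * (2 * (real k - l)\<^sup>2 + 2)" for k
  proof -
    have "(a k - c)\<^sup>2 \<le> (L * \<bar>real k - real m\<bar>)\<^sup>2"
      using lip[of k m] unfolding c_def by (metis abs_ge_zero power2_abs power_mono)
    also have "\<dots> = L\<^sup>2 * (real k - real m)\<^sup>2" by (simp add: power_mult_distrib)
    also have "(real k - real m)\<^sup>2 \<le> 2 * (real k - l)\<^sup>2 + 2 * (l - real m)\<^sup>2"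
      using sum_squares_bound[of "real k - l" "l - real m"]
      by (simp add: power2_eq_square algebra_simps)
    also have "(l - real m)\<^sup>2 \<le> 1"
      using m by (simp add: abs_square_le_1 abs_minus_commute)
    finally show ?thesis by (simp add: mult_left_mono)
  qed
  have egc: "egrow (\<lambda>k. (a k - c)\<^sup>2)"
    unfolding power2_eq_square
    using egrow_add[OF b egrow_const[of "-c"]] by (intro egrow_mult) auto
  have e3: "(\<lambda>k. L\<^sup>2 * (2 * (real k - l)\<^sup>2 + 2)) = (\<lambda>k. L\<^sup>2 * (2 * (real k)\<^sup>2 + ((- 4 * l) * real k + (2 * l\<^sup>2 + 2))))"
    by (auto simp: power2_eq_square algebra_simps)
  have "pavg l (\<lambda>k. (a k - c)\<^sup>2) \<le> pavg l (\<lambda>k. L\<^sup>2 * (2 * (real k - l)\<^sup>2 + 2))"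
    by (rule pavg_mono[OF egc _ l 2], unfold e3)
       (intro egrow_cmult egrow_add egr egrow_real egrow_const)
  also have "\<dots> = L\<^sup>2 * (2 * l + 2)"
    unfolding e3
    by (subst pavg_cmult pavg_add; (intro egrow_cmult egrow_add egr egrow_real egrow_const)?)+
       (simp add: pavg_real pavg_real_sq[unfolded power2_eq_square] power2_eq_square algebra_simps)
  finally show ?thesis using 1 unfolding p_def by (smt (verit) zero_le_power2)
qed

text \<open>Binomial theorem, read as the convolution of two Poisson laws.\<close>

lemma poisson_pmf_add:
  assumes "0 < a" "0 < b"
  shows "bind_pmf (poisson_pmf a) (\<lambda>j. map_pmf ((+) j) (poisson_pmf b)) = poisson_pmf (a + b)"
proof (rule pmf_eqI)
  fix k
  have p: "pmf (map_pmf ((+) j) (poisson_pmf b)) k = (if j \<le> k then pmf (poisson_pmf b) (k - j) else 0)" for j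
  proof (cases "j \<le> k")
    case True
    have "pmf (map_pmf ((+) j) (poisson_pmf b)) (j + (k - j)) = pmf (poisson_pmf b) (k - j)"
      by (rule pmf_map_inj') simp
    then show ?thesis using True by simp
  next
    case False
    then have "k \<notin> set_pmf (map_pmf ((+) j) (poisson_pmf b))" by auto
    then show ?thesis using False by (simp add: pmf_eq_0_set_pmf)
  qed
  have "pmf (bind_pmf (poisson_pmf a) (\<lambda>j. map_pmf ((+) j) (poisson_pmf b))) k =
        (\<Sum>j\<le>k. pmf (map_pmf ((+) j) (poisson_pmf b)) k * pmf (poisson_pmf a) j)"
    unfolding pmf_bind by (rule integral_measure_pmf_real) (auto simp: p split: if_splits)
  also have "\<dots> = (\<Sum>j\<le>k. of_nat (k choose j) * a ^ j * b ^ (k - j)) / fact k * exp (- (a + b))"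
    unfolding sum_divide_distrib sum_distrib_right
    by (intro sum.cong refl)
       (use assms in \<open>auto simp: p binomial_fact field_simps exp_minus exp_add exp_diff\<close>)
  also have "\<dots> = pmf (poisson_pmf (a + b)) k"
    using assms by (simp add: binomial_ring)
  finally show "pmf (bind_pmf (poisson_pmf a) (\<lambda>j. map_pmf ((+) j) (poisson_pmf b))) k
                 = pmf (poisson_pmf (a + b)) k" .
qed

lemma pavg_eq_expectation:
  assumes "0 < l" "\<And>k. \<bar>a k\<bar> \<le> M"
  shows "measure_pmf.expectation (poisson_pmf l) a = pavg l a"
proof -
  have int: "integrable (measure_pmf (poisson_pmf l)) a"
    by (rule measure_pmf.integrable_const_bound[where B = M]) (auto simp: assms)
  then have int': "integrable (count_space UNIV) (\<lambda>k. pmf (poisson_pmf l) k *\<^sub>R a k)"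
    by (subst (asm) measure_pmf_eq_density, subst (asm) integrable_density) auto
  have "measure_pmf.expectation (poisson_pmf l) a = (LINT k|count_space UNIV. pmf (poisson_pmf l) k *\<^sub>R a k)"
    by (subst measure_pmf_eq_density, subst integral_density) auto
  also have "\<dots> = (\<Sum>k. pmf (poisson_pmf l) k *\<^sub>R a k)"
    using int' by (rule integral_count_space_nat)
  finally show ?thesis using assms by (simp add: pavg_def mult.commute)
qed

text \<open>Rings in consecutive time intervals are independent with added parameters; this is the
  source of the semigroup law \<open>S_S\<close>.\<close>

lemma pavg_pavg:
  assumes "0 \<le> a" "0 \<le> b" "\<And>k. \<bar>c k\<bar> \<le> M"
  shows "pavg a (\<lambda>j. pavg b (\<lambda>k. c (j + k))) = pavg (a + b) c"
proof (cases "a = 0 \<or> b = 0")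
  case True
  then show ?thesis by auto
next
  case False
  then have ab: "0 < a" "0 < b" using assms by auto
  have M: "\<bar>pavg b (\<lambda>k. c (j + k))\<bar> \<le> M" for j
    using pavg_abs_le[of "\<lambda>_. M" b "\<lambda>k. c (j + k)"] assms by simp
  have "pavg (a + b) c = measure_pmf.expectation (poisson_pmf (a + b)) c"
    using ab assms by (intro pavg_eq_expectation[symmetric]) auto
  also have "\<dots> = measure_pmf.expectation (poisson_pmf a)
      (\<lambda>j. measure_pmf.expectation (map_pmf ((+) j) (poisson_pmf b)) c)"
    unfolding poisson_pmf_add[OF ab, symmetric] measure_pmf_bind
    by (subst integral_bind[where K = "count_space UNIV" and B' = 1 and B = M])
       (auto simp: assms measure_pmf_in_subprob_space measure_pmf.emeasure_space_1)
  also have "\<dots> = measure_pmf.expectation (poisson_pmf a) (\<lambda>j. pavg b (\<lambda>k. c (j + k)))"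
    using ab assms by (simp add: pavg_eq_expectation[where M = M])
  also have "\<dots> = pavg a (\<lambda>j. pavg b (\<lambda>k. c (j + k)))"
    using ab M by (intro pavg_eq_expectation) auto
  finally show ?thesis ..
qed

lemma pavg_has_derivative:
  assumes "\<And>k. \<bar>a k\<bar> \<le> M"
  shows "((\<lambda>t. pavg (m * t) a) has_real_derivative
           m * (pavg (m * t) (\<lambda>k. a (Suc k)) - pavg (m * t) a)) (at t)"
proof -
  \<comment> \<open>\<open>exp_weighted_series_deriv\<close> wants coefficients bounded by 1;
    \<open>M'\<close> is kept at least 1 so that the division is legitimate.\<close>
  define M' where "M' = max M 1"
  have M': "M' > 0" "\<And>k. \<bar>a k\<bar> \<le> M'" using assms by (auto simp: M'_def le_max_iff_disj)
  have eg: "egrow a" "egrow (\<lambda>k. a (Suc k))" using assms by (auto intro: egrow_bounded)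
  have s: "pavg l (\<lambda>k. a k) = M' * pavg l (\<lambda>k. a k / M')"
          "pavg l (\<lambda>k. a (Suc k)) = M' * pavg l (\<lambda>k. a (Suc k) / M')" for l
    using pavg_cmult[OF eg(1), of l "1/M'"] pavg_cmult[OF eg(2), of l "1/M'"] M' by auto
  have d: "((\<lambda>t. pavg (m * t) (\<lambda>k. a k / M')) has_real_derivative
          m * (pavg (m * t) (\<lambda>k. a (Suc k) / M') - pavg (m * t) (\<lambda>k. a k / M'))) (at t)"
    using exp_weighted_series_deriv[of "\<lambda>k. a k / M'" m t] M' by (simp add: pavg_def)
  show ?thesis unfolding s
    by (rule DERIV_cong[OF DERIV_cmult[OF d]]) (simp add: algebra_simps)
qed

section \<open>Positive unital operators\<close>

text \<open>Markov operators, axiomatised by linearity, unit and monotonicity. Source and target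
  state spaces may differ, so that an expectation is the instance with target
  \<open>unit\<close>.\<close>

definition posop :: "(('x \<Rightarrow> real) \<Rightarrow> ('y \<Rightarrow> real)) \<Rightarrow> bool" where
  "posop A \<longleftrightarrow> (\<forall>f g. A (\<lambda>x. f x + g x) = (\<lambda>y. A f y + A g y)) \<and>
     (\<forall>c f. A (\<lambda>x. c * f x) = (\<lambda>y. c * A f y)) \<and> (\<forall>c. A (\<lambda>_. c) = (\<lambda>_. c)) \<and>
     (\<forall>f g. (\<forall>x. f x \<le> g x) \<longrightarrow> (\<forall>y. A f y \<le> A g y))"

lemma posop_add: "posop A \<Longrightarrow> A (\<lambda>x. f x + g x) y = A f y + A g y"
  unfolding posop_def by metis

lemma posop_cmult: "posop A \<Longrightarrow> A (\<lambda>x. c * f x) y = c * A f y"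
  unfolding posop_def by metis

lemma posop_const: "posop A \<Longrightarrow> A (\<lambda>_. c) y = c"
  unfolding posop_def by metis

lemma posop_mono: "posop A \<Longrightarrow> (\<And>x. f x \<le> g x) \<Longrightarrow> A f y \<le> A g y"
  unfolding posop_def by blast

lemma posop_diff: "posop A \<Longrightarrow> A (\<lambda>x. f x - g x) y = A f y - A g y"
  using posop_add[of A f "\<lambda>x. (-1) * g x" y] posop_cmult[of A "-1" g y] by simp

lemma posop_sum:
  assumes "posop A" shows "A (\<lambda>x. \<Sum>i\<in>I. f i x) y = (\<Sum>i\<in>I. A (f i) y)"
  by (induction I rule: infinite_finite_induct) (simp_all add: posop_const[OF assms] posop_add[OF assms])

lemma posop_abs:
  assumes "posop A" "\<And>x. \<bar>f x\<bar> \<le> g x" shows "\<bar>A f y\<bar> \<le> A g y"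
proof -
  have "A f y \<le> A g y" by (rule posop_mono[OF assms(1)]) (use assms(2) in \<open>auto dest: abs_le_D1\<close>)
  moreover have "A (\<lambda>x. (-1) * f x) y \<le> A g y"
    by (rule posop_mono[OF assms(1)]) (use assms(2) in \<open>auto dest: abs_le_D2\<close>)
  ultimately show ?thesis unfolding posop_cmult[OF assms(1)] by simp
qed

lemma posop_bounded:
  assumes "posop A" "\<And>x. \<bar>f x\<bar> \<le> M" shows "\<bar>A f y\<bar> \<le> M"
  using posop_abs[OF assms(1), of f "\<lambda>_. M" y] assms by (simp add: posop_const)

lemma posop_comp: "posop A \<Longrightarrow> posop B \<Longrightarrow> posop (\<lambda>f. A (B f))"
  unfolding posop_def by auto

lemma posop_funpow:
  fixes A :: "('x \<Rightarrow> real) \<Rightarrow> ('x \<Rightarrow> real)"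
  shows "posop A \<Longrightarrow> posop (A ^^ k)"
proof (induction k)
  case (Suc k)
  then show ?case using posop_comp[of A "A ^^ k"] by (simp add: comp_def)
qed (simp add: posop_def)

text \<open>Jensen's inequality for squares, from positivity of \<open>(f - m)\<^sup>2\<close> with
  \<open>m\<close> the mean.\<close>

lemma posop_square:
  assumes "posop A" shows "(A f y)\<^sup>2 \<le> A (\<lambda>x. (f x)\<^sup>2) y"
proof -
  define m where "m = A f y"
  have "0 \<le> A (\<lambda>x. (f x - m)\<^sup>2) y"
    using posop_mono[OF assms, of "\<lambda>_. 0" "\<lambda>x. (f x - m)\<^sup>2" y] by (simp add: posop_const[OF assms])
  also have "(\<lambda>x. (f x - m)\<^sup>2) = (\<lambda>x. (f x)\<^sup>2 + ((- 2 * m) * f x + m\<^sup>2))"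
    by (auto simp: power2_eq_square algebra_simps)
  also have "A \<dots> y = A (\<lambda>x. (f x)\<^sup>2) y + ((- 2 * m) * m + m\<^sup>2)"
    unfolding m_def by (subst posop_add[OF assms], subst posop_add[OF assms], subst posop_cmult[OF assms])
       (simp add: posop_const[OF assms])
  finally show ?thesis by (simp add: m_def power2_eq_square)
qed

text \<open>The mean is the best constant predictor in mean square, so any convenient centre
  \<open>c\<close> bounds the variance.\<close>

lemma posop_variance_le:
  assumes "posop A" shows "A (\<lambda>x. (f x)\<^sup>2) y - (A f y)\<^sup>2 \<le> A (\<lambda>x. (f x - c)\<^sup>2) y"
proof -
  have "A (\<lambda>x. (f x - c)\<^sup>2) y = A (\<lambda>x. (f x)\<^sup>2 + ((- 2 * c) * f x + c\<^sup>2)) y"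
    by (intro arg_cong[of _ _ "\<lambda>g. A g y"]) (auto simp: power2_eq_square algebra_simps)
  also have "\<dots> = A (\<lambda>x. (f x)\<^sup>2) y + ((- 2 * c) * A f y + c\<^sup>2)"
    by (subst posop_add[OF assms], subst posop_add[OF assms], subst posop_cmult[OF assms])
       (simp add: posop_const[OF assms])
  moreover have "0 \<le> (A f y - c)\<^sup>2" by simp
  ultimately show ?thesis by (simp add: power2_eq_square algebra_simps)
qed

definition bf :: "('x \<Rightarrow> real) \<Rightarrow> bool" where "bf f \<longleftrightarrow> (\<exists>M. \<forall>x. \<bar>f x\<bar> \<le> M)"

lemma bfI: "(\<And>x. \<bar>f x\<bar> \<le> M) \<Longrightarrow> bf f" by (auto simp: bf_def)

lemma bf_const [simp]: "bf (\<lambda>_. c)" by (auto simp: bf_def)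

lemma bf_add: assumes "bf f" "bf g" shows "bf (\<lambda>x. f x + g x)"
proof -
  obtain M M' where "\<And>x. \<bar>f x\<bar> \<le> M" "\<And>x. \<bar>g x\<bar> \<le> M'" using assms by (auto simp: bf_def)
  then show ?thesis by (intro bfI[of _ "M + M'"]) (meson abs_triangle_ineq add_mono order_trans)
qed

lemma bf_mult: assumes "bf f" "bf g" shows "bf (\<lambda>x. f x * g x)"
proof -
  obtain M M' where *: "\<And>x. \<bar>f x\<bar> \<le> M" "\<And>x. \<bar>g x\<bar> \<le> M'" using assms by (auto simp: bf_def)
  show ?thesis
  proof (rule bfI)
    show "\<bar>f x * g x\<bar> \<le> M * M'" for x
      unfolding abs_mult using *[of x] by (intro mult_mono) auto
  qed
qed

lemma bf_diff: "bf f \<Longrightarrow> bf g \<Longrightarrow> bf (\<lambda>x. f x - g x)"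
  using bf_add[of f "\<lambda>x. (-1) * g x"] bf_mult[of "\<lambda>_. -1" g] by simp

lemma bf_sum: "(\<And>i. i \<in> I \<Longrightarrow> bf (f i)) \<Longrightarrow> bf (\<lambda>x. \<Sum>i\<in>I. f i x)"
  by (induction I rule: infinite_finite_induct) (auto intro: bf_add)

lemma bf_prod: "(\<And>i. i \<in> I \<Longrightarrow> bf (f i)) \<Longrightarrow> bf (\<lambda>x. \<Prod>i\<in>I. f i x)"
  by (induction I rule: infinite_finite_induct) (auto intro: bf_mult)

lemma bf_of_bool [simp]: "bf (\<lambda>x. of_bool (P x))" by (rule bfI[of _ 1]) auto

lemma bf_square: "bf f \<Longrightarrow> bf (\<lambda>x. (f x)\<^sup>2)" unfolding power2_eq_square by (rule bf_mult)

lemma posop_bf: "posop A \<Longrightarrow> bf f \<Longrightarrow> bf (A f)"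
  unfolding bf_def using posop_bounded by metis

text \<open>A finite sum, hence interchangeable with Poisson series without integrability
  conditions. For infinite support the sum is 0 by convention, so comparison with the true
  expectation asks for finite support.\<close>

definition pexp :: "'x pmf \<Rightarrow> ('x \<Rightarrow> real) \<Rightarrow> real" where
  "pexp \<nu> f = (\<Sum>x\<in>set_pmf \<nu>. pmf \<nu> x * f x)"

lemma pexp_expectation: "finite (set_pmf \<nu>) \<Longrightarrow> pexp \<nu> f = measure_pmf.expectation \<nu> f"
  unfolding pexp_def by (subst integral_measure_pmf[of "set_pmf \<nu>"]) auto

lemma posop_ev: assumes "finite (set_pmf \<nu>)" shows "posop (\<lambda>f (_::unit). pexp \<nu> f)"
  unfolding posop_def pexp_def
proof (intro conjI allI impI ext)
  show "(\<Sum>x\<in>set_pmf \<nu>. pmf \<nu> x * c) = c" for c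
    by (simp add: sum_distrib_right[symmetric] sum_pmf_eq_1 assms)
qed (auto simp: distrib_left sum.distrib sum_distrib_left mult_ac intro!: sum_mono mult_right_mono)

lemma pexp_return [simp]: "pexp (return_pmf x) f = f x" by (simp add: pexp_def)

lemma pexp_cong: "(\<And>x. x \<in> set_pmf \<nu> \<Longrightarrow> f x = g x) \<Longrightarrow> pexp \<nu> f = pexp \<nu> g"
  unfolding pexp_def by simp

lemma pexp_mono: "(\<And>x. x \<in> set_pmf \<nu> \<Longrightarrow> f x \<le> g x) \<Longrightarrow> pexp \<nu> f \<le> pexp \<nu> g"
  unfolding pexp_def by (intro sum_mono mult_left_mono) auto

lemma pexp_pavg:
  assumes "\<And>x. egrow (\<lambda>k. g k x)"
  shows "pexp \<nu> (\<lambda>x. pavg l (\<lambda>k. g k x)) = pavg l (\<lambda>k. pexp \<nu> (g k))"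
  unfolding pexp_def using assms by (subst pavg_sum) (auto simp: pavg_cmult egrow_cmult)

section \<open>The ring operator of a noisy voter model\<close>

text \<open>The kernel \<open>J\<close> and the colour set are left arbitrary because the theory is
  instantiated for the graph, for pure noise with the identity kernel, for the symbolic model, and
  for the truncated kernel. States are total functions whose values may lie outside
  \<open>C\<close>; the symbolic model starts from such a state.\<close>

locale nvm =
  fixes V :: "'a set" and C :: "'c set" and \<theta> :: real and J :: "'a \<Rightarrow> 'a \<Rightarrow> real"
  assumes finV: "finite V" and neV: "V \<noteq> {}" and finC: "finite C" and neC: "C \<noteq> {}"
    and th0: "0 < \<theta>" and th1: "\<theta> \<le> 1"
    and J0: "\<And>u v. 0 \<le> J u v" and J1: "\<And>u. u \<in> V \<Longrightarrow> (\<Sum>v\<in>V. J u v) = 1"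
begin

abbreviation "n \<equiv> real (card V)"

definition Q :: "'a \<Rightarrow> (('a \<Rightarrow> 'c) \<Rightarrow> real) \<Rightarrow> ('a \<Rightarrow> 'c) \<Rightarrow> real" where
  "Q u f x = \<theta> * ((\<Sum>c\<in>C. f (x(u := c))) / real (card C)) + (1 - \<theta>) * (\<Sum>v\<in>V. J u v * f (x(u := x v)))"

definition T :: "(('a \<Rightarrow> 'c) \<Rightarrow> real) \<Rightarrow> ('a \<Rightarrow> 'c) \<Rightarrow> real" where
  "T f x = (\<Sum>u\<in>V. Q u f x) / n"

text \<open>Backward semigroup: the mean at time \<open>t\<close> of the observable \<open>f\<close>
  from state \<open>x\<close>. All clocks together ring at rate \<open>n\<close>.\<close>

definition S :: "real \<Rightarrow> (('a \<Rightarrow> 'c) \<Rightarrow> real) \<Rightarrow> ('a \<Rightarrow> 'c) \<Rightarrow> real" where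
  "S t f x = pavg (n * t) (\<lambda>k. (T ^^ k) f x)"

lemma n1: "1 \<le> n" using finV neV by (simp add: Suc_le_eq card_gt_0_iff)
lemma n0: "0 < n" using n1 by linarith
lemma cC: "0 < real (card C)" using finC neC by (simp add: card_gt_0_iff)

lemma thn: "0 \<le> 1 - \<theta> / n" "1 - \<theta> / n < 1"
  using n1 th0 th1 by (auto simp: field_simps)

lemma posop_Q: "u \<in> V \<Longrightarrow> posop (Q u)"
  unfolding posop_def Q_def
proof (intro conjI allI impI ext, goal_cases)
  case (1 f g x)
  then show ?case by (simp add: sum.distrib distrib_left add_divide_distrib)
next
  case (2 c f x)
  have "(\<Sum>v\<in>V. J u v * (c * f (x(u := x v)))) = c * (\<Sum>v\<in>V. J u v * f (x(u := x v)))"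
    by (simp add: sum_distrib_left mult_ac)
  then show ?case by (simp add: sum_distrib_left[symmetric] algebra_simps)
next
  case (3 c x)
  then have "(\<Sum>v\<in>V. J u v * c) = c" by (simp add: sum_distrib_right[symmetric] J1)
  then show ?case using cC by (simp add: left_diff_distrib)
next
  case (4 f g x)
  then show ?case using th0 th1
    by (intro add_mono mult_left_mono sum_mono divide_right_mono J0) auto
qed

lemma posop_T: "posop T"
proof -
  have "T (\<lambda>x. f x + g x) = (\<lambda>y. T f y + T g y)" for f g
    by (auto simp: T_def posop_add[OF posop_Q] sum.distrib add_divide_distrib)
  moreover have "T (\<lambda>x. c * f x) = (\<lambda>y. c * T f y)" for c f
    by (auto simp: T_def posop_cmult[OF posop_Q] sum_distrib_left[symmetric])
  moreover have "T (\<lambda>_. c) = (\<lambda>_. c)" for c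
    using n0 by (auto simp: T_def posop_const[OF posop_Q])
  moreover have "T f y \<le> T g y" if "\<forall>x. f x \<le> g x" for f g y
    unfolding T_def using that by (intro divide_right_mono sum_mono posop_mono[OF posop_Q]) auto
  ultimately show ?thesis unfolding posop_def by blast
qed

lemma posop_Tk: "posop (T ^^ k)" by (rule posop_funpow[OF posop_T])

lemma egrow_Tk: "bf f \<Longrightarrow> egrow (\<lambda>k. (T ^^ k) f x)"
proof -
  assume "bf f"
  then obtain M where "\<And>x. \<bar>f x\<bar> \<le> M" by (auto simp: bf_def)
  then show ?thesis by (intro egrow_bounded[of _ M] posop_bounded[OF posop_Tk])
qed

lemma S_add: "bf f \<Longrightarrow> bf g \<Longrightarrow> S t (\<lambda>x. f x + g x) x = S t f x + S t g x"
  by (simp add: S_def posop_add[OF posop_Tk] pavg_add egrow_Tk)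
lemma S_diff: "bf f \<Longrightarrow> bf g \<Longrightarrow> S t (\<lambda>x. f x - g x) x = S t f x - S t g x"
  by (simp add: S_def posop_diff[OF posop_Tk] pavg_diff egrow_Tk)
lemma S_cmult: "bf f \<Longrightarrow> S t (\<lambda>x. c * f x) x = c * S t f x"
  by (simp add: S_def posop_cmult[OF posop_Tk] pavg_cmult egrow_Tk)
lemma S_sum: "(\<And>i. i \<in> I \<Longrightarrow> bf (f i)) \<Longrightarrow> S t (\<lambda>x. \<Sum>i\<in>I. f i x) x = (\<Sum>i\<in>I. S t (f i) x)"
  by (simp add: S_def posop_sum[OF posop_Tk] pavg_sum egrow_Tk)
lemma S_const [simp]: "S t (\<lambda>_. c) x = c"
  by (simp add: S_def posop_const[OF posop_Tk])
lemma S_0 [simp]: "S 0 f x = f x" by (simp add: S_def)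
lemma S_mono: "bf f \<Longrightarrow> bf g \<Longrightarrow> 0 \<le> t \<Longrightarrow> (\<And>x. f x \<le> g x) \<Longrightarrow> S t f x \<le> S t g x"
  unfolding S_def by (intro pavg_mono egrow_Tk posop_mono[OF posop_Tk]) auto
lemma S_abs: "bf g \<Longrightarrow> 0 \<le> t \<Longrightarrow> (\<And>x. \<bar>f x\<bar> \<le> g x) \<Longrightarrow> \<bar>S t f x\<bar> \<le> S t g x"
  unfolding S_def by (intro pavg_abs_le egrow_Tk posop_abs[OF posop_Tk]) auto
lemma S_bounded: "0 \<le> t \<Longrightarrow> (\<And>x. \<bar>f x\<bar> \<le> M) \<Longrightarrow> \<bar>S t f x\<bar> \<le> M"
  using S_abs[of "\<lambda>_. M" t f x] by simp
lemma bf_S: "0 \<le> t \<Longrightarrow> bf f \<Longrightarrow> bf (S t f)"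
  unfolding bf_def using S_bounded by metis

lemma pexp_S: "bf f \<Longrightarrow> pexp \<nu> (S t f) = pavg (n * t) (\<lambda>k. pexp \<nu> ((T ^^ k) f))"
  unfolding S_def by (intro pexp_pavg egrow_Tk)

lemma T_pavg:
  assumes "\<And>x. egrow (\<lambda>k. g k x)"
  shows "T (\<lambda>x. pavg l (\<lambda>k. g k x)) x = pavg l (\<lambda>k. T (g k) x)"
proof -
  have 1: "egrow (\<lambda>k. \<Sum>c\<in>C. g k (x(u := c)))" "egrow (\<lambda>k. \<Sum>v\<in>V. J u v * g k (x(u := x v)))" for u
    by (intro egrow_sum egrow_cmult assms)+
  then have 2: "egrow (\<lambda>k. \<theta> / real (card C) * (\<Sum>c\<in>C. g k (x(u := c))) + (1 - \<theta>) * (\<Sum>v\<in>V. J u v * g k (x(u := x v))))" for u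
    by (intro egrow_add egrow_cmult)
  have e: "T f x = 1 / n * (\<Sum>u\<in>V. \<theta> / real (card C) * (\<Sum>c\<in>C. f (x(u := c))) + (1 - \<theta>) * (\<Sum>v\<in>V. J u v * f (x(u := x v))))" for f
    by (simp add: T_def Q_def)
  have "pavg l (\<lambda>k. T (g k) x) = 1 / n * (\<Sum>u\<in>V. pavg l (\<lambda>k. \<theta> / real (card C) * (\<Sum>c\<in>C. g k (x(u := c)))
          + (1 - \<theta>) * (\<Sum>v\<in>V. J u v * g k (x(u := x v)))))"
    unfolding e by (subst pavg_cmult, intro egrow_sum 2, subst pavg_sum, rule 2) simp
  also have "\<dots> = 1 / n * (\<Sum>u\<in>V. \<theta> / real (card C) * (\<Sum>c\<in>C. pavg l (\<lambda>k. g k (x(u := c))))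
          + (1 - \<theta>) * (\<Sum>v\<in>V. J u v * pavg l (\<lambda>k. g k (x(u := x v)))))"
    by (subst pavg_add, intro egrow_cmult 1, intro egrow_cmult 1,
        subst pavg_cmult, rule 1, subst pavg_cmult, rule 1)
       (simp add: pavg_sum pavg_cmult egrow_cmult assms)
  finally show ?thesis unfolding e ..
qed

lemma Tk_S: "bf f \<Longrightarrow> (T ^^ j) (S t f) x = pavg (n * t) (\<lambda>k. (T ^^ (j + k)) f x)"
proof (induction j arbitrary: x)
  case (Suc j)
  have eg: "egrow (\<lambda>k. (T ^^ (j + k)) f x)" for x
    using posop_bf[OF posop_Tk Suc.prems] Suc.prems
    by (subst add.commute, subst funpow_add) (auto intro!: egrow_Tk simp: comp_def)
  have "(T ^^ j) (S t f) = (\<lambda>x. pavg (n * t) (\<lambda>k. (T ^^ (j + k)) f x))"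
    using Suc by blast
  then have "(T ^^ Suc j) (S t f) x = T (\<lambda>x. pavg (n * t) (\<lambda>k. (T ^^ (j + k)) f x)) x"
    by simp
  also have "\<dots> = pavg (n * t) (\<lambda>k. T ((T ^^ (j + k)) f) x)"
    by (rule T_pavg[OF eg])
  finally show ?case by simp
qed (simp add: S_def)

lemma S_S:
  assumes "bf f" "0 \<le> s" "0 \<le> t" shows "S s (S t f) x = S (s + t) f x"
proof -
  obtain M where M: "\<And>x. \<bar>f x\<bar> \<le> M" using assms by (auto simp: bf_def)
  have "S s (S t f) x = pavg (n * s) (\<lambda>j. pavg (n * t) (\<lambda>k. (T ^^ (j + k)) f x))"
    by (subst S_def) (simp add: Tk_S assms)
  also have "\<dots> = pavg (n * s + n * t) (\<lambda>k. (T ^^ k) f x)"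
    using assms by (intro pavg_pavg[where M = M] posop_bounded[OF posop_Tk] M) auto
  finally show ?thesis by (simp add: S_def distrib_left)
qed

text \<open>Kolmogorov's equation with the generator applied to \<open>f\<close> first: the sum over
  \<open>u\<close> is \<open>n * (T f - f)\<close>. Whenever the generator maps a family of
  observables to linear combinations of the family, their means satisfy a closed linear
  system.\<close>

lemma S_deriv:
  assumes "bf f"
  shows "((\<lambda>t. pexp \<nu> (S t f)) has_real_derivative pexp \<nu> (S t (\<lambda>x. \<Sum>u\<in>V. Q u f x - f x))) (at t)"
proof -
  obtain M where M: "\<And>x. \<bar>f x\<bar> \<le> M" using assms by (auto simp: bf_def)
  define w where "w = (\<Sum>x\<in>set_pmf \<nu>. pmf \<nu> x)"
  have b: "\<bar>pexp \<nu> ((T ^^ k) f)\<bar> \<le> w * M" for k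
  proof -
    have "\<bar>pexp \<nu> ((T ^^ k) f)\<bar> \<le> (\<Sum>x\<in>set_pmf \<nu>. pmf \<nu> x * M)"
      unfolding pexp_def
      by (rule order_trans[OF sum_abs]) (auto intro!: sum_mono mult_left_mono posop_bounded[OF posop_Tk] M simp: abs_mult)
    then show ?thesis by (simp add: w_def sum_distrib_right)
  qed
  have e: "(\<lambda>x. \<Sum>u\<in>V. Q u f x - f x) = (\<lambda>x. n * (T f x - f x))"
    using n0 by (auto simp: T_def sum_subtractf right_diff_distrib)
  have bT: "bf (T f)" by (rule posop_bf[OF posop_T assms])
  have "S t (\<lambda>x. n * (T f x - f x)) x = n * (S t (T f) x - S t f x)" for x
    by (simp add: S_cmult S_diff bT assms bf_diff)
  then have "pexp \<nu> (S t (\<lambda>x. n * (T f x - f x))) = n * (pexp \<nu> (S t (T f)) - pexp \<nu> (S t f))"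
    unfolding pexp_def sum_distrib_left sum_subtractf[symmetric]
    by (intro sum.cong refl) (simp only: right_diff_distrib mult.left_commute)
  moreover have "pexp \<nu> (S t (T f)) = pavg (n * t) (\<lambda>k. pexp \<nu> ((T ^^ Suc k) f))"
    by (subst pexp_S[OF bT]) (simp add: funpow_swap1)
  ultimately show ?thesis
    using pavg_has_derivative[of "\<lambda>k. pexp \<nu> ((T ^^ k) f)" "w * M" n t] b
    unfolding e by (simp add: pexp_S[OF assms])
qed

section \<open>Influences\<close>

definition osc :: "(('a \<Rightarrow> 'c) \<Rightarrow> real) \<Rightarrow> ('a \<Rightarrow> real) \<Rightarrow> bool" where
  "osc f d \<longleftrightarrow> (\<forall>u\<in>V. \<forall>x c. \<bar>f (x(u := c)) - f x\<bar> \<le> d u)"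

text \<open>Transport of influences by the adjoint of the killed walk: a ring of \<open>u\<close>
  passes the influence of \<open>u\<close> on to the copied neighbour \<open>z\<close>, except with
  probability \<open>\<theta>\<close>, when it is lost.\<close>

definition Md :: "('a \<Rightarrow> real) \<Rightarrow> 'a \<Rightarrow> real" where
  "Md d z = d z - d z / n + (1 - \<theta>) / n * (\<Sum>u\<in>V. J u z * d u)"

lemma oscD: "osc f d \<Longrightarrow> u \<in> V \<Longrightarrow> \<bar>f (x(u := c)) - f x\<bar> \<le> d u"
  by (auto simp: osc_def)

lemma osc_nonneg: "osc f d \<Longrightarrow> u \<in> V \<Longrightarrow> 0 \<le> d u"
  using oscD abs_ge_zero order_trans by metis

text \<open>Two states differing only at \<open>z\<close> are updated with the same randomness. A
  ring of \<open>z\<close> erases the discrepancy unless \<open>z\<close> copies itself; a ring of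
  another \<open>u\<close> keeps it and duplicates it at \<open>u\<close> when \<open>z\<close> is
  copied.\<close>

lemma osc_Q:
  assumes d: "osc f d" and z: "z \<in> V" and u: "u \<in> V"
  shows "\<bar>Q u f (x(z := b)) - Q u f x\<bar> \<le> (if u = z then 0 else d z) + (1 - \<theta>) * (J u z * d u)"
proof -
  let ?x = "x(z := b)"
  define e where "e = (if u = z then 0 else d z)"
  have noise: "\<bar>f (?x(u := c)) - f (x(u := c))\<bar> \<le> e" for c
    using oscD[OF d z, of "x(u := c)" b] by (auto simp: e_def fun_upd_twist)
  have jump: "\<bar>f (?x(u := ?x v)) - f (x(u := x v))\<bar> \<le> e + (if v = z then d u else 0)" for v
  proof (cases "v = z")
    case False
    then show ?thesis using oscD[OF d z, of "x(u := x v)" b] by (auto simp: e_def fun_upd_twist)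
  next
    case v: True
    show ?thesis
    proof (cases "u = z")
      case True
      then show ?thesis using v oscD[OF d z, of x b] by (auto simp: e_def)
    next
      case False
      have "\<bar>f (x(u := x z, z := b, u := b)) - f (x(u := x z, z := b))\<bar> \<le> d u"
        "\<bar>f (x(u := x z, z := b)) - f (x(u := x z))\<bar> \<le> d z"
        by (intro oscD[OF d] u z)+
      moreover have "x(u := x z, z := b, u := b) = ?x(u := b)" using False by auto
      ultimately show ?thesis using v False by (simp add: e_def)
    qed
  qed
  have "Q u f ?x - Q u f x = \<theta> * ((\<Sum>c\<in>C. f (?x(u := c)) - f (x(u := c))) / real (card C))
      + (1 - \<theta>) * (\<Sum>v\<in>V. J u v * (f (?x(u := ?x v)) - f (x(u := x v))))"
    unfolding Q_def sum_subtractf right_diff_distrib diff_divide_distrib by linarith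
  moreover have "\<bar>(\<Sum>c\<in>C. f (?x(u := c)) - f (x(u := c))) / real (card C)\<bar> \<le> e"
  proof -
    have "\<bar>\<Sum>c\<in>C. f (?x(u := c)) - f (x(u := c))\<bar> \<le> (\<Sum>c\<in>C. e)"
      by (rule order_trans[OF sum_abs sum_mono[OF noise]])
    then show ?thesis using cC by (simp add: abs_div field_simps)
  qed
  moreover have "\<bar>\<Sum>v\<in>V. J u v * (f (?x(u := ?x v)) - f (x(u := x v)))\<bar> \<le> e + J u z * d u"
  proof -
    have "\<bar>\<Sum>v\<in>V. J u v * (f (?x(u := ?x v)) - f (x(u := x v)))\<bar>
           \<le> (\<Sum>v\<in>V. J u v * (e + (if v = z then d u else 0)))"
      by (rule order_trans[OF sum_abs sum_mono]) (auto simp only: abs_mult abs_of_nonneg[OF J0] intro!: mult_left_mono jump J0)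
    also have "\<dots> = (\<Sum>v\<in>V. J u v) * e + (\<Sum>v\<in>V. if v = z then J u v * d u else 0)"
      unfolding distrib_left sum.distrib sum_distrib_right by (intro arg_cong2[of _ _ _ _ "(+)"] sum.cong) auto
    also have "\<dots> = e + J u z * d u" using z finV J1[OF u] by simp
    finally show ?thesis .
  qed
  ultimately have "\<bar>Q u f ?x - Q u f x\<bar> \<le> \<theta> * e + (1 - \<theta>) * (e + J u z * d u)"
    using th0 th1
    by (simp only: abs_mult abs_of_nonneg order_trans[OF abs_triangle_ineq] add_mono mult_left_mono less_imp_le diff_ge_0_iff_ge)
  then show ?thesis by (simp add: e_def[symmetric] algebra_simps)
qed

lemma osc_T: assumes d: "osc f d" shows "osc (T f) (Md d)"
  unfolding osc_def
proof (intro ballI allI)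
  fix z x b assume z: "z \<in> V"
  have "\<bar>T f (x(z := b)) - T f x\<bar> = \<bar>\<Sum>u\<in>V. Q u f (x(z := b)) - Q u f x\<bar> / n"
    unfolding T_def diff_divide_distrib[symmetric] sum_subtractf[symmetric] using n0 by (simp add: abs_div)
  also have "\<dots> \<le> (\<Sum>u\<in>V. (if u = z then 0 else d z) + (1 - \<theta>) * (J u z * d u)) / n"
    using n0 osc_Q[OF d z]
    by (intro divide_right_mono order_trans[OF sum_abs] sum_mono) auto
  also have "(\<Sum>u\<in>V. (if u = z then 0 else d z) + (1 - \<theta>) * (J u z * d u))
           = (\<Sum>u\<in>V. d z - (if u = z then d z else 0)) + (1 - \<theta>) * (\<Sum>u\<in>V. J u z * d u)"
    unfolding sum.distrib sum_distrib_left by (intro arg_cong2[of _ _ _ _ "(+)"] sum.cong) auto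
  also have "\<dots> = n * d z - d z + (1 - \<theta>) * (\<Sum>u\<in>V. J u z * d u)"
    using z finV by (simp add: sum_subtractf)
  also have "\<dots> / n = Md d z" using n0 by (simp add: Md_def field_simps)
  finally show "\<bar>T f (x(z := b)) - T f x\<bar> \<le> Md d z" .
qed

lemma osc_Tk: "osc f d \<Longrightarrow> osc ((T ^^ k) f) ((Md ^^ k) d)"
  by (induction k) (auto intro: osc_T)

text \<open>Summing the transported influences against \<open>\<omega>\<close> moves
  \<open>J\<close> onto the weight, so a bound \<open>B\<close> on the growth of
  \<open>\<omega>\<close> under \<open>J\<close> controls the growth per ring. The weight 1 with
  \<open>B = 1\<close> gives the contraction; \<open>B = 3\<close> serves weights exponential in the
  distance.\<close>

lemma Md_weighted:
  assumes w: "\<And>u. u \<in> V \<Longrightarrow> (\<Sum>z\<in>V. J u z * \<omega> z) \<le> B * \<omega> u" and d: "\<And>u. u \<in> V \<Longrightarrow> 0 \<le> d u"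
  shows "(\<Sum>z\<in>V. \<omega> z * Md d z) \<le> (1 - 1 / n + (1 - \<theta>) * B / n) * (\<Sum>z\<in>V. \<omega> z * d z)"
proof -
  have "(\<Sum>z\<in>V. \<omega> z * Md d z) = (1 - 1 / n) * (\<Sum>z\<in>V. \<omega> z * d z)
        + (1 - \<theta>) / n * (\<Sum>z\<in>V. \<Sum>u\<in>V. \<omega> z * (J u z * d u))"
    unfolding Md_def sum_distrib_left sum.distrib[symmetric]
    by (intro sum.cong refl) (simp add: algebra_simps sum_distrib_left)
  also have "(\<Sum>z\<in>V. \<Sum>u\<in>V. \<omega> z * (J u z * d u)) = (\<Sum>u\<in>V. d u * (\<Sum>z\<in>V. J u z * \<omega> z))"
    by (subst sum.swap) (simp add: sum_distrib_left mult_ac)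
  also have "(1 - \<theta>) / n * \<dots> \<le> (1 - \<theta>) / n * (\<Sum>u\<in>V. d u * (B * \<omega> u))"
    using th1 n0 by (intro mult_left_mono sum_mono w d) auto
  also have "(\<Sum>u\<in>V. d u * (B * \<omega> u)) = B * (\<Sum>z\<in>V. \<omega> z * d z)"
    by (simp add: sum_distrib_left mult_ac)
  finally show ?thesis by (simp add: algebra_simps)
qed

lemma Md_nonneg: "(\<And>u. u \<in> V \<Longrightarrow> 0 \<le> d u) \<Longrightarrow> z \<in> V \<Longrightarrow> 0 \<le> Md d z"
proof -
  assume d: "\<And>u. u \<in> V \<Longrightarrow> 0 \<le> d u" and z: "z \<in> V"
  have "d z / n \<le> d z" using d[OF z] n1 by (simp add: field_simps mult_le_cancel_left1)
  moreover have "0 \<le> (1 - \<theta>) / n * (\<Sum>u\<in>V. J u z * d u)"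
    using th1 d by (intro mult_nonneg_nonneg divide_nonneg_nonneg sum_nonneg J0) auto
  ultimately show ?thesis by (simp add: Md_def)
qed

lemma Mdk_nonneg: "(\<And>u. u \<in> V \<Longrightarrow> 0 \<le> d u) \<Longrightarrow> z \<in> V \<Longrightarrow> 0 \<le> (Md ^^ k) d z"
  by (induction k arbitrary: z) (auto intro: Md_nonneg)

lemma Mdk_weighted:
  assumes w: "\<And>u. u \<in> V \<Longrightarrow> (\<Sum>z\<in>V. J u z * \<omega> z) \<le> B * \<omega> u" and d: "\<And>u. u \<in> V \<Longrightarrow> 0 \<le> d u"
    and B: "0 \<le> 1 - 1 / n + (1 - \<theta>) * B / n"
  shows "(\<Sum>z\<in>V. \<omega> z * (Md ^^ k) d z) \<le> (1 - 1 / n + (1 - \<theta>) * B / n) ^ k * (\<Sum>z\<in>V. \<omega> z * d z)"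
proof (induction k)
  case (Suc k)
  have "(\<Sum>z\<in>V. \<omega> z * (Md ^^ Suc k) d z) \<le> (1 - 1 / n + (1 - \<theta>) * B / n) * (\<Sum>z\<in>V. \<omega> z * (Md ^^ k) d z)"
    using Md_weighted[OF w, of "(Md ^^ k) d"] Mdk_nonneg[of d, OF d] by simp
  also have "\<dots> \<le> (1 - 1 / n + (1 - \<theta>) * B / n) * ((1 - 1 / n + (1 - \<theta>) * B / n) ^ k * (\<Sum>z\<in>V. \<omega> z * d z))"
    using Suc B by (intro mult_left_mono)
  finally show ?case by simp
qed simp

lemma Mdk_sum:
  assumes d: "\<And>u. u \<in> V \<Longrightarrow> 0 \<le> d u"
  shows "(\<Sum>z\<in>V. (Md ^^ k) d z) \<le> (1 - \<theta> / n) ^ k * (\<Sum>z\<in>V. d z)"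
proof -
  have e: "1 - 1 / n + (1 - \<theta>) * 1 / n = 1 - \<theta> / n" by (simp add: diff_divide_distrib)
  show ?thesis using Mdk_weighted[of "\<lambda>_. 1" 1 d k] d thn unfolding e by (simp add: J1)
qed

lemma osc_total_on:
  assumes d: "osc f d" and W: "W \<subseteq> V" and e: "\<And>u. u \<notin> W \<Longrightarrow> x u = y u"
  shows "\<bar>f x - f y\<bar> \<le> (\<Sum>u\<in>W. d u)"
proof -
  have "finite W" using W finV by (rule finite_subset)
  then show ?thesis using W e
  proof (induction W arbitrary: x rule: finite_induct)
    case empty
    then have "x = y" by auto
    then show ?case by simp
  next
    case (insert w W)
    have "\<bar>f (x(w := y w)) - f y\<bar> \<le> sum d W"
      by (rule insert.IH) (use insert.prems in \<open>auto\<close>)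
    moreover have "\<bar>f (x(w := y w)) - f x\<bar> \<le> d w"
      using insert.prems by (intro oscD[OF d]) auto
    ultimately show ?case using insert.hyps by simp
  qed
qed

lemma osc_total:
  assumes d: "osc f d" and e: "\<And>u. u \<notin> V \<Longrightarrow> x u = y u"
  shows "\<bar>f x - f y\<bar> \<le> (\<Sum>u\<in>V. d u)"
  by (rule osc_total_on[OF d]) (use e in auto)

lemma Tk_contraction:
  assumes d: "osc f d" and e: "\<And>u. u \<notin> V \<Longrightarrow> x u = y u"
  shows "\<bar>(T ^^ k) f x - (T ^^ k) f y\<bar> \<le> (1 - \<theta> / n) ^ k * (\<Sum>u\<in>V. d u)"
  using osc_total[OF osc_Tk[OF d], of x y k] Mdk_sum[of d k] osc_nonneg[OF d] e by force

text \<open>Analytic form of the survival probability of a lineage, with the sites weighed by their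
  influence on \<open>f\<close>. Influences are known only inside \<open>V\<close>, hence the
  agreement of the states outside.\<close>

lemma S_contraction:
  assumes d: "osc f d" and e: "\<And>u. u \<notin> V \<Longrightarrow> x u = y u" and t: "0 \<le> t" and b: "bf f"
  shows "\<bar>S t f x - S t f y\<bar> \<le> exp (- (\<theta> * t)) * (\<Sum>u\<in>V. d u)"
proof -
  have "S t f x - S t f y = pavg (n * t) (\<lambda>k. (T ^^ k) f x - (T ^^ k) f y)"
    by (simp add: S_def pavg_diff egrow_Tk b)
  moreover have "\<bar>\<dots>\<bar> \<le> (\<Sum>u\<in>V. d u) * exp (n * t * ((1 - \<theta> / n) - 1))"
    using Tk_contraction[OF d e] thn t
    by (intro pavg_geometric_le) (auto simp: mult.commute)
  moreover have "n * t * ((1 - \<theta> / n) - 1) = - (\<theta> * t)" using n0 by simp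
  ultimately show ?thesis by (simp add: mult.commute)
qed

text \<open>With respect to the reversing measure \<open>g\<close>, writing \<open>d = g * e\<close>
  turns the adjoint of \<open>J\<close> into \<open>J\<close> acting on \<open>e\<close>, and
  Jensen's inequality makes \<open>J\<close> a contraction of the weighted square norm.\<close>

lemma Md_l2:
  assumes g: "\<And>u. u \<in> V \<Longrightarrow> 0 < g u"
    and rev: "\<And>u v. u \<in> V \<Longrightarrow> v \<in> V \<Longrightarrow> g u * J u v = g v * J v u"
  shows "(\<Sum>z\<in>V. (Md d z)\<^sup>2 / g z) \<le> (1 - \<theta> / n)\<^sup>2 * (\<Sum>z\<in>V. (d z)\<^sup>2 / g z)"
proof -
  define e where "e z = d z / g z" for z
  define b where "b z = (\<Sum>u\<in>V. J z u * e u)" for z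
  have a0: "0 \<le> 1 - 1 / n" "0 \<le> (1 - \<theta>) / n" using n1 th1 by (auto simp: field_simps)
  have s1: "1 - 1 / n + (1 - \<theta>) / n = 1 - \<theta> / n" by (simp add: diff_divide_distrib)
  have M: "Md d z = g z * ((1 - 1 / n) * e z + (1 - \<theta>) / n * b z)" if z: "z \<in> V" for z
  proof -
    have "(\<Sum>u\<in>V. J u z * d u) = (\<Sum>u\<in>V. g z * (J z u * e u))"
    proof (intro sum.cong refl)
      fix u assume u: "u \<in> V"
      have "J u z * d u = (g u * J u z) * e u" using g[OF u] by (simp add: e_def)
      then show "J u z * d u = g z * (J z u * e u)" using rev[OF u z] by simp
    qed
    then have "(\<Sum>u\<in>V. J u z * d u) = g z * b z" by (simp add: b_def sum_distrib_left[symmetric])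
    moreover have "d z = g z * e z" using g[OF z] by (simp add: e_def)
    ultimately show ?thesis by (simp add: Md_def algebra_simps)
  qed
  have b2: "(b z)\<^sup>2 \<le> (\<Sum>u\<in>V. J z u * (e u)\<^sup>2)" if z: "z \<in> V" for z
  proof -
    have "posop (\<lambda>f (_::unit). \<Sum>u\<in>V. J z u * f u)"
      unfolding posop_def
    proof (intro conjI allI impI ext)
      show "(\<Sum>u\<in>V. J z u * c) = c" for c
        by (simp add: sum_distrib_right[symmetric] J1 z)
    qed (auto simp: distrib_left sum.distrib sum_distrib_left mult_ac intro!: sum_mono mult_right_mono J0)
    from posop_square[OF this, of e] show ?thesis by (simp add: b_def)
  qed
  have cs: "(\<alpha> * x + \<beta> * y)\<^sup>2 \<le> (\<alpha> + \<beta>) * (\<alpha> * x\<^sup>2 + \<beta> * y\<^sup>2)" if "0 \<le> \<alpha>" "0 \<le> \<beta>" for \<alpha> \<beta> x y :: real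
  proof -
    have "(\<alpha> + \<beta>) * (\<alpha> * x\<^sup>2 + \<beta> * y\<^sup>2) - (\<alpha> * x + \<beta> * y)\<^sup>2 = \<alpha> * \<beta> * (x - y)\<^sup>2"
      by (simp add: power2_eq_square algebra_simps)
    then show ?thesis using that by (smt (verit) mult_nonneg_nonneg zero_le_power2)
  qed
  have "(\<Sum>z\<in>V. (Md d z)\<^sup>2 / g z) = (\<Sum>z\<in>V. g z * ((1 - 1 / n) * e z + (1 - \<theta>) / n * b z)\<^sup>2)"
    using g by (intro sum.cong refl) (auto simp: M power2_eq_square less_imp_neq[THEN not_sym])
  also have "\<dots> \<le> (\<Sum>z\<in>V. g z * ((1 - \<theta> / n) * ((1 - 1 / n) * (e z)\<^sup>2 + (1 - \<theta>) / n * (\<Sum>u\<in>V. J z u * (e u)\<^sup>2))))"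
  proof (intro sum_mono mult_left_mono)
    fix z assume z: "z \<in> V"
    have "((1 - 1 / n) * e z + (1 - \<theta>) / n * b z)\<^sup>2 \<le> (1 - \<theta> / n) * ((1 - 1 / n) * (e z)\<^sup>2 + (1 - \<theta>) / n * (b z)\<^sup>2)"
      using cs[OF a0] s1 by simp
    also have "\<dots> \<le> (1 - \<theta> / n) * ((1 - 1 / n) * (e z)\<^sup>2 + (1 - \<theta>) / n * (\<Sum>u\<in>V. J z u * (e u)\<^sup>2))"
      using b2[OF z] a0 thn by (intro mult_left_mono add_left_mono) auto
    finally show "((1 - 1 / n) * e z + (1 - \<theta>) / n * b z)\<^sup>2 \<le> \<dots>" .
  qed (use g in \<open>auto intro: less_imp_le\<close>)
  also have "\<dots> = (1 - \<theta> / n) * ((1 - 1 / n) * (\<Sum>z\<in>V. g z * (e z)\<^sup>2) + (1 - \<theta>) / n * (\<Sum>z\<in>V. \<Sum>u\<in>V. g z * (J z u * (e u)\<^sup>2)))"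
  proof -
    have "(\<Sum>z\<in>V. g z * (\<alpha> * (\<beta> * (e z)\<^sup>2 + \<gamma> * (\<Sum>u\<in>V. J z u * (e u)\<^sup>2)))) =
      \<alpha> * (\<beta> * (\<Sum>z\<in>V. g z * (e z)\<^sup>2) + \<gamma> * (\<Sum>z\<in>V. \<Sum>u\<in>V. g z * (J z u * (e u)\<^sup>2)))" for \<alpha> \<beta> \<gamma> :: real
      by (simp add: sum_distrib_left sum.distrib algebra_simps)
    then show ?thesis .
  qed
  also have "(\<Sum>z\<in>V. \<Sum>u\<in>V. g z * (J z u * (e u)\<^sup>2)) = (\<Sum>u\<in>V. \<Sum>z\<in>V. g u * (J u z * (e u)\<^sup>2))"
    by (subst sum.swap, intro sum.cong refl) (metis rev mult.assoc)
  also have "\<dots> = (\<Sum>u\<in>V. g u * (e u)\<^sup>2)"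
    by (intro sum.cong refl) (simp add: sum_distrib_left[symmetric] sum_distrib_right[symmetric] J1)
  also have "(1 - \<theta> / n) * ((1 - 1 / n) * (\<Sum>z\<in>V. g z * (e z)\<^sup>2) + (1 - \<theta>) / n * (\<Sum>u\<in>V. g u * (e u)\<^sup>2))
      = (1 - \<theta> / n) * ((1 - \<theta> / n) * (\<Sum>z\<in>V. g z * (e z)\<^sup>2))"
    unfolding distrib_right[symmetric] s1 ..
  also have "(\<Sum>z\<in>V. g z * (e z)\<^sup>2) = (\<Sum>z\<in>V. (d z)\<^sup>2 / g z)"
    using g by (intro sum.cong refl) (auto simp: e_def power2_eq_square less_imp_neq[THEN not_sym])
  finally show ?thesis by (simp add: power2_eq_square)
qed

text \<open>The comparison of the weighted with the plain square norm is paid once by the factor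
  \<open>G\<close>, not in every step. One of the two contraction factors is given away.\<close>

lemma Mdk_l2:
  assumes g: "\<And>u. u \<in> V \<Longrightarrow> 1 \<le> g u" "\<And>u. u \<in> V \<Longrightarrow> g u \<le> G"
    and rev: "\<And>u v. u \<in> V \<Longrightarrow> v \<in> V \<Longrightarrow> g u * J u v = g v * J v u"
  shows "(\<Sum>z\<in>V. ((Md ^^ k) d z)\<^sup>2) \<le> G * (1 - \<theta> / n) ^ k * (\<Sum>z\<in>V. (d z)\<^sup>2)"
proof -
  have g0: "0 < g u" if "u \<in> V" for u using g(1)[OF that] by linarith
  have 1: "(\<Sum>z\<in>V. ((Md ^^ k) d z)\<^sup>2 / g z) \<le> ((1 - \<theta> / n)\<^sup>2) ^ k * (\<Sum>z\<in>V. (d z)\<^sup>2 / g z)"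
  proof (induction k)
    case (Suc k)
    have "(\<Sum>z\<in>V. ((Md ^^ Suc k) d z)\<^sup>2 / g z) \<le> (1 - \<theta> / n)\<^sup>2 * (\<Sum>z\<in>V. ((Md ^^ k) d z)\<^sup>2 / g z)"
      using Md_l2[of g "(Md ^^ k) d", OF g0 rev] by simp
    also have "\<dots> \<le> (1 - \<theta> / n)\<^sup>2 * (((1 - \<theta> / n)\<^sup>2) ^ k * (\<Sum>z\<in>V. (d z)\<^sup>2 / g z))"
      by (intro mult_left_mono Suc) auto
    finally show ?case by (simp add: mult.assoc)
  qed simp
  obtain v where v: "v \<in> V" using neV by auto
  then have G: "1 \<le> G" using g[OF v] by linarith
  have "(\<Sum>z\<in>V. ((Md ^^ k) d z)\<^sup>2) \<le> (\<Sum>z\<in>V. G * (((Md ^^ k) d z)\<^sup>2 / g z))"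
  proof (intro sum_mono)
    fix z assume z: "z \<in> V"
    have "((Md ^^ k) d z)\<^sup>2 * g z \<le> ((Md ^^ k) d z)\<^sup>2 * G" by (intro mult_left_mono g z) auto
    then show "((Md ^^ k) d z)\<^sup>2 \<le> G * (((Md ^^ k) d z)\<^sup>2 / g z)"
      using g0[OF z] by (simp add: field_simps)
  qed
  also have "\<dots> = G * (\<Sum>z\<in>V. ((Md ^^ k) d z)\<^sup>2 / g z)" by (simp add: sum_distrib_left)
  also have "\<dots> \<le> G * (((1 - \<theta> / n)\<^sup>2) ^ k * (\<Sum>z\<in>V. (d z)\<^sup>2 / g z))"
    using G 1 by (intro mult_left_mono) auto
  also have "\<dots> \<le> G * ((1 - \<theta> / n) ^ k * (\<Sum>z\<in>V. (d z)\<^sup>2))"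
  proof (intro mult_left_mono mult_mono power_mono sum_mono)
    show "(1 - \<theta> / n)\<^sup>2 \<le> 1 - \<theta> / n" using thn by (simp add: power2_eq_square mult_left_le)
    show "(d z)\<^sup>2 / g z \<le> (d z)\<^sup>2" if "z \<in> V" for z
      using g(1)[OF that] by (simp add: divide_le_eq mult_le_cancel_left1)
    show "0 \<le> (\<Sum>z\<in>V. (d z)\<^sup>2 / g z)" using g0 by (intro sum_nonneg divide_nonneg_nonneg) (auto intro: less_imp_le)
  qed (use G thn in auto)
  finally show ?thesis by (simp add: mult.assoc)
qed

section \<open>Variance\<close>

lemma T_variance:
  assumes d: "osc f d"
  shows "T (\<lambda>x. (f x)\<^sup>2) x \<le> (T f x)\<^sup>2 + (\<Sum>u\<in>V. (d u)\<^sup>2) / n"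
proof -
  have "T (\<lambda>y. (f y - f x)\<^sup>2) x \<le> (\<Sum>u\<in>V. (d u)\<^sup>2) / n"
    unfolding T_def
  proof (intro divide_right_mono sum_mono)
    fix u assume u: "u \<in> V"
    have *: "(f (x(u := c)) - f x)\<^sup>2 \<le> (d u)\<^sup>2" for c
      using oscD[OF d u, of x c] by (metis abs_ge_zero power2_abs power_mono)
    have "Q u (\<lambda>y. (f y - f x)\<^sup>2) x \<le> \<theta> * ((\<Sum>c\<in>C. (d u)\<^sup>2) / real (card C)) + (1 - \<theta>) * (\<Sum>v\<in>V. J u v * (d u)\<^sup>2)"
      unfolding Q_def using th0 th1
      by (intro add_mono mult_left_mono divide_right_mono sum_mono * J0) auto
    also have "\<dots> = (d u)\<^sup>2" using cC J1[OF u] by (simp add: sum_distrib_right[symmetric] algebra_simps)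
    finally show "Q u (\<lambda>y. (f y - f x)\<^sup>2) x \<le> (d u)\<^sup>2" .
  qed (use n0 in auto)
  then show ?thesis using posop_variance_le[OF posop_T, of f x "f x"] by linarith
qed

text \<open>Iterated law of total variance: the ring that is followed by \<open>j\<close> others
  contributes the squared influences of \<open>(T ^^ j) f\<close>.\<close>

lemma Tk_variance:
  assumes d: "osc f d"
  shows "(T ^^ k) (\<lambda>x. (f x)\<^sup>2) x \<le> ((T ^^ k) f x)\<^sup>2 + (\<Sum>j<k. (\<Sum>u\<in>V. ((Md ^^ j) d u)\<^sup>2) / n)"
  using d
proof (induction k arbitrary: f d)
  case (Suc k)
  have "(T ^^ Suc k) (\<lambda>x. (f x)\<^sup>2) x = (T ^^ k) (T (\<lambda>x. (f x)\<^sup>2)) x" by (simp add: funpow_swap1)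
  also have "\<dots> \<le> (T ^^ k) (\<lambda>x. (T f x)\<^sup>2 + (\<Sum>u\<in>V. (d u)\<^sup>2) / n) x"
    by (intro posop_mono[OF posop_Tk] T_variance Suc.prems)
  also have "\<dots> = (T ^^ k) (\<lambda>x. (T f x)\<^sup>2) x + (\<Sum>u\<in>V. (d u)\<^sup>2) / n"
    by (simp add: posop_add[OF posop_Tk] posop_const[OF posop_Tk])
  also have "\<dots> \<le> ((T ^^ k) (T f) x)\<^sup>2 + (\<Sum>j<k. (\<Sum>u\<in>V. ((Md ^^ j) (Md d) u)\<^sup>2) / n) + (\<Sum>u\<in>V. (d u)\<^sup>2) / n"
    using Suc.IH[OF osc_T[OF Suc.prems]] by simp
  finally show ?case
    by (simp add: sum.lessThan_Suc_shift funpow_swap1 del: sum.lessThan_Suc)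
qed simp

lemma geometric_le: "(\<Sum>j<k. (1 - \<theta> / n) ^ j / n) \<le> 1 / \<theta>"
proof -
  have "(\<Sum>j<k. (1 - \<theta> / n) ^ j / n) = (1 - (1 - \<theta> / n) ^ k) / \<theta>"
    using thn th0 n0 by (simp add: sum_divide_distrib[symmetric] sum_gp_strict)
  also have "\<dots> \<le> 1 / \<theta>" using th0 thn by (intro divide_right_mono) auto
  finally show ?thesis .
qed

text \<open>The influences decay geometrically, so the bound does not depend on \<open>k\<close> and
  passes to the stationary law.\<close>

lemma Tk_variance_le:
  assumes g: "\<And>u. u \<in> V \<Longrightarrow> 1 \<le> g u" "\<And>u. u \<in> V \<Longrightarrow> g u \<le> G"
    and rev: "\<And>u v. u \<in> V \<Longrightarrow> v \<in> V \<Longrightarrow> g u * J u v = g v * J v u"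
    and d: "osc f d"
  shows "(T ^^ k) (\<lambda>x. (f x)\<^sup>2) x \<le> ((T ^^ k) f x)\<^sup>2 + G / \<theta> * (\<Sum>u\<in>V. (d u)\<^sup>2)"
proof -
  obtain v where v: "v \<in> V" using neV by auto
  then have G: "1 \<le> G" using g[OF v] by linarith
  have "(\<Sum>j<k. (\<Sum>u\<in>V. ((Md ^^ j) d u)\<^sup>2) / n) \<le> (\<Sum>j<k. (G * (1 - \<theta> / n) ^ j * (\<Sum>z\<in>V. (d z)\<^sup>2)) / n)"
    using n0 by (intro sum_mono divide_right_mono Mdk_l2[OF g rev]) auto
  also have "\<dots> = G * (\<Sum>z\<in>V. (d z)\<^sup>2) * (\<Sum>j<k. (1 - \<theta> / n) ^ j / n)"
    by (subst sum_distrib_left) (intro sum.cong refl, simp only: times_divide_eq_right mult.commute mult.left_commute)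
  also have "\<dots> \<le> G * (\<Sum>z\<in>V. (d z)\<^sup>2) * (1 / \<theta>)"
    using G by (intro mult_left_mono geometric_le mult_nonneg_nonneg sum_nonneg) auto
  finally show ?thesis using Tk_variance[OF d, of k x] by simp
qed

end

section \<open>Local functions and product initial laws\<close>

definition dep :: "'a set \<Rightarrow> (('a \<Rightarrow> 'c) \<Rightarrow> real) \<Rightarrow> bool" where
  "dep U f \<longleftrightarrow> (\<forall>x y. (\<forall>u\<in>U. x u = y u) \<longrightarrow> f x = f y)"

text \<open>The two properties of product laws that are used: independence and the Efron--Stein inequality.\<close>
definition goodinit :: "'a set \<Rightarrow> ('a \<Rightarrow> 'c) pmf \<Rightarrow> bool" where
  "goodinit V \<nu> \<longleftrightarrow> finite (set_pmf \<nu>) \<and>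
     (\<forall>U f g. dep U f \<longrightarrow> dep (- U) g \<longrightarrow> bf f \<longrightarrow> bf g \<longrightarrow> pexp \<nu> (\<lambda>x. f x * g x) = pexp \<nu> f * pexp \<nu> g) \<and>
     (\<forall>f d. bf f \<longrightarrow> (\<forall>u\<in>V. \<forall>x c. \<bar>f (x(u := c)) - f x\<bar> \<le> d u) \<longrightarrow>
        pexp \<nu> (\<lambda>x. (f x)\<^sup>2) \<le> (pexp \<nu> f)\<^sup>2 + (\<Sum>u\<in>V. (d u)\<^sup>2))"

lemma goodinit_return: "goodinit V (return_pmf x)"
  unfolding goodinit_def by (auto intro!: sum_nonneg)

lemma goodinit_finite: "goodinit V \<nu> \<Longrightarrow> finite (set_pmf \<nu>)"
  by (simp add: goodinit_def)

lemma goodinit_indep: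
  "goodinit V \<nu> \<Longrightarrow> dep U f \<Longrightarrow> dep (- U) g \<Longrightarrow> bf f \<Longrightarrow> bf g \<Longrightarrow> pexp \<nu> (\<lambda>x. f x * g x) = pexp \<nu> f * pexp \<nu> g"
  by (simp add: goodinit_def)

lemma goodinit_variance:
  "goodinit V \<nu> \<Longrightarrow> bf f \<Longrightarrow> (\<And>u x c. u \<in> V \<Longrightarrow> \<bar>f (x(u := c)) - f x\<bar> \<le> d u) \<Longrightarrow>
     pexp \<nu> (\<lambda>x. (f x)\<^sup>2) \<le> (pexp \<nu> f)\<^sup>2 + (\<Sum>u\<in>V. (d u)\<^sup>2)"
  by (simp add: goodinit_def)

lemma depD: "dep U f \<Longrightarrow> (\<And>u. u \<in> U \<Longrightarrow> x u = y u) \<Longrightarrow> f x = f y"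
  unfolding dep_def by blast

lemma dep_mono: "dep U f \<Longrightarrow> U \<subseteq> W \<Longrightarrow> dep W f"
  unfolding dep_def by blast

lemma dep_prod: "(\<And>i. i \<in> I \<Longrightarrow> dep U (f i)) \<Longrightarrow> dep U (\<lambda>x. \<Prod>i\<in>I. f i x)"
  unfolding dep_def by (auto intro!: prod.cong)

lemma lipschitz_of_steps:
  fixes a :: "nat \<Rightarrow> real"
  assumes "\<And>k. \<bar>a (Suc k) - a k\<bar> \<le> L"
  shows "\<bar>a j - a k\<bar> \<le> L * \<bar>real j - real k\<bar>"
proof -
  have *: "\<bar>a (k + m) - a k\<bar> \<le> L * real m" for k m
  proof (induction m)
    case (Suc m)
    then show ?case using assms[of "k + m"] by (simp add: distrib_left)
  qed simp
  show ?thesis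
  proof (cases "k \<le> j")
    case True then show ?thesis using *[of k "j - k"] by (simp add: of_nat_diff)
  next
    case False then show ?thesis using *[of j "k - j"] by (simp add: of_nat_diff abs_minus_commute)
  qed
qed

text \<open>Pascal's rule; the induction step of the Leibniz formula \<open>Rk_mult\<close>.\<close>

lemma binomial_sum_Suc:
  fixes a :: "nat \<Rightarrow> nat \<Rightarrow> real"
  shows "(\<Sum>j\<le>k. real (k choose j) * (a (Suc j) (k - j) + a j (Suc (k - j)))) =
         (\<Sum>j\<le>Suc k. real (Suc k choose j) * a j (Suc k - j))"
proof -
  have 1: "(\<Sum>j\<le>k. real (k choose j) * a j (Suc (k - j))) = (\<Sum>j\<le>Suc k. real (k choose j) * a j (Suc k - j))"
    by (simp add: Suc_diff_le)
  have 2: "\<dots> = a 0 (Suc k) + (\<Sum>j\<le>k. real (k choose Suc j) * a (Suc j) (k - j))"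
    by (subst sum.atMost_Suc_shift) simp
  have 3: "(\<Sum>j\<le>Suc k. real (Suc k choose j) * a j (Suc k - j)) =
     a 0 (Suc k) + (\<Sum>j\<le>k. real (k choose j) * a (Suc j) (k - j) + real (k choose Suc j) * a (Suc j) (k - j))"
    by (subst sum.atMost_Suc_shift) (simp add: distrib_right)
  show ?thesis
    unfolding distrib_left sum.distrib 1 2 3 by simp
qed

context nvm
begin

lemma Q_osc: assumes d: "osc f d" and u: "u \<in> V" shows "\<bar>Q u f x - f x\<bar> \<le> d u"
proof -
  have "\<bar>Q u (\<lambda>y. f y - f x) x\<bar> \<le> \<theta> * ((\<Sum>c\<in>C. d u) / real (card C)) + (1 - \<theta>) * (\<Sum>v\<in>V. J u v * d u)"
  proof -
    have "\<bar>\<Sum>c\<in>C. f (x(u := c)) - f x\<bar> \<le> (\<Sum>c\<in>C. d u)"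
      by (rule order_trans[OF sum_abs]) (intro sum_mono oscD[OF d u])
    then have 1: "\<bar>(\<Sum>c\<in>C. f (x(u := c)) - f x) / real (card C)\<bar> \<le> (\<Sum>c\<in>C. d u) / real (card C)"
      using cC by (simp only: abs_div_pos[symmetric] divide_right_mono less_imp_le)
    have 2: "\<bar>\<Sum>v\<in>V. J u v * (f (x(u := x v)) - f x)\<bar> \<le> (\<Sum>v\<in>V. J u v * d u)"
      by (rule order_trans[OF sum_abs])
         (auto simp only: abs_mult abs_of_nonneg[OF J0] intro!: sum_mono mult_left_mono J0 oscD[OF d u])
    show ?thesis unfolding Q_def using th0 th1
      by (intro order_trans[OF abs_triangle_ineq] add_mono)
         (simp_all only: abs_mult abs_of_nonneg less_imp_le diff_ge_0_iff_ge, intro mult_left_mono 1, simp, intro mult_left_mono 2, simp)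
  qed
  also have "\<dots> = d u"
  proof -
    have "(\<Sum>v\<in>V. J u v * d u) = d u" using J1[OF u] by (simp add: sum_distrib_right[symmetric])
    then show ?thesis using cC by (simp add: left_diff_distrib)
  qed
  finally show ?thesis by (simp add: posop_diff[OF posop_Q[OF u]] posop_const[OF posop_Q[OF u]])
qed

lemma T_osc: assumes d: "osc f d" shows "\<bar>T f x - f x\<bar> \<le> (\<Sum>u\<in>V. d u) / n"
proof -
  have "T f x - f x = (\<Sum>u\<in>V. Q u f x - f x) / n"
    using n0 by (simp add: T_def sum_subtractf field_simps)
  then show ?thesis using n0
    by (auto simp: abs_div intro!: divide_right_mono order_trans[OF sum_abs] sum_mono Q_osc[OF d])
qed

text \<open>Three sources of randomness: which sites ring and what they copy gives
  \<open>G / \<theta>\<close>, the initial law gives \<open>G\<close> by Efron--Stein, the number of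
  rings gives \<open>2 * t + 2\<close>.\<close>

lemma total_variance:
  assumes \<nu>: "goodinit V \<nu>" and g: "\<And>u. u \<in> V \<Longrightarrow> 1 \<le> g u" "\<And>u. u \<in> V \<Longrightarrow> g u \<le> G"
    and rev: "\<And>u v. u \<in> V \<Longrightarrow> v \<in> V \<Longrightarrow> g u * J u v = g v * J v u"
    and d: "osc f d" and b: "bf f" and t: "0 \<le> t"
  shows "pexp \<nu> (S t (\<lambda>x. (f x)\<^sup>2)) - (pexp \<nu> (S t f))\<^sup>2 \<le> (G / \<theta> + G + 2 * t + 2) * (\<Sum>u\<in>V. (d u)\<^sup>2)"
proof -
  define D where "D = (\<Sum>u\<in>V. (d u)\<^sup>2)"
  have D0: "0 \<le> D" by (simp add: D_def sum_nonneg)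
  obtain v where v: "v \<in> V" using neV by auto
  then have G: "1 \<le> G" using g[OF v] by linarith
  have fin: "finite (set_pmf \<nu>)" using \<nu> by (simp add: goodinit_def)
  note E = posop_ev[OF fin]
  define a where "a k = pexp \<nu> ((T ^^ k) f)" for k
  obtain M where M: "\<And>x. \<bar>f x\<bar> \<le> M" using b by (auto simp: bf_def)
  have bk: "bf ((T ^^ k) f)" for k by (rule posop_bf[OF posop_Tk b])
  have b2: "bf (\<lambda>x. (f x)\<^sup>2)" by (rule bf_square[OF b])
  have ev2: "pexp \<nu> ((T ^^ k) (\<lambda>x. (f x)\<^sup>2)) \<le> (a k)\<^sup>2 + (G / \<theta> + G) * D" for k
  proof -
    have "pexp \<nu> ((T ^^ k) (\<lambda>x. (f x)\<^sup>2)) \<le> pexp \<nu> (\<lambda>x. ((T ^^ k) f x)\<^sup>2 + G / \<theta> * D)"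
      unfolding D_def by (intro pexp_mono Tk_variance_le[OF g rev d])
    also have "\<dots> = pexp \<nu> (\<lambda>x. ((T ^^ k) f x)\<^sup>2) + G / \<theta> * D"
      using posop_add[OF E] posop_const[OF E] by simp
    also have "pexp \<nu> (\<lambda>x. ((T ^^ k) f x)\<^sup>2) \<le> (a k)\<^sup>2 + (\<Sum>u\<in>V. ((Md ^^ k) d u)\<^sup>2)"
      unfolding a_def by (rule goodinit_variance[OF \<nu> bk]) (rule oscD[OF osc_Tk[OF d]])
    also have "(\<Sum>u\<in>V. ((Md ^^ k) d u)\<^sup>2) \<le> G * (1 - \<theta> / n) ^ k * D"
      unfolding D_def by (rule Mdk_l2[OF g rev])
    also have "\<dots> \<le> G * 1 * D" using G thn D0 th0 n0
      by (intro mult_mono mult_left_mono power_le_one mult_nonneg_nonneg) auto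
    finally show ?thesis by (simp add: algebra_simps)
  qed
  \<comment> \<open>One ring affects a site chosen out of \<open>n\<close>, so the mean moves by at
    most the average influence.\<close>
  define L where "L = (\<Sum>u\<in>V. d u) / n"
  have step: "\<bar>a (Suc k) - a k\<bar> \<le> L" for k
  proof -
    have "\<bar>T ((T ^^ k) f) x - (T ^^ k) f x\<bar> \<le> L" for x
    proof -
      have "(\<Sum>u\<in>V. (Md ^^ k) d u) \<le> (1 - \<theta> / n) ^ k * (\<Sum>u\<in>V. d u)"
        by (rule Mdk_sum) (rule osc_nonneg[OF d])
      also have "\<dots> \<le> 1 * (\<Sum>u\<in>V. d u)"
        using thn th0 n0 by (intro mult_right_mono power_le_one sum_nonneg osc_nonneg[OF d]) auto
      finally have "(\<Sum>u\<in>V. (Md ^^ k) d u) / n \<le> L" using n0 by (simp add: L_def divide_right_mono)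
      then show ?thesis using T_osc[OF osc_Tk[OF d, of k], of x] by linarith
    qed
    then have "\<bar>pexp \<nu> (\<lambda>x. T ((T ^^ k) f) x - (T ^^ k) f x)\<bar> \<le> L"
      by (rule posop_bounded[OF E])
    then show ?thesis by (simp add: a_def posop_diff[OF E])
  qed
  have eg: "egrow a" unfolding a_def
    using posop_bounded[OF E posop_bounded[OF posop_Tk M]] by (intro egrow_bounded[of _ M])
  have ega: "egrow (\<lambda>k. (a k)\<^sup>2)" unfolding power2_eq_square by (intro egrow_mult eg)
  have var: "pavg (n * t) (\<lambda>k. (a k)\<^sup>2) - (pavg (n * t) a)\<^sup>2 \<le> L\<^sup>2 * (2 * (n * t) + 2)"
    using t n0 lipschitz_of_steps[of a L, OF step] by (intro pavg_variance_le eg) auto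
  obtain M2 where M2: "\<And>x. \<bar>(f x)\<^sup>2\<bar> \<le> M2" using b2 by (auto simp: bf_def)
  have eg2: "egrow (\<lambda>k. pexp \<nu> ((T ^^ k) (\<lambda>x. (f x)\<^sup>2)))"
    using posop_bounded[OF E posop_bounded[OF posop_Tk M2]] by (intro egrow_bounded[of _ M2])
  have "pexp \<nu> (S t (\<lambda>x. (f x)\<^sup>2)) \<le> pavg (n * t) (\<lambda>k. (a k)\<^sup>2 + (G / \<theta> + G) * D)"
    unfolding pexp_S[OF b2] using t n0 ev2
    by (intro pavg_mono eg2 egrow_add ega egrow_const) auto
  also have "\<dots> = pavg (n * t) (\<lambda>k. (a k)\<^sup>2) + (G / \<theta> + G) * D"
    by (subst pavg_add[OF ega]) auto
  finally have 1: "pexp \<nu> (S t (\<lambda>x. (f x)\<^sup>2)) - (pexp \<nu> (S t f))\<^sup>2 \<le> L\<^sup>2 * (2 * (n * t) + 2) + (G / \<theta> + G) * D"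
    using var unfolding pexp_S[OF b] a_def by linarith
  \<comment> \<open>By Cauchy--Schwarz \<open>L\<^sup>2\<close> is at most \<open>D / n\<close>,
    which compensates the parameter \<open>n * t\<close> of the number of rings.\<close>
  have "(\<Sum>u\<in>V. d u)\<^sup>2 \<le> n * D"
    using sum_squared_le_sum_of_squares[of d V] by (simp add: D_def mult.commute)
  then have "L\<^sup>2 \<le> D / n"
    using n0 by (simp add: L_def power_divide field_simps power2_eq_square)
  then have "L\<^sup>2 * (2 * (n * t) + 2) \<le> D / n * (2 * (n * t) + 2)"
    using t n0 by (intro mult_right_mono) auto
  also have "\<dots> = D * (2 * t + 2 / n)" using n0 by (simp add: field_simps)
  also have "\<dots> \<le> D * (2 * t + 2)" using D0 n1 n0 by (intro mult_left_mono add_left_mono) (auto simp: field_simps)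
  finally show ?thesis using 1 unfolding D_def[symmetric] by (simp add: algebra_simps)
qed

section \<open>Independence of disconnected regions\<close>

text \<open>Sum rather than average over the rings in \<open>U\<close>, so that its exponential is
  multiplicative over a partition of the sites.\<close>

definition R :: "'a set \<Rightarrow> (('a \<Rightarrow> 'c) \<Rightarrow> real) \<Rightarrow> ('a \<Rightarrow> 'c) \<Rightarrow> real" where
  "R U f x = (\<Sum>u\<in>V \<inter> U. Q u f x)"

definition jclosed :: "'a set \<Rightarrow> bool" where
  "jclosed U \<longleftrightarrow> (\<forall>u\<in>V \<inter> U. \<forall>v\<in>V - U. J u v = 0)"

lemma Q_dep_cong:
  assumes c: "jclosed U" and f: "dep U f" and u: "u \<in> V \<inter> U" and xy: "\<And>w. w \<in> U \<Longrightarrow> x w = y w"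
  shows "Q u f x = Q u f y"
proof -
  have 1: "f (x(u := c)) = f (y(u := c))" for c
    using xy by (intro depD[OF f]) auto
  have 2: "J u v * f (x(u := x v)) = J u v * f (y(u := y v))" if "v \<in> V" for v
  proof (cases "v \<in> U")
    case True then show ?thesis using xy 1 by simp
  next
    case False then have "J u v = 0" using c u that by (auto simp: jclosed_def)
    then show ?thesis by simp
  qed
  have "(\<Sum>v\<in>V. J u v * f (x(u := x v))) = (\<Sum>v\<in>V. J u v * f (y(u := y v)))"
    by (rule sum.cong[OF refl 2])
  then show ?thesis unfolding Q_def using 1 by simp
qed

lemma dep_R: "jclosed U \<Longrightarrow> dep U f \<Longrightarrow> dep U (R U f)"
  unfolding dep_def[of U "R U f"] R_def by (intro allI impI sum.cong refl Q_dep_cong) auto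

lemma Q_skip:
  assumes u: "u \<in> V" and g: "dep (- U) g" and uU: "u \<in> U"
  shows "Q u (\<lambda>x. f x * g x) x = Q u f x * g x"
proof -
  have "g (x(u := c)) = g x" for c using uU by (intro depD[OF g]) auto
  then show ?thesis
    by (simp add: Q_def sum_distrib_right[symmetric] mult.assoc[symmetric] distrib_right)
qed

lemma R_mult:
  assumes f: "dep U f" and g: "dep (- U) g"
  shows "R UNIV (\<lambda>x. f x * g x) x = R U f x * g x + f x * R (- U) g x"
proof -
  have "R UNIV (\<lambda>x. f x * g x) x = R U (\<lambda>x. f x * g x) x + R (- U) (\<lambda>x. f x * g x) x"
    unfolding R_def using finV by (subst sum.union_disjoint[symmetric]) (auto intro!: sum.cong)
  also have "R U (\<lambda>x. f x * g x) x = R U f x * g x"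
    unfolding R_def sum_distrib_right using Q_skip[OF _ g] by (intro sum.cong) auto
  also have "R (- U) (\<lambda>x. f x * g x) x = R (- U) (\<lambda>x. g x * f x) x" by (simp add: mult.commute)
  also have "\<dots> = R (- U) g x * f x"
    unfolding R_def sum_distrib_right using Q_skip[of _ "- U" f g] f by (intro sum.cong) auto
  finally show ?thesis by (simp add: mult.commute)
qed

lemma R_add: "R U (\<lambda>x. f x + g x) = (\<lambda>x. R U f x + R U g x)"
  unfolding R_def by (auto simp: posop_add[OF posop_Q] sum.distrib)

lemma Rk_add: "(R U ^^ k) (\<lambda>x. f x + g x) x = (R U ^^ k) f x + (R U ^^ k) g x"
proof (induction k arbitrary: x)
  case (Suc k)
  then have "(R U ^^ k) (\<lambda>x. f x + g x) = (\<lambda>x. (R U ^^ k) f x + (R U ^^ k) g x)" by blast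
  then show ?case by (simp add: R_add)
qed simp

lemma Rk_bounded: "(\<And>x. \<bar>f x\<bar> \<le> M) \<Longrightarrow> \<bar>(R U ^^ k) f x\<bar> \<le> M * real (card (V \<inter> U)) ^ k"
proof (induction k arbitrary: x)
  case (Suc k)
  have "\<bar>R U ((R U ^^ k) f) x\<bar> \<le> (\<Sum>u\<in>V \<inter> U. M * real (card (V \<inter> U)) ^ k)"
    by (subst R_def, intro order_trans[OF sum_abs] sum_mono posop_bounded[OF posop_Q] Suc) (use Suc.prems in auto)
  then show ?case by (simp add: mult_ac)
qed simp

text \<open>Leibniz formula: by \<open>R_mult\<close> the sum over all rings acts as a derivation on
  a product of two factors living on complementary closed sets, and closedness keeps the factors
  local along the iteration.\<close>

lemma Rk_mult:
  assumes "jclosed U" "jclosed (- U)" "dep U f" "dep (- U) g"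
  shows "(R UNIV ^^ k) (\<lambda>x. f x * g x) x
       = (\<Sum>j\<le>k. real (k choose j) * ((R U ^^ j) f x * (R (- U) ^^ (k - j)) g x))"
  using assms(3,4)
proof (induction k arbitrary: f g)
  case (Suc k)
  have "R UNIV (\<lambda>x. f x * g x) = (\<lambda>x. R U f x * g x + f x * R (- U) g x)"
    using R_mult[OF Suc.prems] by blast
  then have "(R UNIV ^^ Suc k) (\<lambda>x. f x * g x) x = (R UNIV ^^ k) (\<lambda>x. R U f x * g x + f x * R (- U) g x) x"
    by (simp add: funpow_swap1)
  also have "\<dots> = (R UNIV ^^ k) (\<lambda>x. R U f x * g x) x + (R UNIV ^^ k) (\<lambda>x. f x * R (- U) g x) x"
    by (rule Rk_add)
  also have "\<dots> = (\<Sum>j\<le>k. real (k choose j) * ((R U ^^ j) (R U f) x * (R (- U) ^^ (k - j)) g x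
        + (R U ^^ j) f x * (R (- U) ^^ (k - j)) (R (- U) g) x))"
    using Suc.IH[OF dep_R[OF assms(1) Suc.prems(1)] Suc.prems(2)]
      Suc.IH[OF Suc.prems(1) dep_R[OF assms(2) Suc.prems(2)]]
    by (simp add: distrib_left sum.distrib)
  also have "\<dots> = (\<Sum>j\<le>k. real (k choose j) * ((R U ^^ Suc j) f x * (R (- U) ^^ (k - j)) g x
        + (R U ^^ j) f x * (R (- U) ^^ (Suc (k - j))) g x))"
    by (simp only: funpow_Suc_right comp_def)
  finally show ?case
    using binomial_sum_Suc[of k "\<lambda>i j. (R U ^^ i) f x * (R (- U) ^^ j) g x"] by simp
qed simp

definition RE :: "'a set \<Rightarrow> real \<Rightarrow> (('a \<Rightarrow> 'c) \<Rightarrow> real) \<Rightarrow> ('a \<Rightarrow> 'c) \<Rightarrow> real" where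
  "RE U t f x = (\<Sum>k. (R U ^^ k) f x * (t ^ k / fact k))"

lemma RE_summable:
  assumes "bf f" shows "summable (\<lambda>k. norm ((R U ^^ k) f x * (t ^ k / fact k)))"
proof -
  obtain M where M: "\<And>x. \<bar>f x\<bar> \<le> M" using assms by (auto simp: bf_def)
  have s: "summable (\<lambda>k. M * (inverse (fact k) * (real (card (V \<inter> U)) * \<bar>t\<bar>) ^ k))"
    by (intro summable_mult summable_exp)
  show ?thesis
  proof (rule summable_comparison_test'[OF s])
    fix k
    have "\<bar>(R U ^^ k) f x\<bar> * (\<bar>t\<bar> ^ k / fact k) \<le> M * real (card (V \<inter> U)) ^ k * (\<bar>t\<bar> ^ k / fact k)"
      by (intro mult_right_mono Rk_bounded M) auto
    then show "norm (norm ((R U ^^ k) f x * (t ^ k / fact k))) \<le> M * (inverse (fact k) * (real (card (V \<inter> U)) * \<bar>t\<bar>) ^ k)"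
      by (simp add: abs_mult power_mult_distrib power_abs field_simps)
  qed
qed

lemma T_R: "(T ^^ k) f x = (R UNIV ^^ k) f x / n ^ k"
proof (induction k arbitrary: x)
  case (Suc k)
  have "(T ^^ k) f = (\<lambda>x. 1 / n ^ k * (R UNIV ^^ k) f x)" using Suc by auto
  then have "(T ^^ Suc k) f x = T (\<lambda>x. 1 / n ^ k * (R UNIV ^^ k) f x) x" by simp
  also have "\<dots> = 1 / n ^ k * T ((R UNIV ^^ k) f) x" by (rule posop_cmult[OF posop_T])
  also have "T g x = R UNIV g x / n" for g by (simp add: T_def R_def)
  finally show ?case by simp
qed simp

lemma S_RE:
  assumes "bf f" shows "S t f x = exp (- (n * t)) * RE UNIV t f x"
proof -
  have "S t f x = (\<Sum>k. exp (- (n * t)) * ((R UNIV ^^ k) f x * (t ^ k / fact k)))"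
    unfolding S_def pavg_def using n0 by (intro suminf_cong) (simp add: T_R power_mult_distrib)
  also have "\<dots> = exp (- (n * t)) * RE UNIV t f x"
    unfolding RE_def by (intro suminf_mult summable_norm_cancel[OF RE_summable[OF assms]])
  finally show ?thesis .
qed

lemma RE_mult:
  assumes "jclosed U" "jclosed (- U)" "dep U f" "dep (- U) g" "bf f" "bf g"
  shows "RE UNIV t (\<lambda>x. f x * g x) x = RE U t f x * RE (- U) t g x"
proof -
  have "RE U t f x * RE (- U) t g x = (\<Sum>k. \<Sum>j\<le>k. ((R U ^^ j) f x * (t ^ j / fact j)) *
      ((R (- U) ^^ (k - j)) g x * (t ^ (k - j) / fact (k - j))))"
    unfolding RE_def by (intro Cauchy_product RE_summable assms)
  also have "\<dots> = RE UNIV t (\<lambda>x. f x * g x) x"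
    unfolding RE_def Rk_mult[OF assms(1-4)] sum_distrib_right
  proof (intro suminf_cong sum.cong refl)
    fix j k :: nat assume "j \<in> {..k}"
    then have jk: "j \<le> k" by simp
    then have "t ^ k = t ^ j * t ^ (k - j)" by (simp add: power_add[symmetric])
    then show "(R U ^^ j) f x * (t ^ j / fact j) * ((R (- U) ^^ (k - j)) g x * (t ^ (k - j) / fact (k - j))) =
         real (k choose j) * ((R U ^^ j) f x * (R (- U) ^^ (k - j)) g x) * (t ^ k / fact k)"
      using jk by (simp add: binomial_fact field_simps)
  qed
  finally show ?thesis ..
qed

lemma RE_const: "RE U t (\<lambda>_. 1) x = exp (real (card (V \<inter> U)) * t)"
proof -
  have "(R U ^^ k) (\<lambda>_. 1) = (\<lambda>_. real (card (V \<inter> U)) ^ k)" for k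
  proof (induction k)
    case (Suc k)
    have "R U (\<lambda>_. c) = (\<lambda>_. real (card (V \<inter> U)) * c)" for c
      by (auto simp: R_def posop_const[OF posop_Q] fun_eq_iff)
    then show ?case using Suc by simp
  qed simp
  then have "RE U t (\<lambda>_. 1) x = (\<Sum>k. (real (card (V \<inter> U)) * t) ^ k /\<^sub>R fact k)"
    by (simp add: RE_def power_mult_distrib field_simps)
  then show ?thesis by (simp add: exp_def)
qed

text \<open>Independence of two regions without jumps between them: the exponential series multiply
  as a Cauchy product. The normalisation is read off by taking one factor constant.\<close>

lemma S_mult:
  assumes c: "jclosed U" "jclosed (- U)" and f: "dep U f" and g: "dep (- U) g" and b: "bf f" "bf g"
  shows "S t (\<lambda>x. f x * g x) x = S t f x * S t g x"
proof -
  have one: "dep W (\<lambda>_. 1)" for W by (simp add: dep_def)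
  have 1: "RE UNIV t f x = RE U t f x * exp (real (card (V \<inter> - U)) * t)"
    using RE_mult[OF c f one b(1), of t x] by (simp add: RE_const)
  have 2: "RE UNIV t g x = exp (real (card (V \<inter> U)) * t) * RE (- U) t g x"
    using RE_mult[OF c one g _ b(2), of t x] by (simp add: RE_const)
  have "n = real (card (V \<inter> U)) + real (card (V \<inter> - U))"
    using finV by (subst of_nat_add[symmetric], subst card_Un_disjoint[symmetric]) (auto intro!: arg_cong[of _ _ card])
  then have "exp (real (card (V \<inter> - U)) * t) * exp (real (card (V \<inter> U)) * t) * exp (- (n * t)) = 1"
    by (simp add: mult_exp_exp algebra_simps)
  then have 3: "exp (- (n * t)) * RE U t f x * RE (- U) t g x = S t f x * S t g x"
    unfolding S_RE[OF b(1)] S_RE[OF b(2)] 1 2 by (simp add: mult_ac)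
  show ?thesis
    unfolding S_RE[OF bf_mult[OF b]] RE_mult[OF c f g b] 3[symmetric] by simp
qed

lemma dep_T: assumes "jclosed U" "dep U f" shows "dep U (T f)"
  unfolding dep_def T_def
proof (intro allI impI arg_cong[of _ _ "\<lambda>s. s / n"] sum.cong refl)
  fix x y :: "'a \<Rightarrow> 'c" and u assume xy: "\<forall>u\<in>U. x u = y u" and u: "u \<in> V"
  show "Q u f x = Q u f y"
  proof (cases "u \<in> U")
    case True then show ?thesis using assms xy u by (intro Q_dep_cong) auto
  next
    case False
    have 1: "f (x(u := c)) = f x" for c using False by (intro depD[OF assms(2)]) auto
    have 2: "f (y(u := c)) = f x" for c using xy False by (intro depD[OF assms(2)]) auto
    have "Q u f x = Q u (\<lambda>_. f x) x" "Q u f y = Q u (\<lambda>_. f x) y"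
      unfolding Q_def 1 2 by (rule refl)+
    then show ?thesis by (simp add: posop_const[OF posop_Q[OF u]])
  qed
qed

lemma dep_Tk: "jclosed U \<Longrightarrow> dep U f \<Longrightarrow> dep U ((T ^^ k) f)"
  by (induction k) (auto intro: dep_T)

lemma dep_S: assumes "jclosed U" "dep U f" shows "dep U (S t f)"
proof -
  have "(\<lambda>k. (T ^^ k) f x) = (\<lambda>k. (T ^^ k) f y)" if "\<forall>u\<in>U. x u = y u" for x y
    by (intro ext depD[OF dep_Tk[OF assms]]) (use that in auto)
  then have "S t f x = S t f y" if "\<forall>u\<in>U. x u = y u" for x y
    unfolding S_def using that by metis
  then show ?thesis unfolding dep_def by blast
qed

lemma pexp_S_prod:
  fixes reg :: "'a \<Rightarrow> 'i"
  assumes \<nu>: "goodinit V \<nu>" and I: "finite I"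
    and reg: "\<And>u v. u \<in> V \<Longrightarrow> v \<in> V \<Longrightarrow> J u v \<noteq> 0 \<Longrightarrow> reg u = reg v"
    and f: "\<And>i. i \<in> I \<Longrightarrow> dep {u. reg u = i} (f i)" and b: "\<And>i. i \<in> I \<Longrightarrow> bf (f i)" and t: "0 \<le> t"
  shows "pexp \<nu> (S t (\<lambda>x. \<Prod>i\<in>I. f i x)) = (\<Prod>i\<in>I. pexp \<nu> (S t (f i)))"
  using I f b
proof (induction I rule: finite_induct)
  case empty
  have "finite (set_pmf \<nu>)" using \<nu> by (simp add: goodinit_def)
  then show ?case using posop_const[OF posop_ev[of \<nu>], of 1] by (simp add: posop_const[OF posop_ev])
next
  case (insert i I)
  let ?U = "{u. reg u = i}" and ?g = "\<lambda>x. \<Prod>j\<in>I. f j x"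
  have c: "jclosed ?U" "jclosed (- ?U)" using reg by (auto simp: jclosed_def)
  have df: "dep ?U (f i)" using insert.prems by auto
  have dg: "dep (- ?U) ?g"
  proof (rule dep_prod)
    fix j assume j: "j \<in> I"
    then have "dep {u. reg u = j} (f j)" using insert.prems by auto
    then show "dep (- ?U) (f j)" using j insert.hyps by (auto elim!: dep_mono)
  qed
  have bb: "bf (f i)" "bf ?g" using insert.prems by (auto intro!: bf_prod)
  have "pexp \<nu> (S t (\<lambda>x. f i x * ?g x)) = pexp \<nu> (\<lambda>x. S t (f i) x * S t ?g x)"
    by (intro pexp_cong S_mult[OF c df dg bb])
  also have "\<dots> = pexp \<nu> (S t (f i)) * pexp \<nu> (S t ?g)"
    by (intro goodinit_indep[OF \<nu> dep_S[OF c(1) df] dep_S[OF c(2) dg]] bf_S t bb)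
  finally show ?case using insert by simp
qed

section \<open>Convergence to a stationary law\<close>

lemma stationary_Tk:
  assumes "\<And>f. bf f \<Longrightarrow> pexp \<mu> (T f) = pexp \<mu> f" "bf f"
  shows "pexp \<mu> ((T ^^ k) f) = pexp \<mu> f"
  using assms(2)
proof (induction k)
  case (Suc k)
  then show ?case using assms(1)[OF posop_bf[OF posop_Tk Suc.prems], of k] by simp
qed simp

lemma stationary_S:
  assumes "\<And>f. bf f \<Longrightarrow> pexp \<mu> (T f) = pexp \<mu> f" "bf f"
  shows "pexp \<mu> (S t f) = pexp \<mu> f"
  by (simp add: pexp_S assms(2) stationary_Tk[OF assms])

lemma Tk_stationary:
  assumes st: "\<And>f. bf f \<Longrightarrow> pexp \<mu> (T f) = pexp \<mu> f" and fin: "finite (set_pmf \<mu>)" and b: "bf f" and d: "osc f d"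
    and x: "\<And>y u. y \<in> set_pmf \<mu> \<Longrightarrow> u \<notin> V \<Longrightarrow> x u = y u"
  shows "\<bar>(T ^^ k) f x - pexp \<mu> f\<bar> \<le> (1 - \<theta> / n) ^ k * (\<Sum>u\<in>V. d u)"
proof -
  define m where "m = (T ^^ k) f x"
  \<comment> \<open>Cut off outside the support, where states could differ from \<open>x\<close>
    outside \<open>V\<close> and the contraction would not apply.\<close>
  define h where "h y = (if y \<in> set_pmf \<mu> then (T ^^ k) f y - m else 0)" for y
  have "\<bar>h y\<bar> \<le> (1 - \<theta> / n) ^ k * (\<Sum>u\<in>V. d u)" for y
    using Tk_contraction[OF d, of y x k] x thn osc_nonneg[OF d] by (auto simp: h_def m_def intro!: mult_nonneg_nonneg sum_nonneg)
  then have "\<bar>pexp \<mu> h\<bar> \<le> (1 - \<theta> / n) ^ k * (\<Sum>u\<in>V. d u)" using posop_bounded[OF posop_ev[OF fin]] by blast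
  moreover have "pexp \<mu> h = pexp \<mu> (\<lambda>y. (T ^^ k) f y - m)" by (rule pexp_cong) (simp add: h_def)
  moreover have "\<dots> = pexp \<mu> f - m"
    using posop_diff[OF posop_ev[OF fin]] posop_const[OF posop_ev[OF fin]] stationary_Tk[OF st b] by simp
  ultimately show ?thesis by (simp add: m_def abs_minus_commute)
qed

lemma S_stationary:
  assumes st: "\<And>f. bf f \<Longrightarrow> pexp \<mu> (T f) = pexp \<mu> f" and fin: "finite (set_pmf \<mu>)" and b: "bf f" and d: "osc f d"
    and x: "\<And>y u. y \<in> set_pmf \<mu> \<Longrightarrow> u \<notin> V \<Longrightarrow> x u = y u" and t: "0 \<le> t"
  shows "\<bar>S t f x - pexp \<mu> f\<bar> \<le> exp (- (\<theta> * t)) * (\<Sum>u\<in>V. d u)"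
proof -
  have "S t f x - pexp \<mu> f = pavg (n * t) (\<lambda>k. (T ^^ k) f x - pexp \<mu> f)"
    by (simp add: S_def pavg_diff egrow_Tk b)
  moreover have "\<bar>\<dots>\<bar> \<le> (\<Sum>u\<in>V. d u) * exp (n * t * ((1 - \<theta> / n) - 1))"
  proof (rule pavg_geometric_le)
    show "\<bar>(T ^^ k) f x - pexp \<mu> f\<bar> \<le> (\<Sum>u\<in>V. d u) * (1 - \<theta> / n) ^ k" for k
      by (subst mult.commute, rule Tk_stationary; use st fin b d x in blast)
  qed (use thn t in auto)
  moreover have "n * t * ((1 - \<theta> / n) - 1) = - (\<theta> * t)" using n0 by simp
  ultimately show ?thesis by (simp add: mult.commute)
qed

lemma bf_osc: "bf f \<Longrightarrow> \<exists>d. osc f d"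
proof -
  assume "bf f"
  then obtain M where M: "\<And>x. \<bar>f x\<bar> \<le> M" by (auto simp: bf_def)
  have "\<bar>f x - f y\<bar> \<le> 2 * M" for x y using M[of x] M[of y] by linarith
  then have "osc f (\<lambda>_. 2 * M)" unfolding osc_def by blast
  then show ?thesis by blast
qed

lemma Tk_tendsto:
  assumes "\<And>f. bf f \<Longrightarrow> pexp \<mu> (T f) = pexp \<mu> f" "finite (set_pmf \<mu>)" "bf f"
    "\<And>y u. y \<in> set_pmf \<mu> \<Longrightarrow> u \<notin> V \<Longrightarrow> x u = y u"
  shows "(\<lambda>k. (T ^^ k) f x) \<longlonglongrightarrow> pexp \<mu> f"
proof -
  obtain d where d: "osc f d" using bf_osc[OF assms(3)] by blast
  have "(\<lambda>k. (1 - \<theta> / n) ^ k * (\<Sum>u\<in>V. d u)) \<longlonglongrightarrow> 0"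
    using thn by (intro tendsto_mult_left_zero LIMSEQ_power_zero) auto
  then have "(\<lambda>k. (T ^^ k) f x - pexp \<mu> f) \<longlonglongrightarrow> 0"
    by (rule Lim_null_comparison[rotated])
       (intro always_eventually allI, unfold real_norm_def, rule Tk_stationary, use assms d in auto)
  then show ?thesis by (simp add: LIM_zero_iff)
qed

lemma S_tendsto:
  assumes "\<And>f. bf f \<Longrightarrow> pexp \<mu> (T f) = pexp \<mu> f" "finite (set_pmf \<mu>)" "bf f"
    "\<And>y u. y \<in> set_pmf \<mu> \<Longrightarrow> u \<notin> V \<Longrightarrow> x u = y u"
  shows "(\<lambda>k. S (real k) f x) \<longlonglongrightarrow> pexp \<mu> f"
proof -
  obtain d where d: "osc f d" using bf_osc[OF assms(3)] by blast
  have "(\<lambda>k. exp (- (\<theta> * real k))) \<longlonglongrightarrow> 0"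
    using th0 by real_asymp
  then have "(\<lambda>k. exp (- (\<theta> * real k)) * (\<Sum>u\<in>V. d u)) \<longlonglongrightarrow> 0"
    by (rule tendsto_mult_left_zero)
  then have "(\<lambda>k. S (real k) f x - pexp \<mu> f) \<longlonglongrightarrow> 0"
    by (rule Lim_null_comparison[rotated])
       (intro always_eventually allI, unfold real_norm_def, rule S_stationary, use assms d in auto)
  then show ?thesis by (simp add: LIM_zero_iff)
qed

end

section \<open>The uniform law as the limit of pure noise\<close>

lemma nvm_pure_noise: "finite V \<Longrightarrow> V \<noteq> {} \<Longrightarrow> finite C \<Longrightarrow> C \<noteq> {} \<Longrightarrow> nvm V C 1 (\<lambda>u v. of_bool (u = v))"
  by unfold_locales (auto simp: of_bool_def)

lemma pexp_uniform:
  assumes "finite V" "finite C" "C \<noteq> {}"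
  shows "pexp (pmf_of_set (V \<rightarrow>\<^sub>E C)) f = (\<Sum>x\<in>V \<rightarrow>\<^sub>E C. f x) / real (card (V \<rightarrow>\<^sub>E C))"
proof -
  have "finite (V \<rightarrow>\<^sub>E C)" "(V \<rightarrow>\<^sub>E C) \<noteq> {}" using assms by (auto simp: finite_PiE PiE_eq_empty_iff)
  then show ?thesis by (simp add: pexp_def sum_divide_distrib)
qed

text \<open>The map from \<open>(x, c)\<close> to \<open>(x(u := c), x u)\<close> is an involution
  of \<open>(V \<rightarrow>\<^sub>E C) \<times> C\<close>.\<close>

lemma uniform_noise_invariant:
  assumes "finite V" "finite C" "C \<noteq> {}" "u \<in> V"
  shows "(\<Sum>x\<in>V \<rightarrow>\<^sub>E C. (\<Sum>c\<in>C. f (x(u := c)))) = real (card C) * (\<Sum>x\<in>V \<rightarrow>\<^sub>E C. f x)"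
proof -
  have "(\<Sum>x\<in>V \<rightarrow>\<^sub>E C. (\<Sum>c\<in>C. f (x(u := c)))) = (\<Sum>(x, c)\<in>(V \<rightarrow>\<^sub>E C) \<times> C. f (x(u := c)))"
    by (simp add: sum.cartesian_product)
  also have "\<dots> = (\<Sum>(x, c)\<in>(V \<rightarrow>\<^sub>E C) \<times> C. f x)"
    by (rule sum.reindex_bij_witness[where i = "\<lambda>(x, c). (x(u := c), x u)" and j = "\<lambda>(x, c). (x(u := c), x u)"])
       (use assms(4) in \<open>auto simp: PiE_iff extensional_def\<close>)
  also have "\<dots> = (\<Sum>x\<in>V \<rightarrow>\<^sub>E C. (\<Sum>c\<in>C. f x))" by (rule sum.cartesian_product[symmetric])
  finally show ?thesis by (simp add: sum_distrib_left)
qed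

lemma uniform_stationary:
  assumes a: "finite V" "V \<noteq> {}" "finite C" "C \<noteq> {}"
  shows "pexp (pmf_of_set (V \<rightarrow>\<^sub>E C)) (nvm.T V C 1 (\<lambda>u v. of_bool (u = v)) f) = pexp (pmf_of_set (V \<rightarrow>\<^sub>E C)) f"
proof -
  interpret N: nvm V C 1 "\<lambda>u v. of_bool (u = v)" by (rule nvm_pure_noise[OF a])
  have T: "N.T f x = (\<Sum>u\<in>V. \<Sum>c\<in>C. f (x(u := c))) / (real (card V) * real (card C))" for x
    by (simp add: N.T_def N.Q_def sum_divide_distrib[symmetric])
  have "(\<Sum>x\<in>V \<rightarrow>\<^sub>E C. N.T f x) = (\<Sum>u\<in>V. \<Sum>x\<in>V \<rightarrow>\<^sub>E C. \<Sum>c\<in>C. f (x(u := c))) / (real (card V) * real (card C))"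
    unfolding T sum_divide_distrib[symmetric] by (subst sum.swap) (rule refl)
  also have "\<dots> = (\<Sum>x\<in>V \<rightarrow>\<^sub>E C. f x)"
    using uniform_noise_invariant[OF a(1,3,4), of _ f] N.cC N.n0 by simp
  finally show ?thesis by (simp add: pexp_uniform a)
qed

text \<open>The uniform law is the limit of pure noise from any one configuration. For the identity
  kernel every set is \<open>jclosed\<close>, so independence is the limit of \<open>S_mult\<close>;
  with \<open>g = 1\<close> the Efron--Stein inequality is the limit of
  \<open>Tk_variance_le\<close>.\<close>

lemma goodinit_uniform:
  fixes V :: "'a set" and C :: "'c set"
  assumes a: "finite V" "V \<noteq> {}" "finite C" "C \<noteq> {}"
  shows "goodinit V (pmf_of_set (V \<rightarrow>\<^sub>E C))"
proof -
  let ?U = "pmf_of_set (V \<rightarrow>\<^sub>E C)"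
  interpret N: nvm V C 1 "\<lambda>u v. of_bool (u = v)" by (rule nvm_pure_noise[OF a])
  have PE: "finite (V \<rightarrow>\<^sub>E C)" "(V \<rightarrow>\<^sub>E C) \<noteq> {}" using a by (auto simp: finite_PiE PiE_eq_empty_iff)
  then have set: "set_pmf ?U = V \<rightarrow>\<^sub>E C" by simp
  obtain x where x: "x \<in> V \<rightarrow>\<^sub>E C" using PE by blast
  have fin: "finite (set_pmf ?U)" using PE by simp
  have off: "\<And>y u. y \<in> set_pmf ?U \<Longrightarrow> u \<notin> V \<Longrightarrow> x u = y u"
    unfolding set using x by (metis PiE_arb)
  have st: "\<And>f. bf f \<Longrightarrow> pexp ?U (N.T f) = pexp ?U f" by (rule uniform_stationary[OF a])
  have lim: "(\<lambda>k. N.S (real k) f x) \<longlonglongrightarrow> pexp ?U f" "(\<lambda>k. (N.T ^^ k) f x) \<longlonglongrightarrow> pexp ?U f" if "bf f" for f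
    by (rule N.S_tendsto N.Tk_tendsto; use st fin that off in blast)+
  show ?thesis unfolding goodinit_def
  proof (intro conjI allI impI)
    fix U and f g :: "('a \<Rightarrow> 'c) \<Rightarrow> real"
    assume d: "dep U f" "dep (- U) g" and b: "bf f" "bf g"
    have c: "N.jclosed U" "N.jclosed (- U)" by (auto simp: N.jclosed_def)
    have "(\<lambda>k. N.S (real k) f x * N.S (real k) g x) \<longlonglongrightarrow> pexp ?U f * pexp ?U g"
      by (intro tendsto_mult lim b)
    then have "(\<lambda>k. N.S (real k) (\<lambda>x. f x * g x) x) \<longlonglongrightarrow> pexp ?U f * pexp ?U g"
      by (simp add: N.S_mult[OF c d b])
    then show "pexp ?U (\<lambda>x. f x * g x) = pexp ?U f * pexp ?U g"
      using lim(1)[OF bf_mult[OF b]] LIMSEQ_unique by blast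
  next
    fix f :: "('a \<Rightarrow> 'c) \<Rightarrow> real" and d
    assume b: "bf f" and d: "\<forall>u\<in>V. \<forall>x c. \<bar>f (x(u := c)) - f x\<bar> \<le> d u"
    then have osc: "N.osc f d" by (simp add: N.osc_def)
    have "(N.T ^^ k) (\<lambda>x. (f x)\<^sup>2) x \<le> ((N.T ^^ k) f x)\<^sup>2 + 1 / 1 * (\<Sum>u\<in>V. (d u)\<^sup>2)" for k
      by (rule N.Tk_variance_le[of "\<lambda>_. 1", OF _ _ _ osc]) auto
    then show "pexp ?U (\<lambda>x. (f x)\<^sup>2) \<le> (pexp ?U f)\<^sup>2 + (\<Sum>u\<in>V. (d u)\<^sup>2)"
      by (intro LIMSEQ_le[OF lim(2)[OF bf_square[OF b]] tendsto_add[OF tendsto_power[OF lim(2)[OF b]] tendsto_const]])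
         auto
  qed (rule fin)
qed

section \<open>Comparison of two dynamics\<close>

text \<open>Duhamel's formula in discrete time: the rings are exchanged one by one, and each
  exchange costs \<open>\<epsilon>\<close> times the weighted influence that has built up by then. A
  weight that is large far from the support of \<open>f\<close> allows a small
  \<open>\<epsilon>\<close> when the dynamics differ only there.\<close>

lemma compare_dynamics:
  fixes V :: "'a set" and C :: "'c set" and \<theta> :: real
  assumes A: "nvm V C \<theta> J" and B: "nvm V C \<theta> J'"
    and Q: "\<And>u g d x. u \<in> V \<Longrightarrow> nvm.osc V g d \<Longrightarrow> \<bar>nvm.Q V C \<theta> J u g x - nvm.Q V C \<theta> J' u g x\<bar> \<le> \<epsilon> * (\<omega> u * d u)"
    and w: "\<And>u. u \<in> V \<Longrightarrow> (\<Sum>z\<in>V. J u z * \<omega> z) \<le> 3 * \<omega> u" and w0: "\<And>u. u \<in> V \<Longrightarrow> 0 \<le> \<omega> u"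
    and eps: "0 \<le> \<epsilon>" and d: "nvm.osc V f d" and b: "bf f" and t: "0 \<le> t"
  shows "\<bar>nvm.S V C \<theta> J t f x - nvm.S V C \<theta> J' t f x\<bar> \<le> \<epsilon> * exp (8 * t) * (\<Sum>u\<in>V. \<omega> u * d u)"
proof -
  interpret A: nvm V C \<theta> J by fact
  interpret B: nvm V C \<theta> J' by fact
  define W where "W = (\<Sum>u\<in>V. \<omega> u * d u)"
  note n0 = A.n0 and n1 = A.n1
  have W0: "0 \<le> W" unfolding W_def using A.osc_nonneg[OF d] w0 by (intro sum_nonneg mult_nonneg_nonneg)
  define r where "r = 1 + 2 / A.n"
  have r: "1 \<le> r" using n0 by (simp add: r_def)
  have rho: "0 \<le> 1 - 1 / A.n + (1 - \<theta>) * 3 / A.n" "1 - 1 / A.n + (1 - \<theta>) * 3 / A.n \<le> r"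
  proof -
    have "(1 - \<theta>) * 3 / A.n \<le> 3 / A.n" "0 \<le> (1 - \<theta>) * 3 / A.n"
      using A.th0 A.th1 n0 by (auto intro!: divide_right_mono)
    moreover have "3 / A.n = 1 / A.n + 2 / A.n" by (simp add: add_divide_distrib[symmetric])
    moreover have "1 / A.n \<le> 1" using n1 by simp
    ultimately show "0 \<le> 1 - 1 / A.n + (1 - \<theta>) * 3 / A.n" "1 - 1 / A.n + (1 - \<theta>) * 3 / A.n \<le> r"
      unfolding r_def by linarith+
  qed
  have Mk: "(\<Sum>u\<in>V. \<omega> u * (A.Md ^^ k) d u) \<le> r ^ k * W" for k
  proof -
    have "(\<Sum>u\<in>V. \<omega> u * (A.Md ^^ k) d u) \<le> (1 - 1 / A.n + (1 - \<theta>) * 3 / A.n) ^ k * W"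
      unfolding W_def using rho by (intro A.Mdk_weighted w A.osc_nonneg[OF d])
    also have "\<dots> \<le> r ^ k * W" using rho W0 by (intro mult_right_mono power_mono)
    finally show ?thesis .
  qed
  have k: "\<bar>(A.T ^^ k) f x - (B.T ^^ k) f x\<bar> \<le> \<epsilon> * (real k / A.n * r ^ k * W)" for k x
  proof (induction k arbitrary: x)
    case (Suc k)
    let ?g = "(A.T ^^ k) f"
    have "\<bar>A.T ?g x - B.T ?g x\<bar> \<le> (\<Sum>u\<in>V. \<epsilon> * (\<omega> u * (A.Md ^^ k) d u)) / A.n"
    proof -
      have "A.T g x - B.T g x = (\<Sum>u\<in>V. A.Q u g x - B.Q u g x) / A.n" for g
        by (simp add: A.T_def B.T_def diff_divide_distrib sum_subtractf)
      then show ?thesis using n0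
        by (auto simp: abs_div intro!: divide_right_mono order_trans[OF sum_abs] sum_mono Q A.osc_Tk[OF d])
    qed
    also have "\<dots> = \<epsilon> * ((\<Sum>u\<in>V. \<omega> u * (A.Md ^^ k) d u) / A.n)" by (simp add: sum_distrib_left)
    also have "\<dots> \<le> \<epsilon> * (r ^ k * W / A.n)" using Mk n0 eps by (intro mult_left_mono divide_right_mono) auto
    also have "\<dots> \<le> \<epsilon> * (r ^ Suc k * W / A.n)" using r n0 eps W0
      by (intro mult_left_mono divide_right_mono mult_right_mono) (auto simp: mult_le_cancel_right1)
    finally have 1: "\<bar>A.T ?g x - B.T ?g x\<bar> \<le> \<epsilon> * (r ^ Suc k * W / A.n)" .
    have "\<bar>B.T (\<lambda>y. ?g y - (B.T ^^ k) f y) x\<bar> \<le> \<epsilon> * (real k / A.n * r ^ k * W)"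
      by (rule posop_bounded[OF B.posop_T Suc])
    also have "\<dots> \<le> \<epsilon> * (real k / A.n * r ^ Suc k * W)"
      using r n0 eps W0 by (intro mult_left_mono mult_right_mono) (auto simp: mult_le_cancel_right1)
    finally have 2: "\<bar>B.T ?g x - B.T ((B.T ^^ k) f) x\<bar> \<le> \<epsilon> * (real k / A.n * r ^ Suc k * W)"
      by (simp add: posop_diff[OF B.posop_T])
    have "\<bar>A.T ?g x - B.T ((B.T ^^ k) f) x\<bar> \<le> \<epsilon> * (r ^ Suc k * W / A.n) + \<epsilon> * (real k / A.n * r ^ Suc k * W)"
      using 1 2 by linarith
    also have "\<dots> = \<epsilon> * (real (Suc k) / A.n * r ^ Suc k * W)" using n0 by (simp add: field_simps)
    finally show ?case by simp
  qed simp
  \<comment> \<open>Bernoulli's inequality hides the factor \<open>k / n\<close> of the telescoping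
    sum in a second copy of \<open>r ^ k\<close>; as \<open>n \<ge> 1\<close>,
    \<open>r * r \<le> 1 + 8 / n\<close>, whence the rate 8.\<close>
  have kr: "real k / A.n * r ^ k \<le> (1 + 8 / A.n) ^ k" for k
  proof -
    have "1 + real k * (1 / A.n) \<le> (1 + 1 / A.n) ^ k" using n0 by (intro Bernoulli_inequality) (auto intro: order_trans[of _ 0])
    then have "real k / A.n \<le> (1 + 1 / A.n) ^ k" by simp
    also have "\<dots> \<le> r ^ k" using n0 by (intro power_mono) (auto simp: r_def divide_right_mono)
    finally have "real k / A.n * r ^ k \<le> r ^ k * r ^ k" using r by (intro mult_right_mono) auto
    also have "\<dots> = (r * r) ^ k" by (simp add: power_mult_distrib)
    also have "\<dots> \<le> (1 + 8 / A.n) ^ k"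
    proof (intro power_mono)
      have "4 / (A.n * A.n) \<le> 4 / A.n" using n1 n0 by (intro divide_left_mono) (auto simp: mult_le_cancel_left1)
      moreover have "r * r = 1 + 4 / A.n + 4 / (A.n * A.n)" by (simp add: r_def algebra_simps)
      ultimately show "r * r \<le> 1 + 8 / A.n" by linarith
    qed (use r in auto)
    finally show ?thesis .
  qed
  have "\<bar>pavg (A.n * t) (\<lambda>k. (A.T ^^ k) f x - (B.T ^^ k) f x)\<bar> \<le> \<epsilon> * W * exp (A.n * t * ((1 + 8 / A.n) - 1))"
  proof (rule pavg_geometric_le)
    fix k
    have "\<epsilon> * (real k / A.n * r ^ k * W) \<le> \<epsilon> * ((1 + 8 / A.n) ^ k * W)"
      using kr W0 eps by (intro mult_left_mono mult_right_mono) auto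
    then show "\<bar>(A.T ^^ k) f x - (B.T ^^ k) f x\<bar> \<le> \<epsilon> * W * (1 + 8 / A.n) ^ k"
      using k[of k x] by (simp add: mult_ac)
  qed (use n0 t in auto)
  then show ?thesis using n0
    by (simp add: A.S_def B.S_def pavg_diff A.egrow_Tk B.egrow_Tk b W_def mult_ac)
qed

lemma pexp_close:
  assumes "finite (set_pmf \<nu>)" "\<And>x. x \<in> set_pmf \<nu> \<Longrightarrow> \<bar>f x - c\<bar> \<le> M"
  shows "\<bar>pexp \<nu> f - c\<bar> \<le> M"
proof -
  have k: "pexp \<nu> (\<lambda>_. k) = k" for k using posop_const[OF posop_ev[OF assms(1)]] .
  have "pexp \<nu> f \<le> pexp \<nu> (\<lambda>_. c + M)" "pexp \<nu> (\<lambda>_. c - M) \<le> pexp \<nu> f"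
    by (rule pexp_mono, use assms(2) in \<open>auto simp: abs_le_iff algebra_simps\<close>)+
  then show ?thesis by (simp add: k abs_le_iff)
qed

lemma pexp_sum_cmult: "pexp \<nu> (\<lambda>x. \<Sum>i\<in>I. c i * f i x) = (\<Sum>i\<in>I. c i * pexp \<nu> (f i))"
  unfolding pexp_def sum_distrib_left by (subst sum.swap) (simp add: mult.left_commute)

section \<open>Indicators of local patterns, and laws at later times\<close>

definition phi :: "'a set \<Rightarrow> ('a \<Rightarrow> 'c) \<Rightarrow> ('a \<Rightarrow> 'c) \<Rightarrow> real" where
  "phi A y x = of_bool (\<forall>a\<in>A. x a = y a)"

lemma bf_phi [simp]: "bf (phi A y)" unfolding phi_def by simp

lemma dep_phi: "dep A (phi A y)" by (auto simp: dep_def phi_def)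

lemma phi_01: "0 \<le> phi A y x" "phi A y x \<le> 1" by (auto simp: phi_def)

context nvm
begin

lemma Q_cong: "(\<And>x. x \<in> V \<rightarrow>\<^sub>E C \<Longrightarrow> f x = g x) \<Longrightarrow> u \<in> V \<Longrightarrow> x \<in> V \<rightarrow>\<^sub>E C \<Longrightarrow> Q u f x = Q u g x"
  unfolding Q_def by (intro arg_cong2[of _ _ _ _ "(+)"] arg_cong2[of _ _ _ _ "(*)"] arg_cong2[of _ _ _ _ "(/)"] sum.cong refl)
    (auto simp: PiE_iff extensional_def)

lemma T_cong: "(\<And>x. x \<in> V \<rightarrow>\<^sub>E C \<Longrightarrow> f x = g x) \<Longrightarrow> x \<in> V \<rightarrow>\<^sub>E C \<Longrightarrow> T f x = T g x"
  unfolding T_def by (intro arg_cong2[of _ _ _ _ "(/)"] sum.cong refl Q_cong)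

lemma Tk_cong: "(\<And>x. x \<in> V \<rightarrow>\<^sub>E C \<Longrightarrow> f x = g x) \<Longrightarrow> x \<in> V \<rightarrow>\<^sub>E C \<Longrightarrow> (T ^^ k) f x = (T ^^ k) g x"
  by (induction k arbitrary: x) (auto intro: T_cong)

lemma S_cong: "(\<And>x. x \<in> V \<rightarrow>\<^sub>E C \<Longrightarrow> f x = g x) \<Longrightarrow> x \<in> V \<rightarrow>\<^sub>E C \<Longrightarrow> S t f x = S t g x"
  unfolding S_def by (simp add: Tk_cong[of f g])

lemma finite_configs: "finite (V \<rightarrow>\<^sub>E C)" using finV finC by (auto intro: finite_PiE)

text \<open>Turns the law at time \<open>s\<close> into a pmf, so that the Markov property can be
  used with it as a new initial law. Its masses are the values of the semigroup on indicators of
  single states.\<close>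

lemma law_exists:
  assumes \<nu>: "set_pmf \<nu> \<subseteq> V \<rightarrow>\<^sub>E C" and s: "0 \<le> s"
  obtains \<nu>' where "set_pmf \<nu>' \<subseteq> V \<rightarrow>\<^sub>E C" "\<And>g. bf g \<Longrightarrow> pexp \<nu> (S s g) = pexp \<nu>' g"
proof -
  have fin: "finite (set_pmf \<nu>)" using \<nu> finite_configs by (rule finite_subset)
  define w where "w y = (if y \<in> V \<rightarrow>\<^sub>E C then pexp \<nu> (S s (\<lambda>x. of_bool (x = y))) else 0)" for y
  have w0: "0 \<le> w y" for y
    using posop_mono[OF posop_ev[OF fin], of "\<lambda>_. 0" "S s (\<lambda>x. of_bool (x = y))"]
      S_mono[of "\<lambda>_. 0" "\<lambda>x. of_bool (x = y)" s] s posop_const[OF posop_ev[OF fin], of 0]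
    by (auto simp: w_def)
  have E: "pexp \<nu> (S s g) = (\<Sum>y\<in>V \<rightarrow>\<^sub>E C. w y * g y)" if "bf g" for g
  proof -
    have "pexp \<nu> (S s g) = pexp \<nu> (\<lambda>x. \<Sum>y\<in>V \<rightarrow>\<^sub>E C. g y * S s (\<lambda>x. of_bool (x = y)) x)"
    proof (intro pexp_cong)
      fix x assume "x \<in> set_pmf \<nu>"
      then have x: "x \<in> V \<rightarrow>\<^sub>E C" using \<nu> by auto
      have "S s g x = S s (\<lambda>x. \<Sum>y\<in>V \<rightarrow>\<^sub>E C. g y * of_bool (x = y)) x"
        using finite_configs by (intro S_cong x) (simp add: sum.delta' if_distrib of_bool_def cong: if_cong)
      also have "\<dots> = (\<Sum>y\<in>V \<rightarrow>\<^sub>E C. g y * S s (\<lambda>x. of_bool (x = y)) x)"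
        by (subst S_sum) (auto intro!: bf_mult simp: S_cmult)
      finally show "S s g x = \<dots>" .
    qed
    also have "\<dots> = (\<Sum>y\<in>V \<rightarrow>\<^sub>E C. g y * pexp \<nu> (S s (\<lambda>x. of_bool (x = y))))"
      by (rule pexp_sum_cmult)
    also have "\<dots> = (\<Sum>y\<in>V \<rightarrow>\<^sub>E C. w y * g y)" by (intro sum.cong) (auto simp: w_def)
    finally show ?thesis .
  qed
  have sum1: "(\<Sum>y\<in>V \<rightarrow>\<^sub>E C. w y) = 1"
  proof -
    have "S s (\<lambda>_. 1) = (\<lambda>_. 1)" by (intro ext S_const)
    then show ?thesis using E[of "\<lambda>_. 1"] posop_const[OF posop_ev[OF fin], of 1] by simp
  qed
  have "(\<integral>\<^sup>+ y. ennreal (w y) \<partial>count_space UNIV) = (\<integral>\<^sup>+ y. ennreal (w y) \<partial>count_space (V \<rightarrow>\<^sub>E C))"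
    by (intro nn_integral_count_space_eq) (auto simp: w_def)
  also have "\<dots> = 1"
    using finite_configs by (simp add: nn_integral_count_space_finite sum1 w0 sum_ennreal)
  finally have pm: "pmf (embed_pmf w) y = w y" for y by (intro pmf_embed_pmf w0)
  have sub: "set_pmf (embed_pmf w) \<subseteq> V \<rightarrow>\<^sub>E C" by (auto simp: set_pmf_iff pm w_def split: if_splits)
  have "pexp (embed_pmf w) g = (\<Sum>y\<in>V \<rightarrow>\<^sub>E C. w y * g y)" for g
    unfolding pexp_def pm using sub finite_configs
    by (intro sum.mono_neutral_left) (auto simp: set_pmf_iff pm)
  then show ?thesis using that[OF sub] E by simp
qed

lemma local_osc:
  assumes "dep A f" "\<And>x. 0 \<le> f x" "\<And>x. f x \<le> 1"
  shows "osc f (\<lambda>u. of_bool (u \<in> A))"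
  unfolding osc_def
proof (intro ballI allI)
  fix u x c
  show "\<bar>f (x(u := c)) - f x\<bar> \<le> of_bool (u \<in> A)"
  proof (cases "u \<in> A")
    case True then show ?thesis using assms(2,3)[of x] assms(2,3)[of "x(u := c)"] by simp
  next
    case False
    then have "f (x(u := c)) = f x" by (intro depD[OF assms(1)]) auto
    then show ?thesis by simp
  qed
qed

text \<open>By the Markov property the law at \<open>t'\<close> is the law at \<open>t\<close> from
  a random initial state; changing the initial state is noticed only if one of the
  \<open>card A\<close> lineages survives for time \<open>t\<close>.\<close>

lemma dirac_decay:
  assumes A: "A \<subseteq> V" "dep A f" "\<And>x. 0 \<le> f x" "\<And>x. f x \<le> 1"
    and x: "x \<in> V \<rightarrow>\<^sub>E C" and t: "0 \<le> t" "t \<le> t'"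
  shows "\<bar>S t f x - S t' f x\<bar> \<le> real (card A) * exp (- (\<theta> * t))"
proof -
  have b: "bf f" using A(3,4) by (intro bfI[of _ 1]) (auto simp: abs_le_iff intro: order_trans[of _ 0])
  obtain \<nu>' where \<nu>': "set_pmf \<nu>' \<subseteq> V \<rightarrow>\<^sub>E C" "\<And>g. bf g \<Longrightarrow> pexp (return_pmf x) (S (t' - t) g) = pexp \<nu>' g"
    using law_exists[of "return_pmf x" "t' - t"] x t by auto
  have "S t' f x = pexp \<nu>' (S t f)"
    using \<nu>'(2)[OF bf_S[OF t(1) b]] S_S[OF b, of "t' - t" t x] t by simp
  moreover have "\<bar>pexp \<nu>' (S t f) - S t f x\<bar> \<le> real (card A) * exp (- (\<theta> * t))"
  proof (rule pexp_close)
    fix y assume "y \<in> set_pmf \<nu>'"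
    then have y: "y \<in> V \<rightarrow>\<^sub>E C" using \<nu>' by auto
    have "\<bar>S t f y - S t f x\<bar> \<le> exp (- (\<theta> * t)) * (\<Sum>u\<in>V. of_bool (u \<in> A))"
      by (rule S_contraction[OF local_osc[OF A(2-4)] _ t(1) b]) (use x y in \<open>metis PiE_arb\<close>)
    also have "(\<Sum>u\<in>V. of_bool (u \<in> A)) = real (card A)"
      using A(1) finV by (simp add: of_bool_def sum.If_cases Int_absorb1)
    finally show "\<bar>S t f y - S t f x\<bar> \<le> real (card A) * exp (- (\<theta> * t))" by (simp add: mult.commute)
  qed (use \<nu>' finite_configs in \<open>auto intro: finite_subset\<close>)
  ultimately show ?thesis by (simp add: abs_minus_commute)
qed

text \<open>The bound is the probability that every clock of \<open>A\<close> rings exactly once and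
  paints the colour prescribed by \<open>y\<close> as noise: \<open>t * exp (- t)\<close> times
  \<open>\<theta> / card C\<close> per site. The proof removes one site of \<open>A\<close> at a
  time and integrates the resulting differential inequality.\<close>

lemma S_phi_lower_aux:
  assumes "finite A" "A \<subseteq> V" "\<And>a. a \<in> A \<Longrightarrow> y a \<in> C" "0 \<le> t"
  shows "(t * (\<theta> / real (card C))) ^ card A \<le> exp (real (card A) * t) * S t (phi A y) x"
  using assms
proof (induction "card A" arbitrary: A t)
  case 0
  then have "phi A y = (\<lambda>_. 1)" by (auto simp: phi_def)
  then show ?case using 0 by simp
next
  case (Suc b)
  define a where "a = real (card A)"
  define \<beta> where "\<beta> = \<theta> / real (card C)"
  have b0: "0 \<le> \<beta>" using th0 by (simp add: \<beta>_def)
  have ab: "a = real b + 1" using Suc.hyps(2) by (simp add: a_def)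
  define L where "L = (\<lambda>x. \<Sum>u\<in>V. Q u (phi A y) x - phi A y x)"
  have bL: "bf L" unfolding L_def
    by (intro bf_sum bf_diff posop_bf[OF posop_Q] bf_phi)
  have Lge: "(\<Sum>u\<in>A. \<beta> * phi (A - {u}) y x - phi A y x) \<le> L x" for x
  proof -
    have "(\<Sum>u\<in>A. \<beta> * phi (A - {u}) y x - phi A y x) \<le> (\<Sum>u\<in>A. Q u (phi A y) x - phi A y x)"
    proof (intro sum_mono diff_right_mono)
      fix u assume u: "u \<in> A"
      have "phi (A - {u}) y x \<le> phi A y (x(u := y u))" by (auto simp: phi_def)
      also have "\<dots> \<le> (\<Sum>c\<in>C. phi A y (x(u := c)))"
        using Suc.prems(3)[OF u] finC by (intro member_le_sum) (auto simp: phi_01)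
      finally have "\<beta> * phi (A - {u}) y x \<le> \<beta> * (\<Sum>c\<in>C. phi A y (x(u := c)))" by (intro mult_left_mono b0)
      moreover have "0 \<le> (1 - \<theta>) * (\<Sum>v\<in>V. J u v * phi A y (x(u := x v)))"
        using th1 by (intro mult_nonneg_nonneg sum_nonneg J0 phi_01) auto
      ultimately show "\<beta> * phi (A - {u}) y x \<le> Q u (phi A y) x" by (simp add: Q_def \<beta>_def)
    qed
    also have "\<dots> = L x" unfolding L_def
    proof (intro sum.mono_neutral_left ballI)
      fix u assume u: "u \<in> V - A"
      then have "phi A y (x(u := c)) = phi A y x" for c by (auto simp: phi_def)
      then have "Q u (phi A y) x = Q u (\<lambda>_. phi A y x) x" by (simp add: Q_def)
      then show "Q u (phi A y) x - phi A y x = 0" using u by (simp add: posop_const[OF posop_Q])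
    qed (use Suc.prems finV in auto)
    finally show ?thesis .
  qed
  define F where "F t = exp (a * t) * S t (phi A y) x - (t * \<beta>) ^ Suc b" for t
  have D: "(F has_real_derivative (a * exp (a * t) * S t (phi A y) x + exp (a * t) * S t L x
       - real (Suc b) * (t * \<beta>) ^ b * \<beta>)) (at t)" for t
    unfolding F_def
  proof -
    have 1: "((\<lambda>t. S t (phi A y) x) has_real_derivative S t L x) (at t)"
      using S_deriv[OF bf_phi, of "return_pmf x" A y t] by (simp add: L_def[symmetric])
    have 2: "((\<lambda>t. t * \<beta>) has_real_derivative \<beta>) (at t)" by (auto intro!: derivative_eq_intros)
    have 3: "((\<lambda>t. exp (a * t)) has_real_derivative a * exp (a * t)) (at t)"
      by (auto intro!: derivative_eq_intros)
    show "((\<lambda>t. exp (a * t) * S t (phi A y) x - (t * \<beta>) ^ Suc b) has_real_derivative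
        (a * exp (a * t) * S t (phi A y) x + exp (a * t) * S t L x - real (Suc b) * (t * \<beta>) ^ b * \<beta>)) (at t)"
      by (rule DERIV_cong[OF DERIV_diff[OF DERIV_mult[OF 3 1] DERIV_power_Suc[OF 2]]])
         (simp add: algebra_simps)
  qed
  have nn: "0 \<le> a * exp (a * t) * S t (phi A y) x + exp (a * t) * S t L x
       - real (Suc b) * (t * \<beta>) ^ b * \<beta>" if t: "0 \<le> t" for t
  proof -
    have "(\<Sum>u\<in>A. \<beta> * S t (phi (A - {u}) y) x - S t (phi A y) x) = S t (\<lambda>x. \<Sum>u\<in>A. \<beta> * phi (A - {u}) y x - phi A y x) x"
      by (subst S_sum) (auto intro!: bf_diff bf_mult simp: S_diff S_cmult bf_mult)
    also have "\<dots> \<le> S t L x"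
      using t Lge by (intro S_mono bL bf_sum bf_diff bf_mult) auto
    finally have 1: "\<beta> * (\<Sum>u\<in>A. S t (phi (A - {u}) y) x) - a * S t (phi A y) x \<le> S t L x"
      by (simp add: sum_subtractf sum_distrib_left a_def)
    have "(\<Sum>u\<in>A. (t * \<beta>) ^ b) \<le> (\<Sum>u\<in>A. exp (a * t) * S t (phi (A - {u}) y) x)"
    proof (intro sum_mono)
      fix u assume u: "u \<in> A"
      have c: "b = card (A - {u})" using Suc.hyps(2) u Suc.prems(1) by simp
      have "(t * \<beta>) ^ b \<le> exp (real b * t) * S t (phi (A - {u}) y) x"
        using Suc.hyps(1)[OF c _ _ _ t] Suc.prems by (auto simp: c[symmetric] \<beta>_def)
      also have "\<dots> \<le> exp (a * t) * S t (phi (A - {u}) y) x"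
        using t S_mono[of "\<lambda>_. 0" "phi (A - {u}) y" t x]
        by (intro mult_right_mono) (auto simp: ab phi_01 mult_right_mono)
      finally show "(t * \<beta>) ^ b \<le> exp (a * t) * S t (phi (A - {u}) y) x" .
    qed
    then have 2: "a * (t * \<beta>) ^ b \<le> exp (a * t) * (\<Sum>u\<in>A. S t (phi (A - {u}) y) x)"
      by (simp add: sum_distrib_left a_def)
    have "\<beta> * (a * (t * \<beta>) ^ b) \<le> \<beta> * (exp (a * t) * (\<Sum>u\<in>A. S t (phi (A - {u}) y) x))"
      by (intro mult_left_mono 2 b0)
    also have "\<dots> = exp (a * t) * (\<beta> * (\<Sum>u\<in>A. S t (phi (A - {u}) y) x))" by (rule mult.left_commute)
    also have "\<dots> \<le> exp (a * t) * (S t L x + a * S t (phi A y) x)"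
      using 1 by (intro mult_left_mono) auto
    finally show ?thesis using Suc.hyps(2) by (simp add: a_def algebra_simps)
  qed
  have "F 0 \<le> F t"
    by (rule DERIV_nonneg_imp_nondecreasing[OF Suc.prems(4)]) (use D nn in blast)
  moreover have "0 \<le> F 0" using phi_01(1)[of A y x] by (simp add: F_def)
  ultimately show ?case by (simp add: F_def a_def \<beta>_def Suc.hyps(2)[symmetric])
qed

text \<open>The bound at time 1 is uniform in the state, so it persists at all later times.\<close>

lemma S_phi_lower:
  assumes "A \<subseteq> V" "\<And>a. a \<in> A \<Longrightarrow> y a \<in> C" "1 \<le> t"
  shows "(\<theta> / (real (card C) * exp 1)) ^ card A \<le> S t (phi A y) x"
proof -
  have fA: "finite A" using assms(1) finV by (rule finite_subset)
  have 1: "(\<theta> / (real (card C) * exp 1)) ^ card A \<le> S 1 (phi A y) x" for x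
  proof -
    have "(\<theta> / real (card C)) ^ card A \<le> exp 1 ^ card A * S 1 (phi A y) x"
      using S_phi_lower_aux[OF fA assms(1), of y 1 x] assms(2) by (simp add: exp_of_nat_mult[symmetric])
    then have "(\<theta> / real (card C)) ^ card A / exp 1 ^ card A \<le> S 1 (phi A y) x"
      by (simp add: divide_le_eq mult.commute)
    then show ?thesis by (simp add: power_divide power_mult_distrib mult.commute)
  qed
  have "S (t - 1) (\<lambda>_. (\<theta> / (real (card C) * exp 1)) ^ card A) x \<le> S (t - 1) (S 1 (phi A y)) x"
    using assms 1 by (intro S_mono bf_S) auto
  then show ?thesis using S_S[OF bf_phi, of "t - 1" 1 A y x] assms by simp
qed

end

section \<open>Chi-square distance of product laws\<close>

text \<open>Distributivity over a partition of the sites; it makes the sum in the chi-square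
  distance of product laws factorise.\<close>

lemma sum_PiE_Union:
  fixes h :: "'i \<Rightarrow> ('a \<Rightarrow> 'c) \<Rightarrow> real"
  assumes "finite I" "\<And>i j. i \<in> I \<Longrightarrow> j \<in> I \<Longrightarrow> i \<noteq> j \<Longrightarrow> A i \<inter> A j = {}" "\<And>i. i \<in> I \<Longrightarrow> dep (A i) (h i)"
  shows "(\<Sum>y\<in>(\<Union>i\<in>I. A i) \<rightarrow>\<^sub>E C. \<Prod>i\<in>I. h i y) = (\<Prod>i\<in>I. \<Sum>y\<in>A i \<rightarrow>\<^sub>E C. h i y)"
  using assms
proof (induction I rule: finite_induct)
  case (insert i I)
  let ?B = "\<Union>j\<in>I. A j"
  have disj: "A i \<inter> ?B = {}" using insert.prems(1) insert.hyps(2) by blast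
  have IH: "(\<Sum>y\<in>?B \<rightarrow>\<^sub>E C. \<Prod>i\<in>I. h i y) = (\<Prod>i\<in>I. \<Sum>y\<in>A i \<rightarrow>\<^sub>E C. h i y)"
    using insert.prems by (intro insert.IH) auto
  have dB: "dep ?B (\<lambda>y. \<Prod>i\<in>I. h i y)"
    by (intro dep_prod dep_mono[OF insert.prems(2)]) auto
  have "(\<Sum>y\<in>(\<Union>j\<in>insert i I. A j) \<rightarrow>\<^sub>E C. \<Prod>j\<in>insert i I. h j y) =
        (\<Sum>y\<in>(A i \<union> ?B) \<rightarrow>\<^sub>E C. h i y * (\<Prod>j\<in>I. h j y))"
    using insert.hyps by simp
  also have "\<dots> = (\<Sum>(y, z)\<in>(A i \<rightarrow>\<^sub>E C) \<times> (?B \<rightarrow>\<^sub>E C). h i y * (\<Prod>j\<in>I. h j z))"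
  proof (rule sum.reindex_bij_witness[where j = "\<lambda>y. (restrict y (A i), restrict y ?B)"
        and i = "\<lambda>(y, z). (\<lambda>v. if v \<in> A i then y v else z v)"], goal_cases)
    case (1 y)
    then show ?case by (auto simp: fun_eq_iff PiE_iff extensional_def restrict_def)
  next
    case (2 y)
    then show ?case by auto
  next
    case (3 p)
    obtain y z where p1: "p = (y, z)" by (rule prod.exhaust)
    with 3 have p: "p = (y, z)" "y \<in> A i \<rightarrow>\<^sub>E C" "z \<in> ?B \<rightarrow>\<^sub>E C" by simp_all
    have "restrict (\<lambda>v. if v \<in> A i then y v else z v) (A i) = y"
    proof
      fix v show "restrict (\<lambda>v. if v \<in> A i then y v else z v) (A i) v = y v"
        using PiE_arb[OF p(2), of v] by (cases "v \<in> A i") simp_all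
    qed
    moreover have "restrict (\<lambda>v. if v \<in> A i then y v else z v) ?B = z"
    proof
      fix v show "restrict (\<lambda>v. if v \<in> A i then y v else z v) ?B v = z v"
      proof (cases "v \<in> ?B")
        case True
        then have "v \<notin> A i" using disj by blast
        then show ?thesis using True by simp
      next
        case False
        then show ?thesis using PiE_arb[OF p(3), of v] by simp
      qed
    qed
    ultimately show ?case by (simp add: p)
  next
    case (4 p)
    then show ?case by (auto simp: PiE_iff extensional_def)
  next
    case (5 y)
    have "h i (restrict y (A i)) = h i y" by (rule depD[OF insert.prems(2)]) auto
    moreover have "(\<Prod>j\<in>I. h j (restrict y ?B)) = (\<Prod>j\<in>I. h j y)" by (rule depD[OF dB]) auto
    ultimately show ?case by simp
  qed
  also have "\<dots> = (\<Sum>y\<in>A i \<rightarrow>\<^sub>E C. h i y) * (\<Sum>z\<in>?B \<rightarrow>\<^sub>E C. \<Prod>j\<in>I. h j z)"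
    by (simp add: sum.cartesian_product[symmetric] sum_product)
  finally show ?case using IH insert.hyps by simp
qed simp

text \<open>Cauchy--Schwarz with respect to the weights \<open>r\<close>. The identity shows the
  multiplicative form of the chi-square distance: one plus it is the sum of
  \<open>(p y)\<^sup>2 / r y\<close>.\<close>

lemma l1_le_chi_square:
  fixes p r :: "'y \<Rightarrow> real"
  assumes "finite Y" and r: "\<And>y. y \<in> Y \<Longrightarrow> 0 < r y" and "(\<Sum>y\<in>Y. p y) = 1" "(\<Sum>y\<in>Y. r y) = 1"
  shows "(\<Sum>y\<in>Y. \<bar>p y - r y\<bar>) \<le> sqrt ((\<Sum>y\<in>Y. (p y)\<^sup>2 / r y) - 1)"
    and "(\<Sum>y\<in>Y. (p y)\<^sup>2 / r y) = 1 + (\<Sum>y\<in>Y. (p y - r y)\<^sup>2 / r y)"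
proof -
  have "posop (\<lambda>f (_::unit). \<Sum>y\<in>Y. r y * f y)"
    unfolding posop_def
  proof (intro conjI allI impI ext)
    show "(\<Sum>y\<in>Y. r y * c) = c" for c by (simp add: sum_distrib_right[symmetric] assms)
  qed (auto simp: distrib_left sum.distrib sum_distrib_left mult_ac intro!: sum_mono mult_right_mono less_imp_le[OF r])
  from posop_square[OF this, of "\<lambda>y. \<bar>p y - r y\<bar> / r y"]
  have 1: "(\<Sum>y\<in>Y. r y * (\<bar>p y - r y\<bar> / r y))\<^sup>2 \<le> (\<Sum>y\<in>Y. r y * (\<bar>p y - r y\<bar> / r y)\<^sup>2)" by simp
  have 2: "(\<Sum>y\<in>Y. r y * (\<bar>p y - r y\<bar> / r y)) = (\<Sum>y\<in>Y. \<bar>p y - r y\<bar>)"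
    using r by (intro sum.cong) (auto simp: less_imp_neq[THEN not_sym])
  have 3: "(\<Sum>y\<in>Y. r y * (\<bar>p y - r y\<bar> / r y)\<^sup>2) = (\<Sum>y\<in>Y. (p y - r y)\<^sup>2 / r y)"
  proof (intro sum.cong refl)
    fix y assume "y \<in> Y"
    then show "r y * (\<bar>p y - r y\<bar> / r y)\<^sup>2 = (p y - r y)\<^sup>2 / r y"
      using r[of y] by (simp add: power_divide power2_eq_square)
  qed
  have "(\<Sum>y\<in>Y. (p y - r y)\<^sup>2 / r y) = (\<Sum>y\<in>Y. (p y)\<^sup>2 / r y - 2 * p y + r y)"
  proof (intro sum.cong refl)
    fix y assume "y \<in> Y"
    then show "(p y - r y)\<^sup>2 / r y = (p y)\<^sup>2 / r y - 2 * p y + r y"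
      using r[of y] by (simp add: power2_eq_square field_simps)
  qed
  then have 4: "(\<Sum>y\<in>Y. (p y - r y)\<^sup>2 / r y) = (\<Sum>y\<in>Y. (p y)\<^sup>2 / r y) - 1"
    by (simp add: sum.distrib sum_subtractf sum_distrib_left[symmetric] assms)
  show "(\<Sum>y\<in>Y. \<bar>p y - r y\<bar>) \<le> sqrt ((\<Sum>y\<in>Y. (p y)\<^sup>2 / r y) - 1)"
    using 1 unfolding 2 3 4 by (rule real_le_rsqrt)
  show "(\<Sum>y\<in>Y. (p y)\<^sup>2 / r y) = 1 + (\<Sum>y\<in>Y. (p y - r y)\<^sup>2 / r y)" using 4 by simp
qed

context nvm
begin

lemma dep_expand:
  assumes "A \<subseteq> V" "dep A f" "x \<in> V \<rightarrow>\<^sub>E C"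
  shows "f x = (\<Sum>y\<in>A \<rightarrow>\<^sub>E C. f y * phi A y x)"
proof -
  have fin: "finite (A \<rightarrow>\<^sub>E C)" using assms(1) finV finC by (auto intro!: finite_PiE intro: finite_subset)
  have "phi A y x = of_bool (y = restrict x A)" if "y \<in> A \<rightarrow>\<^sub>E C" for y
  proof -
    have "(\<forall>a\<in>A. x a = y a) \<longleftrightarrow> y = restrict x A"
    proof
      assume "\<forall>a\<in>A. x a = y a"
      then show "y = restrict x A" using PiE_arb[OF that] by (intro ext) (simp add: restrict_def)
    qed auto
    then show ?thesis by (simp add: phi_def)
  qed
  then have "(\<Sum>y\<in>A \<rightarrow>\<^sub>E C. f y * phi A y x) = (\<Sum>y\<in>A \<rightarrow>\<^sub>E C. if y = restrict x A then f y else 0)"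
    by (intro sum.cong) auto
  also have "\<dots> = f (restrict x A)"     unfolding sum.delta[OF fin] using assms by (auto simp: PiE_iff)
  also have "\<dots> = f x" by (rule depD[OF assms(2)]) auto
  finally show ?thesis ..
qed

lemma pexp_S_expand:
  assumes "set_pmf \<nu> \<subseteq> V \<rightarrow>\<^sub>E C" "A \<subseteq> V" "dep A f"
  shows "pexp \<nu> (S t f) = (\<Sum>y\<in>A \<rightarrow>\<^sub>E C. f y * pexp \<nu> (S t (phi A y)))"
proof -
  have fin: "finite (set_pmf \<nu>)" using assms(1) finite_configs by (rule finite_subset)
  have "pexp \<nu> (S t f) = pexp \<nu> (\<lambda>x. \<Sum>y\<in>A \<rightarrow>\<^sub>E C. f y * S t (phi A y) x)"
  proof (rule pexp_cong)
    fix x assume "x \<in> set_pmf \<nu>"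
    then have x: "x \<in> V \<rightarrow>\<^sub>E C" using assms(1) by auto
    have "S t f x = S t (\<lambda>x. \<Sum>y\<in>A \<rightarrow>\<^sub>E C. f y * phi A y x) x"
      by (intro S_cong x dep_expand assms)
    also have "\<dots> = (\<Sum>y\<in>A \<rightarrow>\<^sub>E C. f y * S t (phi A y) x)"
      by (subst S_sum) (auto intro!: bf_mult simp: S_cmult)
    finally show "S t f x = \<dots>" .
  qed
  then show ?thesis by (simp add: pexp_sum_cmult)
qed

text \<open>One plus the chi-square distance is multiplicative over regions. A region contributes at
  most \<open>card C ^ K\<close> patterns, each with squared error \<open>\<eta>\<^sup>2\<close>
  over a mass bounded below by \<open>S_phi_lower\<close>. Errors enter squared, so
  \<open>card I * \<eta>\<^sup>2\<close> has to be small and not \<open>card I * \<eta>\<close>;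
  this halves the mixing time compared with a union bound.\<close>

lemma product_tv:
  fixes reg :: "'a \<Rightarrow> 'i" and A :: "'i \<Rightarrow> 'a set"
  assumes \<nu>: "goodinit V \<nu>" "set_pmf \<nu> \<subseteq> V \<rightarrow>\<^sub>E C" and I: "finite I"
    and reg: "\<And>u v. u \<in> V \<Longrightarrow> v \<in> V \<Longrightarrow> J u v \<noteq> 0 \<Longrightarrow> reg u = reg v"
    and A: "\<And>i. i \<in> I \<Longrightarrow> A i \<subseteq> V" "\<And>i a. i \<in> I \<Longrightarrow> a \<in> A i \<Longrightarrow> reg a = i" "\<And>i. i \<in> I \<Longrightarrow> card (A i) \<le> K"
    and \<eta>: "\<And>i y. i \<in> I \<Longrightarrow> y \<in> A i \<rightarrow>\<^sub>E C \<Longrightarrow>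
        \<bar>pexp \<nu> (S t (phi (A i) y)) - pexp \<nu> (S t' (phi (A i) y))\<bar> \<le> \<eta>"
    and t: "0 \<le> t" "1 \<le> t'" and f: "dep (\<Union>i\<in>I. A i) f" "\<And>x. \<bar>f x\<bar> \<le> 1"
  shows "\<bar>pexp \<nu> (S t f) - pexp \<nu> (S t' f)\<bar>
    \<le> sqrt (exp (real (card I) * (real (card C) ^ K * \<eta>\<^sup>2 / (\<theta> / (real (card C) * exp 1)) ^ K)) - 1)"
proof -
  define q where "q = real (card C)"
  define c where "c = \<theta> / (q * exp 1)"
  have q1: "1 \<le> q" using finC neC by (simp add: q_def Suc_le_eq card_gt_0_iff)
  have "\<theta> \<le> q * exp 1" using th1 q1 mult_mono[of 1 q 1 "exp 1::real"] by (simp add: order_trans)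
  then have c: "0 < c" "c \<le> 1" using th0 q1 by (auto simp: c_def divide_le_eq)
  have fin: "finite (set_pmf \<nu>)" using goodinit_finite[OF \<nu>(1)] .
  let ?A = "\<Union>i\<in>I. A i"
  have AV: "?A \<subseteq> V" using A(1) by auto
  define p where "p B y = pexp \<nu> (S t (phi B y))" for B y
  define r where "r B y = pexp \<nu> (S t' (phi B y))" for B y
  have fC: "finite (B \<rightarrow>\<^sub>E C)" if "B \<subseteq> V" for B using that finV finC by (auto intro!: finite_PiE intro: finite_subset)
  have sum1: "(\<Sum>y\<in>B \<rightarrow>\<^sub>E C. pexp \<nu> (S s (phi B y))) = 1" if "B \<subseteq> V" for B s
  proof -
    have "S s (\<lambda>_. 1) = (\<lambda>_. 1)" by (intro ext S_const)
    then show ?thesis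
      using pexp_S_expand[OF \<nu>(2) that, of "\<lambda>_. 1" s] posop_const[OF posop_ev[OF fin], of 1] by (simp add: dep_def)
  qed
  have rc: "c ^ card B \<le> r B y" if "B \<subseteq> V" "y \<in> B \<rightarrow>\<^sub>E C" for B y
  proof -
    have "pexp \<nu> (\<lambda>_. c ^ card B) \<le> pexp \<nu> (S t' (phi B y))"
      unfolding c_def q_def using that t by (intro pexp_mono S_phi_lower) auto
    then show ?thesis using posop_const[OF posop_ev[OF fin], of "c ^ card B"] by (simp add: r_def)
  qed
  have phi_prod: "phi ?A y = (\<lambda>x. \<Prod>i\<in>I. phi (A i) y x)" for y
    using I by (auto simp: phi_def fun_eq_iff prod_zero_iff of_bool_def intro: prod.neutral)
  have dphi: "dep {u. reg u = i} (phi (A i) y)" if "i \<in> I" for i y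
    by (rule dep_mono[OF dep_phi]) (use A(2) that in auto)
  have prod: "pexp \<nu> (S s (phi ?A y)) = (\<Prod>i\<in>I. pexp \<nu> (S s (phi (A i) y)))" if "0 \<le> s" for s y
    unfolding phi_prod by (rule pexp_S_prod[OF \<nu>(1) I reg dphi bf_phi that])
  have depy: "dep B (\<lambda>y. pexp \<nu> (S s (phi B y)))" for B s
  proof -
    have "phi B y = phi B z" if "\<forall>u\<in>B. y u = z u" for y z :: "'a \<Rightarrow> 'c"
      using that by (auto simp: phi_def fun_eq_iff)
    then show ?thesis unfolding dep_def by (intro allI impI arg_cong[of _ _ "\<lambda>g. pexp \<nu> (S s g)"]) blast
  qed
  have H: "(\<Sum>y\<in>?A \<rightarrow>\<^sub>E C. (p ?A y)\<^sup>2 / r ?A y) = (\<Prod>i\<in>I. \<Sum>y\<in>A i \<rightarrow>\<^sub>E C. (p (A i) y)\<^sup>2 / r (A i) y)"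
  proof -
    have "(\<Sum>y\<in>?A \<rightarrow>\<^sub>E C. (p ?A y)\<^sup>2 / r ?A y) = (\<Sum>y\<in>?A \<rightarrow>\<^sub>E C. \<Prod>i\<in>I. (p (A i) y)\<^sup>2 / r (A i) y)"

    proof (intro sum.cong refl)
      fix y
      have 1: "p ?A y = (\<Prod>i\<in>I. p (A i) y)" unfolding p_def using t by (intro prod) auto
      have 2: "r ?A y = (\<Prod>i\<in>I. r (A i) y)" unfolding r_def using t by (intro prod) auto
      show "(p ?A y)\<^sup>2 / r ?A y = (\<Prod>i\<in>I. (p (A i) y)\<^sup>2 / r (A i) y)"
        unfolding 1 2 prod_dividef prod_power_distrib by (rule refl)
    qed
    also have "\<dots> = (\<Prod>i\<in>I. \<Sum>y\<in>A i \<rightarrow>\<^sub>E C. (p (A i) y)\<^sup>2 / r (A i) y)"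
    proof (rule sum_PiE_Union[OF I])
      show "dep (A i) (\<lambda>y. (p (A i) y)\<^sup>2 / r (A i) y)" for i
        unfolding p_def r_def dep_def
        by (intro allI impI arg_cong2[of _ _ _ _ "(/)"] arg_cong[of _ _ "\<lambda>s. s\<^sup>2"] depD[OF depy]) auto
      show "A i \<inter> A j = {}" if "i \<in> I" "j \<in> I" "i \<noteq> j" for i j
        using A(2)[OF that(1)] A(2)[OF that(2)] that(3) by fastforce
    qed
    finally show ?thesis .
  qed
  define X where "X = q ^ K * \<eta>\<^sup>2 / c ^ K"
  have "(\<Sum>y\<in>A i \<rightarrow>\<^sub>E C. (p (A i) y)\<^sup>2 / r (A i) y) \<le> exp X" if i: "i \<in> I" for i
  proof -
    have r0: "0 < r (A i) y" if "y \<in> A i \<rightarrow>\<^sub>E C" for y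
      by (rule order.strict_trans2[OF zero_less_power[OF c(1)] rc[OF A(1)[OF i] that]])
    have "(\<Sum>y\<in>A i \<rightarrow>\<^sub>E C. (p (A i) y)\<^sup>2 / r (A i) y) = 1 + (\<Sum>y\<in>A i \<rightarrow>\<^sub>E C. (p (A i) y - r (A i) y)\<^sup>2 / r (A i) y)"
      by (rule l1_le_chi_square(2)[OF fC[OF A(1)[OF i]] r0]) (simp_all add: p_def r_def sum1[OF A(1)[OF i]])
    also have "(\<Sum>y\<in>A i \<rightarrow>\<^sub>E C. (p (A i) y - r (A i) y)\<^sup>2 / r (A i) y) \<le> (\<Sum>y\<in>A i \<rightarrow>\<^sub>E C. \<eta>\<^sup>2 / c ^ K)"
    proof (intro sum_mono frac_le)
      fix y assume y: "y \<in> A i \<rightarrow>\<^sub>E C"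
      show "(p (A i) y - r (A i) y)\<^sup>2 \<le> \<eta>\<^sup>2"
        using \<eta>[OF i y] unfolding p_def r_def by (metis abs_ge_zero power2_abs power_mono)
      have "c ^ K \<le> c ^ card (A i)" using c A(3)[OF i] by (intro power_decreasing) auto
      then show "c ^ K \<le> r (A i) y" using rc[OF A(1)[OF i] y] by linarith
    qed (use c in auto)
    also have "\<dots> = real (card (A i \<rightarrow>\<^sub>E C)) * (\<eta>\<^sup>2 / c ^ K)" by simp
    also have "real (card (A i \<rightarrow>\<^sub>E C)) = q ^ card (A i)"
      using finite_subset[OF A(1)[OF i] finV] by (simp add: card_PiE q_def)
    also have "q ^ card (A i) * (\<eta>\<^sup>2 / c ^ K) \<le> X"
      unfolding X_def times_divide_eq_right[symmetric] using q1 c A(3)[OF i]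
      by (intro mult_right_mono power_increasing) auto
    also have "1 + X \<le> exp X" by (rule exp_ge_add_one_self)
    finally show ?thesis by simp
  qed
  then have "(\<Sum>y\<in>?A \<rightarrow>\<^sub>E C. (p ?A y)\<^sup>2 / r ?A y) \<le> (\<Prod>i\<in>I. exp X)"
    unfolding H
  proof (intro prod_mono conjI)
    fix i assume i: "i \<in> I"
    have "0 \<le> r (A i) y" if "y \<in> A i \<rightarrow>\<^sub>E C" for y
      using order.trans[OF zero_le_power rc[OF A(1)[OF i] that]] c by simp
    then show "0 \<le> (\<Sum>y\<in>A i \<rightarrow>\<^sub>E C. (p (A i) y)\<^sup>2 / r (A i) y)" by (intro sum_nonneg) auto
  qed auto
  also have "\<dots> = exp (real (card I) * X)" by (simp add: exp_of_nat_mult)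
  finally have HX: "(\<Sum>y\<in>?A \<rightarrow>\<^sub>E C. (p ?A y)\<^sup>2 / r ?A y) \<le> exp (real (card I) * X)" .
  have "pexp \<nu> (S t f) - pexp \<nu> (S t' f) = (\<Sum>y\<in>?A \<rightarrow>\<^sub>E C. f y * (p ?A y - r ?A y))"
    by (simp add: pexp_S_expand[OF \<nu>(2) AV f(1)] p_def r_def sum_subtractf right_diff_distrib)
  also have "\<bar>\<dots>\<bar> \<le> (\<Sum>y\<in>?A \<rightarrow>\<^sub>E C. 1 * \<bar>p ?A y - r ?A y\<bar>)"
    by (rule order_trans[OF sum_abs]) (auto simp only: abs_mult intro!: sum_mono mult_right_mono f)
  also have "\<dots> = (\<Sum>y\<in>?A \<rightarrow>\<^sub>E C. \<bar>p ?A y - r ?A y\<bar>)" by simp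
  also have "\<dots> \<le> sqrt ((\<Sum>y\<in>?A \<rightarrow>\<^sub>E C. (p ?A y)\<^sup>2 / r ?A y) - 1)"
  proof (rule l1_le_chi_square(1)[OF fC[OF AV]])
    show "0 < r ?A y" if "y \<in> ?A \<rightarrow>\<^sub>E C" for y
      by (rule order.strict_trans2[OF zero_less_power[OF c(1)] rc[OF AV that]])
  qed (simp_all add: p_def r_def sum1[OF AV])
  also have "\<dots> \<le> sqrt (exp (real (card I) * X) - 1)" using HX by simp
  finally show ?thesis by (simp add: X_def c_def q_def)
qed

end

section \<open>The symbolic voter model\<close>

text \<open>Running the voter model with the sites themselves as initial values records, for every site,
  the site at which its backward lineage ends (Inl) or the noise colour that killed the lineage (Inr).\<close>
definition evalc :: "'a set \<Rightarrow> ('a \<Rightarrow> 'c) \<Rightarrow> ('a \<Rightarrow> 'a + 'c) \<Rightarrow> 'a \<Rightarrow> 'c" where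
  "evalc V x \<sigma> = (\<lambda>v. if v \<in> V then case_sum x id (\<sigma> v) else undefined)"

definition alive :: "'a set \<Rightarrow> ('a \<Rightarrow> 'a + 'c) \<Rightarrow> real" where
  "alive A \<sigma> = of_bool (inj_on \<sigma> A \<and> \<sigma> ` A \<subseteq> range Inl)"

lemma alive_01: "0 \<le> alive A \<sigma>" "alive A \<sigma> \<le> 1" by (auto simp: alive_def)

lemma bf_alive [simp]: "bf (alive A)" unfolding alive_def by simp

locale symb = nvm V C \<theta> J for V :: "'a set" and C :: "'c set" and \<theta> J
begin

text \<open>Noise only writes values \<open>Inr c\<close>, hence a value \<open>Inl w\<close> can
  only be inherited from the initial state \<open>Inl\<close> and names the ancestor of its
  carrier.\<close>

sublocale Y: nvm V "Inr ` C :: ('a + 'c) set" \<theta> J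
  using finV neV finC neC th0 th1 J0 J1 by unfold_locales auto

lemma Q_evalc: "u \<in> V \<Longrightarrow> Q u f (evalc V x \<sigma>) = Y.Q u (\<lambda>\<sigma>. f (evalc V x \<sigma>)) \<sigma>"
proof -
  assume u: "u \<in> V"
  have 1: "evalc V x (\<sigma>(u := Inr c)) = (evalc V x \<sigma>)(u := c)" for c
    using u by (auto simp: evalc_def)
  have 2: "evalc V x (\<sigma>(u := \<sigma> v)) = (evalc V x \<sigma>)(u := evalc V x \<sigma> v)" if "v \<in> V" for v
    using u that by (auto simp: evalc_def)
  have "(\<Sum>c\<in>Inr ` C. f (evalc V x (\<sigma>(u := c)))) = (\<Sum>c\<in>C. f ((evalc V x \<sigma>)(u := c)))"
    by (subst sum.reindex) (auto simp: 1)
  then show ?thesis unfolding Q_def Y.Q_def by (simp add: 2 card_image)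
qed

lemma T_evalc: "T f (evalc V x \<sigma>) = Y.T (\<lambda>\<sigma>. f (evalc V x \<sigma>)) \<sigma>"
  unfolding T_def Y.T_def by (simp add: Q_evalc)

lemma Tk_evalc: "(T ^^ k) f (evalc V x \<sigma>) = (Y.T ^^ k) (\<lambda>\<sigma>. f (evalc V x \<sigma>)) \<sigma>"
proof (induction k arbitrary: \<sigma>)
  case (Suc k)
  have "(T ^^ Suc k) f (evalc V x \<sigma>) = Y.T (\<lambda>\<sigma>. (T ^^ k) f (evalc V x \<sigma>)) \<sigma>" by (simp add: T_evalc)
  also have "(\<lambda>\<sigma>. (T ^^ k) f (evalc V x \<sigma>)) = (Y.T ^^ k) (\<lambda>\<sigma>. f (evalc V x \<sigma>))" using Suc by blast
  finally show ?case by simp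
qed simp

lemma evalc_Inl: "x \<in> V \<rightarrow>\<^sub>E C \<Longrightarrow> evalc V x Inl = x"
  by (auto simp: evalc_def fun_eq_iff PiE_iff extensional_def)

text \<open>Duality. Inserting \<open>x\<close> commutes with every update, so the symbolic run from
  \<open>Inl\<close> serves all initial states at once and \<open>x\<close> is substituted at the
  end.\<close>

lemma S_evalc: "x \<in> V \<rightarrow>\<^sub>E C \<Longrightarrow> S t f x = Y.S t (\<lambda>\<sigma>. f (evalc V x \<sigma>)) Inl"
  using Tk_evalc[of _ f x Inl] by (simp add: S_def Y.S_def evalc_Inl)

lemma pexp_S_evalc:
  assumes "set_pmf \<nu> \<subseteq> V \<rightarrow>\<^sub>E C" "bf f"
  shows "pexp \<nu> (S t f) = Y.S t (\<lambda>\<sigma>. pexp \<nu> (\<lambda>x. f (evalc V x \<sigma>))) Inl"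
proof -
  have b: "bf (\<lambda>\<sigma>. f (evalc V x \<sigma>))" for x using assms(2) by (auto simp: bf_def)
  have "pexp \<nu> (S t f) = pexp \<nu> (\<lambda>x. Y.S t (\<lambda>\<sigma>. f (evalc V x \<sigma>)) Inl)"
    using assms(1) by (intro pexp_cong S_evalc) auto
  also have "\<dots> = Y.S t (\<lambda>\<sigma>. pexp \<nu> (\<lambda>x. f (evalc V x \<sigma>))) Inl"
    unfolding pexp_def by (subst Y.S_sum) (auto intro!: bf_mult b simp: Y.S_cmult b)
  finally show ?thesis .
qed

text \<open>Read backwards, a ring of \<open>u\<close> in \<open>A\<close> kills its lineage by
  noise or moves it to \<open>v\<close>; if \<open>v\<close> carries another lineage of
  \<open>A\<close>, the two coalesce and their ancestors are no longer distinct.\<close>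

lemma T_alive:
  assumes A: "A \<subseteq> V"
  shows "Y.T (alive A) \<sigma> \<le> ((n - real (card A)) * alive A \<sigma> + (1 - \<theta>) * (\<Sum>u\<in>A. \<Sum>v\<in>V.
      J u v * (if v \<in> A - {u} then 0 else alive (insert v (A - {u})) \<sigma>))) / n"
proof -
  have fA: "finite A" using A finV by (rule finite_subset)
  have 1: "Y.Q u (alive A) \<sigma> = alive A \<sigma>" if u: "u \<in> V - A" for u
  proof -
    have "alive A (\<sigma>(u := c)) = alive A \<sigma>" for c
    proof -
      have "(\<sigma>(u := c)) ` A = \<sigma> ` A" "inj_on (\<sigma>(u := c)) A = inj_on \<sigma> A"
        using u by (auto intro!: inj_on_cong image_cong)
      then show ?thesis by (simp add: alive_def)
    qed
    then have "Y.Q u (alive A) \<sigma> = Y.Q u (\<lambda>_. alive A \<sigma>) \<sigma>" by (simp add: Y.Q_def)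
    then show ?thesis using u by (simp add: posop_const[OF Y.posop_Q])
  qed
  have 2: "Y.Q u (alive A) \<sigma> \<le> (1 - \<theta>) * (\<Sum>v\<in>V. J u v * (if v \<in> A - {u} then 0 else alive (insert v (A - {u})) \<sigma>))"
    if u: "u \<in> A" for u
  proof -
    have "alive A (\<sigma>(u := Inr c)) = 0" for c using u by (auto simp: alive_def)
    moreover have "alive A (\<sigma>(u := \<sigma> v)) \<le> (if v \<in> A - {u} then 0 else alive (insert v (A - {u})) \<sigma>)" for v
    proof (cases "v \<in> A - {u}")
      case True
      then have "\<not> inj_on (\<sigma>(u := \<sigma> v)) A" using u
        by (metis DiffE fun_upd_apply inj_onD singletonI)
      then show ?thesis using True by (simp add: alive_def)
    next
      case v: False
      have "inj_on \<sigma> (insert v (A - {u})) \<and> \<sigma> ` insert v (A - {u}) \<subseteq> range Inl"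
        if "inj_on (\<sigma>(u := \<sigma> v)) A" "(\<sigma>(u := \<sigma> v)) ` A \<subseteq> range Inl"
      proof
        have a: "(\<sigma>(u := \<sigma> v)) w = \<sigma> w" if "w \<in> A - {u}" for w using that by auto
        have "\<sigma> w \<in> range Inl" if "w \<in> A - {u}" for w
          using \<open>(\<sigma>(u := \<sigma> v)) ` A \<subseteq> range Inl\<close> that by (auto simp: image_subset_iff split: if_splits)
        moreover have "\<sigma> v \<in> range Inl"
          using \<open>(\<sigma>(u := \<sigma> v)) ` A \<subseteq> range Inl\<close> u by (metis fun_upd_same image_subset_iff)
        ultimately show "\<sigma> ` insert v (A - {u}) \<subseteq> range Inl" by blast
        have "inj_on \<sigma> (A - {u})"
          using inj_on_subset[OF that(1), of "A - {u}"] by (rule inj_on_cong[THEN iffD1, rotated]) auto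
        moreover have "\<sigma> v \<noteq> \<sigma> w" if "w \<in> A - {u}" for w
          using inj_onD[OF \<open>inj_on (\<sigma>(u := \<sigma> v)) A\<close>, of u w] u that by auto
        ultimately show "inj_on \<sigma> (insert v (A - {u}))" by auto
      qed
      then show ?thesis using v by (auto simp: alive_def)
    qed
    ultimately have "Y.Q u (alive A) \<sigma> \<le> \<theta> * 0 + (1 - \<theta>) * (\<Sum>v\<in>V. J u v * (if v \<in> A - {u} then 0 else alive (insert v (A - {u})) \<sigma>))"
      unfolding Y.Q_def using th0 th1 by (intro add_mono mult_left_mono sum_mono J0) (auto simp: sum.reindex)
    then show ?thesis by simp
  qed
  have "(\<Sum>u\<in>V. Y.Q u (alive A) \<sigma>) = (\<Sum>u\<in>V - A. Y.Q u (alive A) \<sigma>) + (\<Sum>u\<in>A. Y.Q u (alive A) \<sigma>)"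
    using A finV by (rule sum.subset_diff)
  also have "(\<Sum>u\<in>V - A. Y.Q u (alive A) \<sigma>) = (n - real (card A)) * alive A \<sigma>"
    using A finV fA by (simp add: 1 card_Diff_subset of_nat_diff card_mono)
  also have "(\<Sum>u\<in>A. Y.Q u (alive A) \<sigma>) \<le> (1 - \<theta>) * (\<Sum>u\<in>A. \<Sum>v\<in>V.
      J u v * (if v \<in> A - {u} then 0 else alive (insert v (A - {u})) \<sigma>))"
    by (subst sum_distrib_left) (rule sum_mono[OF 2])
  finally show ?thesis unfolding Y.T_def using n0 by (simp add: divide_right_mono)
qed

text \<open>Until a death or a coalescence the number of lineages stays \<open>card A\<close>, and
  every ring kills one of them with probability \<open>card A * \<theta> / n\<close>.\<close>

lemma Tk_alive:
  assumes "A \<subseteq> V"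
  shows "(Y.T ^^ k) (alive A) \<sigma> \<le> (1 - real (card A) * \<theta> / n) ^ k"
  using assms
proof (induction k arbitrary: A)
  case 0
  then show ?case by (simp add: alive_01)
next
  case (Suc k)
  define m where "m = real (card A)"
  define b where "b = 1 - m * \<theta> / n"
  have fA: "finite A" using Suc.prems finV by (rule finite_subset)
  have mn: "m \<le> n" using Suc.prems finV by (simp add: m_def card_mono)
  have "m * \<theta> \<le> m * 1" using th1 by (intro mult_left_mono) (auto simp: m_def)
  then have "m * \<theta> / n \<le> 1" using n0 mn by simp
  then have b0: "0 \<le> b" by (simp add: b_def)
  define B where "B u v = (if v \<in> A - {u} then (\<lambda>_. 0) else (alive (insert v (A - {u})) :: ('a \<Rightarrow> 'a + 'c) \<Rightarrow> real))" for u v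
  have B: "(Y.T ^^ k) (B u v) \<sigma> \<le> b ^ k" if "u \<in> A" "v \<in> V" for u v
  proof (cases "v \<in> A - {u}")
    case True
    then show ?thesis using b0 by (simp add: B_def posop_const[OF Y.posop_Tk])
  next
    case False
    then have "card (insert v (A - {u})) = card A"
      using that fA by (metis card_insert_disjoint card_Suc_Diff1 finite_Diff)
    moreover have "B u v = alive (insert v (A - {u}))" using False by (auto simp: B_def)
    moreover have "insert v (A - {u}) \<subseteq> V" using Suc.prems that by auto
    ultimately show ?thesis using Suc.IH[of "insert v (A - {u})"] by (simp add: b_def m_def)
  qed
  have "(Y.T ^^ Suc k) (alive A) \<sigma> = (Y.T ^^ k) (Y.T (alive A)) \<sigma>" by (simp add: funpow_swap1)
  also have "\<dots> \<le> (Y.T ^^ k) (\<lambda>\<sigma>. (n - m) / n * alive A \<sigma> + (1 - \<theta>) / n * (\<Sum>u\<in>A. \<Sum>v\<in>V. J u v * B u v \<sigma>)) \<sigma>"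
    using T_alive[OF Suc.prems] by (intro posop_mono[OF Y.posop_Tk]) (auto simp: m_def B_def add_divide_distrib if_distrib if_distribR cong: if_cong)
  also have "\<dots> = (n - m) / n * (Y.T ^^ k) (alive A) \<sigma> + (1 - \<theta>) / n * (\<Sum>u\<in>A. \<Sum>v\<in>V. J u v * (Y.T ^^ k) (B u v) \<sigma>)"
    by (simp add: posop_add[OF Y.posop_Tk] posop_cmult[OF Y.posop_Tk] posop_sum[OF Y.posop_Tk] del: times_divide_eq_left)
  also have "\<dots> \<le> (n - m) / n * b ^ k + (1 - \<theta>) / n * (\<Sum>u\<in>A. \<Sum>v\<in>V. J u v * b ^ k)"
    using mn n0 th1 Suc.IH[OF Suc.prems] B
    by (intro add_mono mult_left_mono sum_mono J0) (auto simp: b_def m_def)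
  also have "(\<Sum>u\<in>A. \<Sum>v\<in>V. J u v * b ^ k) = (\<Sum>u\<in>A. b ^ k)"
  proof (intro sum.cong refl)
    fix u assume "u \<in> A"
    then show "(\<Sum>v\<in>V. J u v * b ^ k) = b ^ k"
      using J1[of u] Suc.prems by (simp add: sum_distrib_right[symmetric] subset_iff)
  qed
  also have "(n - m) / n * b ^ k + (1 - \<theta>) / n * (\<Sum>u\<in>A. b ^ k) = b * b ^ k"
    using n0 by (simp add: b_def m_def field_simps)
  finally show ?case by (simp add: b_def m_def)
qed

lemma S_alive:
  assumes "A \<subseteq> V" "0 \<le> t"
  shows "Y.S t (alive A) \<sigma> \<le> exp (- (real (card A) * \<theta> * t))"
proof -
  define b where "b = 1 - real (card A) * \<theta> / n"
  have "real (card A) * \<theta> \<le> n * 1" using th0 th1 assms finV by (intro mult_mono) (auto simp: card_mono)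
  then have b0: "0 \<le> b" using n0 by (simp add: b_def)
  have "pavg (n * t) (\<lambda>k. (Y.T ^^ k) (alive A) \<sigma>) \<le> pavg (n * t) (\<lambda>k. b ^ k)"
    using n0 assms Tk_alive[OF assms(1)] b0 by (intro pavg_mono Y.egrow_Tk egrow_power) (auto simp: b_def)
  also have "\<dots> = exp (n * t * (b - 1))" by (rule pavg_power)
  also have "n * t * (b - 1) = - (real (card A) * \<theta> * t)" using n0 by (simp add: b_def)
  finally show ?thesis by (simp add: Y.S_def)
qed

definition anc :: "('a \<Rightarrow> real) \<Rightarrow> 'a \<Rightarrow> ('a \<Rightarrow> 'a + 'c) \<Rightarrow> real" where
  "anc \<omega> v \<sigma> = (case \<sigma> v of Inl w \<Rightarrow> \<omega> w | Inr _ \<Rightarrow> 0)"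

lemma bf_anc: assumes "bf \<omega>" shows "bf (anc \<omega> v)"
proof -
  obtain M where M: "\<And>w. \<bar>\<omega> w\<bar> \<le> M" using assms by (auto simp: bf_def)
  then have "0 \<le> M" using order_trans[OF abs_ge_zero] by blast
  then show ?thesis using M by (intro bfI[of _ M]) (auto simp: anc_def split: sum.splits)
qed

lemma T_anc:
  assumes v: "v \<in> V"
  shows "Y.T (anc \<omega> v) \<sigma> = (1 - 1 / n) * anc \<omega> v \<sigma> + (1 - \<theta>) / n * (\<Sum>w\<in>V. J v w * anc \<omega> w \<sigma>)"
proof -
  have "Y.Q u (anc \<omega> v) \<sigma> = (if u = v then (1 - \<theta>) * (\<Sum>w\<in>V. J v w * anc \<omega> w \<sigma>) else anc \<omega> v \<sigma>)" if u: "u \<in> V" for u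
  proof (cases "u = v")
    case True
    then show ?thesis by (simp add: Y.Q_def anc_def sum.reindex)
  next
    case False
    then have "anc \<omega> v (\<sigma>(u := c)) = anc \<omega> v \<sigma>" for c by (simp add: anc_def)
    then have "Y.Q u (anc \<omega> v) \<sigma> = Y.Q u (\<lambda>_. anc \<omega> v \<sigma>) \<sigma>" by (simp add: Y.Q_def)
    then show ?thesis using False by (simp add: posop_const[OF Y.posop_Q[OF u]])
  qed
  then have "(\<Sum>u\<in>V. Y.Q u (anc \<omega> v) \<sigma>) = (\<Sum>u\<in>V. if u = v then (1 - \<theta>) * (\<Sum>w\<in>V. J v w * anc \<omega> w \<sigma>) else anc \<omega> v \<sigma>)"
    by (intro sum.cong) auto
  also have "\<dots> = (1 - \<theta>) * (\<Sum>w\<in>V. J v w * anc \<omega> w \<sigma>) + (n - 1) * anc \<omega> v \<sigma>"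
    using v finV n1 by (simp add: sum.remove[OF finV v] card_Diff_singleton of_nat_diff)
  finally have e: "(\<Sum>u\<in>V. Y.Q u (anc \<omega> v) \<sigma>) = \<dots>" .
  show ?thesis unfolding Y.T_def e using n0 by (simp add: field_simps)
qed

text \<open>With \<open>\<omega>\<close> the exponential of the distance from \<open>v\<close> this
  is an exponential moment of the displacement of a lineage, to be used in Markov's inequality. One
  step multiplies the weight by at most 3 at rate 1, which gives the rate
  \<open>3 - 1\<close>.\<close>

lemma S_anc:
  assumes w: "\<And>u. u \<in> V \<Longrightarrow> (\<Sum>z\<in>V. J u z * \<omega> z) \<le> 3 * \<omega> u" and w0: "\<And>u. 0 \<le> \<omega> u" and b: "bf \<omega>"
    and v: "v \<in> V" and t: "0 \<le> t"
  shows "Y.S t (anc \<omega> v) Inl \<le> exp (2 * t) * \<omega> v"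
proof -
  have k: "(Y.T ^^ k) (anc \<omega> v) Inl \<le> (1 + 2 / n) ^ k * \<omega> v" if "v \<in> V" for v k
    using that
  proof (induction k arbitrary: v)
    case 0 then show ?case by (simp add: anc_def)
  next
    case (Suc k)
    define r where "r = 1 + 2 / n"
    have "(Y.T ^^ Suc k) (anc \<omega> v) Inl = (Y.T ^^ k) (\<lambda>\<sigma>. (1 - 1 / n) * anc \<omega> v \<sigma> + (1 - \<theta>) / n * (\<Sum>w\<in>V. J v w * anc \<omega> w \<sigma>)) Inl"
    proof -
      have "Y.T (anc \<omega> v) = (\<lambda>\<sigma>. (1 - 1 / n) * anc \<omega> v \<sigma> + (1 - \<theta>) / n * (\<Sum>w\<in>V. J v w * anc \<omega> w \<sigma>))"
        by (intro ext T_anc Suc.prems)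
      then show ?thesis by (simp only: funpow_Suc_right comp_def)
    qed
    also have "\<dots> = (1 - 1 / n) * (Y.T ^^ k) (anc \<omega> v) Inl + (1 - \<theta>) / n * (\<Sum>w\<in>V. J v w * (Y.T ^^ k) (anc \<omega> w) Inl)"
      by (simp add: posop_add[OF Y.posop_Tk] posop_cmult[OF Y.posop_Tk] posop_sum[OF Y.posop_Tk] del: times_divide_eq_left)
    also have "\<dots> \<le> (1 - 1 / n) * (r ^ k * \<omega> v) + (1 - \<theta>) / n * (\<Sum>w\<in>V. J v w * (r ^ k * \<omega> w))"
      using n0 n1 th1 Suc.IH[OF Suc.prems] Suc.IH
      by (intro add_mono mult_left_mono sum_mono J0) (auto simp: r_def)
    also have "(\<Sum>w\<in>V. J v w * (r ^ k * \<omega> w)) = r ^ k * (\<Sum>w\<in>V. J v w * \<omega> w)"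
      by (simp add: sum_distrib_left mult_ac)
    also have "\<dots> \<le> r ^ k * (3 * \<omega> v)" using n0 w[OF Suc.prems] by (intro mult_left_mono) (auto simp: r_def)
    also have "(1 - 1 / n) * (r ^ k * \<omega> v) + (1 - \<theta>) / n * (r ^ k * (3 * \<omega> v))
       = ((1 - 1 / n) + (1 - \<theta>) / n * 3) * (r ^ k * \<omega> v)" by (simp add: algebra_simps)
    also have "\<dots> \<le> r * (r ^ k * \<omega> v)"
    proof (intro mult_right_mono mult_nonneg_nonneg)
      have "(1 - \<theta>) / n * 3 \<le> 1 / n * 3" using th0 n0 by (intro mult_right_mono divide_right_mono) auto
      then show "(1 - 1 / n) + (1 - \<theta>) / n * 3 \<le> r" by (simp add: r_def)
    qed (use w0 n0 in \<open>auto simp: r_def\<close>)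
    finally show ?case using n0 th1 by (simp add: r_def mult_left_mono divide_right_mono mult.assoc)
  qed
  have "pavg (n * t) (\<lambda>k. (Y.T ^^ k) (anc \<omega> v) Inl) \<le> pavg (n * t) (\<lambda>k. \<omega> v * (1 + 2 / n) ^ k)"
    using n0 t k[OF v] by (intro pavg_mono Y.egrow_Tk egrow_power egrow_cmult bf_anc b) (auto simp: mult.commute)
  also have "\<dots> = \<omega> v * exp (2 * t)" using n0 by (subst pavg_cmult) (auto intro: egrow_power simp: pavg_power)
  finally show ?thesis by (simp add: Y.S_def mult.commute)
qed

text \<open>Noise and copying both preserve the uniform marginal of a site, although the joint law
  changes. Hence a single surviving lineage carries no information about the time elapsed since the
  uniform start.\<close>

lemma marginal_uniform:
  assumes w: "w \<in> V" and b: "bf \<phi>"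
  shows "pexp (pmf_of_set (V \<rightarrow>\<^sub>E C)) (S t (\<lambda>x. \<phi> (x w))) = (\<Sum>c\<in>C. \<phi> c) / real (card C)"
proof -
  let ?U = "pmf_of_set (V \<rightarrow>\<^sub>E C)"
  define m where "m = (\<Sum>c\<in>C. \<phi> c) / real (card C)"
  have PE: "(V \<rightarrow>\<^sub>E C) \<noteq> {}" using neC by (auto simp: PiE_eq_empty_iff)
  then have cP: "real (card (V \<rightarrow>\<^sub>E C)) \<noteq> 0" using finite_configs by simp
  have fin: "finite (set_pmf ?U)" using PE finite_configs by simp
  have bb: "bf (\<lambda>x. \<phi> (x w))" for w :: 'a using b by (auto simp: bf_def)
  have base: "pexp ?U (\<lambda>x. \<phi> (x w)) = m" if w: "w \<in> V" for w
  proof -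
    have "(\<Sum>x\<in>V \<rightarrow>\<^sub>E C. (\<Sum>c\<in>C. \<phi> ((x(w := c)) w))) = real (card C) * (\<Sum>x\<in>V \<rightarrow>\<^sub>E C. \<phi> (x w))"
      by (rule uniform_noise_invariant[OF finV finC neC w])
    then have "real (card (V \<rightarrow>\<^sub>E C)) * (\<Sum>c\<in>C. \<phi> c) = real (card C) * (\<Sum>x\<in>V \<rightarrow>\<^sub>E C. \<phi> (x w))" by simp
    then show ?thesis using cP cC by (simp add: pexp_uniform finV finC neC m_def field_simps)
  qed
  have T: "T (\<lambda>x. \<phi> (x w)) x = (1 - 1 / n) * \<phi> (x w) + (\<theta> * m / n + (1 - \<theta>) / n * (\<Sum>v\<in>V. J w v * \<phi> (x v)))"
    if w: "w \<in> V" for w x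
  proof -
    have "Q u (\<lambda>x. \<phi> (x w)) x = (if u = w then \<theta> * m + (1 - \<theta>) * (\<Sum>v\<in>V. J w v * \<phi> (x v)) else \<phi> (x w))" if u: "u \<in> V" for u
    proof (cases "u = w")
      case False
      then have "Q u (\<lambda>x. \<phi> (x w)) x = Q u (\<lambda>_. \<phi> (x w)) x" by (simp add: Q_def)
      then show ?thesis using False by (simp add: posop_const[OF posop_Q[OF u]])
    qed (simp add: Q_def m_def)
    then have "(\<Sum>u\<in>V. Q u (\<lambda>x. \<phi> (x w)) x) = (\<Sum>u\<in>V. if u = w then \<theta> * m + (1 - \<theta>) * (\<Sum>v\<in>V. J w v * \<phi> (x v)) else \<phi> (x w))"
      by (intro sum.cong) auto
    also have "\<dots> = \<theta> * m + (1 - \<theta>) * (\<Sum>v\<in>V. J w v * \<phi> (x v)) + (n - 1) * \<phi> (x w)"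
      using w finV n1 by (simp add: sum.remove[OF finV w] card_Diff_singleton of_nat_diff)
    finally have e: "(\<Sum>u\<in>V. Q u (\<lambda>x. \<phi> (x w)) x) = \<dots>" .
    show ?thesis unfolding T_def e using n0 by (simp add: field_simps)
  qed
  note E = posop_ev[OF fin]
  have k: "pexp ?U ((T ^^ k) (\<lambda>x. \<phi> (x w))) = m" if "w \<in> V" for k w
    using that
  proof (induction k arbitrary: w)
    case (Suc k)
    have e: "(T ^^ Suc k) (\<lambda>x. \<phi> (x w)) = (\<lambda>x. (1 - 1 / n) * (T ^^ k) (\<lambda>x. \<phi> (x w)) x
        + (\<theta> * m / n + (1 - \<theta>) / n * (\<Sum>v\<in>V. J w v * (T ^^ k) (\<lambda>x. \<phi> (x v)) x)))"
    proof
      fix x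
      have "(T ^^ Suc k) (\<lambda>x. \<phi> (x w)) x = (T ^^ k) (\<lambda>x. (1 - 1 / n) * \<phi> (x w) + (\<theta> * m / n + (1 - \<theta>) / n * (\<Sum>v\<in>V. J w v * \<phi> (x v)))) x"
      proof -
        have "T (\<lambda>x. \<phi> (x w)) = (\<lambda>x. (1 - 1 / n) * \<phi> (x w) + (\<theta> * m / n + (1 - \<theta>) / n * (\<Sum>v\<in>V. J w v * \<phi> (x v))))"
          by (intro ext T Suc.prems)
        then show ?thesis by (simp only: funpow_Suc_right comp_def)
      qed
      then show "(T ^^ Suc k) (\<lambda>x. \<phi> (x w)) x = (1 - 1 / n) * (T ^^ k) (\<lambda>x. \<phi> (x w)) x
        + (\<theta> * m / n + (1 - \<theta>) / n * (\<Sum>v\<in>V. J w v * (T ^^ k) (\<lambda>x. \<phi> (x v)) x))"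
        by (simp add: posop_add[OF posop_Tk] posop_cmult[OF posop_Tk] posop_sum[OF posop_Tk] posop_const[OF posop_Tk]
              del: times_divide_eq_left)
    qed
    have "pexp ?U ((T ^^ Suc k) (\<lambda>x. \<phi> (x w))) = (1 - 1 / n) * m + (\<theta> * m / n + (1 - \<theta>) / n * (\<Sum>v\<in>V. J w v * m))"
      unfolding e using Suc.IH Suc.prems
      by (simp add: posop_add[OF E] posop_cmult[OF E] posop_const[OF E] pexp_sum_cmult del: times_divide_eq_left)
    also have "(\<Sum>v\<in>V. J w v * m) = m" using J1[OF Suc.prems] by (simp add: sum_distrib_right[symmetric])
    finally show ?case by (simp add: algebra_simps diff_divide_distrib add_divide_distrib)
  qed (simp add: base)
  show ?thesis by (simp add: pexp_S bb k[OF w] m_def)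
qed

text \<open>Started from the uniform law, only two distinct surviving lineages can carry information.\<close>
lemma uniform_decay:
  assumes A: "A \<subseteq> V" "dep A f" "\<And>x. 0 \<le> f x" "\<And>x. f x \<le> 1" and t: "0 \<le> t" "t \<le> t'"
  shows "\<bar>pexp (pmf_of_set (V \<rightarrow>\<^sub>E C)) (S t f) - pexp (pmf_of_set (V \<rightarrow>\<^sub>E C)) (S t' f)\<bar>
          \<le> (real (card A))\<^sup>2 * exp (- (2 * \<theta> * t))"
proof -
  let ?U = "pmf_of_set (V \<rightarrow>\<^sub>E C)"
  have PE: "(V \<rightarrow>\<^sub>E C) \<noteq> {}" using neC by (auto simp: PiE_eq_empty_iff)
  have setU: "set_pmf ?U \<subseteq> V \<rightarrow>\<^sub>E C" using PE finite_configs by simp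
  have b: "bf f" using A(3,4) by (intro bfI[of _ 1]) (auto simp: abs_le_iff intro: order_trans[of _ 0])
  have fA: "finite A" using A(1) finV by (rule finite_subset)
  obtain \<nu>' where \<nu>': "set_pmf \<nu>' \<subseteq> V \<rightarrow>\<^sub>E C" "\<And>g. bf g \<Longrightarrow> pexp ?U (S (t' - t) g) = pexp \<nu>' g"
    using law_exists[OF setU, of "t' - t"] t by auto
  have finU: "finite (set_pmf ?U)" "finite (set_pmf \<nu>')"
    using setU \<nu>'(1) finite_configs by (auto intro: finite_subset)
  \<comment> \<open>The two laws are run over the last \<open>t\<close> with the same lineages;
    \<open>\<nu>'\<close> is the uniform law after the excess time \<open>t' - t\<close>.\<close>
  define D where "D \<sigma> = pexp ?U (\<lambda>x. f (evalc V x \<sigma>)) - pexp \<nu>' (\<lambda>x. f (evalc V x \<sigma>))" for \<sigma>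
  have be: "bf (\<lambda>\<sigma>. pexp \<nu> (\<lambda>x. f (evalc V x \<sigma>)))" if "finite (set_pmf \<nu>)" for \<nu> :: "('a \<Rightarrow> 'c) pmf"
    by (rule bfI[of _ 1], rule posop_bounded[OF posop_ev[OF that]]) (use A(3,4) in \<open>auto simp: abs_le_iff intro: order_trans[of _ 0]\<close>)
  have "pexp ?U (S t' f) = pexp ?U (S (t' - t) (S t f))"
    using t by (intro pexp_cong) (simp add: S_S b)
  also have "\<dots> = pexp \<nu>' (S t f)" by (rule \<nu>'(2)[OF bf_S[OF t(1) b]])
  finally have "pexp ?U (S t f) - pexp ?U (S t' f) = Y.S t D Inl"
    using pexp_S_evalc[OF setU b, of t] pexp_S_evalc[OF \<nu>'(1) b, of t] unfolding D_def
    by (simp add: Y.S_diff be finU)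
  moreover have "\<bar>Y.S t D Inl\<bar> \<le> Y.S t (\<lambda>\<sigma>. \<Sum>a\<in>A. \<Sum>a'\<in>A - {a}. alive {a, a'} \<sigma>) Inl"
  proof (rule Y.S_abs[OF _ t(1)])
    fix \<sigma> :: "'a \<Rightarrow> 'a + 'c"
    have nn: "0 \<le> (\<Sum>a\<in>A. \<Sum>a'\<in>A - {a}. alive {a, a'} \<sigma>)" by (intro sum_nonneg alive_01)
    show "\<bar>D \<sigma>\<bar> \<le> (\<Sum>a\<in>A. \<Sum>a'\<in>A - {a}. alive {a, a'} \<sigma>)"
    proof (cases "\<exists>a\<in>A. \<exists>a'\<in>A. a \<noteq> a' \<and> alive {a, a'} \<sigma> = 1")
      case True
      then obtain a a' where a: "a \<in> A" "a' \<in> A - {a}" "alive {a, a'} \<sigma> = 1" by auto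
      have "1 \<le> (\<Sum>a'\<in>A - {a}. alive {a, a'} \<sigma>)"
        unfolding a(3)[symmetric] using fA a by (intro member_le_sum alive_01) auto
      also have "\<dots> \<le> (\<Sum>a\<in>A. \<Sum>a'\<in>A - {a}. alive {a, a'} \<sigma>)"
        using fA a by (intro member_le_sum[of a A "\<lambda>a. \<Sum>a'\<in>A - {a}. alive {a, a'} \<sigma>"] sum_nonneg alive_01) auto
      finally have "1 \<le> (\<Sum>a\<in>A. \<Sum>a'\<in>A - {a}. alive {a, a'} \<sigma>)" .
      moreover have "0 \<le> pexp \<nu> (\<lambda>x. f (evalc V x \<sigma>)) \<and> pexp \<nu> (\<lambda>x. f (evalc V x \<sigma>)) \<le> 1" if "finite (set_pmf \<nu>)" for \<nu> :: "('a \<Rightarrow> 'c) pmf"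
        using posop_mono[OF posop_ev[OF that], of "\<lambda>_. 0" "\<lambda>x. f (evalc V x \<sigma>)"] posop_const[OF posop_ev[OF that], of 0]
          posop_mono[OF posop_ev[OF that], of "\<lambda>x. f (evalc V x \<sigma>)" "\<lambda>_. 1"] posop_const[OF posop_ev[OF that], of 1] A(3,4) by simp
      ultimately show ?thesis using finU unfolding D_def by (smt (verit))
    next
      case False
      have eq: "w = w'" if "a \<in> A" "a' \<in> A" "\<sigma> a = Inl w" "\<sigma> a' = Inl w'" for a a' w w'
      proof (rule ccontr)
        assume "w \<noteq> w'"
        then have "alive {a, a'} \<sigma> = 1" "a \<noteq> a'" using that by (auto simp: alive_def)
        then show False using False that by blast
      qed
      \<comment> \<open>No two sites of \<open>A\<close> have distinct ancestors, so
        \<open>f\<close> sees the initial state at one site at most. If no lineage survives, any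
        \<open>w\<close> will do; a \<open>w\<close> outside \<open>V\<close> carries the default
        colour \<open>undefined\<close> under both laws.\<close>
      obtain w where w: "\<And>a w'. a \<in> A \<Longrightarrow> \<sigma> a = Inl w' \<Longrightarrow> w' = w"
      proof (cases "\<exists>a\<in>A. \<exists>w'. \<sigma> a = Inl w'")
        case True
        then obtain a w' where "a \<in> A" "\<sigma> a = Inl w'" by auto
        then show ?thesis using that[of w'] eq by blast
      next
        case False
        then show ?thesis using that[of undefined] by blast
      qed
      have f: "f (evalc V x \<sigma>) = f (evalc V (\<lambda>_. x w) \<sigma>)" for x
      proof (rule depD[OF A(2)])
        fix a assume "a \<in> A"
        then show "evalc V x \<sigma> a = evalc V (\<lambda>_. x w) \<sigma> a"
          using w[of a] by (cases "\<sigma> a") (auto simp: evalc_def)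
      qed
      define \<phi> where "\<phi> c = f (evalc V (\<lambda>_. c) \<sigma>)" for c
      have b\<phi>: "bf \<phi>" using b by (auto simp: bf_def \<phi>_def)
      have b\<phi>': "bf (\<lambda>x. \<phi> (x w))" using b\<phi> by (auto simp: bf_def)
      have D: "D \<sigma> = pexp ?U (\<lambda>x. \<phi> (x w)) - pexp \<nu>' (\<lambda>x. \<phi> (x w))" unfolding D_def \<phi>_def by (subst (1 2) f) simp
      have "pexp ?U (\<lambda>x. \<phi> (x w)) = pexp \<nu>' (\<lambda>x. \<phi> (x w))"
      proof (cases "w \<in> V")
        case True
        moreover have "S 0 (\<lambda>x. \<phi> (x w)) = (\<lambda>x. \<phi> (x w))" by (intro ext S_0)
        ultimately show ?thesis using marginal_uniform[OF True b\<phi>, of 0] marginal_uniform[OF True b\<phi>, of "t' - t"] \<nu>'(2)[OF b\<phi>'] by simp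
      next
        case False
        have "pexp \<nu> (\<lambda>x. \<phi> (x w)) = \<phi> undefined" if "set_pmf \<nu> \<subseteq> V \<rightarrow>\<^sub>E C" "finite (set_pmf \<nu>)" for \<nu>
        proof -
          have "pexp \<nu> (\<lambda>x. \<phi> (x w)) = pexp \<nu> (\<lambda>x. \<phi> undefined)"
            using that(1) False by (intro pexp_cong) (metis PiE_arb subsetD)
          then show ?thesis using posop_const[OF posop_ev[OF that(2)]] by simp
        qed
        then show ?thesis using setU \<nu>'(1) finU by simp
      qed
      then show ?thesis using D nn by simp
    qed
  qed (auto intro!: bf_sum)
  moreover have "Y.S t (\<lambda>\<sigma>. \<Sum>a\<in>A. \<Sum>a'\<in>A - {a}. alive {a, a'} \<sigma>) Inl \<le> (\<Sum>a\<in>A. \<Sum>a'\<in>A - {a}. exp (- (2 * \<theta> * t)))"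
  proof -
    have "Y.S t (\<lambda>\<sigma>. \<Sum>a\<in>A. \<Sum>a'\<in>A - {a}. alive {a, a'} \<sigma>) Inl = (\<Sum>a\<in>A. \<Sum>a'\<in>A - {a}. Y.S t (alive {a, a'}) Inl)"
      by (subst Y.S_sum) (auto intro!: bf_sum sum.cong simp: Y.S_sum)
    also have "\<dots> \<le> (\<Sum>a\<in>A. \<Sum>a'\<in>A - {a}. exp (- (2 * \<theta> * t)))"
    proof (intro sum_mono)
      fix a a' assume a: "a \<in> A" "a' \<in> A - {a}"
      then have "card {a, a'} = 2" by auto
      then show "Y.S t (alive {a, a'}) Inl \<le> exp (- (2 * \<theta> * t))"
        using S_alive[of "{a, a'}" t Inl] a A(1) t by auto
    qed
    finally show ?thesis .
  qed
  moreover have "(\<Sum>a\<in>A. \<Sum>a'\<in>A - {a}. exp (- (2 * \<theta> * t))) \<le> (\<Sum>a\<in>A. \<Sum>a'\<in>A. exp (- (2 * \<theta> * t)))"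
    using fA by (intro sum_mono sum_mono2) auto
  moreover have "(\<Sum>a\<in>A. \<Sum>a'\<in>A. exp (- (2 * \<theta> * t))) = (real (card A))\<^sup>2 * exp (- (2 * \<theta> * t))"
    by (simp add: power2_eq_square)
  ultimately show ?thesis by linarith
qed

end

section \<open>Clusters of surviving lineages\<close>

definition near :: "('a \<times> 'a) set \<Rightarrow> nat \<Rightarrow> 'a \<Rightarrow> 'a set" where
  "near E r u = {v. \<exists>k\<le>r. (u, v) \<in> E ^^ k}"

lemma near_refl: "u \<in> near E r u"
  unfolding near_def by (auto intro!: exI[of _ 0])

lemma near_mono: "r \<le> r' \<Longrightarrow> near E r u \<subseteq> near E r' u"
  unfolding near_def by (auto intro: le_trans)

lemma near_trans: "v \<in> near E r u \<Longrightarrow> w \<in> near E r' v \<Longrightarrow> w \<in> near E (r + r') u"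
proof -
  assume "v \<in> near E r u" "w \<in> near E r' v"
  then obtain k k' where "k \<le> r" "k' \<le> r'" "(u, v) \<in> E ^^ k" "(v, w) \<in> E ^^ k'" by (auto simp: near_def)
  then have "(u, w) \<in> E ^^ (k + k')" "k + k' \<le> r + r'" by (auto simp: relpow_add)
  then show ?thesis unfolding near_def by blast
qed

lemma relpow_sym: "sym E \<Longrightarrow> (u, v) \<in> E ^^ k \<Longrightarrow> (v, u) \<in> E ^^ k"
proof (induction k arbitrary: v)
  case (Suc k)
  then obtain w where "(u, w) \<in> E ^^ k" "(w, v) \<in> E" by auto
  then show ?case using Suc by (metis relpow_Suc_I2 symD)
qed auto

lemma near_sym: "sym E \<Longrightarrow> v \<in> near E r u \<Longrightarrow> u \<in> near E r v"
  unfolding near_def using relpow_sym by fastforce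

lemma near_step: "(u, v) \<in> E \<Longrightarrow> v \<in> near E 1 u"
  unfolding near_def by (auto intro!: exI[of _ 1])

text \<open>Growth histories of a \<open>\<rho>\<close>-connected set, the newest site at the head:
  each site is close to one already present. A connected set may have several histories, which is
  harmless for an upper count.\<close>

fun chain :: "('a \<times> 'a) set \<Rightarrow> nat \<Rightarrow> 'a list \<Rightarrow> bool" where
  "chain E \<rho> [] = True"
| "chain E \<rho> (w # ws) = (w \<notin> set ws \<and> (ws = [] \<or> (\<exists>w'\<in>set ws. w \<in> near E \<rho> w')) \<and> chain E \<rho> ws)"

lemma chain_distinct: "chain E \<rho> ws \<Longrightarrow> distinct ws"
  by (induction ws) auto

text \<open>There are \<open>card V\<close> choices for the oldest site; each of the
  \<open>k\<close> later ones lies in the ball of one of at most \<open>Suc k\<close> sites already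
  present.\<close>

lemma chain_count:
  assumes V: "finite V" and M: "\<And>v. v \<in> V \<Longrightarrow> card (near E \<rho> v \<inter> V) \<le> M"
  shows "finite {ws. chain E \<rho> ws \<and> length ws = k \<and> set ws \<subseteq> V} \<and>
         card {ws. chain E \<rho> ws \<and> length ws = Suc k \<and> set ws \<subseteq> V} \<le> card V * (Suc k * M) ^ k"
proof -
  have fin: "finite {ws. chain E \<rho> ws \<and> length ws = k \<and> set ws \<subseteq> V}" for k
    by (rule finite_subset[OF _ finite_lists_length_eq[OF V, of k]]) auto
  have "card {ws. chain E \<rho> ws \<and> length ws = Suc k \<and> set ws \<subseteq> V} \<le> card V * (Suc k * M) ^ k" for k
  proof (induction k)
    case 0
    have "{ws. chain E \<rho> ws \<and> length ws = Suc 0 \<and> set ws \<subseteq> V} \<subseteq> (\<lambda>v. [v]) ` V"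
      by (auto simp: length_Suc_conv)
    then have "card {ws. chain E \<rho> ws \<and> length ws = Suc 0 \<and> set ws \<subseteq> V} \<le> card ((\<lambda>v. [v]) ` V)"
      using V by (intro card_mono) auto
    also have "\<dots> \<le> card V" using V by (rule card_image_le)
    finally show ?case by simp
  next
    case (Suc k)
    let ?L = "{ws. chain E \<rho> ws \<and> length ws = Suc k \<and> set ws \<subseteq> V}"
    have "{ws. chain E \<rho> ws \<and> length ws = Suc (Suc k) \<and> set ws \<subseteq> V} \<subseteq>
       (\<Union>ws\<in>?L. (\<lambda>w. w # ws) ` (\<Union>w'\<in>set ws. near E \<rho> w' \<inter> V))"
    proof
      fix l assume "l \<in> {ws. chain E \<rho> ws \<and> length ws = Suc (Suc k) \<and> set ws \<subseteq> V}"
      then obtain w ws where l: "l = w # ws" "chain E \<rho> (w # ws)" "length ws = Suc k" "set (w # ws) \<subseteq> V"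
        by (cases l) auto
      then have ws: "ws \<in> ?L" by auto
      have "ws \<noteq> []" using l(3) by auto
      then obtain w' where "w' \<in> set ws" "w \<in> near E \<rho> w'" using l(2) by auto
      then have "w \<in> (\<Union>w'\<in>set ws. near E \<rho> w' \<inter> V)" using l(4) by auto
      then show "l \<in> (\<Union>ws\<in>?L. (\<lambda>w. w # ws) ` (\<Union>w'\<in>set ws. near E \<rho> w' \<inter> V))" using ws l(1) by blast
    qed
    then have "card {ws. chain E \<rho> ws \<and> length ws = Suc (Suc k) \<and> set ws \<subseteq> V} \<le>
       card (\<Union>ws\<in>?L. (\<lambda>w. w # ws) ` (\<Union>w'\<in>set ws. near E \<rho> w' \<inter> V))"
      using V fin by (intro card_mono finite_UN_I finite_imageI) auto
    also have "\<dots> \<le> (\<Sum>ws\<in>?L. card ((\<lambda>w. w # ws) ` (\<Union>w'\<in>set ws. near E \<rho> w' \<inter> V)))"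
      by (rule card_UN_le[OF fin])
    also have "\<dots> \<le> (\<Sum>ws\<in>?L. Suc k * M)"
    proof (intro sum_mono)
      fix ws assume ws: "ws \<in> ?L"
      have "card ((\<lambda>w. w # ws) ` (\<Union>w'\<in>set ws. near E \<rho> w' \<inter> V)) \<le> card (\<Union>w'\<in>set ws. near E \<rho> w' \<inter> V)"
        using V by (intro card_image_le finite_UN_I) auto
      also have "\<dots> \<le> (\<Sum>w'\<in>set ws. card (near E \<rho> w' \<inter> V))" by (rule card_UN_le) auto
      also have "\<dots> \<le> (\<Sum>w'\<in>set ws. M)" using ws by (intro sum_mono M) auto
      also have "\<dots> = card (set ws) * M" by simp
      also have "\<dots> \<le> Suc k * M" using ws by (intro mult_right_mono) (auto intro: order_trans[OF card_length])
      finally show "card ((\<lambda>w. w # ws) ` (\<Union>w'\<in>set ws. near E \<rho> w' \<inter> V)) \<le> Suc k * M" .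
    qed
    also have "\<dots> = card ?L * (Suc k * M)" by simp
    also have "\<dots> \<le> card V * (Suc k * M) ^ k * (Suc k * M)" by (intro mult_right_mono Suc) auto
    also have "\<dots> = card V * (Suc k * M) ^ Suc k" by (simp add: mult_ac)
    also have "\<dots> \<le> card V * (Suc (Suc k) * M) ^ Suc k"
      by (intro mult_left_mono power_mono mult_right_mono) auto
    finally show ?case .
  qed
  then show ?thesis using fin by blast
qed

definition crel :: "('a \<times> 'a) set \<Rightarrow> nat \<Rightarrow> 'a set \<Rightarrow> ('a \<times> 'a) set" where
  "crel E \<rho> A = {(a, b). a \<in> A \<and> b \<in> A \<and> b \<in> near E \<rho> a}"

lemma crel_class_subset: "a \<in> A \<Longrightarrow> (crel E \<rho> A)\<^sup>* `` {a} \<subseteq> A"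
proof
  fix b assume "a \<in> A" "b \<in> (crel E \<rho> A)\<^sup>* `` {a}"
  then have "(a, b) \<in> (crel E \<rho> A)\<^sup>*" by simp
  then show "b \<in> A" using \<open>a \<in> A\<close> by (induction rule: rtrancl_induct) (auto simp: crel_def)
qed

lemma crel_class_eq:
  assumes "sym E" "(a, b) \<in> (crel E \<rho> A)\<^sup>*"
  shows "(crel E \<rho> A)\<^sup>* `` {a} = (crel E \<rho> A)\<^sup>* `` {b}"
proof -
  have "sym (crel E \<rho> A)" unfolding sym_def crel_def using near_sym[OF assms(1)] by blast
  then have "(b, a) \<in> (crel E \<rho> A)\<^sup>*" using assms(2) by (meson sym_rtrancl symD)
  then show ?thesis using assms(2) by (auto intro: rtrancl_trans)
qed

text \<open>As long as the list misses a site of the class, some listed site has an unlisted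
  neighbour in \<open>crel\<close>; otherwise the list would be closed under the relation and
  contain the class.\<close>

lemma class_chain:
  assumes "finite A" "a \<in> A" "k \<le> card ((crel E \<rho> A)\<^sup>* `` {a})"
  shows "\<exists>ws. chain E \<rho> ws \<and> set ws \<subseteq> (crel E \<rho> A)\<^sup>* `` {a} \<and> length ws = k \<and> (k > 0 \<longrightarrow> a \<in> set ws)"
  using assms(3)
proof (induction k)
  case (Suc k)
  let ?c = "(crel E \<rho> A)\<^sup>* `` {a}"
  obtain ws where ws: "chain E \<rho> ws" "set ws \<subseteq> ?c" "length ws = k" "k > 0 \<longrightarrow> a \<in> set ws"
    using Suc by auto
  show ?case
  proof (cases "k = 0")
    case True
    then show ?thesis by (intro exI[of _ "[a]"]) auto
  next
    case False
    then have a: "a \<in> set ws" using ws by auto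
    have "card (set ws) < card ?c"
      using ws(1,3) Suc.prems by (simp add: distinct_card[OF chain_distinct])
    then have "\<not> ?c \<subseteq> set ws" by (metis List.finite_set card_mono not_less)
    have "\<exists>w\<in>set ws. \<exists>w'. (w, w') \<in> crel E \<rho> A \<and> w' \<notin> set ws"
    proof (rule ccontr)
      assume neg: "\<not> ?thesis"
      have "b \<in> set ws" if "(a, b) \<in> (crel E \<rho> A)\<^sup>*" for b
        using that
      proof (induction rule: rtrancl_induct)
        case base then show ?case by (rule a)
      next
        case (step y z) then show ?case using neg by blast
      qed
      then have "?c \<subseteq> set ws" by auto
      then show False using \<open>\<not> ?c \<subseteq> set ws\<close> by simp
    qed
    then obtain w w' where w: "w \<in> set ws" "(w, w') \<in> crel E \<rho> A" "w' \<notin> set ws" by blast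
    have "w \<in> ?c" using w(1) ws(2) by auto
    then have "w' \<in> ?c" using w(2) by auto
    then have "chain E \<rho> (w' # ws) \<and> set (w' # ws) \<subseteq> ?c \<and> length (w' # ws) = Suc k \<and> a \<in> set (w' # ws)"
      using w ws a by (auto simp: crel_def)
    then show ?thesis by blast
  qed
qed auto

text \<open>Distance from the set \<open>A\<close>. Without a connecting walk the value is
  unspecified; connectedness in \<open>gsym\<close> excludes this.\<close>

definition dst :: "('a \<times> 'a) set \<Rightarrow> 'a set \<Rightarrow> 'a \<Rightarrow> nat" where
  "dst E A v = (LEAST k. \<exists>a\<in>A. (a, v) \<in> E ^^ k)"

lemma dst_le: "a \<in> A \<Longrightarrow> v \<in> near E r a \<Longrightarrow> dst E A v \<le> r"
proof -
  assume a: "a \<in> A" "v \<in> near E r a"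
  then obtain k where k: "k \<le> r" "(a, v) \<in> E ^^ k" by (auto simp: near_def)
  then have "dst E A v \<le> k" unfolding dst_def using a by (intro Least_le) blast
  then show ?thesis using k by simp
qed

locale gsym = symb V C \<theta> J for V :: "'a set" and C :: "'c set" and \<theta> J +
  fixes E :: "('a \<times> 'a) set"
  assumes EV: "E \<subseteq> V \<times> V" and symE: "sym E" and conn: "\<And>u v. u \<in> V \<Longrightarrow> v \<in> V \<Longrightarrow> (u, v) \<in> E\<^sup>*"
    and JE: "\<And>u v. u \<in> V \<Longrightarrow> v \<in> V \<Longrightarrow> J u v \<noteq> 0 \<Longrightarrow> (u, v) \<in> E"
begin

lemma dst_attained:
  assumes "A \<noteq> {}" "A \<subseteq> V" "v \<in> V"
  shows "\<exists>a\<in>A. (a, v) \<in> E ^^ dst E A v"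
proof -
  obtain a where "a \<in> A" using assms by auto
  then have "(a, v) \<in> E\<^sup>*" using assms conn by blast
  then obtain k where "(a, v) \<in> E ^^ k" using rtrancl_power by blast
  then have "\<exists>k. \<exists>a\<in>A. (a, v) \<in> E ^^ k" using \<open>a \<in> A\<close> by blast
  then show ?thesis unfolding dst_def by (rule LeastI_ex)
qed

lemma dst_near: "A \<noteq> {} \<Longrightarrow> A \<subseteq> V \<Longrightarrow> v \<in> V \<Longrightarrow> dst E A v \<le> r \<Longrightarrow> \<exists>a\<in>A. v \<in> near E r a"
  using dst_attained[of A v] unfolding near_def by blast

lemma dst_step:
  assumes "A \<noteq> {}" "A \<subseteq> V" "(u, v) \<in> E"
  shows "dst E A v \<le> dst E A u + 1"
proof -
  have "u \<in> V" using assms EV by auto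
  then obtain a where a: "a \<in> A" "u \<in> near E (dst E A u) a" using dst_near[OF assms(1,2)] by blast
  then have "v \<in> near E (dst E A u + 1) a" using near_trans near_step[OF assms(3)] by metis
  then show ?thesis using a(1) by (intro dst_le)
qed

text \<open>The value 0 outside \<open>V\<close> makes the weight bounded, as \<open>bf\<close>
  requires; within \<open>V\<close> it grows by at most a factor \<open>exp 1 \<le> 3\<close> along
  an arc.\<close>

definition wt :: "'a set \<Rightarrow> 'a \<Rightarrow> real" where
  "wt A v = (if v \<in> V then exp (real (dst E A v)) else 0)"

lemma wt_nonneg: "0 \<le> wt A v" by (simp add: wt_def)

lemma bf_wt: "bf (wt A)"
proof (rule bfI)
  fix v
  show "\<bar>wt A v\<bar> \<le> (\<Sum>v\<in>V. wt A v)"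
  proof (cases "v \<in> V")
    case True
    then show ?thesis using finV by (simp add: wt_nonneg member_le_sum)
  next
    case False
    then have "wt A v = 0" by (simp add: wt_def)
    then show ?thesis by (simp add: sum_nonneg wt_nonneg)
  qed
qed

lemma wt_J:
  assumes A: "A \<noteq> {}" "A \<subseteq> V" and u: "u \<in> V"
  shows "(\<Sum>z\<in>V. J u z * wt A z) \<le> 3 * wt A u"
proof -
  have "(\<Sum>z\<in>V. J u z * wt A z) \<le> (\<Sum>z\<in>V. J u z * (3 * wt A u))"
  proof (intro sum_mono)
    fix z assume z: "z \<in> V"
    show "J u z * wt A z \<le> J u z * (3 * wt A u)"
    proof (cases "J u z = 0")
      case False
      then have "dst E A z \<le> dst E A u + 1" using JE[OF u z] A by (intro dst_step)
      then have "exp (real (dst E A z)) \<le> exp (real (dst E A u) + 1)" by simp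
      also have "\<dots> = exp 1 * exp (real (dst E A u))" by (simp add: exp_add)
      also have "\<dots> \<le> 3 * exp (real (dst E A u))" by (intro mult_right_mono exp_le) auto
      finally show ?thesis using u z J0 by (intro mult_left_mono) (auto simp: wt_def)
    qed simp
  qed
  also have "\<dots> = 3 * wt A u" using J1[OF u] by (simp add: sum_distrib_right[symmetric])
  finally show ?thesis .
qed

lemma wt_self: "a \<in> A \<Longrightarrow> A \<subseteq> V \<Longrightarrow> wt A a = 1"
  using dst_le[OF _ near_refl[of a E 0], of A] by (auto simp: wt_def)

text \<open>A jump that would leave its region becomes a lazy step, so that distinct regions evolve independently.\<close>
definition Jt :: "('a \<Rightarrow> 'i) \<Rightarrow> 'a \<Rightarrow> 'a \<Rightarrow> real" where
  "Jt reg u v = (if reg v = reg u then J u v else 0)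
      + (if v = u then (\<Sum>w\<in>V. if reg w = reg u then 0 else J u w) else 0)"

lemma sym_Jt: "symb V C \<theta> (Jt reg)"
proof
  show "0 \<le> Jt reg u v" for u v unfolding Jt_def using J0 by (auto intro!: add_nonneg_nonneg sum_nonneg)
  fix u assume u: "u \<in> V"
  have "(\<Sum>v\<in>V. Jt reg u v) = (\<Sum>v\<in>V. if reg v = reg u then J u v else 0) + (\<Sum>w\<in>V. if reg w = reg u then 0 else J u w)"
    unfolding Jt_def sum.distrib using u finV by simp
  also have "\<dots> = (\<Sum>v\<in>V. J u v)" unfolding sum.distrib[symmetric] by (intro sum.cong) auto
  finally show "(\<Sum>v\<in>V. Jt reg u v) = 1" using J1[OF u] by simp
qed (use finV neV finC neC th0 th1 in auto)

lemma Jt_sum: "u \<in> V \<Longrightarrow> (\<Sum>v\<in>V. Jt reg u v * h v) = (\<Sum>v\<in>V. J u v * h (if reg v = reg u then v else u))"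
proof -
  assume u: "u \<in> V"
  have "(\<Sum>v\<in>V. Jt reg u v * h v) = (\<Sum>v\<in>V. (if reg v = reg u then J u v else 0) * h v)
      + (\<Sum>v\<in>V. if v = u then (\<Sum>w\<in>V. if reg w = reg u then 0 else J u w) * h v else 0)"
    unfolding Jt_def distrib_right sum.distrib by (intro arg_cong2[of _ _ _ _ "(+)"] sum.cong) auto
  also have "(\<Sum>v\<in>V. if v = u then (\<Sum>w\<in>V. if reg w = reg u then 0 else J u w) * h v else 0)
     = (\<Sum>w\<in>V. (if reg w = reg u then 0 else J u w) * h u)"
    using u finV by (simp add: sum_distrib_right)
  finally show ?thesis unfolding sum.distrib[symmetric] by (simp, intro sum.cong) auto
qed

text \<open>The two generators differ only at sites \<open>u\<close> at distance at least
  \<open>rd\<close> from \<open>A\<close>, where \<open>exp (- rd) * wt A u \<ge> 1\<close>. The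
  influence of \<open>f\<close> starts on \<open>A\<close> and has to travel there, which
  \<open>compare_dynamics\<close> prices.\<close>

lemma truncation:
  fixes reg :: "'a \<Rightarrow> 'i"
  assumes A: "A \<noteq> {}" "A \<subseteq> V" and f: "dep A f" "\<And>x. 0 \<le> f x" "\<And>x. f x \<le> 1"
    and rd: "\<And>u v. u \<in> V \<Longrightarrow> v \<in> V \<Longrightarrow> J u v \<noteq> 0 \<Longrightarrow> reg u \<noteq> reg v \<Longrightarrow> rd \<le> dst E A u" and t: "0 \<le> t"
  shows "\<bar>S t f x - nvm.S V C \<theta> (Jt reg) t f x\<bar> \<le> exp (- real rd) * exp (8 * t) * n"
proof -
  interpret N: symb V C \<theta> "Jt reg" by (rule sym_Jt)
  have b: "bf f" using f(2,3) by (intro bfI[of _ 1]) (auto simp: abs_le_iff intro: order_trans[of _ 0])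
  have Q: "\<bar>Q u g x - N.Q u g x\<bar> \<le> exp (- real rd) * (wt A u * d u)"
    if u: "u \<in> V" and d: "osc g d" for u g d x
  proof -
    have d0: "0 \<le> d u" by (rule osc_nonneg[OF d u])
    have eq: "Q u g x - N.Q u g x = (1 - \<theta>) * (\<Sum>v\<in>V. J u v * (g (x(u := x v)) - g (x(u := x (if reg v = reg u then v else u)))))"
      unfolding Q_def N.Q_def Jt_sum[OF u] by (simp add: right_diff_distrib sum_subtractf)
    show ?thesis
    proof (cases "\<exists>v\<in>V. J u v \<noteq> 0 \<and> reg u \<noteq> reg v")
      case True
      then have "rd \<le> dst E A u" using rd[OF u] by auto
      then have "exp (real rd) \<le> wt A u" using u by (simp add: wt_def)
      then have 1: "1 \<le> exp (- real rd) * wt A u" by (simp add: exp_minus field_simps)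
      have "\<bar>\<Sum>v\<in>V. J u v * (g (x(u := x v)) - g (x(u := x (if reg v = reg u then v else u))))\<bar> \<le> (\<Sum>v\<in>V. J u v * d u)"
      proof (rule order_trans[OF sum_abs sum_mono])
        fix v
        have "\<bar>g (x(u := x v)) - g (x(u := x (if reg v = reg u then v else u)))\<bar> \<le> d u"
          using oscD[OF d u, of x "x v"] d0 by auto
        then show "\<bar>J u v * (g (x(u := x v)) - g (x(u := x (if reg v = reg u then v else u))))\<bar> \<le> J u v * d u"
          unfolding abs_mult abs_of_nonneg[OF J0] by (intro mult_left_mono J0)
      qed
      also have "\<dots> = d u" using J1[OF u] by (simp add: sum_distrib_right[symmetric])
      finally have "\<bar>Q u g x - N.Q u g x\<bar> \<le> 1 * d u"
        unfolding eq abs_mult using th0 th1 by (intro mult_mono) auto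
      also have "\<dots> \<le> exp (- real rd) * wt A u * d u" by (intro mult_right_mono 1 d0)
      finally show ?thesis by (simp add: mult.assoc)
    next
      case False
      then have "(\<Sum>v\<in>V. J u v * (g (x(u := x v)) - g (x(u := x (if reg v = reg u then v else u))))) = 0"
        by (intro sum.neutral) auto
      then show ?thesis unfolding eq using d0 wt_nonneg by simp
    qed
  qed
  have "\<bar>S t f x - N.S t f x\<bar> \<le> exp (- real rd) * exp (8 * t) * (\<Sum>u\<in>V. wt A u * of_bool (u \<in> A))"
  proof (rule compare_dynamics[OF nvm_axioms N.nvm_axioms, where \<epsilon> = "exp (- real rd)" and \<omega> = "wt A" and d = "\<lambda>u. of_bool (u \<in> A)"])
    show "\<bar>Q u g x - N.Q u g x\<bar> \<le> exp (- real rd) * (wt A u * d u)" if "u \<in> V" "osc g d" for u g d x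
      by (rule Q[OF that])
    show "(\<Sum>z\<in>V. J u z * wt A z) \<le> 3 * wt A u" if "u \<in> V" for u by (rule wt_J[OF A that])
  qed (use wt_nonneg local_osc[OF f] b t in auto)
  also have "(\<Sum>u\<in>V. wt A u * of_bool (u \<in> A)) \<le> (\<Sum>u\<in>V. 1)"
    using A by (intro sum_mono) (auto simp: wt_self)
  finally show ?thesis by (simp add: mult_left_mono)
qed

text \<open>The exponent j is the number of surviving lineages needed to notice the initial law.\<close>
definition initial :: "nat \<Rightarrow> ('a \<Rightarrow> 'c) pmf \<Rightarrow> bool" where
  "initial j \<nu> \<longleftrightarrow> (j = 1 \<and> (\<exists>x\<in>V \<rightarrow>\<^sub>E C. \<nu> = return_pmf x)) \<or> (j = 2 \<and> \<nu> = pmf_of_set (V \<rightarrow>\<^sub>E C))"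

lemma initial_good: "initial j \<nu> \<Longrightarrow> goodinit V \<nu>"
  unfolding initial_def using goodinit_return goodinit_uniform[OF finV neV finC neC] by auto

lemma initial_set: "initial j \<nu> \<Longrightarrow> set_pmf \<nu> \<subseteq> V \<rightarrow>\<^sub>E C"
proof -
  have "V \<rightarrow>\<^sub>E C \<noteq> {}" using neC by (auto simp: PiE_eq_empty_iff)
  then have "set_pmf (pmf_of_set (V \<rightarrow>\<^sub>E C)) = V \<rightarrow>\<^sub>E C" using finite_configs by simp
  then show "initial j \<nu> \<Longrightarrow> set_pmf \<nu> \<subseteq> V \<rightarrow>\<^sub>E C" unfolding initial_def by (elim disjE) auto
qed

text \<open>Clusters are classes for closeness \<open>2 * rd\<close>, hence balls of radius
  \<open>rd\<close> around different clusters are disjoint. Truncation makes them autonomous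
  regions, to which \<open>product_tv\<close> applies; the error on one cluster is
  \<open>dirac_decay\<close> or \<open>uniform_decay\<close> according to \<open>j\<close>.\<close>

lemma cluster_tv:
  assumes \<nu>: "initial j \<nu>" and A: "A \<subseteq> V" and rd: "1 \<le> rd"
    and cl: "\<And>a. a \<in> A \<Longrightarrow> card ((crel E (2 * rd) A)\<^sup>* `` {a}) \<le> K"
    and f: "dep A f" "\<And>x. 0 \<le> f x" "\<And>x. f x \<le> 1" and t: "0 \<le> t" "t \<le> t'" "1 \<le> t'"
  shows "\<bar>pexp \<nu> (S t f) - pexp \<nu> (S t' f)\<bar> \<le>
     sqrt (exp (n * (real (card C) ^ K * (real K ^ j * exp (- (real j * \<theta> * t)))\<^sup>2 / (\<theta> / (real (card C) * exp 1)) ^ K)) - 1)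
     + 2 * (exp (- real rd) * exp (8 * t') * n)"
proof (cases "A = {}")
  case True
  have fin: "finite (set_pmf \<nu>)" using goodinit_finite[OF initial_good[OF \<nu>]] .
  have "f = (\<lambda>_. f undefined)" using depD[OF f(1)] True by auto
  then have "S s f = (\<lambda>_. f undefined)" for s using S_const[of s "f undefined"] by metis
  then have "pexp \<nu> (S t f) - pexp \<nu> (S t' f) = 0" by simp
  moreover have "0 < \<theta>" using th0 .
  ultimately show ?thesis using n0 by (auto intro!: add_nonneg_nonneg mult_nonneg_nonneg divide_nonneg_nonneg)
next
  case ne: False
  define cls where "cls a = (crel E (2 * rd) A)\<^sup>* `` {a}" for a
  \<comment> \<open>A union of equal sets near \<open>A\<close>; the label \<open>{}\<close>
    collects the sites outside all balls.\<close>
  define reg where "reg u = (\<Union>a\<in>{a\<in>A. u \<in> near E rd a}. cls a)" for u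
  interpret N: symb V C \<theta> "Jt reg" by (rule sym_Jt)
  have fA: "finite A" using A finV by (rule finite_subset)
  have reg: "reg u = cls a" if a: "a \<in> A" "u \<in> near E rd a" for u a
  proof -
    have "cls a' = cls a" if a': "a' \<in> A" "u \<in> near E rd a'" for a'
    proof -
      have "a' \<in> near E (rd + rd) a" by (rule near_trans[OF a(2) near_sym[OF symE a'(2)]])
      then have "(a, a') \<in> crel E (2 * rd) A" using a a' by (simp add: crel_def mult_2)
      then show ?thesis unfolding cls_def using crel_class_eq[OF symE, of a a' "2 * rd" A] by auto
    qed
    then show ?thesis unfolding reg_def using a by blast
  qed
  have self: "a \<in> cls a" for a by (simp add: cls_def)
  have clsA: "cls a \<subseteq> A" if "a \<in> A" for a unfolding cls_def by (rule crel_class_subset[OF that])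
  have cls_eq: "cls b = cls a" if "a \<in> A" "b \<in> cls a" for a b
    using crel_class_eq[OF symE, of a b "2 * rd" A] that by (simp add: cls_def)
  \<comment> \<open>A jump from distance at most \<open>rd - 1\<close> stays inside the same ball,
    so only farther sites feel the truncation.\<close>
  have bdry: "rd \<le> dst E A u" if u: "u \<in> V" "v \<in> V" "J u v \<noteq> 0" "reg u \<noteq> reg v" for u v
  proof (rule ccontr)
    assume "\<not> rd \<le> dst E A u"
    then have "dst E A u \<le> rd - 1" by simp
    then obtain a where a: "a \<in> A" "u \<in> near E (rd - 1) a" using dst_near[OF ne A u(1)] by blast
    have "v \<in> near E (rd - 1 + 1) a" by (rule near_trans[OF a(2) near_step[OF JE[OF u(1-3)]]])
    then have "v \<in> near E rd a" using rd by simp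
    moreover have "u \<in> near E rd a" using a(2) near_mono[of "rd - 1" rd E a] by auto
    ultimately show False using reg[OF a(1)] u(4) by metis
  qed
  define I where "I = cls ` A"
  have I: "finite I" "card I \<le> card V"
    using fA card_image_le[OF fA, of cls] card_mono[OF finV A] by (auto simp: I_def)
  have UA: "(\<Union>i\<in>I. i) = A" using clsA self by (auto simp: I_def)
  have b: "bf f" using f(2,3) by (intro bfI[of _ 1]) (auto simp: abs_le_iff intro: order_trans[of _ 0])
  define \<eta> where "\<eta> = real K ^ j * exp (- (real j * \<theta> * t))"
  have "\<bar>pexp \<nu> (N.S t f) - pexp \<nu> (N.S t' f)\<bar>
    \<le> sqrt (exp (real (card I) * (real (card C) ^ K * \<eta>\<^sup>2 / (\<theta> / (real (card C) * exp 1)) ^ K)) - 1)"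
  proof (rule N.product_tv[where reg = reg and A = "\<lambda>i. i"])
    show "goodinit V \<nu>" "set_pmf \<nu> \<subseteq> V \<rightarrow>\<^sub>E C" using initial_good[OF \<nu>] initial_set[OF \<nu>] by auto
    show "finite I" by (rule I)
    show "reg u = reg v" if "Jt reg u v \<noteq> 0" for u v using that by (auto simp: Jt_def split: if_splits)
    show "i \<subseteq> V" if "i \<in> I" for i using that clsA A by (auto simp: I_def)
    show "reg a = i" if i: "i \<in> I" "a \<in> i" for i a
    proof -
      obtain a0 where a0: "a0 \<in> A" "i = cls a0" using i by (auto simp: I_def)
      then have "a \<in> A" using clsA i by auto
      then have "reg a = cls a" by (rule reg) (rule near_refl)
      then show ?thesis using cls_eq[OF a0(1)] i a0 by simp
    qed
    show cK: "card i \<le> K" if "i \<in> I" for i using that cl by (auto simp: I_def cls_def)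
    show "\<bar>pexp \<nu> (N.S t (phi i y)) - pexp \<nu> (N.S t' (phi i y))\<bar> \<le> \<eta>" if i: "i \<in> I" for i y
    proof -
      have iV: "i \<subseteq> V" using i clsA A by (auto simp: I_def)
      have "\<bar>pexp \<nu> (N.S t (phi i y)) - pexp \<nu> (N.S t' (phi i y))\<bar> \<le> real (card i) ^ j * exp (- (real j * \<theta> * t))"
        using \<nu> unfolding initial_def
      proof (elim disjE conjE bexE)
        fix x assume x: "j = 1" "x \<in> V \<rightarrow>\<^sub>E C" "\<nu> = return_pmf x"
        show ?thesis using N.dirac_decay[OF iV dep_phi[of i y] phi_01 x(2) t(1,2)] x by simp
      next
        assume x: "j = 2" "\<nu> = pmf_of_set (V \<rightarrow>\<^sub>E C)"
        show ?thesis using N.uniform_decay[OF iV dep_phi[of i y] phi_01 t(1,2)] x by simp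
      qed
      also have "\<dots> \<le> \<eta>" unfolding \<eta>_def using cK[OF i] by (intro mult_right_mono power_mono) auto
      finally show ?thesis .
    qed
    show "dep (\<Union>i\<in>I. i) f" unfolding UA by (rule f)
    show "\<bar>f x\<bar> \<le> 1" for x using f(2,3)[of x] by simp
  qed (use t in auto)
  also have "\<dots> \<le> sqrt (exp (n * (real (card C) ^ K * \<eta>\<^sup>2 / (\<theta> / (real (card C) * exp 1)) ^ K)) - 1)"
    using th0 I(2)
    by (intro real_sqrt_le_mono diff_right_mono exp_le_cancel_iff[THEN iffD2] mult_right_mono
          divide_nonneg_nonneg mult_nonneg_nonneg zero_le_power) (auto simp: \<eta>_def)
  finally have 1: "\<bar>pexp \<nu> (N.S t f) - pexp \<nu> (N.S t' f)\<bar> \<le> \<dots>" .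
  have 2: "\<bar>pexp \<nu> (S s f) - pexp \<nu> (N.S s f)\<bar> \<le> exp (- real rd) * exp (8 * t') * n" if s: "0 \<le> s" "s \<le> t'" for s
  proof -
    note E = posop_ev[OF goodinit_finite[OF initial_good[OF \<nu>]]]
    have "\<bar>pexp \<nu> (\<lambda>x. S s f x - N.S s f x)\<bar> \<le> exp (- real rd) * exp (8 * s) * n"
      by (rule posop_bounded[OF E]) (rule truncation[OF ne A f bdry s(1)])
    also have "\<dots> \<le> exp (- real rd) * exp (8 * t') * n" using s n0 by (intro mult_right_mono mult_left_mono) auto
    finally show ?thesis by (simp add: posop_diff[OF E])
  qed
  show ?thesis using 1 2[of t] 2[of t'] t unfolding \<eta>_def by linarith
qed

text \<open>The symbolic outcome \<open>\<sigma>\<close> of the last period \<open>s\<close>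
  determines the set \<open>A\<close> of sites at which the earlier state still has to be known.
  Either some lineage has travelled far, or \<open>K\<close> lineages survive whose starting points
  form a chain, or the clusters of \<open>A\<close> are small and \<open>cluster_tv\<close> applies.
  The last two summands of the bound pay for the exceptional outcomes.\<close>

lemma upper_bound:
  assumes \<nu>: "initial j \<nu>" and rd: "1 \<le> rd" and K: "1 \<le> K" and M: "\<And>v. v \<in> V \<Longrightarrow> card (near E (4 * rd) v \<inter> V) \<le> M"
    and M1: "1 \<le> M" and f: "\<And>x. 0 \<le> f x" "\<And>x. f x \<le> 1" and t: "0 \<le> t" "t \<le> t'" "1 \<le> t'" and s: "0 \<le> s"
  shows "\<bar>pexp \<nu> (S (t + s) f) - pexp \<nu> (S (t' + s) f)\<bar> \<le>
     sqrt (exp (n * (real (card C) ^ K * (real K ^ j * exp (- (real j * \<theta> * t)))\<^sup>2 / (\<theta> / (real (card C) * exp 1)) ^ K)) - 1)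
     + 2 * (exp (- real rd) * exp (8 * t') * n) + n * (exp (- real rd) * exp (2 * s))
     + n * (real K * real M) ^ K * exp (- (real K * \<theta> * s))"
proof -
  define B where "B = sqrt (exp (n * (real (card C) ^ K * (real K ^ j * exp (- (real j * \<theta> * t)))\<^sup>2 / (\<theta> / (real (card C) * exp 1)) ^ K)) - 1)
     + 2 * (exp (- real rd) * exp (8 * t') * n)"
  have B0: "0 \<le> B" unfolding B_def using th0 n0
    by (auto intro!: add_nonneg_nonneg mult_nonneg_nonneg divide_nonneg_nonneg)
  have b: "bf f" using f by (intro bfI[of _ 1]) (auto simp: abs_le_iff intro: order_trans[of _ 0])
  have t'0: "0 \<le> t'" using t by simp
  obtain \<nu>1 where \<nu>1: "set_pmf \<nu>1 \<subseteq> V \<rightarrow>\<^sub>E C" "\<And>g. bf g \<Longrightarrow> pexp \<nu> (S t g) = pexp \<nu>1 g"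
    using law_exists[OF initial_set[OF \<nu>] t(1)] by blast
  obtain \<nu>2 where \<nu>2: "set_pmf \<nu>2 \<subseteq> V \<rightarrow>\<^sub>E C" "\<And>g. bf g \<Longrightarrow> pexp \<nu> (S t' g) = pexp \<nu>2 g"
    using law_exists[OF initial_set[OF \<nu>] t'0] by blast
  have fin: "finite (set_pmf \<nu>1)" "finite (set_pmf \<nu>2)" using \<nu>1(1) \<nu>2(1) finite_configs by (auto intro: finite_subset)
  have e1: "pexp \<nu> (S (t + s) f) = pexp \<nu>1 (S s f)"
    using \<nu>1(2)[OF bf_S[OF s b]] t s by (simp add: S_S[OF b] cong: pexp_cong)
  have e2: "pexp \<nu> (S (t' + s) f) = pexp \<nu>2 (S s f)"
    using \<nu>2(2)[OF bf_S[OF s b]] t'0 s by (simp add: S_S[OF b] cong: pexp_cong)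
  \<comment> \<open>For a fixed outcome \<open>\<sigma>\<close> of the last period, the difference
    between the two intermediate laws \<open>\<nu>1\<close> and \<open>\<nu>2\<close>.\<close>
  define D where "D \<sigma> = pexp \<nu>1 (\<lambda>x. f (evalc V x \<sigma>)) - pexp \<nu>2 (\<lambda>x. f (evalc V x \<sigma>))" for \<sigma>
  have range: "0 \<le> pexp \<nu> (\<lambda>x. f (evalc V x \<sigma>)) \<and> pexp \<nu> (\<lambda>x. f (evalc V x \<sigma>)) \<le> 1" if "finite (set_pmf \<nu>)" for \<nu> :: "('a \<Rightarrow> 'c) pmf" and \<sigma>
    using posop_mono[OF posop_ev[OF that], of "\<lambda>_. 0" "\<lambda>x. f (evalc V x \<sigma>)"] posop_const[OF posop_ev[OF that], of 0]
      posop_mono[OF posop_ev[OF that], of "\<lambda>x. f (evalc V x \<sigma>)" "\<lambda>_. 1"] posop_const[OF posop_ev[OF that], of 1] f by simp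
  have D1: "\<bar>D \<sigma>\<bar> \<le> 1" for \<sigma> using range[OF fin(1), of \<sigma>] range[OF fin(2), of \<sigma>] unfolding D_def by linarith
  have be: "bf (\<lambda>\<sigma>. pexp \<nu> (\<lambda>x. f (evalc V x \<sigma>)))" if "finite (set_pmf \<nu>)" for \<nu> :: "('a \<Rightarrow> 'c) pmf"
    by (rule bfI[of _ 1]) (use range[OF that] in \<open>auto simp: abs_le_iff intro: order_trans[of _ 0]\<close>)
  have main: "pexp \<nu> (S (t + s) f) - pexp \<nu> (S (t' + s) f) = Y.S s D Inl"
    unfolding e1 e2 using pexp_S_evalc[OF \<nu>1(1) b, of s] pexp_S_evalc[OF \<nu>2(1) b, of s] unfolding D_def
    by (simp add: Y.S_diff be fin)
  \<comment> \<open>The union runs over starting points rather than ancestors, because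
    \<open>S_alive\<close> bounds the survival of prescribed starting sites.\<close>
  define L where "L = {ws. chain E (4 * rd) ws \<and> length ws = K \<and> set ws \<subseteq> V}"
  have L: "finite L" "card L \<le> card V * (K * M) ^ K"
  proof -
    have "finite L \<and> card L \<le> card V * (K * M) ^ (K - 1)"
      using chain_count[OF finV M, of K] chain_count[OF finV M, of "K - 1"] K by (simp add: L_def)
    moreover have "(K * M) ^ (K - 1) \<le> (K * M) ^ K" using K M1 by (intro power_increasing) auto
    ultimately show "finite L" "card L \<le> card V * (K * M) ^ K" by (auto intro: order_trans mult_left_mono)
  qed
  define G where "G \<sigma> = B + ((\<Sum>v\<in>V. exp (- real rd) * anc (wt {v}) v \<sigma>) + (\<Sum>ws\<in>L. alive (set ws) \<sigma>))" for \<sigma>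
  have anc0: "0 \<le> anc (wt {v}) v \<sigma>" for v \<sigma> by (auto simp: anc_def wt_nonneg split: sum.splits)
  have DG: "\<bar>D \<sigma>\<bar> \<le> G \<sigma>" for \<sigma>
  proof -
    have s1: "0 \<le> (\<Sum>v\<in>V. exp (- real rd) * anc (wt {v}) v \<sigma>)" by (intro sum_nonneg mult_nonneg_nonneg anc0) auto
    have s2: "0 \<le> (\<Sum>ws\<in>L. alive (set ws) \<sigma>)" by (intro sum_nonneg alive_01)
    show ?thesis
    proof (cases "\<exists>v\<in>V. \<exists>w\<in>V. \<sigma> v = Inl w \<and> w \<notin> near E rd v")
      case True
      then obtain v w where v: "v \<in> V" "w \<in> V" "\<sigma> v = Inl w" "w \<notin> near E rd v" by blast
      have "rd \<le> dst E {v} w"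
      proof (rule ccontr)
        assume "\<not> rd \<le> dst E {v} w"
        then show False using dst_near[of "{v}" w rd] v by auto
      qed
      then have "1 \<le> exp (- real rd) * anc (wt {v}) v \<sigma>" using v by (simp add: anc_def wt_def mult_exp_exp)
      also have "\<dots> \<le> (\<Sum>v\<in>V. exp (- real rd) * anc (wt {v}) v \<sigma>)"
        using v(1) finV anc0 by (intro member_le_sum[of v V "\<lambda>v. exp (- real rd) * anc (wt {v}) v \<sigma>"]) auto
      finally show ?thesis using D1[of \<sigma>] B0 s2 by (simp add: G_def)
    next
      case far: False
      define A where "A = {w\<in>V. \<exists>v\<in>V. \<sigma> v = Inl w}"
      have A: "A \<subseteq> V" by (auto simp: A_def)
      have fA: "finite A" using A finV by (rule finite_subset)
      show ?thesis
      proof (cases "\<exists>a\<in>A. K < card ((crel E (2 * rd) A)\<^sup>* `` {a})")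
        case True
        then obtain a where a: "a \<in> A" "K \<le> card ((crel E (2 * rd) A)\<^sup>* `` {a})" by auto
        then obtain ws where ws: "chain E (2 * rd) ws" "set ws \<subseteq> (crel E (2 * rd) A)\<^sup>* `` {a}" "length ws = K"
          using class_chain[OF fA a] by (elim exE conjE)
        then have wsA: "set ws \<subseteq> A" using crel_class_subset[OF a(1)] by blast
        \<comment> \<open>A site whose lineage ends in \<open>w\<close>; distinct ancestors have
          distinct starting points.\<close>
        define p where "p w = (SOME v. v \<in> V \<and> \<sigma> v = Inl w)" for w
        have p: "p w \<in> V \<and> \<sigma> (p w) = Inl w" if "w \<in> A" for w
        proof -
          have "\<exists>v. v \<in> V \<and> \<sigma> v = Inl w" using that by (simp add: A_def) blast
          then show ?thesis unfolding p_def by (rule someI_ex)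
        qed
        have pn: "p w \<in> near E (4 * rd) (p w')" if w: "w \<in> A" "w' \<in> A" "w \<in> near E (2 * rd) w'" for w w'
        proof -
          have wV: "w \<in> V" "w' \<in> V" using w A by auto
          have n1: "w' \<in> near E rd (p w')" using far p[OF w(2)] wV(2) by metis
          have n2: "w \<in> near E rd (p w)" using far p[OF w(1)] wV(1) by metis
          \<comment> \<open>Both lineages travelled at most \<open>rd\<close> and their ends are
            within \<open>2 * rd\<close>, whence chains of step \<open>4 * rd\<close>.\<close>
          have "p w \<in> near E (rd + 2 * rd + rd) (p w')"
            by (rule near_trans[OF near_trans[OF n1 w(3)] near_sym[OF symE n2]])
          then show ?thesis by (simp add: mult_2 numeral_eq_Suc ac_simps)
        qed
        have "chain E (4 * rd) (map p ws)" using ws(1) wsA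
        proof (induction ws)
          case (Cons w ws)
          have "p w \<noteq> p w'" if "w' \<in> set ws" for w'
            using p[of w] p[of w'] Cons.prems that by auto
          then have "p w \<notin> set (map p ws)" by auto
          moreover have "map p ws = [] \<or> (\<exists>v'\<in>set (map p ws). p w \<in> near E (4 * rd) v')"
          proof (cases "ws = []")
            case False
            then obtain w' where "w' \<in> set ws" "w \<in> near E (2 * rd) w'" using Cons.prems by auto
            then have "p w \<in> near E (4 * rd) (p w')" using Cons.prems by (intro pn) auto
            then show ?thesis using \<open>w' \<in> set ws\<close> by auto
          qed simp
          moreover have "chain E (4 * rd) (map p ws)" using Cons by simp
          ultimately show ?case by simp
        qed simp
        moreover have "set (map p ws) \<subseteq> V"
        proof
          fix v assume "v \<in> set (map p ws)"
          then obtain w where "w \<in> set ws" "v = p w" by auto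
          then show "v \<in> V" using p[of w] wsA by blast
        qed
        ultimately have inL: "map p ws \<in> L" using ws(3) by (simp add: L_def)
        have "inj_on \<sigma> (p ` set ws)"
        proof (rule inj_onI)
          fix v v' assume v: "v \<in> p ` set ws" "v' \<in> p ` set ws" "\<sigma> v = \<sigma> v'"
          then obtain w w' where w: "w \<in> set ws" "v = p w" "w' \<in> set ws" "v' = p w'" by blast
          then have "w \<in> A" "w' \<in> A" using wsA by auto
          then show "v = v'" using p[of w] p[of w'] v(3) w by simp
        qed
        moreover have "\<sigma> ` p ` set ws \<subseteq> range Inl"
        proof
          fix z assume "z \<in> \<sigma> ` p ` set ws"
          then obtain w where "w \<in> set ws" "z = \<sigma> (p w)" by auto
          then show "z \<in> range Inl" using p[of w] wsA by auto
        qed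
        ultimately have "1 \<le> alive (set (map p ws)) \<sigma>" by (simp add: alive_def)
        also have "\<dots> \<le> (\<Sum>ws\<in>L. alive (set ws) \<sigma>)"
          using inL L(1) by (intro member_le_sum[of "map p ws" L "\<lambda>ws. alive (set ws) \<sigma>"] alive_01) auto
        finally show ?thesis using D1[of \<sigma>] B0 s1 by (simp add: G_def)
      next
        case False
        then have cl: "card ((crel E (2 * rd) A)\<^sup>* `` {a}) \<le> K" if "a \<in> A" for a using that by (meson not_less)
        \<comment> \<open>Outside \<open>A\<close> the state is replaced by a default, which
          \<open>f\<close> cannot see as no lineage ends there; this makes \<open>g\<close>
          local.\<close>
        define g where "g x = f (evalc V (restrict x A) \<sigma>)" for x
        have g: "dep A g" unfolding dep_def g_def by (intro allI impI arg_cong[of _ _ "\<lambda>z. f (evalc V z \<sigma>)"] restrict_ext) auto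
        have g01: "0 \<le> g x" "g x \<le> 1" for x using f by (auto simp: g_def)
        have bg: "bf g" using b by (auto simp: bf_def g_def)
        have fg: "f (evalc V x \<sigma>) = g x" if x: "x \<in> V \<rightarrow>\<^sub>E C" for x
        proof -
          have "evalc V x \<sigma> = evalc V (restrict x A) \<sigma>"
          proof
            fix v
            have "x w = restrict x A w" if "v \<in> V" "\<sigma> v = Inl w" for w
              using that PiE_arb[OF x, of w] by (cases "w \<in> V") (auto simp: A_def)
            then show "evalc V x \<sigma> v = evalc V (restrict x A) \<sigma> v"
              by (cases "\<sigma> v") (auto simp: evalc_def)
          qed
          then show ?thesis by (simp add: g_def)
        qed
        have "D \<sigma> = pexp \<nu>1 g - pexp \<nu>2 g"
          unfolding D_def using \<nu>1(1) \<nu>2(1) fg by (intro arg_cong2[of _ _ _ _ "(-)"] pexp_cong) auto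
        also have "\<dots> = pexp \<nu> (S t g) - pexp \<nu> (S t' g)" by (simp add: \<nu>1(2) \<nu>2(2) bg)
        finally have "\<bar>D \<sigma>\<bar> \<le> B" unfolding B_def using cluster_tv[OF \<nu> A rd cl g g01 t] by simp
        then show ?thesis using s1 s2 by (simp add: G_def)
      qed
    qed
  qed
  have bG: "bf (\<lambda>\<sigma>. exp (- real rd) * anc (wt {v}) v \<sigma>)" for v by (intro bf_mult bf_const bf_anc bf_wt)
  have bG1: "bf (\<lambda>\<sigma>. \<Sum>v\<in>V. exp (- real rd) * anc (wt {v}) v \<sigma>)" by (intro bf_sum bG)
  have bG2: "bf (\<lambda>\<sigma>. \<Sum>ws\<in>L. alive (set ws) \<sigma>)" by (intro bf_sum bf_alive)
  have "\<bar>Y.S s D Inl\<bar> \<le> Y.S s G Inl"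
    using DG unfolding G_def by (intro Y.S_abs s bf_add bf_const bG1 bG2)
  also have "\<dots> = B + ((\<Sum>v\<in>V. exp (- real rd) * Y.S s (anc (wt {v}) v) Inl) + (\<Sum>ws\<in>L. Y.S s (alive (set ws)) Inl))"
    unfolding G_def
    by (subst Y.S_add[OF bf_const bf_add[OF bG1 bG2]], subst Y.S_add[OF bG1 bG2])
       (simp add: Y.S_sum bG Y.S_cmult bf_anc bf_wt)
  also have "\<dots> \<le> B + ((\<Sum>v\<in>V. exp (- real rd) * exp (2 * s)) + (\<Sum>ws\<in>L. exp (- (real K * \<theta> * s))))"
  proof (intro add_left_mono add_mono sum_mono mult_left_mono)
    fix v assume v: "v \<in> V"
    have "Y.S s (anc (wt {v}) v) Inl \<le> exp (2 * s) * wt {v} v"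
      using v by (intro S_anc wt_J wt_nonneg bf_wt s) auto
    then show "Y.S s (anc (wt {v}) v) Inl \<le> exp (2 * s)" using wt_self[of v "{v}"] v by simp
  next
    fix ws assume ws: "ws \<in> L"
    then have "chain E (4 * rd) ws" "length ws = K" by (simp_all add: L_def)
    then have "card (set ws) = K" using distinct_card[OF chain_distinct] by metis
    then show "Y.S s (alive (set ws)) Inl \<le> exp (- (real K * \<theta> * s))"
      using S_alive[of "set ws" s Inl] ws s by (simp add: L_def)
  qed auto
  also have "\<dots> = B + (n * (exp (- real rd) * exp (2 * s)) + real (card L) * exp (- (real K * \<theta> * s)))" by simp
  also have "\<dots> \<le> B + (n * (exp (- real rd) * exp (2 * s)) + (n * (real K * real M) ^ K) * exp (- (real K * \<theta> * s)))"
  proof (intro add_left_mono mult_right_mono)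
    have "real (card L) \<le> real (card V * (K * M) ^ K)" using L(2) of_nat_le_iff by blast
    then show "real (card L) \<le> n * (real K * real M) ^ K" by simp
  qed auto
  finally show ?thesis unfolding main B_def by simp
qed

end

section \<open>Two differential inequalities\<close>

text \<open>The negative part is not differentiable at 0; its square is, with derivative 0
  there.\<close>

lemma negpart_square_deriv: "((\<lambda>x::real. (min x 0)\<^sup>2) has_real_derivative 2 * min x 0) (at x)"
proof (cases x "0::real" rule: linorder_cases)
  case less
  have "((\<lambda>x::real. x\<^sup>2) has_real_derivative 2 * min x 0) (at x)"
    using less by (auto intro!: derivative_eq_intros)
  then show ?thesis
    by (rule has_field_derivative_transform_within_open[of _ _ _ "{..<0}"]) (use less in auto)
next
  case equal
  have "(\<lambda>h::real. ((min h 0)\<^sup>2) / h) \<midarrow>0\<rightarrow> 0"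
  proof (rule Lim_null_comparison[of _ "\<lambda>h. \<bar>h\<bar>"])
    show "\<forall>\<^sub>F h::real in at 0. norm ((min h 0)\<^sup>2 / h) \<le> \<bar>h\<bar>"
      by (intro always_eventually allI) (auto simp: min_def power2_eq_square abs_mult)
    show "(\<lambda>h::real. \<bar>h\<bar>) \<midarrow>0\<rightarrow> 0" using tendsto_rabs_zero[OF tendsto_ident_at] by simp
  qed
  then show ?thesis using equal by (simp add: DERIV_def)
next
  case greater
  have "((\<lambda>x::real. 0) has_real_derivative 2 * min x 0) (at x)" using greater by simp
  then show ?thesis
    by (rule has_field_derivative_transform_within_open[of _ _ _ "{0<..}"]) (use greater in auto)
qed

text \<open>A maximum principle, proved by showing that the squared negative part grows at most exponentially.\<close>
lemma ode_nonneg: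
  fixes y y' :: "'i \<Rightarrow> real \<Rightarrow> real"
  assumes I: "finite I" and N: "\<And>i j. i \<in> I \<Longrightarrow> j \<in> I \<Longrightarrow> 0 \<le> N i j" and c: "0 \<le> c"
    and D: "\<And>i t. i \<in> I \<Longrightarrow> (y i has_real_derivative y' i t) (at t)"
    and ge: "\<And>i t. i \<in> I \<Longrightarrow> 0 \<le> t \<Longrightarrow> 0 \<le> y i t \<or> (\<Sum>j\<in>I. N i j * y j t) - c * y i t \<le> y' i t"
    and init: "\<And>i. i \<in> I \<Longrightarrow> 0 \<le> y i 0" and t: "0 \<le> t" and i: "i \<in> I"
  shows "0 \<le> y i t"
proof -
  define m where "m i t = min (y i t) 0" for i t
  define Z where "Z t = (\<Sum>i\<in>I. (m i t)\<^sup>2)" for t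
  define Z' where "Z' t = (\<Sum>i\<in>I. 2 * m i t * y' i t)" for t
  define K where "K = 2 * (\<Sum>i\<in>I. \<Sum>j\<in>I. N i j)"
  have dm: "((\<lambda>t. (m i t)\<^sup>2) has_real_derivative 2 * m i t * y' i t) (at t)" if "i \<in> I" for i t
    unfolding m_def using DERIV_chain2[OF negpart_square_deriv D[OF that]] .
  have dZ: "(Z has_real_derivative Z' t) (at t)" for t
    unfolding Z_def[abs_def] Z'_def by (rule DERIV_sum) (rule dm)
  have Z'le: "Z' t \<le> K * Z t" if t: "0 \<le> t" for t
  proof -
    have m2: "(m i t)\<^sup>2 \<le> Z t" if "i \<in> I" for i
      unfolding Z_def using I that by (intro member_le_sum[of i I "\<lambda>i. (m i t)\<^sup>2"]) auto
    have tle: "2 * m i t * y' i t \<le> 2 * (\<Sum>j\<in>I. N i j) * Z t" if i: "i \<in> I" for i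
    proof (cases "0 \<le> y i t")
      case True
      then have "m i t = 0" by (simp add: m_def)
      then show ?thesis using N i
        by (auto intro!: mult_nonneg_nonneg sum_nonneg simp: Z_def)
    next
      case False
      then have m0: "m i t = y i t" "m i t \<le> 0" by (auto simp: m_def)
      have "m i t * y' i t \<le> m i t * ((\<Sum>j\<in>I. N i j * y j t) - c * y i t)"
        using ge[OF i t] False m0 by (intro mult_left_mono_neg) auto
      also have "\<dots> = (\<Sum>j\<in>I. N i j * (m i t * y j t)) - c * (m i t)\<^sup>2"
        using m0 by (simp add: right_diff_distrib sum_distrib_left power2_eq_square mult_ac)
      \<comment> \<open>Where \<open>y i\<close> is negative the damping \<open>- c * y i\<close>
        pushes it upwards, so it may be dropped.\<close>
      also have "\<dots> \<le> (\<Sum>j\<in>I. N i j * (m i t * y j t))" using c by simp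
      also have "\<dots> \<le> (\<Sum>j\<in>I. N i j * Z t)"
      proof (intro sum_mono mult_left_mono N i)
        fix j assume j: "j \<in> I"
        have "m i t * y j t \<le> m i t * m j t" using m0 by (intro mult_left_mono_neg) (auto simp: m_def)
        also have "\<dots> \<le> ((m i t)\<^sup>2 + (m j t)\<^sup>2) / 2" using sum_squares_bound[of "m i t" "m j t"] by simp
        also have "\<dots> \<le> Z t" using m2[OF i] m2[OF j] by simp
        finally show "m i t * y j t \<le> Z t" .
      qed auto
      finally show ?thesis by (simp add: sum_distrib_right)
    qed
    have "Z' t \<le> (\<Sum>i\<in>I. 2 * (\<Sum>j\<in>I. N i j) * Z t)" unfolding Z'_def by (intro sum_mono tle)
    also have "\<dots> = K * Z t" by (simp add: K_def sum_distrib_left sum_distrib_right)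
    finally show ?thesis .
  qed
  have "exp (- K * t) * Z t \<le> exp (- K * 0) * Z 0"
  proof (rule DERIV_nonpos_imp_nonincreasing[OF t])
    fix s assume s: "0 \<le> s" "s \<le> t"
    have "((\<lambda>t. exp (- K * t) * Z t) has_real_derivative exp (- K * s) * (Z' s - K * Z s)) (at s)"
      by (rule derivative_eq_intros dZ refl | simp)+ (simp add: algebra_simps)
    moreover have "exp (- K * s) * (Z' s - K * Z s) \<le> 0"
      using Z'le[OF s(1)] by (intro mult_nonneg_nonpos) auto
    ultimately show "\<exists>d. ((\<lambda>t. exp (- K * t) * Z t) has_real_derivative d) (at s) \<and> d \<le> 0" by blast
  qed
  moreover have "Z 0 = 0" unfolding Z_def using init by (intro sum.neutral) (auto simp: m_def)
  ultimately have "exp (- K * t) * Z t \<le> 0" by simp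
  then have "Z t \<le> 0" using exp_gt_zero[of "- K * t"] by (simp add: mult_le_0_iff)
  moreover have "(m i t)\<^sup>2 \<le> Z t" unfolding Z_def using I i by (intro member_le_sum[of i I "\<lambda>i. (m i t)\<^sup>2"]) auto
  ultimately have "(m i t)\<^sup>2 \<le> 0" by linarith
  then have "m i t = 0" by simp
  then show ?thesis by (simp add: m_def min_def split: if_splits)
qed

text \<open>The symmetric part of the flow contributes ratios \<open>r + 1 / r \<ge> 2\<close> to the mean logarithm, hence does no harm.\<close>
lemma log_energy:
  fixes D D' :: "'i \<Rightarrow> real \<Rightarrow> real" and a :: "'i \<Rightarrow> 'i \<Rightarrow> real"
  assumes P: "finite P" "P \<noteq> {}" and w: "\<And>x. x \<in> P \<Longrightarrow> 0 < w x"
    and a: "\<And>x y. x \<in> P \<Longrightarrow> y \<in> P \<Longrightarrow> 0 \<le> a x y" "\<And>x y. x \<in> P \<Longrightarrow> y \<in> P \<Longrightarrow> a x y = a y x"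
    and d: "\<And>x t. x \<in> P \<Longrightarrow> (D x has_real_derivative D' x t) (at t)"
    and pos: "\<And>x t. x \<in> P \<Longrightarrow> 0 \<le> t \<Longrightarrow> 0 < D x t"
    and ge: "\<And>x t. x \<in> P \<Longrightarrow> 0 \<le> t \<Longrightarrow> (\<Sum>y\<in>P. a x y * D y t) - c * w x * D x t \<le> w x * D' x t"
    and h: "\<And>x. x \<in> P \<Longrightarrow> h \<le> D x 0" "0 < h" and t: "0 \<le> t"
    and \<rho>: "c * (\<Sum>x\<in>P. w x) - (\<Sum>x\<in>P. \<Sum>y\<in>P. a x y) \<le> \<rho> * (\<Sum>x\<in>P. w x)"
  shows "(\<Sum>x\<in>P. w x) * (h * exp (- (\<rho> * t))) \<le> (\<Sum>x\<in>P. w x * D x t)"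
proof -
  define W where "W = (\<Sum>x\<in>P. w x)"
  have W: "0 < W" unfolding W_def using P w by (intro sum_pos)
  define F where "F t = (\<Sum>x\<in>P. w x * ln (D x t)) + \<rho> * W * t" for t
  have "F 0 \<le> F t"
  proof (rule DERIV_nonneg_imp_nondecreasing[OF t])
    fix s assume s: "0 \<le> s" "s \<le> t"
    have dF: "(F has_real_derivative (\<Sum>x\<in>P. w x * (D' x s / D x s)) + \<rho> * W) (at s)"
      unfolding F_def[abs_def]
    proof (intro DERIV_add DERIV_sum)
      show "((\<lambda>t. w x * ln (D x t)) has_real_derivative w x * (D' x s / D x s)) (at s)" if x: "x \<in> P" for x
        using DERIV_chain2[OF DERIV_ln_divide[OF pos[OF x s(1)]] d[OF x]]
        by (intro DERIV_cmult) (simp add: field_simps)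
      show "((\<lambda>t. \<rho> * W * t) has_real_derivative \<rho> * W) (at s)"
        by (auto intro!: derivative_eq_intros)
    qed
    \<comment> \<open>Exchanging \<open>x\<close> and \<open>y\<close> and averaging, by symmetry of
      \<open>a\<close>, leads to sums of a ratio and its inverse.\<close>
    have sym: "(\<Sum>x\<in>P. \<Sum>y\<in>P. a x y) \<le> (\<Sum>x\<in>P. \<Sum>y\<in>P. a x y * (D y s / D x s))"
    proof -
      have "(\<Sum>x\<in>P. \<Sum>y\<in>P. a x y * (D x s / D y s)) = (\<Sum>x\<in>P. \<Sum>y\<in>P. a x y * (D y s / D x s))"
        by (subst sum.swap) (use a(2) in \<open>auto intro!: sum.cong\<close>)
      then have e: "2 * (\<Sum>x\<in>P. \<Sum>y\<in>P. a x y * (D y s / D x s))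
         = (\<Sum>x\<in>P. \<Sum>y\<in>P. a x y * (D y s / D x s + D x s / D y s))"
        by (simp add: distrib_left sum.distrib)

      have "(\<Sum>x\<in>P. \<Sum>y\<in>P. a x y * 2) \<le> (\<Sum>x\<in>P. \<Sum>y\<in>P. a x y * (D y s / D x s + D x s / D y s))"
      proof (intro sum_mono mult_left_mono a)
        fix x y assume xy: "x \<in> P" "y \<in> P"
        have p: "0 < D x s" "0 < D y s" using pos xy s by auto
        have "0 \<le> (D x s - D y s)\<^sup>2" by simp
        then have "2 * (D x s * D y s) \<le> D y s * D y s + D x s * D x s"
          by (simp add: power2_eq_square algebra_simps)
        then show "2 \<le> D y s / D x s + D x s / D y s" using p by (simp add: field_simps)
      qed auto
      then show ?thesis unfolding e[symmetric] by (simp add: sum_distrib_right[symmetric])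
    qed
    have "(\<Sum>x\<in>P. (\<Sum>y\<in>P. a x y * (D y s / D x s)) - c * w x) \<le> (\<Sum>x\<in>P. w x * (D' x s / D x s))"
    proof (intro sum_mono)
      fix x assume x: "x \<in> P"
      have p: "0 < D x s" using pos x s by auto
      have "((\<Sum>y\<in>P. a x y * D y s) - c * w x * D x s) / D x s \<le> w x * D' x s / D x s"
        using ge[OF x s(1)] p by (intro divide_right_mono) auto
      then show "(\<Sum>y\<in>P. a x y * (D y s / D x s)) - c * w x \<le> w x * (D' x s / D x s)"
        using p by (simp add: diff_divide_distrib sum_divide_distrib)
    qed
    then have "(\<Sum>x\<in>P. \<Sum>y\<in>P. a x y) - c * W \<le> (\<Sum>x\<in>P. w x * (D' x s / D x s))"
      using sym by (simp add: sum_subtractf sum_distrib_left W_def)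
    then have "0 \<le> (\<Sum>x\<in>P. w x * (D' x s / D x s)) + \<rho> * W" using \<rho> by (simp add: W_def)
    then show "\<exists>d. (F has_real_derivative d) (at s) \<and> 0 \<le> d" using dF by blast
  qed
  moreover have "(\<Sum>x\<in>P. w x * ln h) \<le> F 0"
  proof -
    have "(\<Sum>x\<in>P. w x * ln h) \<le> (\<Sum>x\<in>P. w x * ln (D x 0))"
    proof (intro sum_mono mult_left_mono)
      fix x assume x: "x \<in> P"
      show "ln h \<le> ln (D x 0)" using h(1)[OF x] h(2) by simp
      show "0 \<le> w x" using w[OF x] by simp
    qed
    then show ?thesis by (simp add: F_def)
  qed
  ultimately have 1: "W * ln h - \<rho> * W * t \<le> (\<Sum>x\<in>P. w x * ln (D x t))"
    by (simp add: F_def W_def sum_distrib_right)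
  \<comment> \<open>Jensen's inequality in tangent form: \<open>exp\<close> lies above its tangent
    at the lower bound \<open>l\<close> of the mean logarithm.\<close>
  define l where "l = ln h - \<rho> * t"
  have el: "exp l = h * exp (- (\<rho> * t))" using h by (simp add: l_def exp_diff exp_minus field_simps)
  have "(\<Sum>x\<in>P. w x * (exp l * (1 + (ln (D x t) - l)))) \<le> (\<Sum>x\<in>P. w x * D x t)"
  proof (intro sum_mono mult_left_mono)
    fix x assume x: "x \<in> P"
    have p: "0 < D x t" using pos x t by auto
    have "exp l * (1 + (ln (D x t) - l)) \<le> exp l * exp (ln (D x t) - l)" by (intro mult_left_mono exp_ge_add_one_self) auto
    also have "\<dots> = D x t" using p by (simp add: mult_exp_exp)
    finally show "exp l * (1 + (ln (D x t) - l)) \<le> D x t" .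
  qed (use w in \<open>auto intro: less_imp_le\<close>)
  also have "(\<Sum>x\<in>P. w x * (exp l * (1 + (ln (D x t) - l)))) = exp l * (W + ((\<Sum>x\<in>P. w x * ln (D x t)) - W * l))"
    by (simp add: W_def sum_distrib_left sum_distrib_right sum.distrib sum_subtractf algebra_simps)
  finally have "exp l * (W + ((\<Sum>x\<in>P. w x * ln (D x t)) - W * l)) \<le> (\<Sum>x\<in>P. w x * D x t)" .
  moreover have "exp l * (W + 0) \<le> exp l * (W + ((\<Sum>x\<in>P. w x * ln (D x t)) - W * l))"
    using 1 by (intro mult_left_mono add_left_mono) (auto simp: l_def algebra_simps)
  ultimately have "exp l * (W + 0) \<le> (\<Sum>x\<in>P. w x * D x t)" by (rule order_trans[rotated])
  then show ?thesis unfolding el W_def by (simp add: mult.commute)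
qed

section \<open>Distinguishing statistics\<close>

text \<open>The test is the threshold halfway between the two means; each error probability is at
  most the variance over a quarter of the squared gap.\<close>

lemma chebyshev_tv:
  assumes fin: "finite (set_pmf \<nu>)" "finite (set_pmf \<mu>)" and gap: "pexp \<mu> F < pexp \<nu> F"
    and v: "pexp \<nu> (\<lambda>x. (F x)\<^sup>2) - (pexp \<nu> F)\<^sup>2 \<le> v1" "pexp \<mu> (\<lambda>x. (F x)\<^sup>2) - (pexp \<mu> F)\<^sup>2 \<le> v2"
  shows "\<exists>P. 1 - 4 * (v1 + v2) / (pexp \<nu> F - pexp \<mu> F)\<^sup>2 \<le> pexp \<nu> (\<lambda>x. of_bool (x \<in> P)) - pexp \<mu> (\<lambda>x. of_bool (x \<in> P))"
proof -
  define a where "a = pexp \<nu> F"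
  define b where "b = pexp \<mu> F"
  define g where "g = a - b"
  have g: "0 < g" using gap by (simp add: g_def a_def b_def)
  define P where "P = {x. (a + b) / 2 \<le> F x}"
  have sq: "pexp \<kappa> (\<lambda>x. (F x - m)\<^sup>2) = pexp \<kappa> (\<lambda>x. (F x)\<^sup>2) - m\<^sup>2" if "finite (set_pmf \<kappa>)" "m = pexp \<kappa> F" for \<kappa> m
  proof -
    note E = posop_ev[OF that(1)]
    have "pexp \<kappa> (\<lambda>x. (F x - m)\<^sup>2) = pexp \<kappa> (\<lambda>x. (F x)\<^sup>2 + ((- 2 * m) * F x + m\<^sup>2))"
      by (intro pexp_cong) (simp add: power2_eq_square algebra_simps)
    also have "\<dots> = pexp \<kappa> (\<lambda>x. (F x)\<^sup>2) + ((- 2 * m) * pexp \<kappa> F + m\<^sup>2)"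
      by (subst posop_add[OF E], subst posop_add[OF E], subst posop_cmult[OF E], subst posop_const[OF E]) simp
    finally show ?thesis using that(2) by (simp add: power2_eq_square)
  qed
  have key: "1 \<le> 4 / g\<^sup>2 * y\<^sup>2" if "g / 2 \<le> \<bar>y\<bar>" for y
  proof -
    have "(g / 2)\<^sup>2 \<le> y\<^sup>2" using that g by (metis abs_ge_zero divide_nonneg_nonneg less_imp_le power2_abs power_mono zero_le_numeral)
    then show ?thesis using g by (simp add: power_divide field_simps)
  qed
  have 1: "1 - 4 / g\<^sup>2 * v1 \<le> pexp \<nu> (\<lambda>x. of_bool (x \<in> P))"
  proof -
    note E = posop_ev[OF fin(1)]
    have "pexp \<nu> (\<lambda>x. 1 - 4 / g\<^sup>2 * (F x - a)\<^sup>2) \<le> pexp \<nu> (\<lambda>x. of_bool (x \<in> P))"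
    proof (intro pexp_mono)
      fix x
      show "1 - 4 / g\<^sup>2 * (F x - a)\<^sup>2 \<le> of_bool (x \<in> P)"
      proof (cases "x \<in> P")
        case True then show ?thesis by simp
      next
        case False
        then have "F x < (a + b) / 2" by (simp add: P_def)
        then have "g / 2 \<le> a - F x" by (simp add: g_def field_simps)
        then have "g / 2 \<le> \<bar>F x - a\<bar>" by linarith
        then show ?thesis using key False by simp
      qed
    qed
    also have "pexp \<nu> (\<lambda>x. 1 - 4 / g\<^sup>2 * (F x - a)\<^sup>2) = 1 - 4 / g\<^sup>2 * pexp \<nu> (\<lambda>x. (F x - a)\<^sup>2)"
      by (subst posop_diff[OF E], subst posop_cmult[OF E], subst posop_const[OF E]) simp
    finally have "1 - 4 / g\<^sup>2 * pexp \<nu> (\<lambda>x. (F x - a)\<^sup>2) \<le> pexp \<nu> (\<lambda>x. of_bool (x \<in> P))" .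
    moreover have "4 / g\<^sup>2 * pexp \<nu> (\<lambda>x. (F x - a)\<^sup>2) \<le> 4 / g\<^sup>2 * v1"
      using v(1) sq[OF fin(1) a_def] by (intro mult_left_mono) (auto simp: a_def)
    ultimately show ?thesis by linarith
  qed
  have 2: "pexp \<mu> (\<lambda>x. of_bool (x \<in> P)) \<le> 4 / g\<^sup>2 * v2"
  proof -
    note E = posop_ev[OF fin(2)]
    have "pexp \<mu> (\<lambda>x. of_bool (x \<in> P)) \<le> pexp \<mu> (\<lambda>x. 4 / g\<^sup>2 * (F x - b)\<^sup>2)"
    proof (intro pexp_mono)
      fix x
      show "of_bool (x \<in> P) \<le> 4 / g\<^sup>2 * (F x - b)\<^sup>2"
      proof (cases "x \<in> P")
        case True
        then have "(a + b) / 2 \<le> F x" by (simp add: P_def)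
        then have "g / 2 \<le> F x - b" by (simp add: g_def field_simps)
        then have "g / 2 \<le> \<bar>F x - b\<bar>" by linarith
        then show ?thesis using key True by simp
      qed simp
    qed
    also have "\<dots> = 4 / g\<^sup>2 * pexp \<mu> (\<lambda>x. (F x - b)\<^sup>2)" by (rule posop_cmult[OF E])
    also have "\<dots> \<le> 4 / g\<^sup>2 * v2" using v(2) sq[OF fin(2) b_def] by (intro mult_left_mono) (auto simp: b_def)
    finally show ?thesis .
  qed
  have "1 - 4 * (v1 + v2) / g\<^sup>2 \<le> pexp \<nu> (\<lambda>x. of_bool (x \<in> P)) - pexp \<mu> (\<lambda>x. of_bool (x \<in> P))"
    using 1 2 by (simp add: add_divide_distrib distrib_left)
  then show ?thesis unfolding g_def a_def b_def by blast
qed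

text \<open>Simple random walk on \<open>E\<close>: \<open>g\<close> is the degree and serves as the
  reversing measure, \<open>G\<close> bounds it. \<open>\<mu>\<close> is a law invariant under one
  ring.\<close>

locale rgsym = gsym V C \<theta> J E for V :: "'a set" and C :: "'c set" and \<theta> J E +
  fixes g :: "'a \<Rightarrow> real" and G :: real and \<mu> :: "('a \<Rightarrow> 'c) pmf"
  assumes g1: "\<And>u. u \<in> V \<Longrightarrow> 1 \<le> g u" and gG: "\<And>u. u \<in> V \<Longrightarrow> g u \<le> G"
    and Jg: "\<And>u v. u \<in> V \<Longrightarrow> v \<in> V \<Longrightarrow> J u v = (if (u, v) \<in> E then 1 / g u else 0)"
    and irr: "\<And>u. (u, u) \<notin> E"
    and \<mu>V: "set_pmf \<mu> \<subseteq> V \<rightarrow>\<^sub>E C" and \<mu>T: "\<And>f. bf f \<Longrightarrow> pexp \<mu> (T f) = pexp \<mu> f"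
begin

abbreviation "q \<equiv> real (card C)"

lemma g0: "u \<in> V \<Longrightarrow> 0 < g u" using g1[of u] by simp

lemma G1: "1 \<le> G"
proof -
  obtain v where v: "v \<in> V" using neV by auto
  show ?thesis using g1[OF v] gG[OF v] by linarith
qed

lemma rev: "u \<in> V \<Longrightarrow> v \<in> V \<Longrightarrow> g u * J u v = g v * J v u"
  using symE g0[of u] g0[of v] by (auto simp: Jg sym_def)

lemma fin\<mu>: "finite (set_pmf \<mu>)" using \<mu>V finite_configs by (rule finite_subset)

text \<open>Limit of \<open>Tk_variance_le\<close> along the rings from one state in the support of
  \<open>\<mu>\<close>.\<close>

lemma \<mu>_variance:
  assumes d: "osc f d" and b: "bf f"
  shows "pexp \<mu> (\<lambda>x. (f x)\<^sup>2) - (pexp \<mu> f)\<^sup>2 \<le> G / \<theta> * (\<Sum>u\<in>V. (d u)\<^sup>2)"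
proof -
  obtain x where x: "x \<in> set_pmf \<mu>" using set_pmf_not_empty[of \<mu>] by blast
  have off: "x u = y u" if "y \<in> set_pmf \<mu>" "u \<notin> V" for y u
    using that x \<mu>V by (metis PiE_arb subsetD)
  have lim: "(\<lambda>k. (T ^^ k) f x) \<longlonglongrightarrow> pexp \<mu> f" if "bf f" for f
  proof (rule Tk_tendsto[OF \<mu>T fin\<mu> that])
    show "x u = y u" if "y \<in> set_pmf \<mu>" "u \<notin> V" for y u by (rule off[OF that])
  qed
  have "pexp \<mu> (\<lambda>x. (f x)\<^sup>2) \<le> (pexp \<mu> f)\<^sup>2 + G / \<theta> * (\<Sum>u\<in>V. (d u)\<^sup>2)"
  proof (rule LIMSEQ_le)
    show "(\<lambda>k. (T ^^ k) (\<lambda>x. (f x)\<^sup>2) x) \<longlonglongrightarrow> pexp \<mu> (\<lambda>x. (f x)\<^sup>2)"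
      by (rule lim[OF bf_square[OF b]])
    show "(\<lambda>k. ((T ^^ k) f x)\<^sup>2 + G / \<theta> * (\<Sum>u\<in>V. (d u)\<^sup>2)) \<longlonglongrightarrow> (pexp \<mu> f)\<^sup>2 + G / \<theta> * (\<Sum>u\<in>V. (d u)\<^sup>2)"
      by (intro tendsto_add tendsto_power tendsto_const lim b)
    show "\<exists>N. \<forall>k\<ge>N. (T ^^ k) (\<lambda>x. (f x)\<^sup>2) x \<le> ((T ^^ k) f x)\<^sup>2 + G / \<theta> * (\<Sum>u\<in>V. (d u)\<^sup>2)"
      using Tk_variance_le[OF g1 gG rev d] by blast
  qed
  then show ?thesis by simp
qed

lemma lower_tv:
  assumes \<nu>: "goodinit V \<nu>" "set_pmf \<nu> \<subseteq> V \<rightarrow>\<^sub>E C" and d: "osc F d" and b: "bf F" and t: "0 \<le> t"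
    and gap: "pexp \<mu> F < pexp \<nu> (S t F)"
  shows "\<exists>P. 1 - 4 * ((2 * G / \<theta> + G + 2 * t + 2) * (\<Sum>u\<in>V. (d u)\<^sup>2)) / (pexp \<nu> (S t F) - pexp \<mu> F)\<^sup>2
     \<le> pexp \<nu> (S t (\<lambda>x. of_bool (x \<in> P))) - pexp \<mu> (\<lambda>x. of_bool (x \<in> P))"
proof -
  obtain \<nu>1 where \<nu>1: "set_pmf \<nu>1 \<subseteq> V \<rightarrow>\<^sub>E C" "\<And>g. bf g \<Longrightarrow> pexp \<nu> (S t g) = pexp \<nu>1 g"
    using law_exists[OF \<nu>(2) t] by blast
  have f1: "finite (set_pmf \<nu>1)" using \<nu>1(1) finite_configs by (rule finite_subset)
  have v1: "pexp \<nu>1 (\<lambda>x. (F x)\<^sup>2) - (pexp \<nu>1 F)\<^sup>2 \<le> (G / \<theta> + G + 2 * t + 2) * (\<Sum>u\<in>V. (d u)\<^sup>2)"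
    using total_variance[OF \<nu>(1) g1 gG rev d b t] by (simp add: \<nu>1(2) b bf_square)
  have "\<exists>P. 1 - 4 * ((G / \<theta> + G + 2 * t + 2) * (\<Sum>u\<in>V. (d u)\<^sup>2) + G / \<theta> * (\<Sum>u\<in>V. (d u)\<^sup>2)) / (pexp \<nu>1 F - pexp \<mu> F)\<^sup>2
     \<le> pexp \<nu>1 (\<lambda>x. of_bool (x \<in> P)) - pexp \<mu> (\<lambda>x. of_bool (x \<in> P))"
    by (rule chebyshev_tv[OF f1 fin\<mu> _ v1 \<mu>_variance[OF d b]]) (use gap in \<open>simp add: \<nu>1(2) b\<close>)
  moreover have e: "(G / \<theta> + G + 2 * t + 2) * (\<Sum>u\<in>V. (d u)\<^sup>2) + G / \<theta> * (\<Sum>u\<in>V. (d u)\<^sup>2)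
      = (2 * G / \<theta> + G + 2 * t + 2) * (\<Sum>u\<in>V. (d u)\<^sup>2)" by (simp add: algebra_simps)
  ultimately show ?thesis unfolding e by (simp add: \<nu>1(2) b)
qed

text \<open>Centred so that its mean over a noise colour vanishes; noise then acts as pure
  killing.\<close>

definition site :: "'c \<Rightarrow> 'a \<Rightarrow> ('a \<Rightarrow> 'c) \<Rightarrow> real" where
  "site c v x = of_bool (x v = c) - 1 / q"

lemma bf_site [simp]: "bf (site c v)" unfolding site_def[abs_def] by (intro bf_diff bf_of_bool bf_const)

lemma q1: "1 \<le> q" using finC neC by (simp add: Suc_le_eq card_gt_0_iff)

lemma mean_site: "c \<in> C \<Longrightarrow> (\<Sum>b\<in>C. of_bool (b = c) - 1 / q) = 0"
  using finC by (auto simp: sum_subtractf of_bool_def)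

lemma gen_site:
  assumes v: "v \<in> V" and c: "c \<in> C"
  shows "(\<Sum>u\<in>V. Q u (site c v) x - site c v x) = (1 - \<theta>) * (\<Sum>w\<in>V. J v w * site c w x) - site c v x"
proof -
  have "Q u (site c v) x - site c v x = (if u = v then (1 - \<theta>) * (\<Sum>w\<in>V. J v w * site c w x) - site c v x else 0)"
    if u: "u \<in> V" for u
  proof (cases "u = v")
    case True
    then show ?thesis using mean_site[OF c] by (simp add: Q_def site_def)
  next
    case False
    then have "Q u (site c v) x = Q u (\<lambda>_. site c v x) x" by (simp add: Q_def site_def)
    then show ?thesis using False by (simp add: posop_const[OF posop_Q[OF u]])
  qed
  then have "(\<Sum>u\<in>V. Q u (site c v) x - site c v x)
      = (\<Sum>u\<in>V. if u = v then (1 - \<theta>) * (\<Sum>w\<in>V. J v w * site c w x) - site c v x else 0)"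
    by (intro sum.cong) auto
  then show ?thesis using v finV by simp
qed

text \<open>From the uniform law the mean vanishes at all times by \<open>marginal_uniform\<close>,
  and it converges to the mean under \<open>\<mu>\<close>.\<close>

lemma \<mu>_site:
  assumes v: "v \<in> V" and c: "c \<in> C" shows "pexp \<mu> (site c v) = 0"
proof -
  let ?U = "pmf_of_set (V \<rightarrow>\<^sub>E C)"
  have PE: "V \<rightarrow>\<^sub>E C \<noteq> {}" using neC by (auto simp: PiE_eq_empty_iff)
  have fU: "finite (set_pmf ?U)" and sU: "set_pmf ?U = V \<rightarrow>\<^sub>E C" using finite_configs PE by auto
  obtain d where d: "osc (site c v) d" using bf_osc[OF bf_site] by blast
  have m: "pexp ?U (S (real k) (site c v)) = 0" for k
    using marginal_uniform[OF v, of "\<lambda>b. of_bool (b = c) - 1 / q" "real k"] mean_site[OF c]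
    by (simp add: site_def[abs_def] bf_diff)
  have "\<bar>pexp \<mu> (site c v)\<bar> \<le> exp (- (\<theta> * real k)) * (\<Sum>u\<in>V. d u)" for k
  proof -
    have "\<bar>pexp ?U (S (real k) (site c v)) - pexp \<mu> (site c v)\<bar> \<le> exp (- (\<theta> * real k)) * (\<Sum>u\<in>V. d u)"
    proof (rule pexp_close[OF fU])
      fix x assume x: "x \<in> set_pmf ?U"
      show "\<bar>S (real k) (site c v) x - pexp \<mu> (site c v)\<bar> \<le> exp (- (\<theta> * real k)) * (\<Sum>u\<in>V. d u)"
      proof (rule S_stationary[OF \<mu>T fin\<mu> bf_site d])
        fix y u assume "y \<in> set_pmf \<mu>" "u \<notin> V"
        then show "x u = y u" using x \<mu>V unfolding sU by (metis PiE_arb subsetD)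
      next
        show "0 \<le> real k" by (rule of_nat_0_le_iff)
      qed
    qed
    then show ?thesis using m by simp
  qed
  moreover have "(\<lambda>k. exp (- (\<theta> * real k)) * (\<Sum>u\<in>V. d u)) \<longlonglongrightarrow> 0"
  proof (rule tendsto_mult_left_zero)
    show "(\<lambda>k. exp (- (\<theta> * real k))) \<longlonglongrightarrow> 0" using th0 by real_asymp
  qed
  ultimately have "\<bar>pexp \<mu> (site c v)\<bar> \<le> 0" using LIMSEQ_le_const by blast
  then show ?thesis by simp
qed

text \<open>The mean biases \<open>z v\<close> solve a linear system of which
  \<open>p * exp (- (\<theta> * t))\<close> is the solution constant in space, so the comparison
  principle bounds them below. The system is closed because either all sites test the same colour
  or, for \<open>\<theta> = 1\<close>, there is no copying. The gap of the sum is of order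
  \<open>n * exp (- (\<theta> * t))\<close>.\<close>

lemma lower_agree:
  assumes x0: "x0 \<in> V \<rightarrow>\<^sub>E C" and mono: "\<theta> = 1 \<or> (\<exists>c. \<forall>v\<in>V. x0 v = c)" and q2: "2 \<le> card C" and t: "0 \<le> t"
  shows "\<exists>P. 1 - 16 * ((2 * G / \<theta> + G + 2 * t + 2)) / (n * exp (- (2 * \<theta> * t)))
     \<le> S t (\<lambda>x. of_bool (x \<in> P)) x0 - pexp \<mu> (\<lambda>x. of_bool (x \<in> P))"
proof -
  have cC': "x0 v \<in> C" if "v \<in> V" for v using x0 that by auto
  define p where "p = 1 - 1 / q"
  have p: "1 / 2 \<le> p" using q2 by (simp add: p_def field_simps)
  define z where "z v t = S t (site (x0 v) v) x0" for v t
  define z' where "z' v t = (1 - \<theta>) * (\<Sum>w\<in>V. J v w * z w t) - z v t" for v t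
  have dz: "(z v has_real_derivative z' v t) (at t)" if v: "v \<in> V" for v t
  proof -
    have "(z v has_real_derivative S t (\<lambda>x. (1 - \<theta>) * (\<Sum>w\<in>V. J v w * site (x0 v) w x) - site (x0 v) v x) x0) (at t)"
      using S_deriv[of "site (x0 v) v" "return_pmf x0" t] unfolding z_def gen_site[OF v cC'[OF v]] by simp
    also have "S t (\<lambda>x. (1 - \<theta>) * (\<Sum>w\<in>V. J v w * site (x0 v) w x) - site (x0 v) v x) x0
      = (1 - \<theta>) * (\<Sum>w\<in>V. J v w * S t (site (x0 v) w) x0) - S t (site (x0 v) v) x0"
      by (simp add: S_diff S_cmult S_sum bf_sum bf_mult)
    also have "\<dots> = z' v t"
    proof (cases "\<theta> = 1")
      case False
      then have "x0 w = x0 v" if "w \<in> V" for w using mono v that by auto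
      then show ?thesis by (simp add: z'_def z_def)
    qed (simp add: z'_def z_def)
    finally show ?thesis .
  qed
  have zge: "p * exp (- (\<theta> * t)) \<le> z v t" if v: "v \<in> V" for v
  proof -
    have "0 \<le> z v t - p * exp (- (\<theta> * t))"
    proof (rule ode_nonneg[where I = V and N = "\<lambda>u w. (1 - \<theta>) * J u w" and c = 1 and y = "\<lambda>v t. z v t - p * exp (- (\<theta> * t))"
            and y' = "\<lambda>v t. z' v t + p * \<theta> * exp (- (\<theta> * t))"])
      fix u s assume u: "u \<in> V"
      show "((\<lambda>t. z u t - p * exp (- (\<theta> * t))) has_real_derivative z' u s + p * \<theta> * exp (- (\<theta> * s))) (at s)"
        by (rule derivative_eq_intros dz[OF u] refl | simp)+
      have "(\<Sum>w\<in>V. (1 - \<theta>) * J u w * (z w s - p * exp (- (\<theta> * s)))) =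
          (1 - \<theta>) * (\<Sum>w\<in>V. J u w * z w s) - (1 - \<theta>) * (\<Sum>w\<in>V. J u w) * (p * exp (- (\<theta> * s)))"
      proof -
        have "(\<Sum>w\<in>V. b * J u w * (z w s - k)) = b * (\<Sum>w\<in>V. J u w * z w s) - b * (\<Sum>w\<in>V. J u w) * k" for b k
          by (simp add: sum_distrib_left sum_distrib_right sum_subtractf right_diff_distrib mult.assoc)
        then show ?thesis .
      qed
      then show "0 \<le> z u s - p * exp (- (\<theta> * s)) \<or>
         (\<Sum>j\<in>V. (1 - \<theta>) * J u j * (z j s - p * exp (- (\<theta> * s)))) - 1 * (z u s - p * exp (- (\<theta> * s))) \<le> z' u s + p * \<theta> * exp (- (\<theta> * s))"
        unfolding z'_def J1[OF u] by (simp add: algebra_simps)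
    qed (use finV th1 J0 t v in \<open>auto simp: z_def site_def p_def\<close>)
    then show ?thesis by simp
  qed
  define F where "F x = (\<Sum>v\<in>V. site (x0 v) v x)" for x
  have bF: "bf F" unfolding F_def[abs_def] by (intro bf_sum bf_site)
  have oF: "osc F (\<lambda>_. 1)" unfolding osc_def
  proof (intro ballI allI)
    fix u x c assume u: "u \<in> V"
    have "F (x(u := c)) - F x = (\<Sum>v\<in>V. if v = u then of_bool (c = x0 u) - of_bool (x u = x0 u) else 0)"
      unfolding F_def sum_subtractf[symmetric] by (intro sum.cong) (auto simp: site_def)
    then show "\<bar>F (x(u := c)) - F x\<bar> \<le> 1" using u finV by simp
  qed
  have e\<mu>: "pexp \<mu> F = 0"
    unfolding F_def[abs_def] using pexp_sum_cmult[of \<mu> "\<lambda>_. 1" "\<lambda>v. site (x0 v) v" V] \<mu>_site cC' by simp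
  have eS: "S t F x0 = (\<Sum>v\<in>V. z v t)" unfolding F_def[abs_def] z_def by (rule S_sum) simp
  have "(\<Sum>v\<in>V. p * exp (- (\<theta> * t))) \<le> S t F x0" unfolding eS by (intro sum_mono zge)
  then have ge: "n * (p * exp (- (\<theta> * t))) \<le> S t F x0" by simp
  moreover have "n * (1 / 2 * exp (- (\<theta> * t))) \<le> n * (p * exp (- (\<theta> * t)))"
    using p n0 by (intro mult_left_mono mult_right_mono) auto
  ultimately have ge2: "n * exp (- (\<theta> * t)) / 2 \<le> S t F x0" by simp
  have pos: "0 < n * exp (- (\<theta> * t)) / 2" using n0 by simp
  define K where "K = 2 * G / \<theta> + G + 2 * t + 2"
  have K: "0 \<le> K" using G1 th0 t by (simp add: K_def)
  have "\<exists>P. 1 - 4 * (K * (\<Sum>u\<in>V. 1\<^sup>2)) / (pexp (return_pmf x0) (S t F) - pexp \<mu> F)\<^sup>2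
     \<le> pexp (return_pmf x0) (S t (\<lambda>x. of_bool (x \<in> P))) - pexp \<mu> (\<lambda>x. of_bool (x \<in> P))"
    unfolding K_def by (rule lower_tv[OF goodinit_return _ oF bF t]) (use x0 e\<mu> ge2 pos in auto)
  then obtain P where P: "1 - 4 * (K * n) / (S t F x0)\<^sup>2 \<le> S t (\<lambda>x. of_bool (x \<in> P)) x0 - pexp \<mu> (\<lambda>x. of_bool (x \<in> P))"
    using e\<mu> by auto
  have "(n * exp (- (\<theta> * t)) / 2)\<^sup>2 \<le> (S t F x0)\<^sup>2" using ge2 pos by (intro power_mono) auto
  then have "4 * (K * n) / (S t F x0)\<^sup>2 \<le> 4 * (K * n) / (n * exp (- (\<theta> * t)) / 2)\<^sup>2"
    using K n0 pos less_le_trans[OF pos ge2] by (intro divide_left_mono mult_pos_pos zero_less_power) auto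
  also have "\<dots> = 16 * K / (n * exp (- (2 * \<theta> * t)))"
  proof -
    have "exp (- (2 * \<theta> * t)) = exp (- (\<theta> * t)) * exp (- (\<theta> * t))" by (simp add: mult_exp_exp)
    then show ?thesis using n0 by (simp add: power2_eq_square)
  qed
  finally show ?thesis using P unfolding K_def by (intro exI[of _ P]) linarith
qed

text \<open>The statistic weighs each site by the bias that the initial law has left on it.\<close>
lemma lower_single:
  assumes \<nu>: "goodinit V \<nu>" "set_pmf \<nu> \<subseteq> V \<rightarrow>\<^sub>E C" and t: "0 \<le> t"
    and B: "B = (\<Sum>v\<in>V. \<Sum>c\<in>C. (pexp \<nu> (S t (site c v)))\<^sup>2)" "0 < B"
  shows "\<exists>P. 1 - 4 * ((2 * G / \<theta> + G + 2 * t + 2) * q) / B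
     \<le> pexp \<nu> (S t (\<lambda>x. of_bool (x \<in> P))) - pexp \<mu> (\<lambda>x. of_bool (x \<in> P))"
proof -
  define e where "e v c = pexp \<nu> (S t (site c v))" for v c
  define F where "F x = (\<Sum>v\<in>V. \<Sum>c\<in>C. e v c * site c v x)" for x
  have bF: "bf F" unfolding F_def[abs_def] by (intro bf_sum bf_mult bf_const bf_site)
  define d where "d v = (\<Sum>c\<in>C. \<bar>e v c\<bar>)" for v
  have oF: "osc F d" unfolding osc_def
  proof (intro ballI allI)
    fix u x b assume u: "u \<in> V"
    have "F (x(u := b)) - F x = (\<Sum>v\<in>V. if v = u then (\<Sum>c\<in>C. e u c * (of_bool (b = c) - of_bool (x u = c))) else 0)"
      unfolding F_def sum_subtractf[symmetric]
      by (intro sum.cong refl) (auto simp: site_def sum_subtractf[symmetric] algebra_simps intro!: sum.cong)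
    also have "\<dots> = (\<Sum>c\<in>C. e u c * (of_bool (b = c) - of_bool (x u = c)))" using u finV by simp
    also have "\<bar>\<dots>\<bar> \<le> (\<Sum>c\<in>C. \<bar>e u c\<bar> * 1)"
      by (rule order_trans[OF sum_abs]) (auto simp only: abs_mult intro!: sum_mono mult_left_mono, auto)
    finally show "\<bar>F (x(u := b)) - F x\<bar> \<le> d u" by (simp add: d_def)
  qed
  have d2: "(\<Sum>v\<in>V. (d v)\<^sup>2) \<le> q * B"
  proof -
    have "(\<Sum>v\<in>V. (d v)\<^sup>2) \<le> (\<Sum>v\<in>V. q * (\<Sum>c\<in>C. (e v c)\<^sup>2))"
    proof (intro sum_mono)
      fix v
      show "(d v)\<^sup>2 \<le> q * (\<Sum>c\<in>C. (e v c)\<^sup>2)"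
        using sum_squared_le_sum_of_squares[of "\<lambda>c. \<bar>e v c\<bar>" C] by (simp add: d_def mult.commute)
    qed
    then show ?thesis by (simp add: B(1) e_def sum_distrib_left)
  qed
  have e\<mu>: "pexp \<mu> F = 0"
  proof -
    have "pexp \<mu> F = (\<Sum>v\<in>V. 1 * pexp \<mu> (\<lambda>x. \<Sum>c\<in>C. e v c * site c v x))"
      unfolding F_def[abs_def] using pexp_sum_cmult[of \<mu> "\<lambda>_. 1" "\<lambda>v x. \<Sum>c\<in>C. e v c * site c v x" V] by simp
    then show ?thesis by (simp add: pexp_sum_cmult \<mu>_site)
  qed
  \<comment> \<open>The weights are the biases themselves, so the gap equals \<open>B\<close>, while
    by Cauchy--Schwarz over the colours the squared influences add up to at most
    \<open>q * B\<close>.\<close>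
  have e\<nu>: "pexp \<nu> (S t F) = B"
  proof -
    have "S t F = (\<lambda>x. \<Sum>v\<in>V. \<Sum>c\<in>C. e v c * S t (site c v) x)"
      unfolding F_def[abs_def] by (intro ext) (simp add: S_sum S_cmult bf_sum bf_mult)
    then have "pexp \<nu> (S t F) = pexp \<nu> (\<lambda>x. \<Sum>v\<in>V. 1 * (\<Sum>c\<in>C. e v c * S t (site c v) x))" by simp
    also have "\<dots> = (\<Sum>v\<in>V. \<Sum>c\<in>C. e v c * e v c)"
      by (subst pexp_sum_cmult) (simp add: pexp_sum_cmult e_def)
    finally show ?thesis by (simp add: B(1) e_def power2_eq_square)
  qed
  define K where "K = 2 * G / \<theta> + G + 2 * t + 2"
  have K: "0 \<le> K" using G1 th0 t by (simp add: K_def)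
  have "\<exists>P. 1 - 4 * (K * (\<Sum>u\<in>V. (d u)\<^sup>2)) / (pexp \<nu> (S t F) - pexp \<mu> F)\<^sup>2
     \<le> pexp \<nu> (S t (\<lambda>x. of_bool (x \<in> P))) - pexp \<mu> (\<lambda>x. of_bool (x \<in> P))"
    unfolding K_def by (rule lower_tv[OF \<nu> oF bF t]) (simp add: e\<mu> e\<nu> B(2))
  then obtain P where P: "1 - 4 * (K * (\<Sum>u\<in>V. (d u)\<^sup>2)) / B\<^sup>2
     \<le> pexp \<nu> (S t (\<lambda>x. of_bool (x \<in> P))) - pexp \<mu> (\<lambda>x. of_bool (x \<in> P))"
    unfolding e\<mu> e\<nu> by auto
  have "4 * (K * (\<Sum>u\<in>V. (d u)\<^sup>2)) / B\<^sup>2 \<le> 4 * (K * (q * B)) / B\<^sup>2"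
    using K d2 by (intro divide_right_mono mult_left_mono) auto
  also have "\<dots> = 4 * (K * q) / B" using B(2) by (simp add: power2_eq_square)
  finally show ?thesis using P unfolding K_def by (intro exI[of _ P]) linarith
qed

section \<open>Pair correlations in equilibrium and their deficit\<close>

definition pair :: "'a \<Rightarrow> 'a \<Rightarrow> ('a \<Rightarrow> 'c) \<Rightarrow> real" where
  "pair u v x = of_bool (x u = x v) - 1 / q"

lemma bf_pair [simp]: "bf (pair u v)" unfolding pair_def[abs_def] by (intro bf_diff bf_of_bool bf_const)

lemma pair_self: "pair u u = (\<lambda>_. 1 - 1 / q)" by (simp add: pair_def fun_eq_iff)

lemma pair_commute: "pair u v = pair v u" by (auto simp: pair_def fun_eq_iff)

text \<open>A noise ring at \<open>u\<close> or \<open>v\<close> averages the centred indicator to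
  0, provided the other site shows a colour of \<open>C\<close>; hence the restriction to
  configurations.\<close>

lemma gen_pair:
  assumes uv: "u \<in> V" "v \<in> V" "u \<noteq> v" and x: "x \<in> V \<rightarrow>\<^sub>E C"
  shows "(\<Sum>w\<in>V. Q w (pair u v) x - pair u v x) =
     (1 - \<theta>) * ((\<Sum>w\<in>V. J u w * pair w v x) + (\<Sum>w\<in>V. J v w * pair u w x)) - 2 * pair u v x"
proof -
  have q: "Q a (pair a b) x = (1 - \<theta>) * (\<Sum>w\<in>V. J a w * pair w b x)" if ab: "a \<in> V" "b \<in> V" "a \<noteq> b" for a b
  proof -
    have "x b \<in> C" using x ab by auto
    then have "(\<Sum>c\<in>C. pair a b (x(a := c))) = 0"
      using mean_site[of "x b"] ab by (simp add: pair_def)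
    then show ?thesis using ab by (simp add: Q_def pair_def)
  qed
  have "Q w (pair u v) x - pair u v x = (if w = u then (1 - \<theta>) * (\<Sum>w\<in>V. J u w * pair w v x) - pair u v x else 0)
      + (if w = v then (1 - \<theta>) * (\<Sum>w\<in>V. J v w * pair u w x) - pair u v x else 0)" if w: "w \<in> V" for w
  proof -
    consider "w = u" | "w = v" "w \<noteq> u" | "w \<noteq> u" "w \<noteq> v" by blast
    then show ?thesis
    proof cases
      case 1 then show ?thesis using q[OF uv] uv by simp
    next
      case 2
      have "Q v (pair u v) x = Q v (pair v u) x" by (simp only: pair_commute)
      also have "\<dots> = (1 - \<theta>) * (\<Sum>w\<in>V. J v w * pair w u x)" using q[OF uv(2,1)] uv(3) by simp
      also have "\<dots> = (1 - \<theta>) * (\<Sum>w\<in>V. J v w * pair u w x)" by (simp only: pair_commute[of _ u])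
      finally show ?thesis using 2 uv(3) by simp
    next
      case 3
      then have "Q w (pair u v) x = Q w (\<lambda>_. pair u v x) x" by (simp add: Q_def pair_def)
      then show ?thesis using 3 by (simp add: posop_const[OF posop_Q[OF w]])
    qed
  qed
  then have "(\<Sum>w\<in>V. Q w (pair u v) x - pair u v x) = (\<Sum>w\<in>V. (if w = u then (1 - \<theta>) * (\<Sum>w\<in>V. J u w * pair w v x) - pair u v x else 0)
      + (if w = v then (1 - \<theta>) * (\<Sum>w\<in>V. J v w * pair u w x) - pair u v x else 0))"
    by (intro sum.cong) auto
  then show ?thesis using uv finV by (simp add: sum.distrib algebra_simps)
qed

definition hh :: "'a \<Rightarrow> 'a \<Rightarrow> real" where "hh u v = pexp \<mu> (pair u v)"

lemma hh_self: "hh u u = 1 - 1 / q"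
  unfolding hh_def pair_self by (rule posop_const[OF posop_ev[OF fin\<mu>]])

lemma pexp_pair_gen:
  assumes "set_pmf \<kappa> \<subseteq> V \<rightarrow>\<^sub>E C" "finite (set_pmf \<kappa>)" "u \<in> V" "v \<in> V" "u \<noteq> v"
  shows "pexp \<kappa> (\<lambda>x. \<Sum>w\<in>V. Q w (pair u v) x - pair u v x) =
     (1 - \<theta>) * ((\<Sum>w\<in>V. J u w * pexp \<kappa> (pair w v)) + (\<Sum>w\<in>V. J v w * pexp \<kappa> (pair u w))) - 2 * pexp \<kappa> (pair u v)"
proof -
  note E = posop_ev[OF assms(2)]
  have "pexp \<kappa> (\<lambda>x. \<Sum>w\<in>V. Q w (pair u v) x - pair u v x) =
     pexp \<kappa> (\<lambda>x. (1 - \<theta>) * ((\<Sum>w\<in>V. J u w * pair w v x) + (\<Sum>w\<in>V. J v w * pair u w x)) - 2 * pair u v x)"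
    using assms(1) by (intro pexp_cong gen_pair assms) auto
  then show ?thesis
    by (simp add: posop_diff[OF E] posop_cmult[OF E] posop_add[OF E] pexp_sum_cmult)
qed

lemma hh_eq:
  assumes "u \<in> V" "v \<in> V" "u \<noteq> v"
  shows "2 * hh u v = (1 - \<theta>) * ((\<Sum>w\<in>V. J u w * hh w v) + (\<Sum>w\<in>V. J v w * hh u w))"
proof -
  note E = posop_ev[OF fin\<mu>]
  have "(\<lambda>x. \<Sum>w\<in>V. Q w (pair u v) x - pair u v x) = (\<lambda>x. n * (T (pair u v) x - pair u v x))"
    using n0 by (auto simp: T_def sum_subtractf right_diff_distrib)
  then have "pexp \<mu> (\<lambda>x. \<Sum>w\<in>V. Q w (pair u v) x - pair u v x) = n * (pexp \<mu> (T (pair u v)) - pexp \<mu> (pair u v))"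
    by (simp add: posop_cmult[OF E] posop_diff[OF E])
  also have "\<dots> = 0" by (simp add: \<mu>T)
  finally show ?thesis using pexp_pair_gen[OF \<mu>V fin\<mu> assms] by (simp add: hh_def)
qed

text \<open>Minimum principle: an off-diagonal minimum \<open>m\<close> satisfies
  \<open>2 * m \<ge> (1 - \<theta>) * (2 * m)\<close>, so it is not negative; on the diagonal the
  value is \<open>1 - 1 / q\<close>.\<close>

lemma hh_nonneg: assumes uv: "u \<in> V" "v \<in> V" shows "0 \<le> hh u v"
proof -
  define m where "m = Min ((\<lambda>(u, v). hh u v) ` (V \<times> V))"
  have fin: "finite ((\<lambda>(u, v). hh u v) ` (V \<times> V))" and ne: "(\<lambda>(u, v). hh u v) ` (V \<times> V) \<noteq> {}" using finV neV by auto
  have le: "m \<le> hh u v" if "u \<in> V" "v \<in> V" for u v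
    unfolding m_def using fin that by (intro Min_le) auto
  have "m \<in> (\<lambda>(u, v). hh u v) ` (V \<times> V)" unfolding m_def using fin ne by (rule Min_in)
  then obtain a b where ab: "a \<in> V" "b \<in> V" "m = hh a b" by auto
  have "0 \<le> m"
  proof (cases "a = b")
    case True
    have "1 / q \<le> 1" using q1 by simp
    then show ?thesis using True ab by (simp add: hh_self)
  next
    case False
    have "(\<Sum>w\<in>V. J a w * m) + (\<Sum>w\<in>V. J b w * m) \<le> (\<Sum>w\<in>V. J a w * hh w b) + (\<Sum>w\<in>V. J b w * hh a w)"
      using ab by (intro add_mono sum_mono mult_left_mono J0 le) auto
    then have "2 * m \<le> (\<Sum>w\<in>V. J a w * hh w b) + (\<Sum>w\<in>V. J b w * hh a w)"
      using J1[OF ab(1)] J1[OF ab(2)] by (simp add: sum_distrib_right[symmetric])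
    then have "(1 - \<theta>) * (2 * m) \<le> 2 * m"
      unfolding ab(3) hh_eq[OF ab(1,2) False] using th1 by (simp only: ab(3)[symmetric] mult_left_mono diff_ge_0_iff_ge)
    then have "0 \<le> \<theta> * m" by (simp add: algebra_simps)
    then show ?thesis using th0 by (simp add: zero_le_mult_iff)
  qed
  then show ?thesis using le[OF uv] by linarith
qed

text \<open>One term of \<open>hh_eq\<close> moves \<open>u\<close> a step along the walk to
  \<open>v\<close>; dropping the other nonnegative terms costs a factor
  \<open>(1 - \<theta>) / (2 * G)\<close> per step.\<close>

lemma hh_lower:
  assumes "(u, v) \<in> E ^^ k" "u \<in> V" "v \<in> V"
  shows "(1 - 1 / q) * ((1 - \<theta>) / (2 * G)) ^ k \<le> hh u v"
  using assms
proof (induction k arbitrary: u)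
  case 0 then show ?case by (simp add: hh_self)
next
  case (Suc k)
  define b where "b = (1 - \<theta>) / (2 * G)"
  have b: "0 \<le> b" "b \<le> 1" using th0 th1 G1 by (auto simp: b_def field_simps)
  have p: "0 \<le> 1 - 1 / q" using q1 by (simp add: field_simps)
  show ?case
  proof (cases "u = v")
    case True
    have "(1 - 1 / q) * b ^ Suc k \<le> (1 - 1 / q) * 1" using b p by (intro mult_left_mono power_le_one) auto
    then show ?thesis using True by (simp add: hh_self b_def)
  next
    case False
    obtain w where w: "(u, w) \<in> E" "(w, v) \<in> E ^^ k" using Suc.prems(1) by (meson relpow_Suc_D2)
    then have wV: "w \<in> V" using EV by auto
    have IH: "(1 - 1 / q) * b ^ k \<le> hh w v" using Suc.IH[OF w(2) wV Suc.prems(3)] by (simp add: b_def)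
    have Jw: "1 / G \<le> J u w" using w wV Suc.prems gG[of u] g0[of u] by (simp add: Jg frac_le)
    have "(1 - 1 / q) * b ^ Suc k = b * ((1 - 1 / q) * b ^ k)" by simp
    also have "\<dots> \<le> b * hh w v" using b IH by (intro mult_left_mono)
    also have "\<dots> = (1 - \<theta>) / 2 * (1 / G * hh w v)" by (simp add: b_def)
    also have "\<dots> \<le> (1 - \<theta>) / 2 * (J u w * hh w v)"
      using th1 Jw hh_nonneg[OF wV Suc.prems(3)] by (intro mult_left_mono mult_right_mono) auto
    also have "\<dots> \<le> (1 - \<theta>) / 2 * ((\<Sum>w\<in>V. J u w * hh w v) + (\<Sum>w\<in>V. J v w * hh u w))"
    proof (intro mult_left_mono)
      have "J u w * hh w v \<le> (\<Sum>w\<in>V. J u w * hh w v)"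
        using finV wV Suc.prems by (intro member_le_sum mult_nonneg_nonneg J0 hh_nonneg) auto
      moreover have "0 \<le> (\<Sum>w\<in>V. J v w * hh u w)"
        using Suc.prems by (intro sum_nonneg mult_nonneg_nonneg J0 hh_nonneg) auto
      ultimately show "J u w * hh w v \<le> (\<Sum>w\<in>V. J u w * hh w v) + (\<Sum>w\<in>V. J v w * hh u w)" by linarith
    qed (use th1 in auto)
    also have "\<dots> = hh u v" using hh_eq[OF Suc.prems(2,3) False] by simp
    finally show ?thesis by (simp add: b_def)
  qed
qed

text \<open>The function Dd below is the defect between independent and coalescing lineages.  It dominates the
  pair correlations that a uniform initial law would leave behind, whatever the initial law is.\<close>
definition es :: "('a \<Rightarrow> 'c) pmf \<Rightarrow> 'a \<Rightarrow> 'c \<Rightarrow> real \<Rightarrow> real" where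
  "es \<nu> v c t = pexp \<nu> (S t (site c v))"

definition Dd :: "('a \<Rightarrow> 'c) pmf \<Rightarrow> 'a \<times> 'a \<Rightarrow> real \<Rightarrow> real" where
  "Dd \<nu> p t = (\<Sum>c\<in>C. es \<nu> (fst p) c t * es \<nu> (snd p) c t) - pexp \<nu> (S t (pair (fst p) (snd p))) + hh (fst p) (snd p)"

text \<open>Off the diagonal the products of single-site means, the pair means and the equilibrium
  correlations all solve the same linear equation, hence so does \<open>Dd\<close>. On the diagonal
  it is the derivative of the sum of squares in \<open>Dd_self\<close>.\<close>

definition Dd' :: "('a \<Rightarrow> 'c) pmf \<Rightarrow> 'a \<times> 'a \<Rightarrow> real \<Rightarrow> real" where
  "Dd' \<nu> p t = (if fst p = snd p then (\<Sum>c\<in>C. 2 * es \<nu> (fst p) c t * ((1 - \<theta>) * (\<Sum>w\<in>V. J (fst p) w * es \<nu> w c t) - es \<nu> (fst p) c t))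
     else (1 - \<theta>) * ((\<Sum>w\<in>V. J (fst p) w * Dd \<nu> (w, snd p) t) + (\<Sum>w\<in>V. J (snd p) w * Dd \<nu> (fst p, w) t)) - 2 * Dd \<nu> p t)"

lemma es_deriv:
  assumes fin: "finite (set_pmf \<nu>)" and v: "v \<in> V" and c: "c \<in> C"
  shows "((\<lambda>t. es \<nu> v c t) has_real_derivative (1 - \<theta>) * (\<Sum>w\<in>V. J v w * es \<nu> w c t) - es \<nu> v c t) (at t)"
proof -
  note E = posop_ev[OF fin]
  have "(\<lambda>x. \<Sum>u\<in>V. Q u (site c v) x - site c v x) = (\<lambda>x. (1 - \<theta>) * (\<Sum>w\<in>V. J v w * site c w x) - site c v x)"
    using gen_site[OF v c] by blast
  then have "((\<lambda>t. es \<nu> v c t) has_real_derivative pexp \<nu> (S t (\<lambda>x. (1 - \<theta>) * (\<Sum>w\<in>V. J v w * site c w x) - site c v x))) (at t)"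
    using S_deriv[of "site c v" \<nu> t] unfolding es_def by simp
  also have "S t (\<lambda>x. (1 - \<theta>) * (\<Sum>w\<in>V. J v w * site c w x) - site c v x)
     = (\<lambda>x. (1 - \<theta>) * (\<Sum>w\<in>V. J v w * S t (site c w) x) - S t (site c v) x)"
    by (intro ext) (simp add: S_diff S_cmult S_sum bf_sum bf_mult)
  also have "pexp \<nu> \<dots> = (1 - \<theta>) * (\<Sum>w\<in>V. J v w * es \<nu> w c t) - es \<nu> v c t"
    by (simp add: posop_diff[OF E] posop_cmult[OF E] pexp_sum_cmult es_def)
  finally show ?thesis .
qed

text \<open>On the diagonal both pair terms equal \<open>1 - 1 / q\<close> and cancel; the sum of
  squares left is a nonnegative boundary datum.\<close>

lemma Dd_self: "finite (set_pmf \<nu>) \<Longrightarrow> Dd \<nu> (u, u) t = (\<Sum>c\<in>C. (es \<nu> u c t)\<^sup>2)"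
proof -
  assume fin: "finite (set_pmf \<nu>)"
  have "S t (pair u u) = (\<lambda>_. 1 - 1 / q)" unfolding pair_self by (intro ext S_const)
  then have "pexp \<nu> (S t (pair u u)) = 1 - 1 / q" using posop_const[OF posop_ev[OF fin]] by simp
  then show ?thesis by (simp add: Dd_def hh_self power2_eq_square)
qed

lemma Dd_deriv:
  assumes \<nu>: "set_pmf \<nu> \<subseteq> V \<rightarrow>\<^sub>E C" and p: "p \<in> V \<times> V"
  shows "(Dd \<nu> p has_real_derivative Dd' \<nu> p t) (at t)"
proof -
  obtain u v where uv: "p = (u, v)" "u \<in> V" "v \<in> V" using p by auto
  have fin: "finite (set_pmf \<nu>)" using \<nu> finite_configs by (rule finite_subset)
  define e' where "e' v c = (1 - \<theta>) * (\<Sum>w\<in>V. J v w * es \<nu> w c t) - es \<nu> v c t" for v c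
  have de: "((\<lambda>t. es \<nu> v c t) has_real_derivative e' v c) (at t)" if "v \<in> V" "c \<in> C" for v c
    unfolding e'_def by (rule es_deriv[OF fin that])
  show ?thesis
  proof (cases "u = v")
    case True
    have "Dd \<nu> p = (\<lambda>t. \<Sum>c\<in>C. es \<nu> u c t * es \<nu> u c t)"
      unfolding uv(1) True[symmetric] by (simp add: fun_eq_iff Dd_self[OF fin] power2_eq_square)
    moreover have "((\<lambda>t. \<Sum>c\<in>C. es \<nu> u c t * es \<nu> u c t) has_real_derivative (\<Sum>c\<in>C. e' u c * es \<nu> u c t + e' u c * es \<nu> u c t)) (at t)"
      by (intro DERIV_sum DERIV_mult de uv)
    ultimately show ?thesis using True uv by (simp add: Dd'_def e'_def mult_ac)
  next
    case False
    note E = posop_ev[OF fin]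
    define m where "m a b = pexp \<nu> (S t (pair a b))" for a b
    define m' where "m' = (1 - \<theta>) * ((\<Sum>w\<in>V. J u w * m w v) + (\<Sum>w\<in>V. J v w * m u w)) - 2 * m u v"
    have "((\<lambda>t. pexp \<nu> (S t (pair u v))) has_real_derivative pexp \<nu> (S t (\<lambda>x. \<Sum>w\<in>V. Q w (pair u v) x - pair u v x))) (at t)"
      by (rule S_deriv) simp
    also have "pexp \<nu> (S t (\<lambda>x. \<Sum>w\<in>V. Q w (pair u v) x - pair u v x))
      = pexp \<nu> (S t (\<lambda>x. (1 - \<theta>) * ((\<Sum>w\<in>V. J u w * pair w v x) + (\<Sum>w\<in>V. J v w * pair u w x)) - 2 * pair u v x))"
      using \<nu> by (intro pexp_cong S_cong gen_pair uv False) auto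
    also have "S t (\<lambda>x. (1 - \<theta>) * ((\<Sum>w\<in>V. J u w * pair w v x) + (\<Sum>w\<in>V. J v w * pair u w x)) - 2 * pair u v x)
       = (\<lambda>x. (1 - \<theta>) * ((\<Sum>w\<in>V. J u w * S t (pair w v) x) + (\<Sum>w\<in>V. J v w * S t (pair u w) x)) - 2 * S t (pair u v) x)"
      by (intro ext) (simp add: S_diff S_cmult S_add S_sum bf_sum bf_mult bf_add)
    also have "pexp \<nu> \<dots> = m'"
      by (simp add: posop_diff[OF E] posop_cmult[OF E] posop_add[OF E] pexp_sum_cmult m'_def m_def)
    finally have dm: "((\<lambda>t. pexp \<nu> (S t (pair u v))) has_real_derivative m') (at t)" .
    have "((\<lambda>t. (\<Sum>c\<in>C. es \<nu> u c t * es \<nu> v c t) - pexp \<nu> (S t (pair u v)) + hh u v) has_real_derivative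
       (\<Sum>c\<in>C. e' u c * es \<nu> v c t + e' v c * es \<nu> u c t) - m' + 0) (at t)"
      by (intro DERIV_add DERIV_diff DERIV_sum DERIV_mult de dm uv DERIV_const)
    moreover have "(\<Sum>c\<in>C. e' u c * es \<nu> v c t + e' v c * es \<nu> u c t) - m' + 0 = Dd' \<nu> p t"
    proof -
      have 1: "(\<Sum>c\<in>C. e' u c * es \<nu> v c t) = (1 - \<theta>) * (\<Sum>w\<in>V. J u w * (\<Sum>c\<in>C. es \<nu> w c t * es \<nu> v c t)) - (\<Sum>c\<in>C. es \<nu> u c t * es \<nu> v c t)"
      proof -
        have "(\<Sum>c\<in>C. (b * (\<Sum>w\<in>V. J u w * f w c) - k c) * h c) = b * (\<Sum>w\<in>V. J u w * (\<Sum>c\<in>C. f w c * h c)) - (\<Sum>c\<in>C. k c * h c)" for b f k h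
          by (simp add: left_diff_distrib sum_subtractf sum_distrib_left sum_distrib_right mult.assoc) (rule sum.swap)
        then show ?thesis unfolding e'_def .
      qed
      have 2: "(\<Sum>c\<in>C. e' v c * es \<nu> u c t) = (1 - \<theta>) * (\<Sum>w\<in>V. J v w * (\<Sum>c\<in>C. es \<nu> u c t * es \<nu> w c t)) - (\<Sum>c\<in>C. es \<nu> u c t * es \<nu> v c t)"
      proof -
        have "(\<Sum>c\<in>C. (b * (\<Sum>w\<in>V. J v w * f w c) - k c) * h c) = b * (\<Sum>w\<in>V. J v w * (\<Sum>c\<in>C. f w c * h c)) - (\<Sum>c\<in>C. k c * h c)" for b f k h
          by (simp add: left_diff_distrib sum_subtractf sum_distrib_left sum_distrib_right mult.assoc) (rule sum.swap)
        then have "(\<Sum>c\<in>C. e' v c * es \<nu> u c t) = (1 - \<theta>) * (\<Sum>w\<in>V. J v w * (\<Sum>c\<in>C. es \<nu> w c t * es \<nu> u c t)) - (\<Sum>c\<in>C. es \<nu> v c t * es \<nu> u c t)"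
          unfolding e'_def .
        then show ?thesis by (simp add: mult.commute)
      qed
      have 3: "(\<Sum>w\<in>V. J u w * Dd \<nu> (w, v) t) = (\<Sum>w\<in>V. J u w * (\<Sum>c\<in>C. es \<nu> w c t * es \<nu> v c t)) - (\<Sum>w\<in>V. J u w * m w v) + (\<Sum>w\<in>V. J u w * hh w v)"
        by (simp add: Dd_def m_def distrib_left right_diff_distrib sum.distrib sum_subtractf)
      have 4: "(\<Sum>w\<in>V. J v w * Dd \<nu> (u, w) t) = (\<Sum>w\<in>V. J v w * (\<Sum>c\<in>C. es \<nu> u c t * es \<nu> w c t)) - (\<Sum>w\<in>V. J v w * m u w) + (\<Sum>w\<in>V. J v w * hh u w)"
        by (simp add: Dd_def m_def distrib_left right_diff_distrib sum.distrib sum_subtractf)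
      have 5: "Dd \<nu> (u, v) t = (\<Sum>c\<in>C. es \<nu> u c t * es \<nu> v c t) - m u v + hh u v" by (simp add: Dd_def m_def)
      show ?thesis
        unfolding sum.distrib 1 2 using False hh_eq[OF uv(2,3) False]
        by (simp add: uv(1) Dd'_def 3 4 5 m'_def algebra_simps)
    qed
    ultimately show ?thesis unfolding Dd_def[abs_def] uv(1) by simp
  qed
qed

text \<open>On configurations \<open>pair u v\<close> is the sum over colours of the products of
  \<open>site c u\<close> and \<open>site c v\<close>. For independent sites its mean is therefore
  the sum of products of means, and only \<open>hh\<close> remains, whatever the initial
  law.\<close>

lemma Dd_init:
  assumes \<nu>: "goodinit V \<nu>" "set_pmf \<nu> \<subseteq> V \<rightarrow>\<^sub>E C" and uv: "u \<in> V" "v \<in> V" "u \<noteq> v"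
  shows "Dd \<nu> (u, v) 0 = hh u v"
proof -
  have fin: "finite (set_pmf \<nu>)" by (rule goodinit_finite[OF \<nu>(1)])
  have S0: "S 0 f = f" for f by (intro ext S_0)
  have "(\<Sum>c\<in>C. pexp \<nu> (site c u) * pexp \<nu> (site c v)) = (\<Sum>c\<in>C. 1 * pexp \<nu> (\<lambda>x. site c u x * site c v x))"
  proof (intro sum.cong refl)
    fix c
    have "dep {u} (site c u)" "dep (- {u}) (site c v)" using uv by (auto simp: dep_def site_def)
    then show "pexp \<nu> (site c u) * pexp \<nu> (site c v) = 1 * pexp \<nu> (\<lambda>x. site c u x * site c v x)"
      using goodinit_indep[OF \<nu>(1)] by simp
  qed
  also have "\<dots> = pexp \<nu> (\<lambda>x. \<Sum>c\<in>C. 1 * (site c u x * site c v x))" by (rule pexp_sum_cmult[symmetric])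
  also have "\<dots> = pexp \<nu> (pair u v)"
  proof (rule pexp_cong)
    fix x assume "x \<in> set_pmf \<nu>"
    then have x: "x u \<in> C" "x v \<in> C" using \<nu>(2) uv by auto
    have "(\<Sum>c\<in>C. 1 * (site c u x * site c v x)) = (\<Sum>c\<in>C. (if c = x u then (if x u = x v then 1 else 0) else 0)
        - (if c = x u then 1 / q else 0) - (if c = x v then 1 / q else 0) + 1 / q * (1 / q))"
      by (intro sum.cong refl) (auto simp: site_def algebra_simps)
    also have "\<dots> = pair u v x"
      using x finC cC by (simp add: sum.distrib sum_subtractf pair_def)
    finally show "(\<Sum>c\<in>C. 1 * (site c u x * site c v x)) = pair u v x" .
  qed
  finally show ?thesis by (simp add: Dd_def es_def S0)
qed

lemma pair_sum:
  assumes "u \<in> V" "v \<in> V"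
  shows "(\<Sum>y\<in>V \<times> V. (J u (fst y) * of_bool (snd y = v) + J v (snd y) * of_bool (fst y = u)) * f y)
     = (\<Sum>w\<in>V. J u w * f (w, v)) + (\<Sum>w\<in>V. J v w * f (u, w))"
proof -
  have "(\<Sum>y\<in>V \<times> V. (J u (fst y) * of_bool (snd y = v) + J v (snd y) * of_bool (fst y = u)) * f y)
    = (\<Sum>a\<in>V. \<Sum>b\<in>V. (if b = v then J u a * f (a, b) else 0) + (if a = u then J v b * f (a, b) else 0))"
    unfolding sum.cartesian_product by (intro sum.cong refl) (auto simp: algebra_simps)
  also have "\<dots> = (\<Sum>a\<in>V. \<Sum>b\<in>V. if b = v then J u a * f (a, b) else 0) + (\<Sum>a\<in>V. \<Sum>b\<in>V. if a = u then J v b * f (a, b) else 0)"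
    by (simp add: sum.distrib)
  also have "(\<Sum>a\<in>V. \<Sum>b\<in>V. if b = v then J u a * f (a, b) else 0) = (\<Sum>w\<in>V. J u w * f (w, v))"
    using assms finV by (intro sum.cong refl) simp
  also have "(\<Sum>a\<in>V. \<Sum>b\<in>V. if a = u then J v b * f (a, b) else 0) = (\<Sum>w\<in>V. J v w * f (u, w))"
    using assms finV by (subst sum.swap) (intro sum.cong refl, simp)
  finally show ?thesis .
qed

text \<open>Comparison principle on pairs: a linear equation off the diagonal, a sum of squares on
  it, and the nonnegative \<open>hh\<close> as initial value off the diagonal.\<close>

lemma Dd_nonneg:
  assumes \<nu>: "goodinit V \<nu>" "set_pmf \<nu> \<subseteq> V \<rightarrow>\<^sub>E C" and t: "0 \<le> t" and p: "p \<in> V \<times> V"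
  shows "0 \<le> Dd \<nu> p t"
proof (rule ode_nonneg[where I = "V \<times> V" and y = "Dd \<nu>" and y' = "Dd' \<nu>" and c = 2
      and N = "\<lambda>x y. (1 - \<theta>) * (J (fst x) (fst y) * of_bool (snd y = snd x) + J (snd x) (snd y) * of_bool (fst y = fst x))"])
  fix x s assume x: "x \<in> V \<times> V" and s: "0 \<le> (s::real)"
  obtain u v where uv: "x = (u, v)" "u \<in> V" "v \<in> V" using x by auto
  show "0 \<le> Dd \<nu> x s \<or> (\<Sum>y\<in>V \<times> V. (1 - \<theta>) * (J (fst x) (fst y) * of_bool (snd y = snd x) + J (snd x) (snd y) * of_bool (fst y = fst x)) * Dd \<nu> y s) - 2 * Dd \<nu> x s \<le> Dd' \<nu> x s"
  proof (cases "u = v")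
    case True
    then show ?thesis using Dd_self[OF goodinit_finite[OF \<nu>(1)], of u s] uv(1) by (simp add: sum_nonneg)
  next
    case False
    have "(\<Sum>y\<in>V \<times> V. (1 - \<theta>) * (J (fst x) (fst y) * of_bool (snd y = snd x) + J (snd x) (snd y) * of_bool (fst y = fst x)) * Dd \<nu> y s)
      = (1 - \<theta>) * ((\<Sum>w\<in>V. J u w * Dd \<nu> (w, v) s) + (\<Sum>w\<in>V. J v w * Dd \<nu> (u, w) s))"
    proof -
      have "(\<Sum>y\<in>V \<times> V. (1 - \<theta>) * (J (fst x) (fst y) * of_bool (snd y = snd x) + J (snd x) (snd y) * of_bool (fst y = fst x)) * Dd \<nu> y s)
        = (1 - \<theta>) * (\<Sum>y\<in>V \<times> V. (J u (fst y) * of_bool (snd y = v) + J v (snd y) * of_bool (fst y = u)) * Dd \<nu> y s)"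
        by (simp add: sum_distrib_left mult.assoc uv(1))
      then show ?thesis by (simp only: pair_sum[OF uv(2,3)])
    qed
    then show ?thesis using False uv(1) by (simp add: Dd'_def)
  qed
next
  fix x assume "x \<in> V \<times> V"
  then obtain u v where uv: "x = (u, v)" "u \<in> V" "v \<in> V" by auto
  show "0 \<le> Dd \<nu> x 0"
  proof (cases "u = v")
    case True
    then show ?thesis using Dd_self[OF goodinit_finite[OF \<nu>(1)], of u 0] uv(1) by (simp add: sum_nonneg)
  next
    case False
    then show ?thesis using Dd_init[OF \<nu> uv(2,3)] hh_nonneg[OF uv(2,3)] uv(1) by simp
  qed
qed (use finV th1 t p Dd_deriv[OF \<nu>(2)] in \<open>auto intro!: mult_nonneg_nonneg add_nonneg_nonneg J0\<close>)

text \<open>Complements \<open>lower_single\<close> when the single-site biases are too small: the stationary law has more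
  monochromatic pairs at distance at most \<open>r\<close> than the law at time \<open>t\<close>.\<close>
lemma lower_pair:
  assumes \<nu>: "goodinit V \<nu>" "set_pmf \<nu> \<subseteq> V \<rightarrow>\<^sub>E C" and t: "0 \<le> t" and th: "\<theta> < 1" and q2: "2 \<le> card C"
    and P: "P = {(u, v). u \<in> V \<and> v \<in> V \<and> u \<noteq> v \<and> v \<in> near E r u}" "P \<noteq> {}"
    and P': "P' = {(u, v). u \<in> V \<and> v \<in> V \<and> u \<noteq> v \<and> v \<in> near E (r - 1) u}" and r: "1 \<le> r"
    and M: "\<And>v. v \<in> V \<Longrightarrow> card (near E r v \<inter> V) \<le> M"
    and \<beta>: "real (card (P - P')) + real (card E) \<le> \<beta> * real (card P)"
    and B: "B = (\<Sum>v\<in>V. \<Sum>c\<in>C. (pexp \<nu> (S t (site c v)))\<^sup>2)"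
    and gap: "gap = real (card P) * ((1 - 1 / q) * ((1 - \<theta>) / (2 * G)) ^ r * exp (- ((2 * \<theta> + 2 * G\<^sup>2 * \<beta>) * t))) - G\<^sup>2 * real M * B" "0 < gap"
  shows "\<exists>A. 1 - 4 * ((2 * G / \<theta> + G + 2 * t + 2) * (n * (2 * G\<^sup>2 * real M)\<^sup>2)) / gap\<^sup>2
     \<le> pexp \<nu> (S t (\<lambda>x. of_bool (x \<in> A))) - pexp \<mu> (\<lambda>x. of_bool (x \<in> A))"
proof -
  have fin: "finite (set_pmf \<nu>)" by (rule goodinit_finite[OF \<nu>(1)])
  have PV: "P \<subseteq> V \<times> V" unfolding P(1) by auto
  have fP: "finite P" using PV finV by (auto intro: finite_subset)
  have fE: "finite E" using EV finV by (auto intro: finite_subset)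
  have swapP: "(v, u) \<in> P" if "(u, v) \<in> P" for u v using that near_sym[OF symE, of v r u] unfolding P(1) by auto
  \<comment> \<open>The product of degrees reverses the walk of two independent particles, which
    makes \<open>a\<close> below symmetric.\<close>
  define w where "w p = g (fst p) * g (snd p)" for p
  have w1: "1 \<le> w p" "w p \<le> G\<^sup>2" if "p \<in> P" for p
  proof -
    have p: "fst p \<in> V" "snd p \<in> V" using that PV by auto
    have "1 * 1 \<le> w p" unfolding w_def using g1[OF p(1)] g1[OF p(2)] by (intro mult_mono) auto
    then show "1 \<le> w p" by simp
    have "w p \<le> G * G" unfolding w_def using gG[OF p(1)] gG[OF p(2)] g0[OF p(1)] g0[OF p(2)] G1 by (intro mult_mono) auto
    then show "w p \<le> G\<^sup>2" by (simp add: power2_eq_square)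
  qed
  have w0: "0 < w p" if "p \<in> P" for p using w1[OF that] by simp
  have fstsum: "(\<Sum>p\<in>P. b (fst p)) \<le> real M * (\<Sum>u\<in>V. b u)" if b: "\<And>u. 0 \<le> b u" for b :: "'a \<Rightarrow> real"
  proof -
    have "(\<Sum>p\<in>P. b (fst p)) \<le> (\<Sum>p\<in>Sigma V (\<lambda>u. near E r u \<inter> V). b (fst p))"
      using finV b unfolding P(1) by (intro sum_mono2) auto
    also have "\<dots> = (\<Sum>u\<in>V. \<Sum>v\<in>near E r u \<inter> V. b u)" using finV by (subst sum.Sigma) (auto intro!: sum.cong)
    also have "\<dots> = (\<Sum>u\<in>V. real (card (near E r u \<inter> V)) * b u)" by simp
    also have "\<dots> \<le> (\<Sum>u\<in>V. real M * b u)" using M b by (intro sum_mono mult_right_mono) auto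
    finally show ?thesis by (simp add: sum_distrib_left)
  qed
  have sndsum: "(\<Sum>p\<in>P. b (snd p)) \<le> real M * (\<Sum>u\<in>V. b u)" if b: "\<And>u. 0 \<le> b u" for b :: "'a \<Rightarrow> real"
  proof -
    have "(\<Sum>p\<in>P. b (snd p)) = (\<Sum>p\<in>P. b (fst p))"
      by (rule sum.reindex_bij_witness[where i = prod.swap and j = prod.swap]) (use swapP in auto)
    then show ?thesis using fstsum[of b, OF b] by simp
  qed
  define a where "a x y = w x * ((1 - \<theta>) * (J (fst x) (fst y) * of_bool (snd y = snd x) + J (snd x) (snd y) * of_bool (fst y = fst x)))" for x y
  define h where "h = (1 - 1 / q) * ((1 - \<theta>) / (2 * G)) ^ r"
  have p0: "0 < 1 - 1 / q" using q2 by (simp add: field_simps)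
  have h0: "0 < h" unfolding h_def using p0 th G1 by (intro mult_pos_pos zero_less_power divide_pos_pos) auto
  have hle: "h \<le> Dd \<nu> p 0" if p: "p \<in> P" for p
  proof -
    obtain u v where uv: "p = (u, v)" "u \<in> V" "v \<in> V" "u \<noteq> v" "v \<in> near E r u" using p unfolding P(1) by auto
    obtain k where k: "k \<le> r" "(u, v) \<in> E ^^ k" using uv(5) by (auto simp: near_def)
    have "h \<le> (1 - 1 / q) * ((1 - \<theta>) / (2 * G)) ^ k"
      unfolding h_def using p0 th th0 G1 k by (intro mult_left_mono power_decreasing) (auto simp: field_simps)
    also have "\<dots> \<le> hh u v" by (rule hh_lower[OF k(2) uv(2,3)])
    finally show ?thesis using Dd_init[OF \<nu> uv(2-4)] uv(1) by simp
  qed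
  have D': "Dd' \<nu> p s = (1 - \<theta>) * ((\<Sum>w\<in>V. J (fst p) w * Dd \<nu> (w, snd p) s) + (\<Sum>w\<in>V. J (snd p) w * Dd \<nu> (fst p, w) s)) - 2 * Dd \<nu> p s"
    if "p \<in> P" for p s using that unfolding P(1) by (auto simp: Dd'_def)
  have nn: "0 \<le> (1 - \<theta>) * ((\<Sum>w\<in>V. J (fst p) w * Dd \<nu> (w, snd p) s) + (\<Sum>w\<in>V. J (snd p) w * Dd \<nu> (fst p, w) s))"
    if "p \<in> P" "0 \<le> s" for p s
    using that PV th by (intro mult_nonneg_nonneg add_nonneg_nonneg sum_nonneg J0 Dd_nonneg[OF \<nu>]) auto
  \<comment> \<open>Logarithms of \<open>Dd\<close> require strict positivity:
    \<open>exp (2 * t) * Dd \<nu> p t\<close> never decreases in \<open>t\<close>, the inflow being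
    nonnegative, and it starts at \<open>h\<close> or above.\<close>
  have pos: "0 < Dd \<nu> p s" if p: "p \<in> P" and s: "0 \<le> s" for p s
  proof -
    have "exp (2 * 0) * Dd \<nu> p 0 \<le> exp (2 * s) * Dd \<nu> p s"
    proof (rule DERIV_nonneg_imp_nondecreasing[OF s])
      fix z assume z: "0 \<le> z" "z \<le> s"
      have "((\<lambda>t. exp (2 * t) * Dd \<nu> p t) has_real_derivative exp (2 * z) * (2 * Dd \<nu> p z + Dd' \<nu> p z)) (at z)"
        using Dd_deriv[OF \<nu>(2), of p z] p PV
        by (auto intro!: derivative_eq_intros simp: algebra_simps)
      moreover have "0 \<le> exp (2 * z) * (2 * Dd \<nu> p z + Dd' \<nu> p z)"
        using nn[OF p z(1)] unfolding D'[OF p] by (intro mult_nonneg_nonneg) auto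
      ultimately show "\<exists>y. ((\<lambda>t. exp (2 * t) * Dd \<nu> p t) has_real_derivative y) (at z) \<and> 0 \<le> y" by blast
    qed
    then have "0 < exp (2 * s) * Dd \<nu> p s" using hle[OF p] h0 by simp
    then show ?thesis by (simp add: zero_less_mult_iff)
  qed
  have asum: "(\<Sum>y\<in>V \<times> V. a x y * f y) = w x * ((1 - \<theta>) * ((\<Sum>w\<in>V. J (fst x) w * f (w, snd x)) + (\<Sum>w\<in>V. J (snd x) w * f (fst x, w))))"
    if "x \<in> P" for x f
  proof -
    have "fst x \<in> V" "snd x \<in> V" using that PV by auto
    from pair_sum[OF this, of f] show ?thesis
      unfolding a_def by (simp add: sum_distrib_left[symmetric] mult.assoc)
  qed
  have a0: "0 \<le> a x y" if "x \<in> P" for x y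
    unfolding a_def using w0[OF that] th by (intro mult_nonneg_nonneg add_nonneg_nonneg J0) auto
  have asym: "a x y = a y x" if xy: "x \<in> P" "y \<in> P" for x y
  proof -
    obtain u v u' v' where e: "x = (u, v)" "y = (u', v')" by (metis prod.exhaust)
    then have V: "u \<in> V" "v \<in> V" "u' \<in> V" "v' \<in> V" using xy PV by auto
    have 1: "g u * g v * (J u u' * of_bool (v' = v)) = g u' * g v' * (J u' u * of_bool (v = v'))"
      using rev[OF V(1,3)] by (cases "v = v'") (simp_all add: mult_ac)
    have 2: "g u * g v * (J v v' * of_bool (u' = u)) = g u' * g v' * (J v' v * of_bool (u = u'))"
      using rev[OF V(2,4)] by (cases "u = u'") (simp_all add: mult_ac)
    have "a x y = (1 - \<theta>) * (g u * g v * (J u u' * of_bool (v' = v)) + g u * g v * (J v v' * of_bool (u' = u)))"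
      by (simp add: a_def w_def e algebra_simps)
    also have "\<dots> = a y x" unfolding 1 2 by (simp add: a_def w_def e algebra_simps)
    finally show ?thesis .
  qed
  define W where "W = (\<Sum>x\<in>P. w x)"
  have cW: "real (card P) \<le> W"
  proof -
    have "(\<Sum>x\<in>P. 1) \<le> W" unfolding W_def using w1 by (intro sum_mono) auto
    then show ?thesis by simp
  qed
  have cP: "0 < real (card P)" using P(2) fP by (simp add: card_gt_0_iff)
  have \<beta>0: "0 \<le> \<beta>" using \<beta> cP by (smt (verit) mult_neg_pos of_nat_0_le_iff)
  \<comment> \<open>Boundary pairs, from which a step may leave \<open>P\<close>: those at distance
    exactly \<open>r\<close>, and adjacent ones, which may meet.\<close>
  define Bd where "Bd = {x\<in>P. x \<notin> P' \<or> x \<in> E}"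
  have int: "w x * (2 * (1 - \<theta>)) \<le> (\<Sum>y\<in>P. a x y)" if x: "x \<in> P" "x \<notin> Bd" for x
  proof -
    obtain u v where e: "x = (u, v)" by (metis prod.exhaust)
    have uv: "u \<in> V" "v \<in> V" "u \<noteq> v" "v \<in> near E (r - 1) u" "(u, v) \<notin> E"
      using x unfolding Bd_def P' e by auto
    have 1: "J u w * of_bool ((w, v) \<in> P) = J u w" if w: "w \<in> V" for w
    proof (cases "J u w = 0")
      case False
      then have uw: "(u, w) \<in> E" by (rule JE[OF uv(1) w])
      then have "u \<in> near E 1 w" using symE by (intro near_step) (auto simp: sym_def)
      then have "v \<in> near E (1 + (r - 1)) w" by (rule near_trans[OF _ uv(4)])
      moreover have "w \<noteq> v" using uw uv(5) by auto
      ultimately have "(w, v) \<in> P" using w uv r unfolding P(1) by simp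
      then show ?thesis by simp
    qed simp
    have 2: "J v w * of_bool ((u, w) \<in> P) = J v w" if w: "w \<in> V" for w
    proof (cases "J v w = 0")
      case False
      then have vw: "(v, w) \<in> E" by (rule JE[OF uv(2) w])
      then have "w \<in> near E ((r - 1) + 1) u" by (rule near_trans[OF uv(4) near_step])
      moreover have "w \<noteq> u" using vw uv(5) symE by (auto simp: sym_def)
      ultimately have "(u, w) \<in> P" using w uv r unfolding P(1) by simp
      then show ?thesis by simp
    qed simp
    have "(\<Sum>y\<in>P. a x y) = (\<Sum>y\<in>V \<times> V. a x y * of_bool (y \<in> P))"
      using PV finV by (intro sum.mono_neutral_cong_left) auto
    also have "\<dots> = w x * ((1 - \<theta>) * ((\<Sum>w\<in>V. J u w * of_bool ((w, v) \<in> P)) + (\<Sum>w\<in>V. J v w * of_bool ((u, w) \<in> P))))"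
      using asum[OF x(1), of "\<lambda>y. of_bool (y \<in> P)"] by (simp add: e)
    also have "\<dots> = w x * ((1 - \<theta>) * (1 + 1))"
    proof -
      have s1: "(\<Sum>w\<in>V. J u w * of_bool ((w, v) \<in> P)) = 1"
        unfolding J1[OF uv(1), symmetric] by (rule sum.cong[OF refl]) (rule 1)
      have s2: "(\<Sum>w\<in>V. J v w * of_bool ((u, w) \<in> P)) = 1"
        unfolding J1[OF uv(2), symmetric] by (rule sum.cong[OF refl]) (rule 2)
      show ?thesis unfolding s1 s2 ..
    qed
    finally show ?thesis by (simp add: mult.commute)
  qed
  \<comment> \<open>An interior pair loses at most
    \<open>2 - 2 * (1 - \<theta>) = 2 * \<theta>\<close>; a boundary pair loses at most 2, weighted
    by at most \<open>G\<^sup>2\<close>, and \<open>\<beta>\<close> bounds the fraction of such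
    pairs.\<close>
  have \<rho>: "2 * (\<Sum>x\<in>P. w x) - (\<Sum>x\<in>P. \<Sum>y\<in>P. a x y) \<le> (2 * \<theta> + 2 * G\<^sup>2 * \<beta>) * (\<Sum>x\<in>P. w x)"
  proof -
    have "(\<Sum>x\<in>P. 2 * w x - (\<Sum>y\<in>P. a x y)) \<le> (\<Sum>x\<in>P. 2 * \<theta> * w x + (if x \<in> Bd then 2 * G\<^sup>2 else 0))"
    proof (intro sum_mono)
      fix x assume x: "x \<in> P"
      show "2 * w x - (\<Sum>y\<in>P. a x y) \<le> 2 * \<theta> * w x + (if x \<in> Bd then 2 * G\<^sup>2 else 0)"
      proof (cases "x \<in> Bd")
        case True
        have "0 \<le> (\<Sum>y\<in>P. a x y)" by (intro sum_nonneg a0[OF x])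
        moreover have "0 \<le> 2 * \<theta> * w x" using w0[OF x] th0 by simp
        ultimately show ?thesis using True w1(2)[OF x] by simp
      next
        case False
        then show ?thesis using int[OF x False] by (simp add: algebra_simps)
      qed
    qed
    also have "\<dots> = 2 * \<theta> * W + 2 * G\<^sup>2 * real (card Bd)"
    proof -
      have "(\<Sum>x\<in>P. if x \<in> Bd then 2 * G\<^sup>2 else 0) = (\<Sum>x\<in>Bd. 2 * G\<^sup>2)"
        using fP by (intro sum.mono_neutral_cong_right) (auto simp: Bd_def)
      then show ?thesis by (simp add: sum.distrib W_def sum_distrib_left)
    qed
    finally have 1: "(\<Sum>x\<in>P. 2 * w x - (\<Sum>y\<in>P. a x y)) \<le> 2 * \<theta> * W + 2 * G\<^sup>2 * real (card Bd)" .
    have "real (card Bd) \<le> \<beta> * real (card P)"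
    proof -
      have "card Bd \<le> card ((P - P') \<union> E)" using fP fE by (intro card_mono) (auto simp: Bd_def)
      also have "\<dots> \<le> card (P - P') + card E" by (rule card_Un_le)
      finally show ?thesis using \<beta> by linarith
    qed
    also have "\<beta> * real (card P) \<le> \<beta> * W" by (intro mult_left_mono cW \<beta>0)
    finally have "2 * G\<^sup>2 * real (card Bd) \<le> 2 * G\<^sup>2 * (\<beta> * W)" by (intro mult_left_mono) auto
    then have "(\<Sum>x\<in>P. 2 * w x) - (\<Sum>x\<in>P. \<Sum>y\<in>P. a x y) \<le> (2 * \<theta> + 2 * G\<^sup>2 * \<beta>) * W"
      using 1 unfolding sum_subtractf by (simp add: distrib_right mult.assoc)
    then show ?thesis by (simp only: sum_distrib_left[symmetric] W_def)
  qed
  have energy: "W * (h * exp (- ((2 * \<theta> + 2 * G\<^sup>2 * \<beta>) * t))) \<le> (\<Sum>x\<in>P. w x * Dd \<nu> x t)"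
    unfolding W_def
  proof (rule log_energy[where D' = "Dd' \<nu>" and a = a and c = 2])
    show "(Dd \<nu> x has_real_derivative Dd' \<nu> x t) (at t)" if "x \<in> P" for x t
      using that PV by (intro Dd_deriv \<nu>) auto
    show "(\<Sum>y\<in>P. a x y * Dd \<nu> y s) - 2 * w x * Dd \<nu> x s \<le> w x * Dd' \<nu> x s" if x: "x \<in> P" and s: "0 \<le> s" for x s
    proof -
      have "(\<Sum>y\<in>P. a x y * Dd \<nu> y s) \<le> (\<Sum>y\<in>V \<times> V. a x y * Dd \<nu> y s)"
        using PV finV s by (intro sum_mono2 mult_nonneg_nonneg a0[OF x] Dd_nonneg[OF \<nu>]) auto
      then show ?thesis unfolding asum[OF x] D'[OF x] by (simp add: algebra_simps)
    qed
  qed (use fP P(2) w0 a0 asym pos hle h0 t \<rho> in auto)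
  define b where "b v = (\<Sum>c\<in>C. (es \<nu> v c t)\<^sup>2)" for v
  have b0: "0 \<le> b v" for v by (simp add: b_def sum_nonneg)
  have Bb: "B = (\<Sum>v\<in>V. b v)" unfolding B b_def es_def ..
  \<comment> \<open>The part of \<open>Dd\<close> due to single-site biases; a site occurs in at
    most \<open>M\<close> pairs on either side.\<close>
  have psi: "(\<Sum>p\<in>P. w p * (\<Sum>c\<in>C. es \<nu> (fst p) c t * es \<nu> (snd p) c t)) \<le> G\<^sup>2 * real M * B"
  proof -
    have "(\<Sum>p\<in>P. w p * (\<Sum>c\<in>C. es \<nu> (fst p) c t * es \<nu> (snd p) c t)) \<le> (\<Sum>p\<in>P. G\<^sup>2 / 2 * (b (fst p) + b (snd p)))"
    proof (intro sum_mono)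
      fix p assume p: "p \<in> P"
      have "(\<Sum>c\<in>C. es \<nu> (fst p) c t * es \<nu> (snd p) c t) \<le> (\<Sum>c\<in>C. ((es \<nu> (fst p) c t)\<^sup>2 + (es \<nu> (snd p) c t)\<^sup>2) / 2)"
      proof (intro sum_mono)
        fix c show "es \<nu> (fst p) c t * es \<nu> (snd p) c t \<le> ((es \<nu> (fst p) c t)\<^sup>2 + (es \<nu> (snd p) c t)\<^sup>2) / 2"
          using sum_squares_bound[of "es \<nu> (fst p) c t" "es \<nu> (snd p) c t"] by simp
      qed
      also have "\<dots> = (b (fst p) + b (snd p)) / 2" by (simp add: b_def sum.distrib sum_divide_distrib[symmetric])
      finally have "w p * (\<Sum>c\<in>C. es \<nu> (fst p) c t * es \<nu> (snd p) c t) \<le> w p * ((b (fst p) + b (snd p)) / 2)"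
        using w0[OF p] by (intro mult_left_mono) auto
      also have "\<dots> \<le> G\<^sup>2 * ((b (fst p) + b (snd p)) / 2)" using w1[OF p] b0 by (intro mult_right_mono) auto
      finally show "w p * (\<Sum>c\<in>C. es \<nu> (fst p) c t * es \<nu> (snd p) c t) \<le> G\<^sup>2 / 2 * (b (fst p) + b (snd p))" by simp
    qed
    also have "\<dots> = G\<^sup>2 / 2 * ((\<Sum>p\<in>P. b (fst p)) + (\<Sum>p\<in>P. b (snd p)))" by (simp add: sum_distrib_left sum.distrib distrib_left)
    also have "\<dots> \<le> G\<^sup>2 / 2 * (real M * B + real M * B)"
      unfolding Bb by (intro mult_left_mono add_mono fstsum sndsum b0) auto
    finally show ?thesis by (simp add: mult_ac)
  qed
  \<comment> \<open>The minus sign is there because the law at time \<open>t\<close> has fewer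
    agreeing pairs than \<open>\<mu>\<close>.\<close>
  define F where "F x = (\<Sum>p\<in>P. - w p * pair (fst p) (snd p) x)" for x
  have bF: "bf F" unfolding F_def[abs_def] by (intro bf_sum bf_mult bf_const bf_pair)
  have oF: "osc F (\<lambda>_. 2 * G\<^sup>2 * real M)" unfolding osc_def
  proof (intro ballI allI)
    fix z x c assume z: "z \<in> V"
    have "F (x(z := c)) - F x = (\<Sum>p\<in>P. w p * (pair (fst p) (snd p) x - pair (fst p) (snd p) (x(z := c))))"
      unfolding F_def sum_subtractf[symmetric] by (intro sum.cong refl) (simp add: algebra_simps)
    also have "\<bar>\<dots>\<bar> \<le> (\<Sum>p\<in>P. G\<^sup>2 * (of_bool (fst p = z) + of_bool (snd p = z)))"
    proof (rule order_trans[OF sum_abs sum_mono])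
      fix p assume p: "p \<in> P"
      have "\<bar>pair (fst p) (snd p) x - pair (fst p) (snd p) (x(z := c))\<bar> \<le> of_bool (fst p = z) + of_bool (snd p = z)"
        by (auto simp: pair_def)
      then show "\<bar>w p * (pair (fst p) (snd p) x - pair (fst p) (snd p) (x(z := c)))\<bar> \<le> G\<^sup>2 * (of_bool (fst p = z) + of_bool (snd p = z))"
        unfolding abs_mult using w0[OF p] w1[OF p] by (intro mult_mono) auto
    qed
    also have "\<dots> = G\<^sup>2 * ((\<Sum>p\<in>P. of_bool (fst p = z)) + (\<Sum>p\<in>P. of_bool (snd p = z)))"
      by (simp add: sum_distrib_left sum.distrib distrib_left)
    also have "\<dots> \<le> G\<^sup>2 * (real M * (\<Sum>u\<in>V. of_bool (u = z)) + real M * (\<Sum>u\<in>V. of_bool (u = z)))"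
      by (intro mult_left_mono add_mono fstsum[of "\<lambda>u. of_bool (u = z)"] sndsum[of "\<lambda>u. of_bool (u = z)"]) auto
    also have "(\<Sum>u\<in>V. of_bool (u = z)) = (1::real)" using z finV by (simp add: of_bool_def)
    finally have "\<bar>F (x(z := c)) - F x\<bar> \<le> G\<^sup>2 * (real M * 1 + real M * 1)" .
    moreover have "G\<^sup>2 * (real M * 1 + real M * 1) = 2 * G\<^sup>2 * real M" by (simp only: mult_1_right) (simp add: algebra_simps)
    ultimately show "\<bar>F (x(z := c)) - F x\<bar> \<le> 2 * G\<^sup>2 * real M" by (simp only:)
  qed
  have e\<mu>: "pexp \<mu> F = (\<Sum>p\<in>P. - w p * hh (fst p) (snd p))" unfolding F_def[abs_def] hh_def by (rule pexp_sum_cmult)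
  have e\<nu>: "pexp \<nu> (S t F) = (\<Sum>p\<in>P. - w p * pexp \<nu> (S t (pair (fst p) (snd p))))"
  proof -
    have "S t F = (\<lambda>x. \<Sum>p\<in>P. - w p * S t (pair (fst p) (snd p)) x)"
      unfolding F_def[abs_def] by (intro ext, subst S_sum) (auto intro!: bf_mult sum.cong simp only: S_cmult bf_pair bf_const)
    then show ?thesis by (simp only: pexp_sum_cmult)
  qed
  have "pexp \<nu> (S t F) - pexp \<mu> F = (\<Sum>p\<in>P. w p * Dd \<nu> p t) - (\<Sum>p\<in>P. w p * (\<Sum>c\<in>C. es \<nu> (fst p) c t * es \<nu> (snd p) c t))"
    unfolding e\<mu> e\<nu> sum_subtractf[symmetric] by (intro sum.cong refl) (simp add: Dd_def algebra_simps)
  moreover have "real (card P) * (h * exp (- ((2 * \<theta> + 2 * G\<^sup>2 * \<beta>) * t))) \<le> W * (h * exp (- ((2 * \<theta> + 2 * G\<^sup>2 * \<beta>) * t)))"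
    using cW h0 by (intro mult_right_mono) auto
  ultimately have gle: "gap \<le> pexp \<nu> (S t F) - pexp \<mu> F"
    using energy psi unfolding gap(1) h_def by linarith
  define K where "K = 2 * G / \<theta> + G + 2 * t + 2"
  have K: "0 \<le> K" using G1 th0 t by (simp add: K_def)
  have "\<exists>A. 1 - 4 * (K * (\<Sum>u\<in>V. (2 * G\<^sup>2 * real M)\<^sup>2)) / (pexp \<nu> (S t F) - pexp \<mu> F)\<^sup>2
     \<le> pexp \<nu> (S t (\<lambda>x. of_bool (x \<in> A))) - pexp \<mu> (\<lambda>x. of_bool (x \<in> A))"
    unfolding K_def by (rule lower_tv[OF \<nu> oF bF t]) (use gle gap(2) in simp)
  then obtain A where A: "1 - 4 * (K * (n * (2 * G\<^sup>2 * real M)\<^sup>2)) / (pexp \<nu> (S t F) - pexp \<mu> F)\<^sup>2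
     \<le> pexp \<nu> (S t (\<lambda>x. of_bool (x \<in> A))) - pexp \<mu> (\<lambda>x. of_bool (x \<in> A))" by auto
  have "gap\<^sup>2 \<le> (pexp \<nu> (S t F) - pexp \<mu> F)\<^sup>2" using gle gap(2) by (intro power_mono) auto
  then have "4 * (K * (n * (2 * G\<^sup>2 * real M)\<^sup>2)) / (pexp \<nu> (S t F) - pexp \<mu> F)\<^sup>2 \<le> 4 * (K * (n * (2 * G\<^sup>2 * real M)\<^sup>2)) / gap\<^sup>2"
    using K gap(2) gle by (intro divide_left_mono mult_pos_pos zero_less_power) auto
  then show ?thesis using A unfolding K_def by (intro exI[of _ A]) linarith
qed

end

section \<open>The stationary law\<close>

context nvm
begin

lemma Tk_expand:
  assumes "x \<in> V \<rightarrow>\<^sub>E C"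
  shows "(T ^^ k) f x = (\<Sum>y\<in>V \<rightarrow>\<^sub>E C. f y * (T ^^ k) (\<lambda>x. of_bool (x = y)) x)"
proof -
  have "(T ^^ k) f x = (T ^^ k) (\<lambda>x. \<Sum>y\<in>V \<rightarrow>\<^sub>E C. f y * of_bool (x = y)) x"
    using finite_configs by (intro Tk_cong assms) (simp add: sum.delta' if_distrib of_bool_def cong: if_cong)
  also have "\<dots> = (\<Sum>y\<in>V \<rightarrow>\<^sub>E C. f y * (T ^^ k) (\<lambda>x. of_bool (x = y)) x)"
    by (simp add: posop_sum[OF posop_Tk] posop_cmult[OF posop_Tk])
  finally show ?thesis .
qed

text \<open>By contraction the means from one state form Cauchy sequences; the limits over
  indicators are the masses of an invariant pmf.\<close>

lemma stationary_exists: "\<exists>\<mu>. set_pmf \<mu> \<subseteq> V \<rightarrow>\<^sub>E C \<and> (\<forall>f. bf f \<longrightarrow> pexp \<mu> (T f) = pexp \<mu> f)"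
proof -
  have "V \<rightarrow>\<^sub>E C \<noteq> {}" using neC by (auto simp: PiE_eq_empty_iff)
  then obtain x0 where x0: "x0 \<in> V \<rightarrow>\<^sub>E C" by blast
  define a where "a y k = (T ^^ k) (\<lambda>x. of_bool (x = y)) x0" for y k
  have conv: "convergent (a y)" for y
  proof -
    define f where "f x = (of_bool (x = y) :: real)" for x
    have b: "bf f" unfolding f_def[abs_def] by simp
    obtain d where d: "osc f d" using bf_osc[OF b] by blast
    define W where "W = (\<Sum>u\<in>V. d u)"
    have W0: "0 \<le> W" unfolding W_def by (intro sum_nonneg osc_nonneg[OF d])
    have step: "\<bar>a y (k + m) - a y k\<bar> \<le> (1 - \<theta> / n) ^ k * W" for k m
    proof -
      define h where "h x = (if x \<in> V \<rightarrow>\<^sub>E C then (T ^^ k) f x - (T ^^ k) f x0 else 0)" for x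
      have "\<bar>h x\<bar> \<le> (1 - \<theta> / n) ^ k * W" for x
      proof (cases "x \<in> V \<rightarrow>\<^sub>E C")
        case True
        have "x u = x0 u" if "u \<notin> V" for u using PiE_arb[OF True that] PiE_arb[OF x0 that] by simp
        then show ?thesis using Tk_contraction[OF d, of x x0 k] True by (simp add: h_def W_def)
      next
        case False
        then show ?thesis using W0 thn by (simp add: h_def)
      qed
      then have "\<bar>(T ^^ m) h x0\<bar> \<le> (1 - \<theta> / n) ^ k * W" by (rule posop_bounded[OF posop_Tk])
      moreover have "(T ^^ m) h x0 = (T ^^ m) (\<lambda>x. (T ^^ k) f x - (T ^^ k) f x0) x0"
        by (intro Tk_cong x0) (simp add: h_def)
      moreover have "\<dots> = a y (k + m) - a y k"
        by (simp add: posop_diff[OF posop_Tk] posop_const[OF posop_Tk] a_def f_def[abs_def] add.commute[of k] funpow_add)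
      ultimately show ?thesis by simp
    qed
    have lim: "(\<lambda>k. (1 - \<theta> / n) ^ k * W) \<longlonglongrightarrow> 0"
      using thn by (intro tendsto_mult_left_zero LIMSEQ_power_zero) auto
    have "Cauchy (a y)"
    proof (rule CauchyI)
      fix e :: real assume e: "0 < e"
      then have "\<forall>\<^sub>F k in sequentially. (1 - \<theta> / n) ^ k * W < e / 2"
        using lim by (intro order_tendstoD) auto
      then obtain N where N: "(1 - \<theta> / n) ^ N * W < e / 2" using eventually_sequentially by auto
      have "norm (a y m - a y k) < e" if "N \<le> m" "N \<le> k" for m k
        using step[of N "m - N"] step[of N "k - N"] that N by (simp add: abs_le_iff) linarith
      then show "\<exists>M. \<forall>m\<ge>M. \<forall>k\<ge>M. norm (a y m - a y k) < e" by blast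
    qed
    then show ?thesis by (simp add: Cauchy_convergent)
  qed
  define w where "w y = (if y \<in> V \<rightarrow>\<^sub>E C then lim (a y) else 0)" for y
  have lw: "a y \<longlonglongrightarrow> w y" if "y \<in> V \<rightarrow>\<^sub>E C" for y
    using conv that by (simp add: w_def convergent_LIMSEQ_iff)
  have lf: "(\<lambda>k. (T ^^ k) f x0) \<longlonglongrightarrow> (\<Sum>y\<in>V \<rightarrow>\<^sub>E C. f y * w y)" for f
  proof -
    have "(\<lambda>k. \<Sum>y\<in>V \<rightarrow>\<^sub>E C. f y * a y k) \<longlonglongrightarrow> (\<Sum>y\<in>V \<rightarrow>\<^sub>E C. f y * w y)"
      by (intro tendsto_sum tendsto_mult_left lw)
    moreover have "(\<lambda>k. \<Sum>y\<in>V \<rightarrow>\<^sub>E C. f y * a y k) = (\<lambda>k. (T ^^ k) f x0)"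
      unfolding a_def by (intro ext Tk_expand[OF x0, symmetric])
    ultimately show ?thesis by (simp only:)
  qed
  have w0: "0 \<le> w y" for y
  proof (cases "y \<in> V \<rightarrow>\<^sub>E C")
    case True
    have "0 \<le> a y k" for k
      unfolding a_def using posop_mono[OF posop_Tk, of "\<lambda>_. 0" "\<lambda>x. of_bool (x = y)" k x0] posop_const[OF posop_Tk, of k 0 x0] by simp
    then show ?thesis by (intro LIMSEQ_le_const[OF lw[OF True]] exI allI impI)
  qed (simp add: w_def)
  have sum1: "(\<Sum>y\<in>V \<rightarrow>\<^sub>E C. w y) = 1"
  proof -
    have "(\<lambda>k. 1::real) \<longlonglongrightarrow> (\<Sum>y\<in>V \<rightarrow>\<^sub>E C. w y)"
      using lf[of "\<lambda>_. 1"] by (simp add: posop_const[OF posop_Tk])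
    from LIMSEQ_unique[OF this tendsto_const] show ?thesis by simp
  qed
  have "(\<integral>\<^sup>+ y. ennreal (w y) \<partial>count_space UNIV) = (\<integral>\<^sup>+ y. ennreal (w y) \<partial>count_space (V \<rightarrow>\<^sub>E C))"
    by (intro nn_integral_count_space_eq) (auto simp: w_def)
  also have "\<dots> = 1"
    using finite_configs by (simp add: nn_integral_count_space_finite sum1 w0 sum_ennreal)
  finally have pm: "pmf (embed_pmf w) y = w y" for y by (intro pmf_embed_pmf w0)
  have sub: "set_pmf (embed_pmf w) \<subseteq> V \<rightarrow>\<^sub>E C" by (auto simp: set_pmf_iff pm w_def split: if_splits)
  have evw: "pexp (embed_pmf w) g = (\<Sum>y\<in>V \<rightarrow>\<^sub>E C. g y * w y)" for g
    unfolding pexp_def pm using sub finite_configs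
    by (subst mult.commute, intro sum.mono_neutral_left) (auto simp: set_pmf_iff pm)
  have "pexp (embed_pmf w) (T f) = pexp (embed_pmf w) f" for f
  proof -
    have "(\<lambda>k. (T ^^ k) (T f) x0) = (\<lambda>k. (T ^^ Suc k) f x0)" by (simp add: funpow_swap1)
    then have "(\<lambda>k. (T ^^ Suc k) f x0) \<longlonglongrightarrow> pexp (embed_pmf w) (T f)" using lf[of "T f"] by (simp add: evw)
    moreover have "(\<lambda>k. (T ^^ Suc k) f x0) \<longlonglongrightarrow> pexp (embed_pmf w) f" using LIMSEQ_Suc[OF lf[of f]] by (simp add: evw)
    ultimately show ?thesis by (rule LIMSEQ_unique)
  qed
  then show ?thesis using sub by blast
qed

end

section \<open>Total variation distance\<close>

lemma tv_dist_ge: "measure_pmf.prob p A - measure_pmf.prob p' A \<le> tv_dist p p'"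
proof -
  have "\<bar>measure_pmf.prob p A - measure_pmf.prob p' A\<bar> \<le> tv_dist p p'"
    unfolding tv_dist_def
  proof (intro cSUP_upper)
    show "bdd_above (range (\<lambda>A. \<bar>measure_pmf.prob p A - measure_pmf.prob p' A\<bar>))"
      by (intro bdd_aboveI2[of _ _ 1]) (smt (verit) measure_nonneg measure_pmf.prob_le_1)
  qed simp
  then show ?thesis by linarith
qed

lemma tv_dist_le: "(\<And>A. \<bar>measure_pmf.prob p A - measure_pmf.prob p' A\<bar> \<le> M) \<Longrightarrow> tv_dist p p' \<le> M"
  unfolding tv_dist_def by (rule cSUP_least) auto

lemma prob_ev: "finite (set_pmf p) \<Longrightarrow> measure_pmf.prob p A = pexp p (\<lambda>x. of_bool (x \<in> A))"
proof -
  assume "finite (set_pmf p)"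
  then have "measure_pmf.prob p A = (\<Sum>x\<in>A \<inter> set_pmf p. pmf p x)"
    by (subst measure_Int_set_pmf[symmetric], subst measure_measure_pmf_finite) auto
  also have "\<dots> = pexp p (\<lambda>x. of_bool (x \<in> A))"
    unfolding pexp_def using \<open>finite (set_pmf p)\<close> by (intro sum.mono_neutral_cong_left) auto
  finally show ?thesis .
qed

section \<open>The voter model of a graph\<close>

definition jump :: "'a pair_pre_digraph \<Rightarrow> 'a \<Rightarrow> 'a \<Rightarrow> real" where
  "jump G u v = (if (u, v) \<in> parcs G then 1 / real (card (nbrs G u)) else 0)"

lemma relpow_awalk:
  assumes "pair_graph G" "u \<in> pverts G" "(u, v) \<in> parcs G ^^ k"
  shows "\<exists>p. pre_digraph.awalk (with_proj G) u p v \<and> length p = k"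
  using assms(2,3)
proof (induction k arbitrary: u)
  interpret pair_graph G by fact
  {
    case 0
    then have "awalk u [] v" by (simp add: awalk_Nil_iff)
    then show ?case by (intro exI[of _ "[]"]) simp
  next
    case (Suc k)
    obtain w where w: "(u, w) \<in> parcs G" "(w, v) \<in> parcs G ^^ k" using Suc.prems(2) by (meson relpow_Suc_D2)
    have "w \<in> pverts G" using w(1) by (rule in_arcsD2)
    then obtain p where p: "awalk w p v" "length p = k" using Suc.IH w(2) by blast
    have "awalk u ((u, w) # p) v" using p w by (simp add: awalk_Cons_iff)
    then show ?case using p by (intro exI[of _ "(u, w) # p"]) simp
  }
qed

text \<open>A walk of length \<open>k\<close> has cost \<open>k\<close> for unit arc weights. The
  inclusion transfers upper bounds on balls.\<close>

lemma near_graph_ball: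
  assumes "pair_graph G" "u \<in> pverts G"
  shows "near (parcs G) k u \<inter> pverts G \<subseteq> graph_ball G u (real k)"
proof
  interpret pair_graph G by fact
  fix v assume v: "v \<in> near (parcs G) k u \<inter> pverts G"
  then obtain j where j: "j \<le> k" "(u, v) \<in> parcs G ^^ j" by (auto simp: near_def)
  obtain p where p: "awalk u p v" "length p = j" using relpow_awalk[OF assms(1,2) j(2)] by blast
  have "\<mu> (\<lambda>_. 1) u v \<le> ereal (awalk_cost (\<lambda>_. 1) p)" by (rule min_cost_le_walk_cost[OF p(1)])
  also have "awalk_cost (\<lambda>_. 1) p = real (length p)" by (induction p) auto
  also have "ereal (real (length p)) \<le> ereal (real k)" using p(2) j(1) by simp
  finally show "v \<in> graph_ball G u (real k)" using v by (simp add: graph_ball_def)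
qed

text \<open>With at least two vertices, connectedness gives every vertex a neighbour, so
  \<open>jump\<close> is stochastic.\<close>

locale voter =
  fixes G :: "'a pair_pre_digraph" and q :: nat and \<theta> :: real
  assumes pg: "pair_graph G" and con: "connected (with_proj G)" and card2: "2 \<le> card (pverts G)"
    and q2: "2 \<le> q" and theta0: "0 < \<theta>" and theta1: "\<theta> \<le> 1"
begin

lemma finV: "finite (pverts G)" using pg by (simp add: pair_graph_def pair_digraph_def pair_fin_digraph_def pair_fin_digraph_axioms_def)

lemma EV: "parcs G \<subseteq> pverts G \<times> pverts G"
proof -
  interpret pair_graph G by (rule pg)
  show ?thesis using in_arcsD1 in_arcsD2 by auto
qed

lemma symE: "sym (parcs G)"
proof -
  interpret pair_graph G by (rule pg)
  show ?thesis using pair_sym_arcs by (simp add: symmetric_def)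
qed

lemma irr: "(u, u) \<notin> parcs G"
proof -
  interpret pair_graph G by (rule pg)
  show ?thesis using pair_no_loops[of "(u, u)"] by auto
qed

lemma conn: assumes "u \<in> pverts G" "v \<in> pverts G" shows "(u, v) \<in> (parcs G)\<^sup>*"
proof -
  interpret pair_graph G by (rule pg)
  \<comment> \<open>\<open>connected\<close> speaks of the symmetrised graph; the arcs being
    symmetric already, reachability is the same.\<close>
  have "reachable (with_proj (mk_symmetric (with_proj G))) u v"
    using con assms unfolding connected_def strongly_connected_def by (simp add: mk_symmetric_def)
  then have "reachable (with_proj G) u v" using reachable_mk_symmetric_eq[OF sym_arcs] by simp
  then show ?thesis using reachable_rtranclI by fastforce
qed

lemma nbrs_sub: "nbrs G u \<subseteq> pverts G" using EV by (auto simp: nbrs_def)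

lemma fin_nbrs: "finite (nbrs G u)" using nbrs_sub finV by (rule finite_subset)

lemma nbrs_ne: assumes u: "u \<in> pverts G" shows "nbrs G u \<noteq> {}"
proof -
  have "pverts G \<noteq> {u}" using card2 by auto
  then obtain v where v: "v \<in> pverts G" "v \<noteq> u" using u by auto
  then have "(u, v) \<in> (parcs G)\<^sup>*" using conn u by blast
  then obtain w where "(u, w) \<in> parcs G" using v(2) by (metis converse_rtranclE)
  then show ?thesis by (auto simp: nbrs_def)
qed

lemma sum_jump: "u \<in> pverts G \<Longrightarrow> (\<Sum>v\<in>pverts G. jump G u v * h v) = (\<Sum>v\<in>nbrs G u. h v) / real (card (nbrs G u))"
proof -
  assume u: "u \<in> pverts G"
  have "(\<Sum>v\<in>pverts G. jump G u v * h v) = (\<Sum>v\<in>nbrs G u. h v / real (card (nbrs G u)))"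
    using finV nbrs_sub[of u] by (intro sum.mono_neutral_cong_right) (auto simp: jump_def nbrs_def)
  then show ?thesis by (simp add: sum_divide_distrib)
qed

lemma colours_ne: "{..<q} \<noteq> {}"
proof -
  have "0 \<in> {..<q}" using q2 by simp
  then show ?thesis by blast
qed

sublocale gsym "pverts G" "{..<q}" \<theta> "jump G" "parcs G"
proof
  show "{..<q} \<noteq> {}" by (rule colours_ne)
  show "(\<Sum>v\<in>pverts G. jump G u v) = 1" if "u \<in> pverts G" for u
    using sum_jump[OF that, of "\<lambda>_. 1"] nbrs_ne[OF that] fin_nbrs[of u] by (simp add: card_gt_0_iff)
  show "(u, v) \<in> parcs G" if "jump G u v \<noteq> 0" for u v using that by (auto simp: jump_def split: if_splits)
qed (use finV card2 q2 theta0 theta1 EV symE conn in \<open>auto simp: jump_def\<close>)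

lemma configs_eq: "configs G q = pverts G \<rightarrow>\<^sub>E {..<q}" by (simp add: configs_def)

lemma update_expectation:
  assumes u: "u \<in> pverts G"
  shows "measure_pmf.expectation (voter_update G q \<theta> u x) f = Q u f x"
    and "finite (set_pmf (voter_update G q \<theta> u x))"
    and "x \<in> pverts G \<rightarrow>\<^sub>E {..<q} \<Longrightarrow> set_pmf (voter_update G q \<theta> u x) \<subseteq> pverts G \<rightarrow>\<^sub>E {..<q}"
proof -
  have C: "finite {..<q}" "{..<q} \<noteq> {}" using colours_ne by auto
  note N = fin_nbrs[of u] nbrs_ne[OF u]
  define k where "k noise = (if noise then map_pmf (\<lambda>c. x(u := c)) (pmf_of_set {..<q})
       else map_pmf (\<lambda>v. x(u := x v)) (pmf_of_set (nbrs G u)))" for noise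
  have upd: "voter_update G q \<theta> u x = bind_pmf (bernoulli_pmf \<theta>) k" by (simp add: voter_update_def k_def[abs_def])
  have fin: "finite (set_pmf (k b))" for b using C N by (simp add: k_def)
  have "measure_pmf.expectation (voter_update G q \<theta> u x) f = (\<Sum>b\<in>UNIV. pmf (bernoulli_pmf \<theta>) b *\<^sub>R measure_pmf.expectation (k b) f)"
    unfolding upd by (rule pmf_expectation_bind) (use fin in auto)
  also have "\<dots> = \<theta> * measure_pmf.expectation (k True) f + (1 - \<theta>) * measure_pmf.expectation (k False) f"
    using theta0 theta1 by (simp add: UNIV_bool)
  also have "measure_pmf.expectation (k True) f = (\<Sum>c\<in>{..<q}. f (x(u := c))) / real q"
    using C by (simp add: k_def integral_pmf_of_set)
  also have "measure_pmf.expectation (k False) f = (\<Sum>v\<in>pverts G. jump G u v * f (x(u := x v)))"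
    using N by (simp add: k_def integral_pmf_of_set sum_jump[OF u])
  finally show "measure_pmf.expectation (voter_update G q \<theta> u x) f = Q u f x" by (simp add: Q_def fun_upd_def)
  show "finite (set_pmf (voter_update G q \<theta> u x))" unfolding upd using fin by auto
  show "set_pmf (voter_update G q \<theta> u x) \<subseteq> pverts G \<rightarrow>\<^sub>E {..<q}" if x: "x \<in> pverts G \<rightarrow>\<^sub>E {..<q}"
  proof
    fix y assume "y \<in> set_pmf (voter_update G q \<theta> u x)"
    then obtain b where b: "y \<in> set_pmf (k b)" unfolding upd by auto
    then show "y \<in> pverts G \<rightarrow>\<^sub>E {..<q}"
      using x u C N nbrs_sub[of u] by (cases b) (auto simp: k_def PiE_iff extensional_def subset_iff)
  qed
qed

lemma ring_ev:
  assumes \<nu>: "set_pmf \<nu> \<subseteq> pverts G \<rightarrow>\<^sub>E {..<q}"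
  shows "set_pmf (voter_ring G q \<theta> \<nu>) \<subseteq> pverts G \<rightarrow>\<^sub>E {..<q}" and "pexp (voter_ring G q \<theta> \<nu>) f = pexp \<nu> (T f)"
proof -
  have V: "finite (pverts G)" "pverts G \<noteq> {}" using finV card2 by auto
  have fin: "finite (set_pmf \<nu>)" using \<nu> finite_configs by (rule finite_subset)
  define k where "k x = bind_pmf (pmf_of_set (pverts G)) (\<lambda>u. voter_update G q \<theta> u x)" for x
  have ring: "voter_ring G q \<theta> \<nu> = bind_pmf \<nu> k" by (simp add: voter_ring_def k_def[abs_def])
  have fk: "finite (set_pmf (k x))" for x unfolding k_def using V update_expectation(2) by auto
  have ek: "measure_pmf.expectation (k x) f = T f x" for x
  proof -
    have "measure_pmf.expectation (k x) f = (\<Sum>u\<in>pverts G. pmf (pmf_of_set (pverts G)) u *\<^sub>R measure_pmf.expectation (voter_update G q \<theta> u x) f)"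
      unfolding k_def by (rule pmf_expectation_bind) (use V update_expectation(2) in auto)
    then show ?thesis using V by (simp add: update_expectation(1) T_def sum_divide_distrib)
  qed
  show sub: "set_pmf (voter_ring G q \<theta> \<nu>) \<subseteq> pverts G \<rightarrow>\<^sub>E {..<q}"
  proof
    fix y assume "y \<in> set_pmf (voter_ring G q \<theta> \<nu>)"
    then obtain x u where xu: "x \<in> set_pmf \<nu>" "u \<in> pverts G" "y \<in> set_pmf (voter_update G q \<theta> u x)"
      unfolding ring k_def using V by auto
    show "y \<in> pverts G \<rightarrow>\<^sub>E {..<q}"
      by (rule subsetD[OF update_expectation(3)[OF xu(2) subsetD[OF \<nu> xu(1)]] xu(3)])
  qed
  have "pexp (voter_ring G q \<theta> \<nu>) f = measure_pmf.expectation (bind_pmf \<nu> k) f"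
    using pexp_expectation[OF finite_subset[OF sub finite_configs]] by (simp add: ring)
  also have "\<dots> = (\<Sum>x\<in>set_pmf \<nu>. pmf \<nu> x *\<^sub>R measure_pmf.expectation (k x) f)"
    by (rule pmf_expectation_bind) (use fin fk in auto)
  finally show "pexp (voter_ring G q \<theta> \<nu>) f = pexp \<nu> (T f)" by (simp add: ek pexp_def)
qed

lemma ringk_ev:
  assumes \<nu>: "set_pmf \<nu> \<subseteq> pverts G \<rightarrow>\<^sub>E {..<q}"
  shows "set_pmf ((voter_ring G q \<theta> ^^ k) \<nu>) \<subseteq> pverts G \<rightarrow>\<^sub>E {..<q} \<and> pexp ((voter_ring G q \<theta> ^^ k) \<nu>) f = pexp \<nu> ((T ^^ k) f)"
proof (induction k arbitrary: f)
  case (Suc k)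
  have s: "set_pmf ((voter_ring G q \<theta> ^^ k) \<nu>) \<subseteq> pverts G \<rightarrow>\<^sub>E {..<q}" using Suc by blast
  have "pexp ((voter_ring G q \<theta> ^^ Suc k) \<nu>) f = pexp \<nu> ((T ^^ k) (T f))" using ring_ev(2)[OF s] Suc by simp
  then show ?case using ring_ev(1)[OF s] by (simp add: funpow_swap1)
qed (use \<nu> in simp)

text \<open>Bridge from the process to the operator semigroup: the Poisson mixture of pmfs becomes
  \<open>pavg\<close>.\<close>

lemma law_prob:
  assumes \<nu>: "set_pmf \<nu> \<subseteq> pverts G \<rightarrow>\<^sub>E {..<q}" and t: "0 \<le> t"
  shows "measure_pmf.prob (voter_law G q \<theta> \<nu> t) A = pexp \<nu> (S t (\<lambda>x. of_bool (x \<in> A)))"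
proof -
  let ?C = "pverts G \<rightarrow>\<^sub>E {..<q}"
  have sub: "set_pmf (voter_law G q \<theta> \<nu> t) \<subseteq> ?C"
  proof
    fix y assume y: "y \<in> set_pmf (voter_law G q \<theta> \<nu> t)"
    show "y \<in> ?C"
    proof (cases "t = 0")
      case True
      then have "y \<in> set_pmf \<nu>" using y by (simp add: voter_law_def)
      then show ?thesis using \<nu> by (rule rev_subsetD)
    next
      case False
      then obtain k where "y \<in> set_pmf ((voter_ring G q \<theta> ^^ k) \<nu>)" using y by (auto simp: voter_law_def)
      then show ?thesis using conjunct1[OF ringk_ev[OF \<nu>]] by (rule rev_subsetD)
    qed
  qed
  have fin: "finite (set_pmf (voter_law G q \<theta> \<nu> t))" using sub finite_configs by (rule finite_subset)
  have "measure_pmf.prob (voter_law G q \<theta> \<nu> t) A = (\<Sum>y\<in>?C. of_bool (y \<in> A) * pmf (voter_law G q \<theta> \<nu> t) y)"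
    unfolding prob_ev[OF fin] pexp_def using sub finite_configs
    by (subst mult.commute, intro sum.mono_neutral_left) (auto simp: set_pmf_iff)
  also have "\<dots> = (\<Sum>y\<in>?C. of_bool (y \<in> A) * pavg (n * t) (\<lambda>k. pmf ((voter_ring G q \<theta> ^^ k) \<nu>) y))"
    using finV card2 t by (subst pmf_voter_law) (auto simp: pavg_def)
  also have "\<dots> = pavg (n * t) (\<lambda>k. \<Sum>y\<in>?C. of_bool (y \<in> A) * pmf ((voter_ring G q \<theta> ^^ k) \<nu>) y)"
  proof -
    have eg: "egrow (\<lambda>k. pmf ((voter_ring G q \<theta> ^^ k) \<nu>) y)" for y
      by (rule egrow_bounded[of _ 1]) (simp add: pmf_le_1)
    show ?thesis by (simp add: pavg_sum pavg_cmult egrow_cmult eg)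
  qed
  also have "(\<lambda>k. \<Sum>y\<in>?C. of_bool (y \<in> A) * pmf ((voter_ring G q \<theta> ^^ k) \<nu>) y) = (\<lambda>k. pexp \<nu> ((T ^^ k) (\<lambda>x. of_bool (x \<in> A))))"
  proof
    fix k
    have s: "set_pmf ((voter_ring G q \<theta> ^^ k) \<nu>) \<subseteq> ?C" by (rule conjunct1[OF ringk_ev[OF \<nu>]])
    have "(\<Sum>y\<in>?C. of_bool (y \<in> A) * pmf ((voter_ring G q \<theta> ^^ k) \<nu>) y) = pexp ((voter_ring G q \<theta> ^^ k) \<nu>) (\<lambda>x. of_bool (x \<in> A))"
      unfolding pexp_def using s finite_configs
      by (subst mult.commute, intro sum.mono_neutral_right) (auto simp: set_pmf_iff)
    then show "(\<Sum>y\<in>?C. of_bool (y \<in> A) * pmf ((voter_ring G q \<theta> ^^ k) \<nu>) y) = pexp \<nu> ((T ^^ k) (\<lambda>x. of_bool (x \<in> A)))"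
      by (rule trans[OF _ conjunct2[OF ringk_ev[OF \<nu>]]])
  qed
  finally show ?thesis by (simp add: pexp_S)
qed

text \<open>Justifies the definite description in \<open>voter_measure\<close>. Uniqueness: a
  stationary law does not move in time, while \<open>S_stationary\<close> pulls every law on
  configurations to the invariant one.\<close>

lemma measure_stationary:
  "set_pmf (voter_measure G q \<theta>) \<subseteq> pverts G \<rightarrow>\<^sub>E {..<q} \<and> (\<forall>f. bf f \<longrightarrow> pexp (voter_measure G q \<theta>) (T f) = pexp (voter_measure G q \<theta>) f)"
proof -
  obtain \<mu> where \<mu>: "set_pmf \<mu> \<subseteq> pverts G \<rightarrow>\<^sub>E {..<q}" "\<And>f. bf f \<Longrightarrow> pexp \<mu> (T f) = pexp \<mu> f"
    using stationary_exists by blast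
  have fin: "finite (set_pmf \<mu>)" using \<mu>(1) finite_configs by (rule finite_subset)
  have pmf_prob: "pmf p y = measure_pmf.prob p {y}" for p :: "('a \<Rightarrow> nat) pmf" and y
    by (simp add: measure_pmf_single)
  have "voter_stationary G q \<theta> \<mu>" unfolding voter_stationary_def configs_eq
  proof (intro conjI allI impI \<mu>(1) pmf_eqI)
    fix t :: real and y assume t: "0 \<le> t"
    show "pmf (voter_law G q \<theta> \<mu> t) y = pmf \<mu> y"
      unfolding pmf_prob law_prob[OF \<mu>(1) t] prob_ev[OF fin] by (rule stationary_S[OF \<mu>(2) bf_of_bool])
  qed
  moreover have "\<mu>' = \<mu>" if "voter_stationary G q \<theta> \<mu>'" for \<mu>'
  proof (rule pmf_eqI)
    fix y
    have s: "set_pmf \<mu>' \<subseteq> pverts G \<rightarrow>\<^sub>E {..<q}" "\<And>t. 0 \<le> t \<Longrightarrow> voter_law G q \<theta> \<mu>' t = \<mu>'"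
      using that by (auto simp: voter_stationary_def configs_eq)
    have f': "finite (set_pmf \<mu>')" using s(1) finite_configs by (rule finite_subset)
    define f where "f x = (of_bool (x \<in> {y}) :: real)" for x :: "'a \<Rightarrow> nat"
    have b: "bf f" unfolding f_def[abs_def] by (rule bf_of_bool)
    obtain d where d: "osc f d" using bf_osc[OF b] by blast
    have bound: "\<bar>pmf \<mu>' y - pmf \<mu> y\<bar> \<le> exp (- (\<theta> * real k)) * (\<Sum>u\<in>pverts G. d u)" for k
    proof -
      have "pmf \<mu>' y = pexp \<mu>' (S (real k) f)"
        using law_prob[OF s(1), of "real k" "{y}"] s(2)[of "real k"] by (simp only: pmf_prob f_def[abs_def] of_nat_0_le_iff)
      moreover have "pmf \<mu> y = pexp \<mu> f" by (simp only: pmf_prob prob_ev[OF fin] f_def[abs_def])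
      moreover have "\<bar>pexp \<mu>' (S (real k) f) - pexp \<mu> f\<bar> \<le> exp (- (\<theta> * real k)) * (\<Sum>u\<in>pverts G. d u)"
      proof (rule pexp_close[OF f'])
        fix x assume x: "x \<in> set_pmf \<mu>'"
        show "\<bar>S (real k) f x - pexp \<mu> f\<bar> \<le> exp (- (\<theta> * real k)) * (\<Sum>u\<in>pverts G. d u)"
        proof (rule S_stationary[OF \<mu>(2) fin b d])
          fix z u assume "z \<in> set_pmf \<mu>" "u \<notin> pverts G"
          note a = this
          show "x u = z u" unfolding PiE_arb[OF subsetD[OF s(1) x] a(2)] PiE_arb[OF subsetD[OF \<mu>(1) a(1)] a(2)] ..
        next
          show "0 \<le> real k" by (rule of_nat_0_le_iff)
        qed
      qed
      ultimately show ?thesis by simp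
    qed
    have lim: "(\<lambda>k. exp (- (\<theta> * real k)) * (\<Sum>u\<in>pverts G. d u)) \<longlonglongrightarrow> 0"
    proof (rule tendsto_mult_left_zero)
      show "(\<lambda>k. exp (- (\<theta> * real k))) \<longlonglongrightarrow> 0" using theta0 by real_asymp
    qed
    have "\<bar>pmf \<mu>' y - pmf \<mu> y\<bar> \<le> 0"
    proof (rule LIMSEQ_le_const[OF lim], intro exI allI impI)
      fix k show "\<bar>pmf \<mu>' y - pmf \<mu> y\<bar> \<le> exp (- (\<theta> * real k)) * (\<Sum>u\<in>pverts G. d u)" by (rule bound)
    qed
    then show "pmf \<mu>' y = pmf \<mu> y" by simp
  qed
  ultimately have "voter_measure G q \<theta> = \<mu>" unfolding voter_measure_def by (rule the_equality)
  then show ?thesis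
  proof (intro conjI allI impI)
    assume eq: "voter_measure G q \<theta> = \<mu>"
    show "set_pmf (voter_measure G q \<theta>) \<subseteq> pverts G \<rightarrow>\<^sub>E {..<q}" unfolding eq by (rule \<mu>(1))
    fix f :: "('a \<Rightarrow> nat) \<Rightarrow> real" assume "bf f"
    then show "pexp (voter_measure G q \<theta>) (T f) = pexp (voter_measure G q \<theta>) f" unfolding eq by (rule \<mu>(2))
  qed
qed

abbreviation "\<mu>s \<equiv> voter_measure G q \<theta>"

lemma fin_\<mu>s: "finite (set_pmf \<mu>s)"
  using measure_stationary finite_configs by (blast intro: finite_subset)

lemma tv_law_ge:
  assumes "set_pmf \<nu> \<subseteq> pverts G \<rightarrow>\<^sub>E {..<q}" "0 \<le> t"
  shows "pexp \<nu> (S t (\<lambda>x. of_bool (x \<in> A))) - pexp \<mu>s (\<lambda>x. of_bool (x \<in> A)) \<le> tv_dist (voter_law G q \<theta> \<nu> t) \<mu>s"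
  using tv_dist_ge[of "voter_law G q \<theta> \<nu> t" A \<mu>s] by (simp only: law_prob[OF assms] prob_ev[OF fin_\<mu>s])

lemma tv_law_le:
  assumes "set_pmf \<nu> \<subseteq> pverts G \<rightarrow>\<^sub>E {..<q}" "0 \<le> t"
    and "\<And>A. \<bar>pexp \<nu> (S t (\<lambda>x. of_bool (x \<in> A))) - pexp \<mu>s (\<lambda>x. of_bool (x \<in> A))\<bar> \<le> M"
  shows "tv_dist (voter_law G q \<theta> \<nu> t) \<mu>s \<le> M"
  by (rule tv_dist_le) (simp only: law_prob[OF assms(1,2)] prob_ev[OF fin_\<mu>s] assms(3))

lemma rgsym_graph:
  assumes D: "\<And>u. u \<in> pverts G \<Longrightarrow> real (card (nbrs G u)) \<le> D"
  shows "rgsym (pverts G) {..<q} \<theta> (jump G) (parcs G) (\<lambda>u. real (card (nbrs G u))) D \<mu>s"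
proof
  show "1 \<le> real (card (nbrs G u))" if "u \<in> pverts G" for u
    using nbrs_ne[OF that] fin_nbrs[of u] by (simp add: Suc_le_eq card_gt_0_iff)
qed (use D irr measure_stationary in \<open>auto simp: jump_def\<close>)

end

section \<open>Upper bounds for graphs of subexponential growth\<close>

locale growing_voter = voter G q \<theta> for G :: "'a pair_pre_digraph" and q :: nat and \<theta> :: real +
  fixes \<kappa> \<alpha> :: real
  assumes k0: "0 < \<kappa>" and a0: "0 < \<alpha>" and a1: "\<alpha> < 1" and growth: "subexp_growth \<kappa> \<alpha> G"
begin

lemma near_card:
  assumes u: "u \<in> pverts G" and k: "1 \<le> k"
  shows "real (card (near (parcs G) k u \<inter> pverts G)) \<le> \<kappa> * exp (real k powr (1 - \<alpha>))"
proof -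
  have "card (near (parcs G) k u \<inter> pverts G) \<le> card (graph_ball G u (real k))"
    using near_graph_ball[OF pg u] finV by (intro card_mono) (auto simp: graph_ball_def)
  also have "real \<dots> \<le> \<kappa> * exp (real k powr (1 - \<alpha>))"
    using growth u k unfolding subexp_growth_def by simp
  finally show ?thesis by simp
qed

abbreviation "D \<equiv> \<kappa> * exp 1"

text \<open>Neighbours lie in the ball of radius 1, so the growth hypothesis bounds the
  degrees.\<close>

lemma deg_le:
  assumes u: "u \<in> pverts G"
  shows "real (card (nbrs G u)) \<le> D"
proof -
  have "nbrs G u \<subseteq> near (parcs G) 1 u \<inter> pverts G"
    using nbrs_sub[of u] by (auto simp: nbrs_def near_def intro!: exI[of _ "1::nat"])
  then have "card (nbrs G u) \<le> card (near (parcs G) 1 u \<inter> pverts G)"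
    using finV by (intro card_mono) auto
  also have "real \<dots> \<le> D" using near_card[OF u, of 1] by simp
  finally show ?thesis by simp
qed

sublocale rgsym "pverts G" "{..<q}" \<theta> "jump G" "parcs G" "\<lambda>u. real (card (nbrs G u))" D \<mu>s
  by (rule rgsym_graph[OF deg_le])

lemma D_ge1: "1 \<le> D"
proof -
  obtain u where u: "u \<in> pverts G" using card2 by (cases "pverts G = {}") auto
  show ?thesis using g1[OF u] gG[OF u] by linarith
qed

lemma n_ge2: "2 \<le> n" using card2 by simp

text \<open>The late time \<open>t'\<close> stands for infinity: the crude contraction bound
  \<open>n * exp (- (\<theta> * t'))\<close> covers the remaining distance to equilibrium.\<close>

lemma tv_upper:
  assumes \<nu>: "initial j \<nu>" and rd: "1 \<le> rd" and K: "1 \<le> K"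
    and M: "\<And>v. v \<in> pverts G \<Longrightarrow> card (near (parcs G) (4 * rd) v \<inter> pverts G) \<le> M"
    and M1: "1 \<le> M" and t: "0 \<le> t" "t \<le> t'" "1 \<le> t'" and s: "0 \<le> s"
  shows "tv_dist (voter_law G q \<theta> \<nu> (t + s)) \<mu>s \<le>
     sqrt (exp (n * (real q ^ K * (real K ^ j * exp (- (real j * \<theta> * t)))\<^sup>2 / (\<theta> / (real q * exp 1)) ^ K)) - 1)
     + 2 * (exp (- real rd) * exp (8 * t') * n) + n * (exp (- real rd) * exp (2 * s))
     + n * (real K * real M) ^ K * exp (- (real K * \<theta> * s)) + n * exp (- (\<theta> * t'))" (is "_ \<le> ?B + _")
proof (rule tv_law_le[OF initial_set[OF \<nu>]])
  show "0 \<le> t + s" using t s by simp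
  fix A :: "('a \<Rightarrow> nat) set"
  define f where "f x = (of_bool (x \<in> A) :: real)" for x
  have b: "bf f" unfolding f_def[abs_def] by (rule bf_of_bool)
  have fin: "finite (set_pmf \<nu>)" using initial_set[OF \<nu>] finite_configs by (rule finite_subset)
  have d: "osc f (\<lambda>_. 1)" by (auto simp: osc_def f_def)
  have "\<bar>pexp \<nu> (S (t + s) f) - pexp \<nu> (S (t' + s) f)\<bar> \<le> ?B"
    using upper_bound[OF \<nu> rd K M M1 _ _ t s, of f] by (simp add: f_def)
  moreover have "\<bar>pexp \<nu> (S (t' + s) f) - pexp \<mu>s f\<bar> \<le> n * exp (- (\<theta> * t'))"
  proof (rule pexp_close[OF fin])
    fix x assume x: "x \<in> set_pmf \<nu>"
    have "\<bar>S (t' + s) f x - pexp \<mu>s f\<bar> \<le> exp (- (\<theta> * (t' + s))) * (\<Sum>u\<in>pverts G. 1)"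
    proof (rule S_stationary[OF \<mu>T fin_\<mu>s b d])
      fix y u assume yu: "y \<in> set_pmf \<mu>s" "u \<notin> pverts G"
      show "x u = y u"
        unfolding PiE_arb[OF subsetD[OF initial_set[OF \<nu>] x] yu(2)] PiE_arb[OF subsetD[OF \<mu>V yu(1)] yu(2)] ..
    qed (use t s in auto)
    also have "\<dots> \<le> exp (- (\<theta> * t')) * n"
      using theta0 s by (intro mult_mono) auto
    finally show "\<bar>S (t' + s) f x - pexp \<mu>s f\<bar> \<le> n * exp (- (\<theta> * t'))" by (simp add: mult.commute)
  qed
  ultimately have "\<bar>pexp \<nu> (S (t + s) f) - pexp \<mu>s f\<bar> \<le> ?B + n * exp (- (\<theta> * t'))" by linarith
  then show "\<bar>pexp \<nu> (S (t + s) (\<lambda>x. of_bool (x \<in> A))) - pexp \<mu>s (\<lambda>x. of_bool (x \<in> A))\<bar> \<le> ?B + n * exp (- (\<theta> * t'))"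
    by (simp only: f_def[abs_def])
qed

text \<open>The numerical hypotheses are what is left after choosing about \<open>l powr (\<alpha> / 2)\<close> lineages
  to track; they hold for all large \<open>l\<close>.\<close>
lemma tv_upper_log:
  assumes \<nu>: "initial j \<nu>" and l: "l = ln n"
    and k: "k = l powr (\<alpha> / 2)" "1 \<le> k" and s: "s = 2 / \<theta> * l powr (1 - \<alpha> / 2)" and C: "C1 = 16 / \<theta> + 3"
    and Z: "Z = ln \<kappa> + (4 * (C1 * l + 1)) powr (1 - \<alpha>)"
    and e1: "sqrt (exp (exp ((k + 1) * (ln ((real q)\<^sup>2 * exp 1 / \<theta>) + 4) - 2 * \<theta> * s)) - 1) < \<epsilon> / 5"
    and e2: "2 * exp (- (2 * l)) < \<epsilon> / 5" and e3: "exp (l - C1 * l + 2 * s) < \<epsilon> / 5"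
    and e4: "k + 1 + Z - \<theta> * s \<le> 0" "exp (l + k * (k + 1 + Z - \<theta> * s)) < \<epsilon> / 5"
    and e5: "exp (- l) < \<epsilon> / 5" and e6: "l / (2 * \<theta>) + s \<le> 2 * l / \<theta>" "1 \<le> 2 * l / \<theta>"
  shows "tv_dist (voter_law G q \<theta> \<nu> (l / (2 * real j * \<theta>) + 2 * s)) \<mu>s < \<epsilon>"
proof -
  have nl: "n = exp l" using l n_ge2 by simp
  have l0: "0 < l" using e6 theta0 by (simp add: field_simps)
  have s0: "0 \<le> s" using s theta0 by simp
  have j: "j = 1 \<or> j = 2" using \<nu> by (auto simp: initial_def)
  have C10: "0 < C1" using C theta0 by (simp add: add_pos_pos)
  define t where "t = l / (2 * real j * \<theta>) + s"
  define K where "K = nat \<lceil>k\<rceil>"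
  \<comment> \<open>With \<open>C1 = 16 / \<theta> + 3\<close>, \<open>exp (- rd)\<close> beats both
    \<open>n\<close> and \<open>exp (8 * t')\<close> at the late time
    \<open>t' = 2 * l / \<theta>\<close> and leaves \<open>exp (- (2 * l))\<close>.\<close>
  define rd where "rd = nat \<lceil>C1 * l\<rceil>"
  define M where "M = nat \<lfloor>\<kappa> * exp (real (4 * rd) powr (1 - \<alpha>))\<rfloor>"
  have K1: "1 \<le> K" "k \<le> real K" "real K \<le> k + 1" using k(2) unfolding K_def by linarith+
  have rdr: "C1 * l \<le> real rd" "real rd \<le> C1 * l + 1" using C10 l0 unfolding rd_def by (auto intro: of_nat_ceiling)
  have rd1: "1 \<le> rd" using rdr(1) mult_pos_pos[OF C10 l0] by (cases rd) auto
  have Mb: "card (near (parcs G) (4 * rd) v \<inter> pverts G) \<le> M" if v: "v \<in> pverts G" for v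
    using near_card[OF v, of "4 * rd"] rd1 unfolding M_def by (simp add: le_nat_floor)
  obtain u where u: "u \<in> pverts G" using card2 by (cases "pverts G = {}") auto
  have "0 < card (near (parcs G) (4 * rd) u \<inter> pverts G)"
    using near_refl[of u] u finV by (auto simp: card_gt_0_iff)
  then have M1: "1 \<le> M" using Mb[OF u] by simp
  have "real M \<le> \<kappa> * exp (real (4 * rd) powr (1 - \<alpha>))" unfolding M_def using k0 by simp
  then have "ln (real M) \<le> ln (\<kappa> * exp (real (4 * rd) powr (1 - \<alpha>)))" using M1 k0 by (subst ln_le_cancel_iff) auto
  also have "\<dots> = ln \<kappa> + real (4 * rd) powr (1 - \<alpha>)" using k0 by (simp add: ln_mult)
  also have "\<dots> \<le> Z" unfolding Z using rdr(2) a1 by (intro add_left_mono powr_mono2) auto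
  finally have lM: "ln (real M) \<le> Z" .
  have lK: "0 \<le> ln (real K)" "ln (real K) \<le> k + 1"
    using K1 ln_le_minus_one[of "real K"] by auto
  have tt: "t \<le> 2 * l / \<theta>"
  proof -
    have "l / (2 * real j * \<theta>) \<le> l / (2 * \<theta>)" using j l0 theta0 by (auto simp: field_simps)
    then show ?thesis using e6(1) unfolding t_def by linarith
  qed
  have t0: "0 \<le> t" unfolding t_def using l0 theta0 s0 by (intro add_nonneg_nonneg) auto
  define T1 where "T1 = n * (real q ^ K * (real K ^ j * exp (- (real j * \<theta> * t)))\<^sup>2 / (\<theta> / (real q * exp 1)) ^ K)"
  define A where "A = (real q)\<^sup>2 * exp 1 / \<theta>"
  have A1: "1 < A"
  proof -
    have "\<theta> < 4" using theta1 by simp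
    also have "(4::real) \<le> (real q)\<^sup>2 * 1" using q2 power_mono[of 2 "real q" 2] by simp
    also have "\<dots> \<le> (real q)\<^sup>2 * exp 1" by (intro mult_left_mono) auto
    finally show ?thesis unfolding A_def using theta0 by simp
  qed
  \<comment> \<open>At \<open>t = l / (2 * j * \<theta>) + s\<close> the factor \<open>n\<close> is
    used up exactly and \<open>exp (- (2 * j * \<theta> * s))\<close> is left to pay for
    \<open>A ^ K\<close> and the powers of \<open>K\<close>; since \<open>ln K \<le> k + 1\<close>
    and \<open>j \<le> 2\<close>, these cost at most \<open>(k + 1) * (ln A + 4)\<close> in the
    exponent.\<close>
  have T1: "T1 \<le> exp ((k + 1) * (ln A + 4) - 2 * \<theta> * s)"
  proof -
    have "T1 = (n * exp (- (2 * real j * \<theta> * t))) * (real q ^ K / (\<theta> / (real q * exp 1)) ^ K) * (real K ^ j)\<^sup>2"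
      unfolding T1_def by (simp add: power_mult_distrib exp_double[symmetric] mult_ac)
    also have "real q ^ K / (\<theta> / (real q * exp 1)) ^ K = A ^ K"
      unfolding power_divide[symmetric] A_def by (simp add: power2_eq_square mult_ac)
    also have "A ^ K = exp (real K * ln A)" using A1 by (simp add: exp_of_nat_mult)
    also have "real K ^ j = exp (real j * ln (real K))" using K1 by (simp add: exp_of_nat_mult)
    also have "n * exp (- (2 * real j * \<theta> * t)) = exp (- (2 * real j * \<theta> * s))"
      unfolding nl exp_add[symmetric] t_def using theta0 j by (auto simp: field_simps)
    also have "exp (- (2 * real j * \<theta> * s)) * exp (real K * ln A) * (exp (real j * ln (real K)))\<^sup>2
       = exp (real K * ln A + 2 * real j * ln (real K) - 2 * real j * \<theta> * s)"
      by (simp add: exp_add[symmetric] exp_double[symmetric] algebra_simps)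
    also have "\<dots> \<le> exp ((k + 1) * (ln A + 4) - 2 * \<theta> * s)"
    proof -
      have "real K * ln A \<le> (k + 1) * ln A" using K1 A1 by (intro mult_right_mono) auto
      moreover have "2 * real j * ln (real K) \<le> 4 * (k + 1)"
        using j lK k(2) by auto
      moreover have "2 * \<theta> * s \<le> 2 * real j * \<theta> * s" using j s0 theta0 by auto
      ultimately show ?thesis by (simp add: algebra_simps)
    qed
    finally show ?thesis .
  qed
  have E1: "sqrt (exp T1 - 1) < \<epsilon> / 5"
    by (rule le_less_trans[OF _ e1]) (use T1 in \<open>simp add: A_def\<close>)
  have E2: "2 * (exp (- real rd) * exp (8 * (2 * l / \<theta>)) * n) < \<epsilon> / 5"
  proof (rule le_less_trans[OF _ e2])
    have "exp (- real rd) * exp (8 * (2 * l / \<theta>)) * n = exp (- real rd + 8 * (2 * l / \<theta>) + l)"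
      unfolding nl by (simp only: exp_add)
    also have "\<dots> \<le> exp (- (2 * l))" using rdr(1) unfolding C by (simp add: algebra_simps)
    finally show "2 * (exp (- real rd) * exp (8 * (2 * l / \<theta>)) * n) \<le> 2 * exp (- (2 * l))" by simp
  qed
  have E3: "n * (exp (- real rd) * exp (2 * s)) < \<epsilon> / 5"
    by (rule le_less_trans[OF _ e3]) (use rdr(1) in \<open>simp add: nl exp_add[symmetric]\<close>)
  \<comment> \<open>Each of the \<open>K\<close> survivors costs \<open>ln K + ln M\<close> in
    entropy and gains \<open>\<theta> * s\<close>; the balance is bounded by a quantity that is not
    positive, so \<open>K\<close> may then be replaced by the smaller \<open>k\<close>.\<close>
  have E4: "n * (real K * real M) ^ K * exp (- (real K * \<theta> * s)) < \<epsilon> / 5"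
  proof (rule le_less_trans[OF _ e4(2)])
    have "real K * real M = exp (ln (real K) + ln (real M))" using K1 M1 by (simp add: exp_add)
    then have "(real K * real M) ^ K = exp (real K * (ln (real K) + ln (real M)))" by (simp only: exp_of_nat_mult)
    then have "n * (real K * real M) ^ K * exp (- (real K * \<theta> * s)) = exp (l + real K * (ln (real K) + ln (real M) - \<theta> * s))"
      unfolding nl by (simp add: exp_add[symmetric] algebra_simps)
    also have "\<dots> \<le> exp (l + k * (k + 1 + Z - \<theta> * s))"
    proof -
      have "real K * (ln (real K) + ln (real M) - \<theta> * s) \<le> real K * (k + 1 + Z - \<theta> * s)"
        using lK lM by (intro mult_left_mono) auto
      also have "\<dots> \<le> k * (k + 1 + Z - \<theta> * s)" using K1(2) e4(1) by (rule mult_right_mono_neg)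
      finally show ?thesis by simp
    qed
    finally show "n * (real K * real M) ^ K * exp (- (real K * \<theta> * s)) \<le> exp (l + k * (k + 1 + Z - \<theta> * s))" .
  qed
  have E5: "n * exp (- (\<theta> * (2 * l / \<theta>))) < \<epsilon> / 5"
    by (rule le_less_trans[OF _ e5]) (use theta0 in \<open>simp add: nl exp_add[symmetric]\<close>)
  have ts: "l / (2 * real j * \<theta>) + 2 * s = t + s" by (simp add: t_def)
  have "tv_dist (voter_law G q \<theta> \<nu> (t + s)) \<mu>s \<le> sqrt (exp T1 - 1)
     + 2 * (exp (- real rd) * exp (8 * (2 * l / \<theta>)) * n) + n * (exp (- real rd) * exp (2 * s))
     + n * (real K * real M) ^ K * exp (- (real K * \<theta> * s)) + n * exp (- (\<theta> * (2 * l / \<theta>)))"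
    unfolding T1_def by (rule tv_upper[OF \<nu> rd1 K1(1) _ M1 t0 tt e6(2) s0]) (rule Mb)
  then show ?thesis unfolding ts using E1 E2 E3 E4 E5 by linarith
qed

section \<open>Lower bounds for graphs of subexponential growth\<close>

text \<open>By connectedness an arc leaves every ball that does not exhaust the graph, so the ball
  gains a site per unit of radius. This bounds the number of pairs below by
  \<open>n * r\<close>.\<close>

lemma near_grows:
  assumes u: "u \<in> pverts G"
  shows "min (r + 1) (card (pverts G)) \<le> card (near (parcs G) r u \<inter> pverts G)"
proof (induction r)
  case 0
  have "card {u} \<le> card (near (parcs G) 0 u \<inter> pverts G)"
    using finV u near_refl[of u] by (intro card_mono) auto
  then show ?case by simp
next
  case (Suc r)
  have sub: "near (parcs G) r u \<subseteq> near (parcs G) (Suc r) u" by (rule near_mono) simp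
  show ?case
  proof (cases "near (parcs G) r u \<inter> pverts G = pverts G")
    case True
    then have "near (parcs G) (Suc r) u \<inter> pverts G = pverts G" using sub by blast
    then show ?thesis by simp
  next
    case False
    then obtain v where v: "v \<in> pverts G" "v \<notin> near (parcs G) r u" by blast
    have "\<exists>a b. a \<in> near (parcs G) r u \<and> b \<notin> near (parcs G) r u \<and> (a, b) \<in> parcs G"
    proof (rule ccontr)
      assume no: "\<not> ?thesis"
      have "(u, v) \<in> (parcs G)\<^sup>*" by (rule conn[OF u v(1)])
      then have "v \<in> near (parcs G) r u"
      proof (induction rule: rtrancl_induct)
        case base
        show ?case by (rule near_refl)
      next
        case (step y z)
        then show ?case using no by blast
      qed
      with v show False by simp
    qed
    then obtain a b where ab: "a \<in> near (parcs G) r u" "b \<notin> near (parcs G) r u" "(a, b) \<in> parcs G" by blast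
    obtain k where k: "k \<le> r" "(u, a) \<in> parcs G ^^ k" using ab(1) by (auto simp: near_def)
    have "(u, b) \<in> parcs G ^^ Suc k" using k(2) ab(3) by auto
    then have "b \<in> near (parcs G) (Suc r) u" using k(1) unfolding near_def by (intro CollectI exI[of _ "Suc k"]) auto
    then have "card (insert b (near (parcs G) r u \<inter> pverts G)) \<le> card (near (parcs G) (Suc r) u \<inter> pverts G)"
      using finV sub ab(3) EV by (intro card_mono) auto
    moreover have "card (insert b (near (parcs G) r u \<inter> pverts G)) = Suc (card (near (parcs G) r u \<inter> pverts G))"
      using finV ab(2) by (intro card_insert_disjoint) auto
    ultimately show ?thesis using Suc by linarith
  qed
qed

definition pairs :: "nat \<Rightarrow> ('a \<times> 'a) set" where
  "pairs r = {(u, v). u \<in> pverts G \<and> v \<in> pverts G \<and> u \<noteq> v \<and> v \<in> near (parcs G) r u}"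

lemma finite_pairs: "finite (pairs r)"
  by (rule finite_subset[of _ "pverts G \<times> pverts G"]) (use finV in \<open>auto simp: pairs_def\<close>)

lemma pairs_mono: "r \<le> r' \<Longrightarrow> pairs r \<subseteq> pairs r'"
  unfolding pairs_def by (auto intro: subsetD[OF near_mono])

lemma card_pairs: "card (pairs r) = (\<Sum>u\<in>pverts G. card (near (parcs G) r u \<inter> pverts G) - 1)"
proof -
  have "pairs r = Sigma (pverts G) (\<lambda>u. (near (parcs G) r u \<inter> pverts G) - {u})" by (auto simp: pairs_def)
  then have "card (pairs r) = (\<Sum>u\<in>pverts G. card ((near (parcs G) r u \<inter> pverts G) - {u}))"
    using finV by simp
  also have "\<dots> = (\<Sum>u\<in>pverts G. card (near (parcs G) r u \<inter> pverts G) - 1)"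
    using near_refl by (intro sum.cong refl card_Diff_singleton) auto
  finally show ?thesis .
qed

lemma pairs_ge:
  assumes "r + 1 \<le> card (pverts G)"
  shows "n * real r \<le> real (card (pairs r))"
proof -
  have "(\<Sum>u\<in>pverts G. r) \<le> card (pairs r)"
    unfolding card_pairs
  proof (rule sum_mono)
    fix u assume "u \<in> pverts G"
    then show "r \<le> card (near (parcs G) r u \<inter> pverts G) - 1" using near_grows[of u r] assms by linarith
  qed
  then have "real (card (pverts G) * r) \<le> real (card (pairs r))" by (simp only: sum_constant of_nat_id of_nat_le_iff)
  then show ?thesis by simp
qed

lemma pairs_le:
  assumes "1 \<le> r"
  shows "real (card (pairs r)) \<le> n * (\<kappa> * exp (real r powr (1 - \<alpha>)))"
proof -
  have "real (card (pairs r)) \<le> (\<Sum>u\<in>pverts G. \<kappa> * exp (real r powr (1 - \<alpha>)))"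
    unfolding card_pairs of_nat_sum
  proof (rule sum_mono)
    fix u assume "u \<in> pverts G"
    then show "real (card (near (parcs G) r u \<inter> pverts G) - 1) \<le> \<kappa> * exp (real r powr (1 - \<alpha>))"
      using near_card[of u r] assms by linarith
  qed
  then show ?thesis by simp
qed

text \<open>Subexponential growth forces a scale at which the sphere is a small part of the ball.\<close>
lemma good_radius:
  assumes m: "1 \<le> m" "m + 1 \<le> card (pverts G)" and small: "\<kappa> * exp (- (real m powr (1 - \<alpha>))) < 1"
  shows "\<exists>r. m < r \<and> r \<le> 2 * m \<and>
    real (card (pairs r - pairs (r - 1))) \<le> 3 * real m powr (- \<alpha>) * real (card (pairs r))"
proof (rule ccontr)
  assume no: "\<not> ?thesis"
  \<comment> \<open>If every radius above \<open>m\<close> and up to \<open>2 * m\<close> failed,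
    \<open>pairs\<close> would grow by
    \<open>exp (m * \<delta>) = exp (3 * m powr (1 - \<alpha>))\<close>, whereas the growth
    hypothesis allows at most \<open>2 * m powr (1 - \<alpha>)\<close> in the exponent; hence the
    factor 3.\<close>
  define \<delta> where "\<delta> = 3 * real m powr (- \<alpha>)"
  have step: "real (card (pairs (r - 1))) \<le> exp (- \<delta>) * real (card (pairs r))" if r: "m < r" "r \<le> 2 * m" for r
  proof -
    have "card (pairs r - pairs (r - 1)) = card (pairs r) - card (pairs (r - 1))"
      by (rule card_Diff_subset[OF finite_pairs pairs_mono]) simp
    moreover have "card (pairs (r - 1)) \<le> card (pairs r)"
      by (rule card_mono[OF finite_pairs pairs_mono]) simp
    ultimately have "real (card (pairs r)) - real (card (pairs (r - 1))) > \<delta> * real (card (pairs r))"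
      using no r unfolding \<delta>_def by (auto simp: of_nat_diff not_le)
    then have "real (card (pairs (r - 1))) \<le> (1 - \<delta>) * real (card (pairs r))" by (simp add: algebra_simps)
    also have "\<dots> \<le> exp (- \<delta>) * real (card (pairs r))"
      using exp_ge_add_one_self[of "- \<delta>"] by (intro mult_right_mono) auto
    finally show ?thesis .
  qed
  have iter: "real (card (pairs m)) \<le> exp (- (real i * \<delta>)) * real (card (pairs (m + i)))" if "i \<le> m" for i
    using that
  proof (induction i)
    case (Suc i)
    have "real (card (pairs m)) \<le> exp (- (real i * \<delta>)) * real (card (pairs (m + i)))" using Suc by simp
    also have "\<dots> \<le> exp (- (real i * \<delta>)) * (exp (- \<delta>) * real (card (pairs (m + Suc i))))"
      using step[of "m + Suc i"] Suc.prems by (intro mult_left_mono) auto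
    also have "\<dots> = exp (- (real (Suc i) * \<delta>)) * real (card (pairs (m + Suc i)))"
      by (simp add: exp_add[symmetric] mult.assoc[symmetric] algebra_simps)
    finally show ?case .
  qed simp
  have m0: "0 < real m" using m by simp
  have "n * 1 \<le> n * real m" using m by (intro mult_left_mono) auto
  also have "\<dots> \<le> real (card (pairs m))" by (rule pairs_ge[OF m(2)])
  also have "\<dots> \<le> exp (- (real m * \<delta>)) * real (card (pairs (m + m)))" by (rule iter) simp
  also have "\<dots> \<le> exp (- (real m * \<delta>)) * (n * (\<kappa> * exp (real (m + m) powr (1 - \<alpha>))))"
    using m by (intro mult_left_mono pairs_le) auto
  also have "\<dots> = n * (\<kappa> * exp (real (m + m) powr (1 - \<alpha>) - real m * \<delta>))"
    by (simp add: exp_diff exp_minus field_simps)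
  also have "\<dots> \<le> n * (\<kappa> * exp (- (real m powr (1 - \<alpha>))))"
  proof -
    have "real (m + m) powr (1 - \<alpha>) = 2 powr (1 - \<alpha>) * real m powr (1 - \<alpha>)"
      using m0 by (simp add: powr_mult[symmetric])
    also have "\<dots> \<le> 2 powr 1 * real m powr (1 - \<alpha>)" using a0 by (intro mult_right_mono powr_mono) auto
    finally have "real (m + m) powr (1 - \<alpha>) \<le> 2 * real m powr (1 - \<alpha>)" by simp
    moreover have "real m * \<delta> = 3 * real m powr (1 - \<alpha>)"
      using m0 by (simp add: \<delta>_def powr_diff powr_minus field_simps)
    ultimately show ?thesis using k0 by (intro mult_left_mono) auto
  qed
  also have "\<dots> < n * 1" using small n_ge2 by (intro mult_strict_left_mono) auto
  finally show False by simp
qed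

lemma card_arcs: "real (card (parcs G)) \<le> n * D"
proof -
  have "parcs G = Sigma (pverts G) (nbrs G)" using EV by (auto simp: nbrs_def)
  then have "card (parcs G) = (\<Sum>u\<in>pverts G. card (nbrs G u))" using finV fin_nbrs by simp
  then have "real (card (parcs G)) = (\<Sum>u\<in>pverts G. real (card (nbrs G u)))" by simp
  also have "\<dots> \<le> (\<Sum>u\<in>pverts G. D)" by (intro sum_mono deg_le)
  finally show ?thesis by simp
qed

text \<open>Before the cut-off by the window \<open>l powr (1 - \<alpha> / 2)\<close>, the quantity
  \<open>n * exp (- (2 * \<theta> * t))\<close> is at least the exponential of
  \<open>2 * \<theta>\<close> times the window and beats the variance factor of order
  \<open>l\<close>.\<close>

lemma tv_lower_agree:
  assumes x0: "x0 \<in> pverts G \<rightarrow>\<^sub>E {..<q}" and mono: "\<theta> = 1 \<or> (\<exists>c. \<forall>v\<in>pverts G. x0 v = c)"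
    and l: "l = ln n" and t: "0 \<le> t" "t \<le> l / (2 * \<theta>) - l powr (1 - \<alpha> / 2)"
    and e: "16 * (2 * D / \<theta> + D + l / \<theta> + 2) * exp (- (2 * \<theta> * l powr (1 - \<alpha> / 2))) < 1 - \<epsilon>"
  shows "\<epsilon> < tv_dist (voter_law G q \<theta> (return_pmf x0) t) \<mu>s"
proof -
  have nl: "n = exp l" using l n_ge2 by simp
  obtain P where P: "1 - 16 * ((2 * D / \<theta> + D + 2 * t + 2)) / (n * exp (- (2 * \<theta> * t)))
     \<le> S t (\<lambda>x. of_bool (x \<in> P)) x0 - pexp \<mu>s (\<lambda>x. of_bool (x \<in> P))"
    using lower_agree[OF x0 mono _ t(1)] q2 by auto
  have s: "set_pmf (return_pmf x0) \<subseteq> pverts G \<rightarrow>\<^sub>E {..<q}" using x0 by simp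
  have 1: "S t (\<lambda>x. of_bool (x \<in> P)) x0 - pexp \<mu>s (\<lambda>x. of_bool (x \<in> P)) \<le> tv_dist (voter_law G q \<theta> (return_pmf x0) t) \<mu>s"
    using tv_law_ge[OF s t(1), of P] by simp
  have up: "0 \<le> l powr (1 - \<alpha> / 2)" by simp
  have "2 * t \<le> 2 * (l / (2 * \<theta>))" using t(2) up by (intro mult_left_mono) linarith+
  then have 2: "16 * (2 * D / \<theta> + D + 2 * t + 2) \<le> 16 * (2 * D / \<theta> + D + l / \<theta> + 2)" by simp
  have 3: "2 * \<theta> * l powr (1 - \<alpha> / 2) \<le> l - 2 * \<theta> * t"
    using mult_left_mono[OF t(2), of "2 * \<theta>"] theta0 by (simp add: right_diff_distrib)
  have W0: "0 \<le> 16 * (2 * D / \<theta> + D + 2 * t + 2)" using theta0 k0 t(1) by simp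
  have "16 * ((2 * D / \<theta> + D + 2 * t + 2)) / (n * exp (- (2 * \<theta> * t)))
    = 16 * (2 * D / \<theta> + D + 2 * t + 2) * exp (- (l - 2 * \<theta> * t))"
    unfolding nl exp_add[symmetric] by (simp only: exp_minus divide_inverse) simp
  also have "\<dots> \<le> 16 * (2 * D / \<theta> + D + l / \<theta> + 2) * exp (- (2 * \<theta> * l powr (1 - \<alpha> / 2)))"
    using 2 3 W0 by (intro mult_mono) auto
  finally show ?thesis using e P 1 by linarith
qed

text \<open>Dichotomy in the total squared bias \<open>B\<close>: if it reaches
  \<open>l\<^sup>2\<close>, it beats the variance factor of order \<open>l\<close> in
  \<open>lower_single\<close>; otherwise it is too small to spoil \<open>lower_pair\<close>.
  \<open>C3\<close> collects the exponents lost in the second case: the boundary term,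
  \<open>c1\<close> per unit of radius, and 6 for the ball sizes with a margin.\<close>

lemma tv_lower_log:
  assumes \<nu>: "goodinit (pverts G) \<nu>" "set_pmf \<nu> \<subseteq> pverts G \<rightarrow>\<^sub>E {..<q}" and th: "\<theta> < 1"
    and l: "l = ln n" "1 \<le> l" and c1: "c1 = ln (2 * D / (1 - \<theta>))"
    and C3: "C3 = (D\<^sup>2 * (3 + D) / \<theta> + 4 * c1 + 6) / (4 * \<theta>)"
    and t: "0 \<le> t" "t \<le> l / (4 * \<theta>) - C3 * l powr (1 - \<alpha> / 2)"
    and W: "W = 2 * D / \<theta> + D + l / (2 * \<theta>) + 2"
    and e1: "256 * W * D ^ 4 * \<kappa>\<^sup>2 * exp (4 + 4 * c1 - 2 * sqrt l) < 1 - \<epsilon>"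
    and e2: "2 * D\<^sup>2 * \<kappa> * exp (2 * sqrt l + 2) * l\<^sup>2 \<le> exp (l / 2)"
    and e3: "4 * W * real q / l\<^sup>2 < 1 - \<epsilon>"
    and e4: "\<kappa> * exp (- (sqrt l powr (1 - \<alpha>))) < 1" "sqrt l + 2 \<le> exp l"
    and e5: "2 \<le> 6 * sqrt l - 4 * c1"
  shows "\<epsilon> < tv_dist (voter_law G q \<theta> \<nu> t) \<mu>s"
proof -
  have nl: "n = exp l" using l n_ge2 by simp
  have D1: "1 \<le> D" by (rule D_ge1)
  define u where "u = l powr (1 - \<alpha> / 2)"
  have u: "sqrt l \<le> u" unfolding u_def using l(2) a1 by (simp add: powr_half_sqrt[symmetric] powr_mono)
  have sl: "1 \<le> sqrt l" using l(2) by simp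
  have th': "(1 - \<theta>) \<le> 2 * D" using D1 theta0 by linarith
  have c10: "0 \<le> c1" unfolding c1 using th th' by (intro ln_ge_zero) (simp add: field_simps)
  have C30: "0 \<le> C3" unfolding C3 using theta0 D1 less_imp_le[OF k0] k0 c10 by (intro divide_nonneg_nonneg add_nonneg_nonneg mult_nonneg_nonneg) auto
  have tl: "t \<le> l / (4 * \<theta>)" using t(2) mult_nonneg_nonneg[OF C30, of u] u sl unfolding u_def by linarith
  define W' where "W' = 2 * D / \<theta> + D + 2 * t + 2"
  have W': "0 \<le> W'" "W' \<le> W" unfolding W'_def W using theta0 D1 less_imp_le[OF k0] t(1) tl by (auto intro!: add_nonneg_nonneg)
  define B where "B = (\<Sum>v\<in>pverts G. \<Sum>c\<in>{..<q}. (pexp \<nu> (S t (site c v)))\<^sup>2)"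
  have B0: "0 \<le> B" unfolding B_def by (intro sum_nonneg) auto
  have l2: "0 < l\<^sup>2" using l(2) by simp
  show ?thesis
  proof (cases "l\<^sup>2 \<le> B")
    case True
    then have Bp: "0 < B" using l2 by linarith
    obtain P where P: "1 - 4 * (W' * real q) / B \<le> pexp \<nu> (S t (\<lambda>x. of_bool (x \<in> P))) - pexp \<mu>s (\<lambda>x. of_bool (x \<in> P))"
      using lower_single[OF \<nu> t(1) B_def Bp] unfolding W'_def by auto
    have "4 * (W' * real q) / B \<le> 4 * (W * real q) / l\<^sup>2"
      using W' True l2 by (intro frac_le mult_left_mono mult_right_mono mult_nonneg_nonneg) auto
    then show ?thesis using e3 P tv_law_ge[OF \<nu>(2) t(1), of P] by (simp add: mult.assoc)
  next
    case False
    \<comment> \<open>A radius of order \<open>sqrt l\<close> keeps balls below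
      \<open>\<kappa> * exp (2 * sqrt l + 2)\<close>, subpolynomial in \<open>n\<close>, yet makes
      the boundary fraction of order \<open>l powr (- (\<alpha> / 2))\<close>.\<close>
    define m where "m = nat \<lceil>sqrt l\<rceil>"
    have m: "1 \<le> m" "sqrt l \<le> real m" "real m \<le> sqrt l + 1" using sl unfolding m_def by linarith+
    have "real (m + 1) \<le> n" unfolding nl using m(3) e4(2) by simp
    then have mn: "m + 1 \<le> card (pverts G)" by simp
    have "sqrt l powr (1 - \<alpha>) \<le> real m powr (1 - \<alpha>)" using m(2) sl a1 by (intro powr_mono2) auto
    then have "\<kappa> * exp (- (real m powr (1 - \<alpha>))) \<le> \<kappa> * exp (- (sqrt l powr (1 - \<alpha>)))"
      using k0 by (intro mult_left_mono) auto
    then have small: "\<kappa> * exp (- (real m powr (1 - \<alpha>))) < 1" using e4(1) by linarith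
    obtain r where r: "m < r" "r \<le> 2 * m"
      and sph: "real (card (pairs r - pairs (r - 1))) \<le> 3 * real m powr (- \<alpha>) * real (card (pairs r))"
      using good_radius[OF m(1) mn small] by blast
    have r1: "1 \<le> r" and rs: "real r \<le> 2 * sqrt l + 2" using r m(1,3) by linarith+
    define N where "N = real (card (pairs r))"
    have "n * real m \<le> real (card (pairs m))" by (rule pairs_ge[OF mn])
    also have "\<dots> \<le> N" unfolding N_def using card_mono[OF finite_pairs pairs_mono, of m r] r(1) by simp
    finally have Nm: "n * real m \<le> N" .
    have "n * 1 \<le> n * real m" using m(1) by (intro mult_left_mono) auto
    then have Nn: "n \<le> N" using Nm by simp
    have N0: "0 < N" using Nn n_ge2 by linarith
    have ne: "pairs r \<noteq> {}" using N0 unfolding N_def by auto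
    define \<beta> where "\<beta> = (3 + D) * real m powr (- \<alpha>)"
    have m0: "0 < real m" using m(1) by simp
    \<comment> \<open>Adjacent pairs also count as boundary; there are at most \<open>n * D\<close>
      of them, against at least \<open>n * m\<close> pairs in all.\<close>
    have arcs: "real (card (parcs G)) \<le> D * real m powr (- \<alpha>) * N"
    proof -
      have "real (card (parcs G)) \<le> n * D" by (rule card_arcs)
      also have "\<dots> = D * (real m powr (- 1)) * (n * real m)" using m0 by (simp add: powr_minus field_simps)
      also have "\<dots> \<le> D * real m powr (- \<alpha>) * N"
        using Nm D1 less_imp_le[OF k0] a1 m(1) n_ge2 by (intro mult_mono powr_mono mult_left_mono mult_nonneg_nonneg) auto
      finally show ?thesis .
    qed
    have \<beta>: "real (card (pairs r - pairs (r - 1))) + real (card (parcs G)) \<le> \<beta> * real (card (pairs r))"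
      using sph arcs unfolding \<beta>_def N_def by (simp add: algebra_simps)
    define M where "M = nat \<lfloor>\<kappa> * exp (real r powr (1 - \<alpha>))\<rfloor>"
    have Mb: "card (near (parcs G) r v \<inter> pverts G) \<le> M" if v: "v \<in> pverts G" for v
      using near_card[OF v r1] unfolding M_def by (simp add: le_nat_floor)
    have "real M \<le> \<kappa> * exp (real r powr (1 - \<alpha>))" unfolding M_def using k0 by simp
    also have "\<dots> \<le> \<kappa> * exp (2 * sqrt l + 2)"
    proof -
      have "real r powr (1 - \<alpha>) \<le> real r powr 1" using r1 a0 by (intro powr_mono) auto
      then have "real r powr (1 - \<alpha>) \<le> 2 * sqrt l + 2" using rs r1 by simp
      then show ?thesis using k0 by (intro mult_left_mono) auto
    qed
    finally have M: "real M \<le> \<kappa> * exp (2 * sqrt l + 2)" .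
    \<comment> \<open>The deficit per pair is at least \<open>exp (- y) / 2\<close>:
      \<open>r * c1\<close> is the price of the equilibrium correlation at distance
      \<open>r\<close>, the rest is decay up to time \<open>t\<close>.\<close>
    define y where "y = real r * c1 + (2 * \<theta> + 2 * D\<^sup>2 * \<beta>) * t"
    define X where "X = (1 - 1 / real q) * ((1 - \<theta>) / (2 * D)) ^ r * exp (- ((2 * \<theta> + 2 * D\<^sup>2 * \<beta>) * t))"
    have X: "1 / 2 * exp (- y) \<le> X"
    proof -
      have "((1 - \<theta>) / (2 * D)) = exp (- c1)" using th D1 less_imp_le[OF k0] unfolding c1 exp_minus by (subst exp_ln) (auto simp: field_simps)
      then have "((1 - \<theta>) / (2 * D)) ^ r = exp (- (real r * c1))" using exp_of_nat_mult[of r "- c1"] by simp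
      then have "X = (1 - 1 / real q) * exp (- y)" unfolding X_def y_def by (simp add: exp_add[symmetric] mult.assoc)
      moreover have "1 / 2 \<le> 1 - 1 / real q" using q2 by (simp add: field_simps)
      ultimately show ?thesis by simp
    qed
    \<comment> \<open>Up to the constant \<open>4 * c1\<close> each loss is at most a multiple of
      \<open>u\<close>, since \<open>sqrt l \<le> u\<close> and \<open>\<beta> * t\<close> is of
      order \<open>u\<close>; \<open>C3\<close> is chosen to pay for their sum.\<close>
    have y: "6 * sqrt l - 4 * c1 \<le> l - 2 * y"
    proof -
      have a: "4 * \<theta> * t \<le> l - 4 * \<theta> * C3 * u"
        using mult_left_mono[OF t(2), of "4 * \<theta>"] theta0 unfolding u_def by (simp add: right_diff_distrib mult.assoc)
      have b: "4 * D\<^sup>2 * \<beta> * t \<le> D\<^sup>2 * (3 + D) / \<theta> * u"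
      proof -
        have "real m powr (- \<alpha>) \<le> sqrt l powr (- \<alpha>)" using m(2) sl a0 by (intro powr_mono2') auto
        also have "\<dots> = l powr (- \<alpha> / 2)" using l(2) by (simp add: powr_half_sqrt[symmetric] powr_powr)
        finally have "\<beta> \<le> (3 + D) * l powr (- \<alpha> / 2)" unfolding \<beta>_def using D1 by (intro mult_left_mono) auto
        then have "4 * D\<^sup>2 * \<beta> * t \<le> 4 * D\<^sup>2 * ((3 + D) * l powr (- \<alpha> / 2)) * (l / (4 * \<theta>))"
          using tl t(1) D1 less_imp_le[OF k0] by (intro mult_mono mult_left_mono) auto
        also have "\<dots> = D\<^sup>2 * (3 + D) / \<theta> * (l powr (- \<alpha> / 2) * l)"
          using theta0 by (simp add: field_simps)
        also have "l powr (- \<alpha> / 2) * l = u" unfolding u_def using l(2) powr_mult_base[of l "- \<alpha> / 2"] by (simp add: mult.commute)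
        finally show ?thesis .
      qed
      have c: "2 * (real r * c1) \<le> 4 * c1 * u + 4 * c1"
      proof -
        have "real r * c1 \<le> (2 * u + 2) * c1" using rs u c10 by (intro mult_right_mono) auto
        then show ?thesis by (simp add: algebra_simps)
      qed
      have "4 * \<theta> * C3 = D\<^sup>2 * (3 + D) / \<theta> + 4 * c1 + 6" unfolding C3 using theta0 by simp
      then have "4 * \<theta> * C3 * u = D\<^sup>2 * (3 + D) / \<theta> * u + 4 * c1 * u + 6 * u" by (simp only: distrib_right)
      moreover have "2 * y = 2 * (real r * c1) + 4 * \<theta> * t + 4 * D\<^sup>2 * \<beta> * t" unfolding y_def by (simp add: algebra_simps)
      ultimately show ?thesis using a b c u by linarith
    qed
    define gap where "gap = N * X - D\<^sup>2 * real M * B"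
    \<comment> \<open>The biases cost at most half of the main term
      \<open>n * exp (- y) / 2\<close>, because \<open>exp (l / 2)\<close> is at most half of
      \<open>n * exp (- y)\<close>.\<close>
    have gap: "1 / 4 * (n * exp (- y)) \<le> gap"
    proof -
      have "D\<^sup>2 * real M * B \<le> D\<^sup>2 * (\<kappa> * exp (2 * sqrt l + 2)) * l\<^sup>2"
        using M False B0 D1 less_imp_le[OF k0] k0 by (intro mult_mono mult_left_mono mult_nonneg_nonneg) auto
      also have "\<dots> \<le> 1 / 2 * exp (l / 2)" using e2 by (simp add: mult_ac)
      also have "\<dots> \<le> 1 / 2 * (1 / 2 * (n * exp (- y)))"
      proof -
        have "1 \<le> l / 2 - y" using y e5 by linarith
        then have "2 \<le> exp (l / 2 - y)" using exp_ge_add_one_self[of "l / 2 - y"] by linarith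
        then have "exp (l / 2) * 2 \<le> exp (l / 2) * exp (l / 2 - y)" by (intro mult_left_mono) auto
        also have "\<dots> = n * exp (- y)" unfolding nl exp_add[symmetric] by simp
        finally show ?thesis by simp
      qed
      finally have 1: "D\<^sup>2 * real M * B \<le> 1 / 4 * (n * exp (- y))" by simp
      have "n * (1 / 2 * exp (- y)) \<le> N * X" using Nn X N0 by (intro mult_mono) auto
      then show ?thesis using 1 unfolding gap_def by simp
    qed
    have gap0: "0 < gap" using gap n_ge2 by (smt (verit) exp_gt_zero mult_pos_pos zero_less_divide_iff)
    obtain P where P: "1 - 4 * (W' * (n * (2 * D\<^sup>2 * real M)\<^sup>2)) / gap\<^sup>2
       \<le> pexp \<nu> (S t (\<lambda>x. of_bool (x \<in> P))) - pexp \<mu>s (\<lambda>x. of_bool (x \<in> P))"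
      using lower_pair[OF \<nu> t(1) th _ pairs_def ne pairs_def r1 Mb \<beta> B_def, of gap] q2 gap0
      unfolding W'_def gap_def X_def N_def by auto
    have "4 * (W' * (n * (2 * D\<^sup>2 * real M)\<^sup>2)) / gap\<^sup>2
      \<le> 4 * (W * (n * (2 * D\<^sup>2 * (\<kappa> * exp (2 * sqrt l + 2)))\<^sup>2)) / (1 / 4 * (n * exp (- y)))\<^sup>2"
      using W' M gap n_ge2 D1 less_imp_le[OF k0] k0 by (intro frac_le mult_left_mono mult_mono power_mono mult_nonneg_nonneg) auto
    also have "\<dots> = 256 * W * D ^ 4 * \<kappa>\<^sup>2 * exp (4 + 4 * sqrt l - (l - 2 * y))"
    proof -
      have "(exp (2 * sqrt l + 2))\<^sup>2 = exp (4 + 4 * sqrt l)" by (simp add: exp_double[symmetric] algebra_simps)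
      moreover have "n / (n * exp (- y))\<^sup>2 = exp (- (l - 2 * y))"
        unfolding nl by (simp add: power_mult_distrib exp_double[symmetric] exp_minus exp_diff field_simps power2_eq_square exp_add[symmetric])
      moreover have "4 * (W * (n * (2 * D\<^sup>2 * (\<kappa> * exp (2 * sqrt l + 2)))\<^sup>2)) / (1 / 4 * (n * exp (- y)))\<^sup>2
         = 256 * W * D ^ 4 * \<kappa>\<^sup>2 * ((exp (2 * sqrt l + 2))\<^sup>2 * (n / (n * exp (- y))\<^sup>2))"
        by (simp add: power_mult_distrib power_divide)
      ultimately show ?thesis by (simp only: exp_add[symmetric]) simp
    qed
    also have "\<dots> \<le> 256 * W * D ^ 4 * \<kappa>\<^sup>2 * exp (4 + 4 * c1 - 2 * sqrt l)"
      using y W' D1 less_imp_le[OF k0] by (intro mult_left_mono mult_nonneg_nonneg) auto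
    finally show ?thesis using e1 P tv_law_ge[OF \<nu>(2) t(1), of P] by linarith
  qed
qed

end

section \<open>Asymptotics\<close>

text \<open>Orders of growth: \<open>k * s = 2 * l / \<theta>\<close>, while \<open>k\<close> and
  \<open>Z\<close> are of smaller order than \<open>s\<close> because
  \<open>\<alpha> / 2 < 1 - \<alpha> / 2\<close> and
  \<open>1 - \<alpha> < 1 - \<alpha> / 2\<close>.\<close>

lemma upper_numeric:
  fixes \<theta> \<alpha> e x y C1 :: real
  assumes \<theta>: "0 < \<theta>" and \<alpha>: "0 < \<alpha>" "\<alpha> < 1" and e: "0 < e" and C1: "C1 = 16 / \<theta> + 3"
  shows "\<forall>\<^sub>F l in at_top. \<forall>k s Z. k = l powr (\<alpha> / 2) \<longrightarrow> s = 2 / \<theta> * l powr (1 - \<alpha> / 2) \<longrightarrow>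
    Z = y + (4 * (C1 * l + 1)) powr (1 - \<alpha>) \<longrightarrow>
    1 \<le> k \<and> sqrt (exp (exp ((k + 1) * x - 2 * \<theta> * s)) - 1) < e \<and> 2 * exp (- (2 * l)) < e \<and>
    exp (l - C1 * l + 2 * s) < e \<and> k + 1 + Z - \<theta> * s \<le> 0 \<and> exp (l + k * (k + 1 + Z - \<theta> * s)) < e \<and>
    exp (- l) < e \<and> l / (2 * \<theta>) + s \<le> 2 * l / \<theta> \<and> 1 \<le> 2 * l / \<theta>"
proof -
  have C10: "0 < C1" using C1 \<theta> by (simp add: add_pos_pos)
  have g: "filterlim (\<lambda>l::real. (l powr (\<alpha> / 2) + 1) * x - 4 * l powr (1 - \<alpha> / 2)) at_bot at_top"
    using \<alpha> by real_asymp
  have "((\<lambda>z::real. sqrt (exp (exp z) - 1)) \<longlongrightarrow> 0) at_bot" by real_asymp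
  from filterlim_compose[OF this g]
  have 1: "\<forall>\<^sub>F l in at_top. sqrt (exp (exp ((l powr (\<alpha> / 2) + 1) * x - 4 * l powr (1 - \<alpha> / 2))) - 1) < e"
    using e by (rule order_tendstoD(2))
  have 2: "\<forall>\<^sub>F l::real in at_top. 2 * exp (- (2 * l)) < e" "\<forall>\<^sub>F l::real in at_top. exp (- l) < e"
    "\<forall>\<^sub>F l::real in at_top. exp (- l / 2) < e"
    using e by real_asymp+
  have 3: "\<forall>\<^sub>F l::real in at_top. 4 / \<theta> * l powr (1 - \<alpha> / 2) \<le> l"
    using \<theta> \<alpha> by real_asymp
  have 4: "\<forall>\<^sub>F l::real in at_top. (4 * (C1 * l + 1)) powr (1 - \<alpha>) \<le> l powr (1 - \<alpha> / 2) / 4"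
    using C10 \<alpha> by real_asymp
  have 5: "\<forall>\<^sub>F l::real in at_top. l powr (\<alpha> / 2) + (1 + y) \<le> l powr (1 - \<alpha> / 2) / 4"
    using \<alpha> by real_asymp
  have 6: "\<forall>\<^sub>F l::real in at_top. l / (2 * \<theta>) + 2 / \<theta> * l powr (1 - \<alpha> / 2) \<le> 2 * l / \<theta>"
    "\<forall>\<^sub>F l::real in at_top. 1 \<le> 2 * l / \<theta>" "\<forall>\<^sub>F l::real in at_top. 1 \<le> l powr (\<alpha> / 2)"
    using \<theta> \<alpha> by real_asymp+
  show ?thesis
    using 1 2 3 4 5 6 eventually_gt_at_top[of 0]
  proof eventually_elim
    case (elim l)
    show ?case
    proof (intro allI impI conjI)
      fix k s Z assume k: "k = l powr (\<alpha> / 2)" and s: "s = 2 / \<theta> * l powr (1 - \<alpha> / 2)"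
        and Z: "Z = y + (4 * (C1 * l + 1)) powr (1 - \<alpha>)"
      have \<theta>s: "\<theta> * s = 2 * l powr (1 - \<alpha> / 2)" "2 * \<theta> * s = 4 * l powr (1 - \<alpha> / 2)" unfolding s using \<theta> by auto
      have kw: "k * l powr (1 - \<alpha> / 2) = l" unfolding k using elim by (simp add: powr_add[symmetric])
      have b: "k + 1 + Z - \<theta> * s \<le> - (3 / 2 * l powr (1 - \<alpha> / 2))"
        using elim unfolding k Z \<theta>s by linarith
      also have "\<dots> \<le> 0" by simp
      finally show "k + 1 + Z - \<theta> * s \<le> 0" .
      have "k * (k + 1 + Z - \<theta> * s) \<le> k * - (3 / 2 * l powr (1 - \<alpha> / 2))"
        using b by (rule mult_left_mono) (simp add: k)
      also have "\<dots> = - (3 / 2) * l" using kw by simp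
      finally have "exp (l + k * (k + 1 + Z - \<theta> * s)) \<le> exp (- l / 2)" by simp
      also have "\<dots> < e" using elim by simp
      finally show "exp (l + k * (k + 1 + Z - \<theta> * s)) < e" .
      have "0 \<le> 16 / \<theta> * l" using elim \<theta> by simp
      then have "l - C1 * l + 2 * s \<le> - l" using elim unfolding C1 s distrib_right by simp
      then have "exp (l - C1 * l + 2 * s) \<le> exp (- l)" by simp
      then show "exp (l - C1 * l + 2 * s) < e" using elim by linarith
    qed (use elim \<theta> in \<open>simp_all add: C1 mult.assoc\<close>)
  qed
qed

lemma lower_numeric:
  fixes \<theta> \<alpha> e \<kappa> c1 D W q :: real
  assumes \<theta>: "0 < \<theta>" and \<alpha>: "0 < \<alpha>" "\<alpha> < 1" and e: "0 < e"
  shows "\<forall>\<^sub>F l in at_top.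
     16 * (2 * D / \<theta> + D + l / \<theta> + 2) * exp (- (2 * \<theta> * l powr (1 - \<alpha> / 2))) < e \<and> 1 \<le> l \<and>
     256 * (2 * D / \<theta> + D + l / (2 * \<theta>) + 2) * D ^ 4 * \<kappa>\<^sup>2 * exp (4 + 4 * c1 - 2 * sqrt l) < e \<and>
     2 * D\<^sup>2 * \<kappa> * exp (2 * sqrt l + 2) * l\<^sup>2 \<le> exp (l / 2) \<and>
     4 * (2 * D / \<theta> + D + l / (2 * \<theta>) + 2) * q / l\<^sup>2 < e \<and>
     \<kappa> * exp (- (sqrt l powr (1 - \<alpha>))) < 1 \<and> sqrt l + 2 \<le> exp l \<and> 2 \<le> 6 * sqrt l - 4 * c1"
proof (intro eventually_conj)
  define x where "x = 2 * D / \<theta> + D"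
  have \<alpha>': "0 < 1 - \<alpha>" using \<alpha> by simp
  show "\<forall>\<^sub>F l in at_top. 16 * (2 * D / \<theta> + D + l / \<theta> + 2) * exp (- (2 * \<theta> * l powr (1 - \<alpha> / 2))) < e"
    unfolding x_def[symmetric] by (rule order_tendstoD(2)[OF _ e]) (use \<theta> \<alpha> in real_asymp)
  show "\<forall>\<^sub>F l in at_top. 256 * (2 * D / \<theta> + D + l / (2 * \<theta>) + 2) * D ^ 4 * \<kappa>\<^sup>2 * exp (4 + 4 * c1 - 2 * sqrt l) < e"
  proof -
    define A where "A = 256 * D ^ 4 * \<kappa>\<^sup>2 * exp (4 + 4 * c1) * (x + 2)"
    define B where "B = 256 * D ^ 4 * \<kappa>\<^sup>2 * exp (4 + 4 * c1) / (2 * \<theta>)"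
    have "((\<lambda>l. (A + B * l) * exp (- (2 * sqrt l))) \<longlongrightarrow> 0) at_top" by real_asymp
    then have "\<forall>\<^sub>F l in at_top. (A + B * l) * exp (- (2 * sqrt l)) < e" using e by (rule order_tendstoD)
    moreover have "(A + B * l) * exp (- (2 * sqrt l))
      = 256 * (2 * D / \<theta> + D + l / (2 * \<theta>) + 2) * D ^ 4 * \<kappa>\<^sup>2 * exp (4 + 4 * c1 - 2 * sqrt l)" for l
      unfolding A_def B_def x_def using \<theta> by (simp add: exp_diff exp_minus field_simps)
    ultimately show ?thesis by simp
  qed
  show "\<forall>\<^sub>F l in at_top. 2 * D\<^sup>2 * \<kappa> * exp (2 * sqrt l + 2) * l\<^sup>2 \<le> exp (l / 2)"
  proof -
    define z where "z = 2 * D\<^sup>2 * \<kappa>"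
    have "((\<lambda>l. z * exp (2 * sqrt l + 2) * l\<^sup>2 / exp (l / 2)) \<longlongrightarrow> 0) at_top" by real_asymp
    then have "\<forall>\<^sub>F l in at_top. z * exp (2 * sqrt l + 2) * l\<^sup>2 / exp (l / 2) < 1" by (rule order_tendstoD) simp
    then show ?thesis unfolding z_def[symmetric] by eventually_elim (simp add: field_simps)
  qed
  show "\<forall>\<^sub>F l in at_top. 4 * (2 * D / \<theta> + D + l / (2 * \<theta>) + 2) * q / l\<^sup>2 < e"
  proof -
    define A where "A = 4 * (x + 2) * q"
    define B where "B = 4 * q / (2 * \<theta>)"
    have "((\<lambda>l. (A + B * l) / l\<^sup>2) \<longlongrightarrow> 0) at_top" by real_asymp
    then have "\<forall>\<^sub>F l in at_top. (A + B * l) / l\<^sup>2 < e" using e by (rule order_tendstoD)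
    moreover have "(A + B * l) / l\<^sup>2 = 4 * (2 * D / \<theta> + D + l / (2 * \<theta>) + 2) * q / l\<^sup>2" for l
      unfolding A_def B_def x_def using \<theta> by (simp add: algebra_simps)
    ultimately show ?thesis by simp
  qed
  show "\<forall>\<^sub>F l in at_top. \<kappa> * exp (- (sqrt l powr (1 - \<alpha>))) < 1"
    by (rule order_tendstoD(2)[OF _ zero_less_one]) (use \<alpha>' in real_asymp)
  show "\<forall>\<^sub>F l::real in at_top. sqrt l + 2 \<le> exp l" by real_asymp
  show "\<forall>\<^sub>F l in at_top. 2 \<le> 6 * sqrt l - 4 * c1" by real_asymp
  show "\<forall>\<^sub>F l::real in at_top. 1 \<le> l" by (rule eventually_ge_at_top)
qed

section \<open>From distance bounds to mixing times\<close>

lemma tmix_le: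
  assumes "0 \<le> t" "tv_dist (voter_law G q \<theta> \<nu> t) (voter_measure G q \<theta>) < \<epsilon>"
  shows "tmix_from G q \<theta> \<nu> \<epsilon> \<le> t"
  unfolding tmix_from_def by (rule cInf_lower) (use assms in \<open>auto intro!: bdd_belowI[of _ 0]\<close>)

text \<open>The infimum of an empty set is unspecified, so a lower bound also asks for one time at
  which the distance is below \<open>\<epsilon>\<close>; the upper estimates provide it.\<close>

lemma tmix_ge:
  assumes "0 \<le> t" "tv_dist (voter_law G q \<theta> \<nu> t) (voter_measure G q \<theta>) < \<epsilon>"
    and lower: "\<And>s. 0 \<le> s \<Longrightarrow> s \<le> t0 \<Longrightarrow> \<epsilon> < tv_dist (voter_law G q \<theta> \<nu> s) (voter_measure G q \<theta>)"
  shows "t0 \<le> tmix_from G q \<theta> \<nu> \<epsilon>"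
  unfolding tmix_from_def
proof (rule cInf_greatest)
  show "{t. 0 \<le> t \<and> tv_dist (voter_law G q \<theta> \<nu> t) (voter_measure G q \<theta>) < \<epsilon>} \<noteq> {}" using assms(1,2) by blast
  fix s assume "s \<in> {t. 0 \<le> t \<and> tv_dist (voter_law G q \<theta> \<nu> t) (voter_measure G q \<theta>) < \<epsilon>}"
  then show "t0 \<le> s" using lower[of s] by fastforce
qed

text \<open>All bounds for one graph with a common constant \<open>C\<close> and window
  \<open>b\<close>. The lower bound for the uniform start is restricted to
  \<open>\<theta> < 1\<close>: under pure noise the uniform law is already stationary and its mixing
  time is 0.\<close>

definition tmix_window :: "real \<Rightarrow> real \<Rightarrow> nat \<Rightarrow> real \<Rightarrow> real \<Rightarrow> real \<Rightarrow> 'a pair_pre_digraph \<Rightarrow> bool" where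
  "tmix_window \<theta> \<epsilon> q l b C G \<longleftrightarrow>
     (\<forall>x\<in>configs G q. tmix_state G q \<theta> x \<epsilon> \<le> l / (2 * \<theta>) + C * b \<and> l / (4 * \<theta>) - C * b \<le> tmix_state G q \<theta> x \<epsilon> \<and>
        ((\<exists>c. \<forall>v\<in>pverts G. x v = c) \<longrightarrow> l / (2 * \<theta>) - C * b \<le> tmix_state G q \<theta> x \<epsilon>)) \<and>
     0 \<le> tmix_unif G q \<theta> \<epsilon> \<and> tmix_unif G q \<theta> \<epsilon> \<le> l / (4 * \<theta>) + C * b \<and>
     (\<theta> < 1 \<longrightarrow> l / (4 * \<theta>) - C * b \<le> tmix_unif G q \<theta> \<epsilon>)"

text \<open>The constant and the threshold on \<open>l\<close> precede the graph, which makes the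
  error terms uniform over all admissible graphs.\<close>

lemma tmix_bounds:
  fixes \<theta> \<epsilon> \<kappa> \<alpha> :: real and q :: nat
  assumes \<theta>: "0 < \<theta>" "\<theta> \<le> 1" and q: "2 \<le> q" and \<kappa>: "0 < \<kappa>" and \<alpha>: "0 < \<alpha>" "\<alpha> < 1" and \<epsilon>: "0 < \<epsilon>" "\<epsilon> < 1"
  shows "\<exists>C\<ge>0. \<forall>\<^sub>F l in at_top. \<forall>n. \<forall>G :: 'a pair_pre_digraph. l = ln (real n) \<longrightarrow> subexp_graph \<kappa> \<alpha> n G \<longrightarrow>
    tmix_window \<theta> \<epsilon> q l (l powr (1 - \<alpha> / 2)) C G"
proof -
  define D where "D = \<kappa> * exp 1"
  define c1 where "c1 = ln (2 * D / (1 - \<theta>))"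
  define C3 where "C3 = (D\<^sup>2 * (3 + D) / \<theta> + 4 * c1 + 6) / (4 * \<theta>)"
  \<comment> \<open>\<open>4 / \<theta>\<close> is the extra time \<open>2 * s\<close> in units of
    the window, 1 belongs to \<open>tv_lower_agree\<close> and \<open>C3\<close> to
    \<open>tv_lower_log\<close>.\<close>
  define C where "C = 4 / \<theta> + 1 + \<bar>C3\<bar>"
  have C: "0 \<le> C" "4 / \<theta> \<le> C" "1 \<le> C" "C3 \<le> C"   proof -
    have "0 < 4 / \<theta>" using \<theta>(1) by simp
    then show "0 \<le> C" "4 / \<theta> \<le> C" "1 \<le> C" "C3 \<le> C" unfolding C_def by linarith+
  qed
  have \<epsilon>5: "0 < \<epsilon> / 5" "0 < 1 - \<epsilon>" using \<epsilon> by auto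
  define C1 where "C1 = 16 / \<theta> + 3"
  have "\<forall>\<^sub>F l in at_top. \<forall>n. \<forall>G :: 'a pair_pre_digraph. l = ln (real n) \<longrightarrow> subexp_graph \<kappa> \<alpha> n G \<longrightarrow>
    tmix_window \<theta> \<epsilon> q l (l powr (1 - \<alpha> / 2)) C G"
    using upper_numeric[OF \<theta>(1) \<alpha> \<epsilon>5(1) C1_def, of "ln \<kappa>" "ln ((real q)\<^sup>2 * exp 1 / \<theta>) + 4"]
      lower_numeric[OF \<theta>(1) \<alpha> \<epsilon>5(2), of D \<kappa> c1 "real q"]
  proof eventually_elim
    case (elim l)
    show ?case
    proof (intro allI impI)
      fix n :: nat and G :: "'a pair_pre_digraph"
      assume ln: "l = ln (real n)" and G: "subexp_graph \<kappa> \<alpha> n G"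
      have l1: "1 \<le> l" using elim(2) by simp
      have card: "card (pverts G) = n" using G by (simp add: subexp_graph_def)
      have "2 \<le> n"
      proof (rule ccontr)
        assume "\<not> 2 \<le> n"
        then have "n = 0 \<or> n = 1" by auto
        then show False using l1 ln by auto
      qed
      then interpret growing_voter G q \<theta> \<kappa> \<alpha>
        using G \<theta> q \<kappa> \<alpha> by (intro growing_voter.intro voter.intro growing_voter_axioms.intro) (simp_all add: subexp_graph_def)
      have l: "l = ln (real (card (pverts G)))" by (simp add: card ln)
      define b where "b = l powr (1 - \<alpha> / 2)"
      have b0: "0 \<le> b" by (simp add: b_def)
      have Cb: "4 / \<theta> * b \<le> C * b" "1 * b \<le> C * b" "C3 * b \<le> C * b" "0 \<le> C * b"
        by (intro mult_right_mono mult_nonneg_nonneg C b0)+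
      define s where "s = 2 / \<theta> * l powr (1 - \<alpha> / 2)"
      have s0: "0 \<le> s" and s2: "2 * s = 4 / \<theta> * b" unfolding s_def b_def using \<theta> by auto
      have up: "tv_dist (voter_law G q \<theta> \<nu> (l / (2 * real j * \<theta>) + 2 * s)) (voter_measure G q \<theta>) < \<epsilon>"
        if "initial j \<nu>" for j \<nu>
      proof -
        define k where "k = l powr (\<alpha> / 2)"
        define Z where "Z = ln \<kappa> + (4 * (C1 * l + 1)) powr (1 - \<alpha>)"
        note E = elim(1)[rule_format, OF k_def s_def Z_def]
        show ?thesis
          by (rule tv_upper_log[OF that l k_def _ s_def C1_def Z_def]) (use E in blast)+
      qed
      have pos: "0 \<le> l / (2 * real j * \<theta>) + 2 * s" for j using l1 \<theta> s0 by simp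
      note le = tmix_le[OF pos up] and ge = tmix_ge[OF pos up]
      have st: "initial 1 (return_pmf x)" if "x \<in> configs G q" for x
        using that by (auto simp: initial_def configs_def)
      have un: "initial 2 (pmf_of_set (configs G q))" by (auto simp: initial_def configs_def)
      have agree: "l / (2 * \<theta>) - b \<le> tmix_state G q \<theta> x \<epsilon>"
        if x: "x \<in> configs G q" and m: "\<theta> = 1 \<or> (\<exists>c. \<forall>v\<in>pverts G. x v = c)" for x
        unfolding tmix_state_def
      proof (rule ge[OF st[OF x]])
        fix t assume t: "0 \<le> t" "t \<le> l / (2 * \<theta>) - b"
        show "\<epsilon> < tv_dist (voter_law G q \<theta> (return_pmf x) t) (voter_measure G q \<theta>)"
          by (rule tv_lower_agree[OF x[unfolded configs_def] m l t[unfolded b_def]]) (use elim(2) in \<open>simp add: D_def\<close>)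
      qed
      have gen: "l / (4 * \<theta>) - C3 * b \<le> tmix_from G q \<theta> \<nu> \<epsilon>" if \<nu>: "initial j \<nu>" and th: "\<theta> < 1" for j \<nu>
      proof (rule ge[OF \<nu>])
        fix t assume t: "0 \<le> t" "t \<le> l / (4 * \<theta>) - C3 * b"
        show "\<epsilon> < tv_dist (voter_law G q \<theta> \<nu> t) (voter_measure G q \<theta>)"
          by (rule tv_lower_log[OF initial_good[OF \<nu>] initial_set[OF \<nu>] th l l1 c1_def[unfolded D_def] C3_def[unfolded D_def]
                t[unfolded b_def] refl]) (use elim(2) in \<open>simp_all add: D_def\<close>)
      qed
      show "tmix_window \<theta> \<epsilon> q l (l powr (1 - \<alpha> / 2)) C G"
        unfolding tmix_window_def b_def[symmetric]
      proof (intro conjI ballI impI)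
        fix x assume x: "x \<in> configs G q"
        show "tmix_state G q \<theta> x \<epsilon> \<le> l / (2 * \<theta>) + C * b"
          using le[OF st[OF x]] Cb unfolding tmix_state_def s2 by simp
        show "l / (2 * \<theta>) - C * b \<le> tmix_state G q \<theta> x \<epsilon>" if "\<exists>c. \<forall>v\<in>pverts G. x v = c"
          using agree[OF x disjI2[OF that]] Cb by simp
        show "l / (4 * \<theta>) - C * b \<le> tmix_state G q \<theta> x \<epsilon>"
        \<comment> \<open>Under pure noise the agreement statistic serves every deterministic
          initial state and gives even \<open>l / (2 * \<theta>)\<close> as leading term.\<close>
        proof (cases "\<theta> = 1")
          case True
          then show ?thesis using agree[OF x disjI1[OF True]] Cb l1 by simp
        next
          case False
          then have "\<theta> < 1" using \<theta> by simp
          from gen[OF st[OF x] this] show ?thesis using Cb unfolding tmix_state_def by simp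
        qed
      next
        show "tmix_unif G q \<theta> \<epsilon> \<le> l / (4 * \<theta>) + C * b"
          using le[OF un] Cb unfolding tmix_unif_def s2 by simp
        show "0 \<le> tmix_unif G q \<theta> \<epsilon>"
          unfolding tmix_unif_def tmix_from_def
        proof (rule cInf_greatest)
          show "{t. 0 \<le> t \<and> tv_dist (voter_law G q \<theta> (pmf_of_set (configs G q)) t) (voter_measure G q \<theta>) < \<epsilon>} \<noteq> {}"
            using up[OF un] pos[of 2] by blast
        qed simp
        show "l / (4 * \<theta>) - C * b \<le> tmix_unif G q \<theta> \<epsilon>" if "\<theta> < 1"
          using gen[OF un that] Cb unfolding tmix_unif_def by simp
      qed
    qed
  qed
  then show ?thesis using C(1) by blast
qed

text \<open>An additive error \<open>C * l powr (1 - \<alpha> / 2)\<close>, relative to the main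
  term \<open>l / c\<close>, is \<open>c * C * l powr (- (\<alpha> / 2))\<close>.\<close>

lemma relative_error:
  fixes c C l \<alpha> \<tau> :: real
  assumes "0 < c" "0 < l" "l / c - C * l powr (1 - \<alpha> / 2) \<le> \<tau>" "\<tau> \<le> l / c + C * l powr (1 - \<alpha> / 2)"
  shows "\<exists>\<delta>. \<bar>\<delta>\<bar> \<le> c * C * l powr (- (\<alpha> / 2)) \<and> \<tau> = (1 + \<delta>) / c * l"
proof (intro exI conjI)
  have w: "l powr (1 - \<alpha> / 2) = l * l powr (- (\<alpha> / 2))" using assms(2) powr_add[of l 1 "- (\<alpha> / 2)"] by simp
  show "\<tau> = (1 + (c * \<tau> / l - 1)) / c * l" using assms(1,2) by simp
  have "c * \<tau> / l - 1 = c / l * (\<tau> - l / c)" using assms(1,2) by (simp add: field_simps)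
  also have "\<bar>\<dots>\<bar> \<le> c / l * (C * l powr (1 - \<alpha> / 2))"
    unfolding abs_mult using assms by (intro mult_mono) (auto simp: abs_le_iff)
  also have "\<dots> = c * C * l powr (- (\<alpha> / 2))" unfolding w using assms(2) by simp
  finally show "\<bar>c * \<tau> / l - 1\<bar> \<le> c * C * l powr (- (\<alpha> / 2))" .
qed

text \<open>The quotient in the last claim is taken in the extended reals, where a positive time
  divided by 0 is infinite; this covers \<open>\<theta> = 1\<close>. The constant \<open>C\<close>
  and the sequence \<open>e\<close> do not depend on the graph.\<close>

theorem corollary1p4:
  fixes \<theta> \<epsilon> \<kappa> \<alpha> :: real and q :: nat
  assumes "0 < \<theta>" and "\<theta> \<le> 1" and "2 \<le> q"
    and "0 < \<kappa>" and "0 < \<alpha>" and "\<alpha> < 1"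
    and "0 < \<epsilon>" and "\<epsilon> < 1"
  shows
    "(\<theta> < 1 \<longrightarrow>
       (\<exists>C. \<forall>\<^sub>F n in sequentially. \<forall>G :: 'a pair_pre_digraph. subexp_graph \<kappa> \<alpha> n G \<longrightarrow>
          (\<exists>\<delta>. \<bar>\<delta>\<bar> \<le> C * ln (real n) powr (- (\<alpha> / 2)) \<and>
               tmix_unif G q \<theta> \<epsilon> = (1 + \<delta>) / (4 * \<theta>) * ln (real n)))) \<and>
     (\<exists>e :: nat \<Rightarrow> real. e \<longlonglongrightarrow> 0 \<and>
       (\<forall>\<^sub>F n in sequentially. \<forall>G :: 'a pair_pre_digraph. subexp_graph \<kappa> \<alpha> n G \<longrightarrow>
          (\<exists>\<delta>. \<bar>\<delta>\<bar> \<le> e n \<and>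
               tmix G q \<theta> \<epsilon> = (1 + \<delta>) / (2 * \<theta>) * ln (real n)) \<and>
          (\<forall>c<q. \<exists>\<delta>. \<bar>\<delta>\<bar> \<le> e n \<and>
               tmix_state G q \<theta> (monochrome G c) \<epsilon> = (1 + \<delta>) / (2 * \<theta>) * ln (real n)))) \<and>
     (\<forall>(G :: nat \<Rightarrow> 'a pair_pre_digraph) x.
        (\<forall>n\<ge>1. subexp_graph \<kappa> \<alpha> n (G n) \<and> x n \<in> configs (G n) q) \<longrightarrow>
        liminf (\<lambda>n. ereal (tmix_state (G n) q \<theta> (x n) \<epsilon>) / ereal (tmix_unif (G n) q \<theta> \<epsilon>)) \<ge> 1)"
proof -
  define w where "w l = l powr (1 - \<alpha> / 2)" for l :: real
  obtain C where C: "0 \<le> C" and win: "\<forall>\<^sub>F l in at_top. \<forall>n. \<forall>G :: 'a pair_pre_digraph. l = ln (real n) \<longrightarrow>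
      subexp_graph \<kappa> \<alpha> n G \<longrightarrow> tmix_window \<theta> \<epsilon> q l (w l) C G"
    using tmix_bounds[OF assms, where 'a = 'a] unfolding w_def by blast
  have lim: "filterlim (\<lambda>n. ln (real n)) at_top sequentially" by real_asymp
  have "\<forall>\<^sub>F n in sequentially. (\<forall>m. \<forall>G :: 'a pair_pre_digraph. ln (real n) = ln (real m) \<longrightarrow>
      subexp_graph \<kappa> \<alpha> m G \<longrightarrow> tmix_window \<theta> \<epsilon> q (ln (real n)) (w (ln (real n))) C G)"
    by (rule eventually_compose_filterlim[OF win lim])
  then have window: "\<forall>\<^sub>F n in sequentially. \<forall>G :: 'a pair_pre_digraph.
      subexp_graph \<kappa> \<alpha> n G \<longrightarrow> tmix_window \<theta> \<epsilon> q (ln (real n)) (w (ln (real n))) C G"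
    by eventually_elim blast
  have pos: "\<forall>\<^sub>F n in sequentially. 0 < ln (real n)" by real_asymp
  have c4: "0 < 4 * \<theta>" and c2: "0 < 2 * \<theta>" using assms by auto
  define v where "v n = ln (real n) powr (- (\<alpha> / 2))" for n :: nat
  have v: "v \<longlonglongrightarrow> 0" unfolding v_def[abs_def] using assms by real_asymp
  have mono: "monochrome G c \<in> configs G q" "\<exists>c'. \<forall>v\<in>pverts G. monochrome G c v = c'"
    if "c < q" for G :: "'a pair_pre_digraph" and c
    using that by (auto simp: monochrome_def configs_def)
  have fin: "finite (configs G q)" if "subexp_graph \<kappa> \<alpha> n G" for n and G :: "'a pair_pre_digraph"
  proof -
    interpret pair_graph G using that by (simp add: subexp_graph_def)
    show ?thesis unfolding configs_def by (intro finite_PiE finite_lessThan) simp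
  qed
  have q0: "0 < q" using assms by simp
  show ?thesis
  proof (intro conjI impI)
    assume th: "\<theta> < 1"
    show "\<exists>C. \<forall>\<^sub>F n in sequentially. \<forall>G :: 'a pair_pre_digraph. subexp_graph \<kappa> \<alpha> n G \<longrightarrow>
          (\<exists>\<delta>. \<bar>\<delta>\<bar> \<le> C * ln (real n) powr (- (\<alpha> / 2)) \<and>
               tmix_unif G q \<theta> \<epsilon> = (1 + \<delta>) / (4 * \<theta>) * ln (real n))"
    proof (rule exI[of _ "4 * \<theta> * C"])
      show "\<forall>\<^sub>F n in sequentially. \<forall>G :: 'a pair_pre_digraph. subexp_graph \<kappa> \<alpha> n G \<longrightarrow>
          (\<exists>\<delta>. \<bar>\<delta>\<bar> \<le> 4 * \<theta> * C * ln (real n) powr (- (\<alpha> / 2)) \<and>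
               tmix_unif G q \<theta> \<epsilon> = (1 + \<delta>) / (4 * \<theta>) * ln (real n))"
        using window pos
      proof eventually_elim
        case (elim n)
        show ?case
        proof (intro allI impI)
          fix G :: "'a pair_pre_digraph" assume G: "subexp_graph \<kappa> \<alpha> n G"
          have W: "tmix_window \<theta> \<epsilon> q (ln (real n)) (w (ln (real n))) C G" using elim(1) G by blast
          show "\<exists>\<delta>. \<bar>\<delta>\<bar> \<le> 4 * \<theta> * C * ln (real n) powr (- (\<alpha> / 2)) \<and>
               tmix_unif G q \<theta> \<epsilon> = (1 + \<delta>) / (4 * \<theta>) * ln (real n)"
            by (rule relative_error[OF c4 elim(2)]) (use W th in \<open>simp_all add: tmix_window_def w_def\<close>)
        qed
      qed
    qed
  next
    show "\<exists>e :: nat \<Rightarrow> real. e \<longlonglongrightarrow> 0 \<and>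
       (\<forall>\<^sub>F n in sequentially. \<forall>G :: 'a pair_pre_digraph. subexp_graph \<kappa> \<alpha> n G \<longrightarrow>
          (\<exists>\<delta>. \<bar>\<delta>\<bar> \<le> e n \<and>
               tmix G q \<theta> \<epsilon> = (1 + \<delta>) / (2 * \<theta>) * ln (real n)) \<and>
          (\<forall>c<q. \<exists>\<delta>. \<bar>\<delta>\<bar> \<le> e n \<and>
               tmix_state G q \<theta> (monochrome G c) \<epsilon> = (1 + \<delta>) / (2 * \<theta>) * ln (real n)))"
    proof (intro exI[of _ "\<lambda>n. 2 * \<theta> * C * v n"] conjI)
      show "(\<lambda>n. 2 * \<theta> * C * v n) \<longlonglongrightarrow> 0" by (rule tendsto_mult_right_zero[OF v])
      show "\<forall>\<^sub>F n in sequentially. \<forall>G :: 'a pair_pre_digraph. subexp_graph \<kappa> \<alpha> n G \<longrightarrow>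
          (\<exists>\<delta>. \<bar>\<delta>\<bar> \<le> 2 * \<theta> * C * v n \<and>
               tmix G q \<theta> \<epsilon> = (1 + \<delta>) / (2 * \<theta>) * ln (real n)) \<and>
          (\<forall>c<q. \<exists>\<delta>. \<bar>\<delta>\<bar> \<le> 2 * \<theta> * C * v n \<and>
               tmix_state G q \<theta> (monochrome G c) \<epsilon> = (1 + \<delta>) / (2 * \<theta>) * ln (real n))"
        using window pos
      proof eventually_elim
        case (elim n)
        show ?case
        proof (intro allI impI)
          fix G :: "'a pair_pre_digraph" assume G: "subexp_graph \<kappa> \<alpha> n G"
          have W: "tmix_window \<theta> \<epsilon> q (ln (real n)) (w (ln (real n))) C G" using elim(1) G by blast
          have lo: "ln (real n) / (2 * \<theta>) - C * w (ln (real n)) \<le> tmix_state G q \<theta> (monochrome G c) \<epsilon>" if "c < q" for c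
            using W mono[OF that, of G] unfolding tmix_window_def by blast
          have hi: "tmix_state G q \<theta> x \<epsilon> \<le> ln (real n) / (2 * \<theta>) + C * w (ln (real n))" if "x \<in> configs G q" for x
            using W that unfolding tmix_window_def by blast
          have "tmix_state G q \<theta> (monochrome G 0) \<epsilon> \<le> tmix G q \<theta> \<epsilon>"
            unfolding tmix_def using fin[OF G] mono(1)[OF q0] by (intro Max_ge) auto
          then have lo': "ln (real n) / (2 * \<theta>) - C * w (ln (real n)) \<le> tmix G q \<theta> \<epsilon>" using lo[OF q0] by linarith
          have hi': "tmix G q \<theta> \<epsilon> \<le> ln (real n) / (2 * \<theta>) + C * w (ln (real n))"
            unfolding tmix_def using fin[OF G] mono(1)[OF q0, of G] hi by (subst Max_le_iff) auto
          show "(\<exists>\<delta>. \<bar>\<delta>\<bar> \<le> 2 * \<theta> * C * v n \<and>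
               tmix G q \<theta> \<epsilon> = (1 + \<delta>) / (2 * \<theta>) * ln (real n)) \<and>
            (\<forall>c<q. \<exists>\<delta>. \<bar>\<delta>\<bar> \<le> 2 * \<theta> * C * v n \<and>
               tmix_state G q \<theta> (monochrome G c) \<epsilon> = (1 + \<delta>) / (2 * \<theta>) * ln (real n))"
            unfolding v_def
            by (intro conjI allI impI relative_error[OF c2 elim(2)] lo'[unfolded w_def] hi'[unfolded w_def]
                lo[unfolded w_def] hi[unfolded w_def] mono)
        qed
      qed
    qed
  next
    show "\<forall>(G :: nat \<Rightarrow> 'a pair_pre_digraph) x.
        (\<forall>n\<ge>1. subexp_graph \<kappa> \<alpha> n (G n) \<and> x n \<in> configs (G n) q) \<longrightarrow>
        liminf (\<lambda>n. ereal (tmix_state (G n) q \<theta> (x n) \<epsilon>) / ereal (tmix_unif (G n) q \<theta> \<epsilon>)) \<ge> 1"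
    proof (intro allI impI)
      fix G :: "nat \<Rightarrow> 'a pair_pre_digraph" and x
      assume G: "\<forall>n\<ge>1. subexp_graph \<kappa> \<alpha> n (G n) \<and> x n \<in> configs (G n) q"
      define c where "c = 4 * \<theta> * C"
      have c0: "0 \<le> c" unfolding c_def using C assms by simp
      have "(\<lambda>n. c * v n) \<longlonglongrightarrow> 0" by (rule tendsto_mult_right_zero[OF v])
      then have small: "\<forall>\<^sub>F n in sequentially. c * v n < 1" by (rule order_tendstoD) simp
      \<comment> \<open>In units of \<open>l / (4 * \<theta>)\<close> the numerator is at least
        \<open>1 - c * v n\<close> and the denominator at most \<open>1 + c * v n\<close>.\<close>
      define h where "h n = (1 - c * v n) / (1 + c * v n)" for n
      have "h \<longlonglongrightarrow> (1 - c * 0) / (1 + c * 0)"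
        unfolding h_def[abs_def] by (intro tendsto_intros v) simp
      then have "(\<lambda>n. ereal (h n)) \<longlonglongrightarrow> 1" by (simp add: one_ereal_def)
      then have "1 = liminf (\<lambda>n. ereal (h n))" by (simp add: lim_imp_Liminf)
      also have "\<dots> \<le> liminf (\<lambda>n. ereal (tmix_state (G n) q \<theta> (x n) \<epsilon>) / ereal (tmix_unif (G n) q \<theta> \<epsilon>))"
      proof (rule Liminf_mono)
        show "\<forall>\<^sub>F n in sequentially. ereal (h n) \<le> ereal (tmix_state (G n) q \<theta> (x n) \<epsilon>) / ereal (tmix_unif (G n) q \<theta> \<epsilon>)"
          using window pos small eventually_ge_at_top[of 1]
        proof eventually_elim
          case (elim n)
          define l where "l = ln (real n)"
          define s where "s = tmix_state (G n) q \<theta> (x n) \<epsilon>"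
          define U where "U = tmix_unif (G n) q \<theta> \<epsilon>"
          have l0: "0 < l" unfolding l_def by (rule elim(2))
          have Gn: "subexp_graph \<kappa> \<alpha> n (G n)" "x n \<in> configs (G n) q" using G elim(4) by auto
          have W: "tmix_window \<theta> \<epsilon> q l (w l) C (G n)" using elim(1) Gn(1) unfolding l_def by blast
          have Cw: "C * w l = l / (4 * \<theta>) * (c * v n)"
            unfolding c_def v_def w_def l_def[symmetric] using assms l0 powr_add[of l 1 "- (\<alpha> / 2)"] by simp
          have s: "l / (4 * \<theta>) * (1 - c * v n) \<le> s"
            using W Gn(2) Cw unfolding tmix_window_def s_def right_diff_distrib by simp
          have U: "0 \<le> U" "U \<le> l / (4 * \<theta>) * (1 + c * v n)"
            using W Cw unfolding tmix_window_def U_def distrib_left by simp_all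
          have lp: "0 < l / (4 * \<theta>)" using l0 assms by simp
          have sp: "0 < s" using s mult_pos_pos[OF lp, of "1 - c * v n"] elim(3) by linarith
          have v0: "0 \<le> c * v n" using c0 by (simp add: v_def)
          show "ereal (h n) \<le> ereal (tmix_state (G n) q \<theta> (x n) \<epsilon>) / ereal (tmix_unif (G n) q \<theta> \<epsilon>)"
            unfolding s_def[symmetric] U_def[symmetric]
          \<comment> \<open>This happens for \<open>\<theta> = 1\<close>; as \<open>s\<close> is
            positive, the quotient is then infinite.\<close>
          proof (cases "U = 0")
            case True
            then have "ereal s / ereal U = \<infinity>" using sp by (simp add: divide_ereal_def zero_ereal_def[symmetric])
            then show "ereal (h n) \<le> ereal s / ereal U" by simp
          next
            case False
            have "h n = (l / (4 * \<theta>) * (1 - c * v n)) / (l / (4 * \<theta>) * (1 + c * v n))"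
              unfolding h_def by (rule mult_divide_mult_cancel_left[symmetric]) (use lp in linarith)
            also have "\<dots> \<le> s / U"
              using s U False sp lp v0 elim(3) by (intro frac_le) auto
            finally show "ereal (h n) \<le> ereal s / ereal U" using False by simp
          qed
        qed
      qed
      finally show "1 \<le> liminf (\<lambda>n. ereal (tmix_state (G n) q \<theta> (x n) \<epsilon>) / ereal (tmix_unif (G n) q \<theta> \<epsilon>))" .
    qed
  qed
qed

end
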